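(* Let $N\in\mathbb{N}$, let $k:(0,\infty)\to[0,\infty)$ be a nonincreasing function satisfying (k) below, and let $f:\mathbb{R}\to\mathbb{R}$ satisfy (F1) and (F2) below. Then every nonnegative bounded continuous solution $u\in\mathcal{D}^J(\mathbb{R}^N)$ of $Iu=f(u)$ in $\mathbb{R}^N$ with $\lim_{|x|\to\infty}u(x)=0$ is radially symmetric up to translation, i.e. there is $z_0\in\mathbb{R}^N$ such that $u(\cdot-z_0)$ is radially symmetric. Moreover, either $u\equiv0$ in $\mathbb{R}^N$, or $u(\cdot-z_0)$ is strictly decreasing in its radial direction and therefore $u>0$ in $\mathbb{R}^N$.
   Context: (k): there is $r_0>0$ such that $k$ is strictly decreasing on $(0,r_0)$, and $\int_0^\infty\min\{1,r^2\}k(r)r^{N-1}dr<\infty$, $\int_0^\infty k(r)r^{N-1}dr=\infty$. $\mathcal{J}(v,w)=\int_{\mathbb{R}^N}\int_{\mathbb{R}^N}(v(x)-v(y))(w(x)-w(y))k(|x-y|)\,dxdy$, $\mathcal{D}^J(\mathbb{R}^N)=\{u\in L^2(\mathbb{R}^N):\mathcal{J}(u,u)<\infty\}$; $I$ is the operator associated with $\mathcal{J}$. $u\in\mathcal{D}^J(\mathbb{R}^N)$ is a solution of $Iu=f(u)$ in $\mathbb{R}^N$ if for all $\varphi\in\mathcal{D}^J(\mathbb{R}^N)$ with compact support the integral $\int f(u)\varphi\,dx$ exists and $\mathcal{J}(u,\varphi)=\int_{\mathbb{R}^N}f(u(x))\varphi(x)\,dx$. (F1): for every $K>0$ there is $L=L(K)>0$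 with $|f(u)-f(v)|\leq L|u-v|$ for all $u,v\in[-K,K]$. (F2): $f(0)=0$, and there is $\delta>0$ with $\frac{f(u)}{u}\leq0$ for all $u\in[-\delta,\delta]\setminus\{0\}$. *)

theory Defs
  imports "HOL-Analysis.Analysis"
begin

definition kernel_cond :: "nat \<Rightarrow> (real \<Rightarrow> real) \<Rightarrow> bool" where
  "kernel_cond N k \<longleftrightarrow>
     (\<exists>r0>0. strict_antimono_on {0<..<r0} k) \<and>
     (\<integral>\<^sup>+ r\<in>{0<..}. ennreal (min 1 (r\<^sup>2) * k r * r ^ (N - 1)) \<partial>lborel) < \<infinity> \<and>
     (\<integral>\<^sup>+ r\<in>{0<..}. ennreal (k r * r ^ (N - 1)) \<partial>lborel) = \<infinity>"

definition formJ :: "(real \<Rightarrow> real) \<Rightarrow> (real^'n \<Rightarrow> real) \<Rightarrow> (real^'n \<Rightarrow> real) \<Rightarrow> real" where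
  "formJ k v w = (\<integral> p. (v (fst p) - v (snd p)) * (w (fst p) - w (snd p)) * k (dist (fst p) (snd p))
                     \<partial>(lborel \<Otimes>\<^sub>M lborel))"

text \<open>The energy space D^J(R^N) = {u \<in> L^2(R^N) : J(u,u) < \<infinity>}; J(u,u) is a
  nonnegative integral, so its finiteness is expressed via the nonnegative integral.\<close>
definition DJ :: "(real \<Rightarrow> real) \<Rightarrow> (real^'n \<Rightarrow> real) set" where
  "DJ k = {u. u \<in> borel_measurable lborel \<and> integrable lborel (\<lambda>x. (u x)\<^sup>2) \<and>
              (\<integral>\<^sup>+ p. ennreal ((u (fst p) - u (snd p))\<^sup>2 * k (dist (fst p) (snd p)))
                  \<partial>(lborel \<Otimes>\<^sub>M lborel)) < \<infinity>}"

definition is_solution :: "(real \<Rightarrow> real) \<Rightarrow> (real \<Rightarrow> real) \<Rightarrow> (real^'n \<Rightarrow> real) \<Rightarrow> bool" where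
  "is_solution k f u \<longleftrightarrow> u \<in> DJ k \<and>
     (\<forall>\<phi> \<in> DJ k. compact (closure {x. \<phi> x \<noteq> 0}) \<longrightarrow>
        integrable lborel (\<lambda>x. f (u x) * \<phi> x) \<and>
        formJ k u \<phi> = (\<integral> x. f (u x) * \<phi> x \<partial>lborel))"

definition F1 :: "(real \<Rightarrow> real) \<Rightarrow> bool" where
  "F1 f \<longleftrightarrow> (\<forall>K>0. \<exists>L>0. \<forall>u v. \<bar>u\<bar> \<le> K \<longrightarrow> \<bar>v\<bar> \<le> K \<longrightarrow> \<bar>f u - f v\<bar> \<le> L * \<bar>u - v\<bar>)"

definition F2 :: "(real \<Rightarrow> real) \<Rightarrow> bool" where
  "F2 f \<longleftrightarrow> f 0 = 0 \<and> (\<exists>\<delta>>0. \<forall>u. u \<noteq> 0 \<longrightarrow> \<bar>u\<bar> \<le> \<delta> \<longrightarrow> f u / u \<le> 0)"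

end

theory Submission
  imports Defs
begin

text \<open>
  For large \<open>\<Lambda>\<close> the function \<open>v = f u + \<Lambda> u\<close> is increasing in \<open>u\<close>, and the equation reads
  \<open>u = (\<Lambda> + I)\<^sup>-\<^sup>1 v\<close>. This is the limit of the resolvents of the kernels truncated at height \<open>m\<close>, which have
  the form \<open>a + g *\<close> with \<open>g\<close> radially decreasing.

  Fix a unit vector \<open>e\<close> and a step \<open>h\<close>. On each line \<open>x + h \<int> e\<close> a superlevel set of \<open>v\<close> splits into runs of
  consecutive points. Moving all runs with centre above \<open>\<lambda>\<close> down by one step does not decrease the quadratic form of
  the resolvent; if \<open>v\<close> is larger than its reflection at one point above the plane \<open>x \<bullet> e = \<lambda>\<close> and at one point below it,
  the form gains at least \<open>\<kappa> h\<close>. On the other hand \<open>u\<close>, being the image of \<open>v\<close> under the resolvent, allows no first order gain: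
  the upper bound has errors of order \<open>h\<^sup>2\<close>, apart from a term carried by the runs centred within \<open>h / 2\<close> of the plane, and
  these terms have a bounded sum over the \<open>\<delta> / (4 h)\<close> planes at heights \<open>\<lambda> + j h\<close>. Hence the difference of \<open>u\<close>
  and its reflection has a sign on each half space. As \<open>\<lambda>\<close> runs through the connected line, some plane orthogonal to \<open>e\<close>
  must be a plane of symmetry; all these planes pass through one point, since two parallel ones would make \<open>u\<close> periodic.
  Strict monotonicity follows from a propagation of strict inequalities by the resolvent.
\<close>

section \<open>Measure preserving maps and reflections\<close>

text \<open>What closes the estimate is the infinite mass of the kernel. A Lipschitz minorant
  \<open>\<rho>\<close> of large mass makes the resolvent small on differences of a function and its
  translate: its norm there is about \<open>1 / q\<close>, where \<open>q\<close> is
  \<open>\<Lambda>\<close> plus twice the mass of \<open>\<rho>\<close>. This absorbs the quadratic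
  term at one plane, and it bounds the sum of the terms carried by runs near the planes by
  \<open>3 / q * ip v v\<close>, which is less than the total gain of order
  \<open>\<delta> \<kappa>\<close>. A single plane would not suffice, since its own term is not
  known to be small compared with \<open>h\<close>.

  So \<open>\<kappa>\<close> has to be bounded below before \<open>q\<close>, then \<open>h\<close>,
  then the truncation height \<open>m\<close> are chosen. This is why the strict decrease of the
  resolvent kernels is proved with a constant valid for all large \<open>m\<close>. The kernels are
  never passed to a limit: only the functions \<open>Gop a g v\<close> converge, to \<open>u\<close>
  in mean square, and this error and the atom are made small last, when \<open>h\<close> is already
  fixed.\<close>

definition mpres :: "('a::euclidean_space \<Rightarrow> 'a) \<Rightarrow> bool" where
  "mpres T \<longleftrightarrow> T \<in> borel_measurable borel \<and> distr lborel borel T = lborel"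

lemma mpres_nn_integral:
  assumes "mpres T" "f \<in> borel_measurable borel"
  shows "(\<integral>\<^sup>+x. f (T x) \<partial>lborel) = (\<integral>\<^sup>+x. f x \<partial>lborel)"
proof -
  have "(\<integral>\<^sup>+x. f x \<partial>lborel) = (\<integral>\<^sup>+x. f x \<partial>(distr lborel borel T))"
    using assms by (simp add: mpres_def)
  also have "\<dots> = (\<integral>\<^sup>+x. f (T x) \<partial>lborel)"
    using assms by (intro nn_integral_distr) (auto simp: mpres_def)
  finally show ?thesis by simp
qed

lemma mpres_integral:
  fixes f :: "'a::euclidean_space \<Rightarrow> real"
  assumes "mpres T" "f \<in> borel_measurable borel"
  shows "(\<integral>x. f (T x) \<partial>lborel) = (\<integral>x. f x \<partial>lborel)"
proof -
  have "(\<integral>x. f x \<partial>lborel) = (\<integral>x. f x \<partial>(distr lborel borel T))"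
    using assms by (simp add: mpres_def)
  also have "\<dots> = (\<integral>x. f (T x) \<partial>lborel)"
    using assms by (intro integral_distr) (auto simp: mpres_def)
  finally show ?thesis by simp
qed

lemma mpres_integrable:
  fixes f :: "'a::euclidean_space \<Rightarrow> real"
  assumes "mpres T" "f \<in> borel_measurable borel"
  shows "integrable lborel (\<lambda>x. f (T x)) \<longleftrightarrow> integrable lborel f"
proof -
  have "integrable lborel f \<longleftrightarrow> integrable (distr lborel borel T) f"
    using assms by (simp add: mpres_def)
  also have "\<dots> \<longleftrightarrow> integrable lborel (\<lambda>x. f (T x))"
    using assms by (intro integrable_distr_eq) (auto simp: mpres_def)
  finally show ?thesis by simp
qed

lemma mpres_add: "mpres (\<lambda>x. x + c)"
  using lborel_distr_plus[of c] by (simp add: mpres_def add.commute[of _ c])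

lemma mpres_uminus: "mpres (\<lambda>x::'a::euclidean_space. - x)"
proof -
  have "distr lborel borel (\<lambda>x::'a. - x) = lborel"
    using lborel_affine[of "-1" "0::'a"] by (simp add: density_1)
  then show ?thesis by (simp add: mpres_def)
qed

lemma mpres_comp:
  assumes "mpres S" "mpres T" shows "mpres (\<lambda>x. S (T x))"
proof -
  have "distr (distr lborel borel T) borel S = distr lborel borel (S \<circ> T)"
    using assms by (intro distr_distr) (auto simp: mpres_def)
  then show ?thesis using assms
    by (auto simp: mpres_def comp_def intro: measurable_compose)
qed

lemma mpres_diff_left: "mpres (\<lambda>x. c - x)"
  using mpres_comp[OF mpres_add[of c] mpres_uminus] by simp

lemma mpres_diff_right: "mpres (\<lambda>x. x - c)"
  using mpres_add[of "-c"] by simp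

section \<open>Reflections in hyperplanes\<close>

definition rfl :: "'a::euclidean_space \<Rightarrow> real \<Rightarrow> 'a \<Rightarrow> 'a" where
  "rfl e l x = x + (2 * (l - x \<bullet> e)) *\<^sub>R e"

lemma rfl_inner: "norm e = 1 \<Longrightarrow> rfl e l x \<bullet> e = 2 * l - x \<bullet> e"
  by (simp add: rfl_def inner_add_left inner_scaleR_left algebra_simps dot_square_norm)

lemma rfl_rfl: "norm e = 1 \<Longrightarrow> rfl e l (rfl e l x) = x"
  using rfl_inner[of e l x]
  by (simp add: rfl_def[of e l "rfl e l x"]) (simp add: rfl_def algebra_simps flip: scaleR_add_left)

lemma norm_sq_diff_unit:
  fixes z e :: "'a::euclidean_space"
  assumes "norm e = 1"
  shows "(norm (z - c *\<^sub>R e))\<^sup>2 = (norm z)\<^sup>2 - 2 * c * (z \<bullet> e) + c\<^sup>2"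
proof -
  have ee: "e \<bullet> e = 1" using assms by (simp add: dot_square_norm)
  have "(z - c *\<^sub>R e) \<bullet> (z - c *\<^sub>R e) = z \<bullet> z - 2 * c * (z \<bullet> e) + c * c * (e \<bullet> e)"
    unfolding inner_diff_left inner_diff_right inner_scaleR_left inner_scaleR_right
    by (simp add: inner_commute algebra_simps)
  then show ?thesis unfolding power2_norm_eq_inner ee by (simp add: power2_eq_square)
qed

lemma norm_rfl_diff: "norm e = 1 \<Longrightarrow> norm (rfl e l x - rfl e l y) = norm (x - y)"
proof -
  assume e: "norm e = 1"
  define z where "z = x - y"
  have 1: "rfl e l x - rfl e l y = z - (2 * (z \<bullet> e)) *\<^sub>R e"
    by (simp add: rfl_def z_def algebra_simps inner_diff_left)
  have "(norm (z - (2 * (z \<bullet> e)) *\<^sub>R e))\<^sup>2 = (norm z)\<^sup>2"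
    unfolding norm_sq_diff_unit[OF e] by (simp add: power2_eq_square)
  then show ?thesis unfolding 1 z_def[symmetric] by simp
qed

text \<open>The sign of the last product decides which of \<open>y\<close> and its mirror image is
  nearer to \<open>x\<close>. Kernel values at mirror points are compared through this
  identity.\<close>

lemma norm_rfl_sq:
  assumes "norm e = 1"
  shows "(norm (x - rfl e l y))\<^sup>2 = (norm (x - y))\<^sup>2 + 4 * (x \<bullet> e - l) * (y \<bullet> e - l)"
proof -
  have *: "x - rfl e l y = (x - y) - (2 * (l - y \<bullet> e)) *\<^sub>R e" by (simp add: rfl_def)
  show ?thesis unfolding * norm_sq_diff_unit[OF assms]
    by (simp add: inner_diff_left power2_eq_square algebra_simps)
qed

lemma continuous_rfl: "continuous_on UNIV (rfl e l)"
  unfolding rfl_def by (intro continuous_intros)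

lemma measurable_rfl[measurable]: "rfl e l \<in> borel_measurable borel"
  by (rule borel_measurable_continuous_onI[OF continuous_rfl])

text \<open>Uniqueness of translation invariant measures, in the form needed here. The reflection
  carries translations to translations, so by Fubini the integrals of \<open>f\<close> and of its
  reflection are proportional; the indicator \<open>b\<close> of a ball is fixed by the reflection
  and shows that the factor is 1.\<close>

lemma mpres_rfl0:
  fixes e :: "'a::euclidean_space"
  assumes e: "norm e = 1"
  shows "mpres (rfl e 0)"
proof -
  let ?s = "rfl e 0"
  have slin: "?s x + c = ?s (x + ?s c)" for x c
    using rfl_rfl[OF e, of 0 c] by (simp add: rfl_def inner_add_left algebra_simps)
  have n: "norm (?s x) = norm x" for x
    using norm_rfl_diff[OF e, of 0 x 0] by (simp add: rfl_def)
  have main: "(\<integral>\<^sup>+x. f (?s x) \<partial>lborel) = (\<integral>\<^sup>+x. f x \<partial>lborel)"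
    if [measurable]: "f \<in> borel_measurable borel" for f :: "'a \<Rightarrow> ennreal"
  proof -
    define b :: "'a \<Rightarrow> ennreal" where "b = indicator (ball 0 1)"
    have [measurable]: "b \<in> borel_measurable borel" unfolding b_def by (intro borel_measurable_indicator) simp
    define B where "B = (\<integral>\<^sup>+x. b x \<partial>lborel)"
    have B: "B \<noteq> 0" "B \<noteq> \<infinity>"
      unfolding B_def b_def by (auto simp: emeasure_ball unit_ball_vol_pos[THEN less_imp_neq, symmetric] emeasure_lborel_ball_finite less_top)
    have bs: "b (?s x) = b x" for x by (simp add: b_def n indicator_def)
    have inv: "(\<integral>\<^sup>+x. g (?s x) \<partial>lborel) = (\<integral>\<^sup>+x. g (?s x + c) \<partial>lborel)"
      if [measurable]: "g \<in> borel_measurable borel" for g :: "'a \<Rightarrow> ennreal" and c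
    proof -
      have "(\<integral>\<^sup>+x. g (?s x + c) \<partial>lborel) = (\<integral>\<^sup>+x. g (?s (x + ?s c)) \<partial>lborel)"
        by (simp add: slin)
      also have "\<dots> = (\<integral>\<^sup>+x. g (?s x) \<partial>lborel)"
        by (rule mpres_nn_integral[OF mpres_add, of "\<lambda>x. g (?s x)"]) simp
      finally show ?thesis by simp
    qed
    have "(\<integral>\<^sup>+x. f (?s x) \<partial>lborel) * B = (\<integral>\<^sup>+x. (\<integral>\<^sup>+y. f (?s x) * b y \<partial>lborel) \<partial>lborel)"
      unfolding B_def by (simp add: nn_integral_cmult nn_integral_multc)
    also have "\<dots> = (\<integral>\<^sup>+x. (\<integral>\<^sup>+y. f (?s x) * b (y + ?s x) \<partial>lborel) \<partial>lborel)"
      by (intro nn_integral_cong mpres_nn_integral[OF mpres_add, symmetric]) simp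
    also have "\<dots> = (\<integral>\<^sup>+y. (\<integral>\<^sup>+x. f (?s x) * b (y + ?s x) \<partial>lborel) \<partial>lborel)"
      by (rule lborel_pair.Fubini') simp
    also have "\<dots> = (\<integral>\<^sup>+y. (\<integral>\<^sup>+x. f (?s x + - y) * b (y + (?s x + - y)) \<partial>lborel) \<partial>lborel)"
    proof (rule nn_integral_cong)
      fix y :: 'a
      show "(\<integral>\<^sup>+x. f (?s x) * b (y + ?s x) \<partial>lborel) = (\<integral>\<^sup>+x. f (?s x + - y) * b (y + (?s x + - y)) \<partial>lborel)"
        by (rule inv[of "\<lambda>z. f z * b (y + z)" "- y"]) simp
    qed
    also have "\<dots> = (\<integral>\<^sup>+y. (\<integral>\<^sup>+x. f (?s x - y) * b (?s x) \<partial>lborel) \<partial>lborel)"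
      by simp
    also have "\<dots> = (\<integral>\<^sup>+x. (\<integral>\<^sup>+y. f (?s x - y) * b (?s x) \<partial>lborel) \<partial>lborel)"
      by (rule lborel_pair.Fubini') simp
    also have "\<dots> = (\<integral>\<^sup>+x. (\<integral>\<^sup>+y. f (?s x - y) \<partial>lborel) * b x \<partial>lborel)"
      by (intro nn_integral_cong) (simp add: nn_integral_multc bs)
    also have "\<dots> = (\<integral>\<^sup>+x. (\<integral>\<^sup>+y. f y \<partial>lborel) * b x \<partial>lborel)"
      by (intro nn_integral_cong arg_cong2[where f="(*)"] refl mpres_nn_integral[OF mpres_diff_left]) simp_all
    also have "\<dots> = (\<integral>\<^sup>+y. f y \<partial>lborel) * B"
      by (simp add: B_def nn_integral_cmult)
    finally show ?thesis using B by (metis mult_divide_eq_ennreal infinity_ennreal_def)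
  qed
  have "distr lborel borel ?s = lborel"
  proof (rule measure_eqI)
    fix A assume "A \<in> sets (distr lborel borel ?s)"
    then have [measurable]: "A \<in> sets borel" by simp
    have "emeasure (distr lborel borel ?s) A = (\<integral>\<^sup>+x. indicator A (?s x) \<partial>lborel)"
      using nn_integral_distr[of ?s lborel borel "indicator A"] by simp
    also have "\<dots> = emeasure lborel A" by (subst main) auto
    finally show "emeasure (distr lborel borel ?s) A = emeasure lborel A" .
  qed simp
  then show ?thesis by (simp add: mpres_def)
qed

lemma mpres_rfl:
  assumes e: "norm e = 1" shows "mpres (rfl e l)"
proof -
  have "rfl e l = (\<lambda>x. rfl e 0 x + (2 * l) *\<^sub>R e)"
    by (auto simp: rfl_def fun_eq_iff algebra_simps)
  then show ?thesis using mpres_comp[OF mpres_add[of "(2*l) *\<^sub>R e"] mpres_rfl0[OF e]] by simp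
qed

text \<open>The mirror is the perpendicular bisector of the two points. It reduces monotonicity of
  radial functions to comparisons across single planes.\<close>

lemma exists_rfl_swap:
  fixes x y :: "'a::euclidean_space"
  assumes "x \<noteq> y"
  obtains e l where "norm e = 1" "rfl e l x = y"
    "\<And>z. (z \<bullet> e \<le> l) \<longleftrightarrow> norm (z - x) \<le> norm (z - y)"
proof -
  define e where "e = (y - x) /\<^sub>R norm (y - x)"
  define l where "l = ((x + y) \<bullet> e) / 2"
  have e: "norm e = 1" using assms by (simp add: e_def)
  have ye: "y - x = norm (y - x) *\<^sub>R e" using assms by (simp add: e_def)
  have yxe: "(y - x) \<bullet> e = norm (y - x)" 
    by (subst ye) (simp add: dot_square_norm e)
  have r: "rfl e l x = y"
  proof -
    have "2 * (l - x \<bullet> e) = norm (y - x)" using yxe by (simp add: l_def inner_add_left inner_diff_left)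
    then show ?thesis using ye by (simp add: rfl_def)
  qed
  have n: "(z \<bullet> e \<le> l) \<longleftrightarrow> norm (z - x) \<le> norm (z - y)" for z
  proof -
    have "(y - x) \<bullet> e > 0" using assms by (simp add: yxe)
    then have xl: "x \<bullet> e < l" unfolding l_def by (simp add: inner_add_left inner_diff_left)
    have "(norm (z - y))\<^sup>2 = (norm (z - x))\<^sup>2 + 4 * ((z \<bullet> e - l) * (x \<bullet> e - l))"
      using norm_rfl_sq[OF e, of z l x] r by (simp only: mult.assoc)
    moreover have "norm (z - x) \<le> norm (z - y) \<longleftrightarrow> (norm (z - x))\<^sup>2 \<le> (norm (z - y))\<^sup>2"
      by (metis norm_ge_zero power2_le_imp_le power_mono)
    ultimately have "norm (z - x) \<le> norm (z - y) \<longleftrightarrow> 0 \<le> (z \<bullet> e - l) * (x \<bullet> e - l)" by linarith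
    also have "\<dots> \<longleftrightarrow> z \<bullet> e \<le> l" using xl by (simp add: zero_le_mult_iff)
    finally show ?thesis by simp
  qed
  show ?thesis using that[OF e r n] .
qed

section \<open>Square integrable functions and convolution\<close>

text \<open>Boundedness makes the convolution with an integrable kernel defined at every point, so
  that identities between functions hold everywhere and not only almost everywhere. Square
  integrability is added in \<open>nice\<close> for the inner product.\<close>

definition bdm :: "('a::euclidean_space \<Rightarrow> real) \<Rightarrow> bool" where
  "bdm \<phi> \<longleftrightarrow> \<phi> \<in> borel_measurable borel \<and> (\<exists>B. \<forall>x. \<bar>\<phi> x\<bar> \<le> B)"

definition nice :: "('a::euclidean_space \<Rightarrow> real) \<Rightarrow> bool" where
  "nice \<phi> \<longleftrightarrow> bdm \<phi> \<and> integrable lborel (\<lambda>x. (\<phi> x)\<^sup>2)"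

definition conv :: "('a::euclidean_space \<Rightarrow> real) \<Rightarrow> ('a \<Rightarrow> real) \<Rightarrow> 'a \<Rightarrow> real" where
  "conv g \<phi> x = (\<integral>z. g z * \<phi> (x - z) \<partial>lborel)"

definition ip :: "('a::euclidean_space \<Rightarrow> real) \<Rightarrow> ('a \<Rightarrow> real) \<Rightarrow> real" where
  "ip \<phi> \<psi> = (\<integral>x. \<phi> x * \<psi> x \<partial>lborel)"

definition nrm :: "('a::euclidean_space \<Rightarrow> real) \<Rightarrow> real" where
  "nrm \<phi> = sqrt (ip \<phi> \<phi>)"

lemma bdm_meas: "bdm \<phi> \<Longrightarrow> \<phi> \<in> borel_measurable borel"
  by (simp add: bdm_def)

lemma bdmI: "\<phi> \<in> borel_measurable borel \<Longrightarrow> (\<And>x. \<bar>\<phi> x\<bar> \<le> B) \<Longrightarrow> bdm \<phi>"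
  by (auto simp: bdm_def)

lemma bdmE: assumes "bdm \<phi>" obtains B where "B \<ge> 0" "\<And>x. \<bar>\<phi> x\<bar> \<le> B"
  using assms unfolding bdm_def by (meson abs_ge_zero order_trans)

lemma nice_bdm: "nice \<phi> \<Longrightarrow> bdm \<phi>" by (simp add: nice_def)
lemma nice_sq: "nice \<phi> \<Longrightarrow> integrable lborel (\<lambda>x. (\<phi> x)\<^sup>2)" by (simp add: nice_def)
lemma nice_meas: "nice \<phi> \<Longrightarrow> \<phi> \<in> borel_measurable borel" by (simp add: nice_def bdm_def)

lemma bdm_add: assumes "bdm \<phi>" "bdm \<psi>" shows "bdm (\<lambda>x. \<phi> x + \<psi> x)"
proof -
  obtain A where A: "\<And>x. \<bar>\<phi> x\<bar> \<le> A" using bdmE[OF assms(1)] by metis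
  obtain B where B: "\<And>x. \<bar>\<psi> x\<bar> \<le> B" using bdmE[OF assms(2)] by metis
  have [measurable]: "\<phi> \<in> borel_measurable borel" "\<psi> \<in> borel_measurable borel" using assms by (auto simp: bdm_def)
  have "\<bar>\<phi> x + \<psi> x\<bar> \<le> A + B" for x using A[of x] B[of x] by linarith
  then show ?thesis by (intro bdmI[of _ "A + B"]) auto
qed

lemma bdm_cmult: assumes "bdm \<phi>" shows "bdm (\<lambda>x. c * \<phi> x)"
proof -
  obtain A where A: "\<And>x. \<bar>\<phi> x\<bar> \<le> A" using bdmE[OF assms(1)] by metis
  have [measurable]: "\<phi> \<in> borel_measurable borel" using assms by (auto simp: bdm_def)
  have "\<bar>c * \<phi> x\<bar> \<le> \<bar>c\<bar> * A" for x by (simp add: abs_mult mult_left_mono A)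
  then show ?thesis by (intro bdmI[of _ "\<bar>c\<bar> * A"]) auto
qed

lemma bdm_diff: assumes "bdm \<phi>" "bdm \<psi>" shows "bdm (\<lambda>x. \<phi> x - \<psi> x)"
  using bdm_add[OF assms(1) bdm_cmult[OF assms(2), of "-1"]] by simp

lemma bdm_mpres: assumes "bdm \<phi>" "mpres T" shows "bdm (\<lambda>x. \<phi> (T x))"
proof -
  have [measurable]: "\<phi> \<in> borel_measurable borel" "T \<in> borel_measurable borel" using assms by (auto simp: bdm_def mpres_def)
  have "(\<lambda>x. \<phi> (T x)) \<in> borel_measurable borel" by measurable
  then show ?thesis using assms by (auto simp: bdm_def)
qed

lemma nice_mult_integrable:
  assumes "nice \<phi>" "nice \<psi>" shows "integrable lborel (\<lambda>x. \<phi> x * \<psi> x)"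
proof (rule Bochner_Integration.integrable_bound)
  show "integrable lborel (\<lambda>x. (\<phi> x)\<^sup>2 + (\<psi> x)\<^sup>2)" using assms by (auto simp: nice_def)
  show "(\<lambda>x. \<phi> x * \<psi> x) \<in> borel_measurable lborel" using assms by (auto simp: nice_def bdm_def)
  have "\<bar>a * b\<bar> \<le> a\<^sup>2 + b\<^sup>2" for a b :: real
  proof -
    have "2 * (\<bar>a\<bar> * \<bar>b\<bar>) \<le> a\<^sup>2 + b\<^sup>2" using sum_squares_bound[of "\<bar>a\<bar>" "\<bar>b\<bar>"] by simp
    moreover have "0 \<le> \<bar>a\<bar> * \<bar>b\<bar>" by simp
    ultimately show ?thesis unfolding abs_mult by linarith
  qed
  then show "AE x in lborel. norm (\<phi> x * \<psi> x) \<le> norm ((\<phi> x)\<^sup>2 + (\<psi> x)\<^sup>2)"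
    by (intro AE_I2) (metis abs_of_nonneg real_norm_def add_nonneg_nonneg zero_le_power2)
qed

lemma nice_add: assumes "nice \<phi>" "nice \<psi>" shows "nice (\<lambda>x. \<phi> x + \<psi> x)"
proof -
  have "integrable lborel (\<lambda>x. (\<phi> x)\<^sup>2 + 2 * (\<phi> x * \<psi> x) + (\<psi> x)\<^sup>2)"
    using assms nice_mult_integrable[OF assms] by (auto simp: nice_def)
  then show ?thesis using assms bdm_add by (auto simp: nice_def power2_sum algebra_simps)
qed

lemma nice_cmult: assumes "nice \<phi>" shows "nice (\<lambda>x. c * \<phi> x)"
  using assms bdm_cmult by (auto simp: nice_def power_mult_distrib)

lemma nice_diff: assumes "nice \<phi>" "nice \<psi>" shows "nice (\<lambda>x. \<phi> x - \<psi> x)"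
  using nice_add[OF assms(1) nice_cmult[OF assms(2), of "-1"]] by simp

lemma nice_mpres: assumes "nice \<phi>" "mpres T" shows "nice (\<lambda>x. \<phi> (T x))"
  using assms bdm_mpres[of \<phi> T] mpres_integrable[OF assms(2), of "\<lambda>x. (\<phi> x)\<^sup>2"]
  by (auto simp: nice_def bdm_def)

lemma nice_le:
  assumes "nice \<phi>" "\<psi> \<in> borel_measurable borel" "\<And>x. \<bar>\<psi> x\<bar> \<le> \<bar>\<phi> x\<bar>"
  shows "nice \<psi>"
proof -
  obtain B where B: "\<And>x. \<bar>\<phi> x\<bar> \<le> B" using bdmE[OF nice_bdm[OF assms(1)]] by metis
  have "bdm \<psi>" using assms(2,3) B by (intro bdmI[of _ B]) (auto intro: order_trans)
  moreover have "integrable lborel (\<lambda>x. (\<psi> x)\<^sup>2)"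
    by (rule Bochner_Integration.integrable_bound[OF nice_sq[OF assms(1)]]) 
       (use assms(2,3) in \<open>auto intro!: AE_I2 simp: abs_le_square_iff\<close>)
  ultimately show ?thesis by (simp add: nice_def)
qed

section \<open>Inner product and norm of square integrable functions\<close>

lemma ip_commute: "ip \<phi> \<psi> = ip \<psi> \<phi>" by (simp add: ip_def mult.commute)

lemma ip_add_left: "nice \<phi> \<Longrightarrow> nice \<psi> \<Longrightarrow> nice \<omega> \<Longrightarrow> ip (\<lambda>x. \<phi> x + \<psi> x) \<omega> = ip \<phi> \<omega> + ip \<psi> \<omega>"
  by (simp add: ip_def distrib_right nice_mult_integrable)
lemma ip_diff_left: "nice \<phi> \<Longrightarrow> nice \<psi> \<Longrightarrow> nice \<omega> \<Longrightarrow> ip (\<lambda>x. \<phi> x - \<psi> x) \<omega> = ip \<phi> \<omega> - ip \<psi> \<omega>"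
  by (simp add: ip_def left_diff_distrib nice_mult_integrable)
lemma ip_add_right: "nice \<phi> \<Longrightarrow> nice \<psi> \<Longrightarrow> nice \<omega> \<Longrightarrow> ip \<omega> (\<lambda>x. \<phi> x + \<psi> x) = ip \<omega> \<phi> + ip \<omega> \<psi>"
  by (simp add: ip_def distrib_left nice_mult_integrable)
lemma ip_diff_right: "nice \<phi> \<Longrightarrow> nice \<psi> \<Longrightarrow> nice \<omega> \<Longrightarrow> ip \<omega> (\<lambda>x. \<phi> x - \<psi> x) = ip \<omega> \<phi> - ip \<omega> \<psi>"
  by (simp add: ip_def right_diff_distrib nice_mult_integrable)
lemma ip_cmult_left: "ip (\<lambda>x. c * \<phi> x) \<omega> = c * ip \<phi> \<omega>"
  by (simp add: ip_def mult.assoc)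
lemma ip_cmult_right: "ip \<omega> (\<lambda>x. c * \<phi> x) = c * ip \<omega> \<phi>"
  by (simp add: ip_def mult.left_commute)

lemma ip_nonneg: "0 \<le> ip \<phi> \<phi>" by (simp add: ip_def)

lemma ip_mpres:
  assumes "nice \<phi>" "nice \<psi>" "mpres T" shows "ip (\<lambda>x. \<phi> (T x)) (\<lambda>x. \<psi> (T x)) = ip \<phi> \<psi>"
  unfolding ip_def using assms by (intro mpres_integral[of T "\<lambda>x. \<phi> x * \<psi> x"]) (auto simp: nice_def bdm_def)

lemma ip_CS:
  assumes "nice \<phi>" "nice \<psi>" shows "\<bar>ip \<phi> \<psi>\<bar> \<le> nrm \<phi> * nrm \<psi>"
proof -
  let ?a = "ip \<phi> \<phi>" let ?b = "ip \<psi> \<psi>" let ?c = "ip \<phi> \<psi>"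
  have q: "0 \<le> s\<^sup>2 * ?a - 2 * s * t * ?c + t\<^sup>2 * ?b" for s t
  proof -
    have n: "nice (\<lambda>x. s * \<phi> x)" "nice (\<lambda>x. t * \<psi> x)" using assms nice_cmult by auto
    have "0 \<le> ip (\<lambda>x. s * \<phi> x - t * \<psi> x) (\<lambda>x. s * \<phi> x - t * \<psi> x)" by (rule ip_nonneg)
    also have "\<dots> = s\<^sup>2 * ?a - 2 * s * t * ?c + t\<^sup>2 * ?b"
      unfolding ip_diff_left[OF n nice_diff[OF n]] ip_diff_right[OF n n(1)] ip_diff_right[OF n n(2)]
      by (simp add: ip_cmult_left ip_cmult_right ip_commute[of \<psi> \<phi>] power2_eq_square algebra_simps)
    finally show ?thesis .
  qed
  have "?c\<^sup>2 \<le> ?a * ?b"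
  proof (cases "?b = 0")
    case True
    \<comment> \<open>With \<open>?b = 0\<close> the form is affine in \<open>t\<close>, and a
      nonzero coefficient would let it take the value \<open>-1\<close>.\<close>
    have "?c = 0"
    proof (rule ccontr)
      assume c: "?c \<noteq> 0"
      have "0 \<le> ?a - 2 * ((?a + 1) / (2 * ?c)) * ?c" using q[of 1 "(?a + 1) / (2 * ?c)"] True by simp
      also have "2 * ((?a + 1) / (2 * ?c)) * ?c = ?a + 1" using c by simp
      finally show False by simp
    qed
    then show ?thesis using ip_nonneg[of \<phi>] ip_nonneg[of \<psi>] by simp
  next
    case False
    then have b: "?b > 0" using ip_nonneg[of \<psi>] by linarith
    have "0 \<le> ?b * (?a * ?b - ?c\<^sup>2)" using q[of ?b ?c] by (simp add: power2_eq_square algebra_simps)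
    then show ?thesis using b by (simp add: zero_le_mult_iff)
  qed
  then have "sqrt (?c\<^sup>2) \<le> sqrt (?a * ?b)" by (rule real_sqrt_le_mono)
  then show ?thesis by (simp add: nrm_def real_sqrt_mult)
qed

lemma nrm_nonneg: "0 \<le> nrm \<phi>" by (simp add: nrm_def ip_nonneg)
lemma nrm_sq: "(nrm \<phi>)\<^sup>2 = ip \<phi> \<phi>" by (simp add: nrm_def ip_nonneg)
lemma nrm_mpres: "nice \<phi> \<Longrightarrow> mpres T \<Longrightarrow> nrm (\<lambda>x. \<phi> (T x)) = nrm \<phi>"
  by (simp add: nrm_def ip_mpres)
lemma nrm_cmult: "nrm (\<lambda>x. c * \<phi> x) = \<bar>c\<bar> * nrm \<phi>"
  by (simp add: nrm_def ip_cmult_left ip_cmult_right real_sqrt_mult flip: mult.assoc)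

lemma nrm_triangle:
  assumes "nice \<phi>" "nice \<psi>" shows "nrm (\<lambda>x. \<phi> x + \<psi> x) \<le> nrm \<phi> + nrm \<psi>"
proof (rule power2_le_imp_le)
  have "(nrm (\<lambda>x. \<phi> x + \<psi> x))\<^sup>2 = ip \<phi> \<phi> + 2 * ip \<phi> \<psi> + ip \<psi> \<psi>"
    using assms nice_add[OF assms] by (simp add: nrm_sq ip_add_left ip_add_right ip_commute[of \<psi> \<phi>])
  also have "\<dots> \<le> (nrm \<phi> + nrm \<psi>)\<^sup>2"
    using ip_CS[OF assms] by (simp add: power2_sum nrm_sq)
  finally show "(nrm (\<lambda>x. \<phi> x + \<psi> x))\<^sup>2 \<le> (nrm \<phi> + nrm \<psi>)\<^sup>2" .
qed (simp add: nrm_nonneg)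

lemma nrm_triangle_diff:
  assumes "nice \<phi>" "nice \<psi>" shows "nrm (\<lambda>x. \<phi> x - \<psi> x) \<le> nrm \<phi> + nrm \<psi>"
  using nrm_triangle[OF assms(1) nice_cmult[OF assms(2), of "-1"]] nrm_cmult[of "-1" \<psi>] by simp

lemma nrm_mono:
  assumes "nice \<phi>" "nice \<psi>" "\<And>x. \<bar>\<psi> x\<bar> \<le> \<bar>\<phi> x\<bar>" shows "nrm \<psi> \<le> nrm \<phi>"
proof -
  have "ip \<psi> \<psi> \<le> ip \<phi> \<phi>" unfolding ip_def
    by (intro integral_mono nice_mult_integrable assms(1,2)) (metis abs_le_square_iff assms(3) power2_eq_square)
  then show ?thesis by (simp add: nrm_def)
qed

section \<open>Convolution with integrable kernels\<close>

lemma conv_integrable: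
  assumes "integrable lborel g" "bdm \<phi>"
  shows "integrable lborel (\<lambda>z. g z * \<phi> (x - z))"
proof -
  obtain B where B0: "B \<ge> 0" and B: "\<And>x. \<bar>\<phi> x\<bar> \<le> B" using bdmE[OF assms(2)] by metis
  have [measurable]: "\<phi> \<in> borel_measurable borel" "g \<in> borel_measurable borel" using assms by (auto simp: bdm_def)
  have "\<bar>g z * \<phi> (x - z)\<bar> \<le> \<bar>B * g z\<bar>" for z
    using B0 mult_mono[OF B[of "x - z"] order_refl[of "\<bar>g z\<bar>"]] by (simp add: abs_mult mult.commute)
  then have ae: "AE z in lborel. norm (g z * \<phi> (x - z)) \<le> norm (B * g z)" by simp
  show ?thesis
    by (rule Bochner_Integration.integrable_bound[OF _ _ ae]) (use assms(1) in simp_all)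
qed

lemma conv_alt:
  assumes "g \<in> borel_measurable borel" "\<phi> \<in> borel_measurable borel"
  shows "conv g \<phi> x = (\<integral>y. g (x - y) * \<phi> y \<partial>lborel)"
proof -
  have [measurable]: "g \<in> borel_measurable borel" "\<phi> \<in> borel_measurable borel" using assms by auto
  show ?thesis unfolding conv_def
    by (subst mpres_integral[OF mpres_diff_left[of x], symmetric]) simp_all
qed

lemma conv_alt_integrable:
  assumes "integrable lborel g" "bdm \<phi>"
  shows "integrable lborel (\<lambda>y. g (x - y) * \<phi> y)"
proof -
  have [measurable]: "g \<in> borel_measurable borel" "\<phi> \<in> borel_measurable borel" using assms by (auto simp: bdm_def)
  show ?thesis using conv_integrable[OF assms, of x]
    by (subst (asm) mpres_integrable[OF mpres_diff_left[of x], symmetric]) simp_all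
qed

lemma conv_measurable:
  assumes [measurable]: "g \<in> borel_measurable borel" "\<phi> \<in> borel_measurable borel"
  shows "conv g \<phi> \<in> borel_measurable borel"
  unfolding conv_def by measurable

lemma conv_bound:
  assumes "integrable lborel g" "bdm \<phi>" "\<And>x. \<bar>\<phi> x\<bar> \<le> B"
  shows "\<bar>conv g \<phi> x\<bar> \<le> (\<integral>z. \<bar>g z\<bar> \<partial>lborel) * B"
proof -
  have "\<bar>conv g \<phi> x\<bar> \<le> (\<integral>z. \<bar>g z * \<phi> (x - z)\<bar> \<partial>lborel)"
    unfolding conv_def using integral_norm_bound[of lborel "\<lambda>z. g z * \<phi> (x - z)"] by simp
  also have "\<dots> \<le> (\<integral>z. \<bar>g z\<bar> * B \<partial>lborel)"
  proof (rule integral_mono)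
    show "integrable lborel (\<lambda>z. \<bar>g z * \<phi> (x - z)\<bar>)" using conv_integrable[OF assms(1,2)] by (rule integrable_abs)
    show "integrable lborel (\<lambda>z. \<bar>g z\<bar> * B)" using assms(1) by auto
    show "\<bar>g z * \<phi> (x - z)\<bar> \<le> \<bar>g z\<bar> * B" for z by (simp add: abs_mult mult_left_mono assms(3))
  qed
  finally show ?thesis by simp
qed

lemma bdm_conv: assumes "integrable lborel g" "bdm \<phi>" shows "bdm (conv g \<phi>)"
proof -
  obtain B where B: "\<And>x. \<bar>\<phi> x\<bar> \<le> B" using bdmE[OF assms(2)] by metis
  show ?thesis using conv_bound[OF assms B] conv_measurable[of g \<phi>] assms by (auto simp: bdm_def)
qed

lemma conv_add_right: "integrable lborel g \<Longrightarrow> bdm \<phi> \<Longrightarrow> bdm \<psi> \<Longrightarrow> conv g (\<lambda>x. \<phi> x + \<psi> x) x = conv g \<phi> x + conv g \<psi> x"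
  by (simp add: conv_def distrib_left conv_integrable)
lemma conv_diff_right: "integrable lborel g \<Longrightarrow> bdm \<phi> \<Longrightarrow> bdm \<psi> \<Longrightarrow> conv g (\<lambda>x. \<phi> x - \<psi> x) x = conv g \<phi> x - conv g \<psi> x"
  by (simp add: conv_def right_diff_distrib conv_integrable)
lemma conv_cmult_right: "conv g (\<lambda>x. c * \<phi> x) x = c * conv g \<phi> x"
  by (simp add: conv_def mult.left_commute)
lemma conv_add_left: "integrable lborel f \<Longrightarrow> integrable lborel g \<Longrightarrow> bdm \<phi> \<Longrightarrow> conv (\<lambda>x. f x + g x) \<phi> x = conv f \<phi> x + conv g \<phi> x"
  by (simp add: conv_def distrib_right conv_integrable)
lemma conv_diff_left: "integrable lborel f \<Longrightarrow> integrable lborel g \<Longrightarrow> bdm \<phi> \<Longrightarrow> conv (\<lambda>x. f x - g x) \<phi> x = conv f \<phi> x - conv g \<phi> x"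
  by (simp add: conv_def left_diff_distrib conv_integrable)
lemma conv_cmult_left: "conv (\<lambda>x. c * g x) \<phi> x = c * conv g \<phi> x"
  by (simp add: conv_def mult.assoc)

lemma conv_mono:
  assumes "integrable lborel g" "\<And>x. 0 \<le> g x" "bdm \<phi>" "bdm \<psi>" "\<And>x. \<phi> x \<le> \<psi> x"
  shows "conv g \<phi> x \<le> conv g \<psi> x"
  unfolding conv_def by (intro integral_mono conv_integrable assms mult_left_mono)

lemma conv_nonneg: "(\<And>x. 0 \<le> g x) \<Longrightarrow> (\<And>x. 0 \<le> \<phi> x) \<Longrightarrow> 0 \<le> conv g \<phi> x"
  by (simp add: conv_def)

lemma prod_integrable:
  fixes f g :: "'a::euclidean_space \<Rightarrow> real"
  assumes "integrable lborel f" "integrable lborel g"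
  shows "integrable (lborel \<Otimes>\<^sub>M lborel) (\<lambda>(x, y). f x * g y)"
proof (rule lborel_pair.Fubini_integrable)
  have [measurable]: "f \<in> borel_measurable borel" "g \<in> borel_measurable borel" using assms by auto
  show "(\<lambda>(x, y). f x * g y) \<in> borel_measurable (lborel \<Otimes>\<^sub>M lborel)" by simp
  show "integrable lborel (\<lambda>x. LINT y|lborel. norm (case (x, y) of (x, y) \<Rightarrow> f x * g y))"
    using assms by (simp add: abs_mult)
  show "AE x in lborel. integrable lborel (\<lambda>y. case (x, y) of (x, y) \<Rightarrow> f x * g y)"
    using assms by simp
qed

lemma prod_bdm_integrable:
  fixes f g :: "'a::euclidean_space \<Rightarrow> real"
  assumes "integrable lborel f" "integrable lborel g"
    and [measurable]: "h \<in> borel_measurable (lborel \<Otimes>\<^sub>M lborel)" and h: "\<And>p. \<bar>h p\<bar> \<le> B"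
  shows "integrable (lborel \<Otimes>\<^sub>M lborel) (\<lambda>(x, y). f x * g y * h (x, y))"
proof (rule Bochner_Integration.integrable_bound[OF integrable_mult_right[OF prod_integrable[OF assms(1,2)], of B]])
  have [measurable]: "f \<in> borel_measurable borel" "g \<in> borel_measurable borel" using assms by auto
  show "(\<lambda>(x, y). f x * g y * h (x, y)) \<in> borel_measurable (lborel \<Otimes>\<^sub>M lborel)" by simp
  have B: "B \<ge> 0" using h[of undefined] by linarith
  have "\<bar>a * h p\<bar> \<le> \<bar>B * a\<bar>" for a p
    using B mult_mono[OF h[of p] order_refl[of "\<bar>a\<bar>"]] by (simp add: abs_mult mult.commute)
  then show "AE x in lborel \<Otimes>\<^sub>M lborel. norm (case x of (x, y) \<Rightarrow> f x * g y * h (x, y)) \<le> norm (B * (case x of (x, y) \<Rightarrow> f x * g y))"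
    by (intro AE_I2) (auto split: prod.split)
qed

lemma conv_commute:
  assumes f: "integrable lborel f" and g: "integrable lborel g" and \<phi>: "bdm \<phi>"
  shows "conv f (conv g \<phi>) x = conv g (conv f \<phi>) x"
proof -
  have [measurable]: "f \<in> borel_measurable borel" "g \<in> borel_measurable borel" "\<phi> \<in> borel_measurable borel"
    using assms by (auto simp: bdm_def)
  obtain B where B: "\<And>x. \<bar>\<phi> x\<bar> \<le> B" using bdmE[OF \<phi>] by metis
  have i: "integrable (lborel \<Otimes>\<^sub>M lborel) (\<lambda>(z, y). f z * g y * \<phi> (x - z - y))"
    using prod_bdm_integrable[OF f g, of "\<lambda>(z, y). \<phi> (x - z - y)" B] B by (auto split: prod.splits)
  have "conv f (conv g \<phi>) x = (\<integral>z. (\<integral>y. f z * g y * \<phi> (x - z - y) \<partial>lborel) \<partial>lborel)"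
    by (simp add: conv_def mult.assoc)
  also have "\<dots> = (\<integral>y. (\<integral>z. f z * g y * \<phi> (x - z - y) \<partial>lborel) \<partial>lborel)"
    by (rule lborel_pair.Fubini_integral[OF i, symmetric])
  also have "\<dots> = (\<integral>y. (\<integral>z. g y * (f z * \<phi> (x - y - z)) \<partial>lborel) \<partial>lborel)"
    by (intro Bochner_Integration.integral_cong refl) (simp add: mult_ac diff_diff_eq add.commute)
  also have "\<dots> = conv g (conv f \<phi>) x"
    by (simp add: conv_def)
  finally show ?thesis .
qed

lemma shifted_prod_integrable:
  fixes f g :: "'a::euclidean_space \<Rightarrow> real"
  assumes f: "integrable lborel f" and g: "integrable lborel g"
  shows "integrable (lborel \<Otimes>\<^sub>M lborel) (\<lambda>(z, x). f z * g (x - z))"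
proof (rule lborel_pair.Fubini_integrable)
  have [measurable]: "f \<in> borel_measurable borel" "g \<in> borel_measurable borel"
    using assms by auto
  have ig: "integrable lborel (\<lambda>x. g (x - z))" for z using g mpres_integrable[OF mpres_diff_right, of g z] by simp
  have ega: "(\<integral>x. \<bar>g (x - z)\<bar> \<partial>lborel) = (\<integral>x. \<bar>g x\<bar> \<partial>lborel)" for z using mpres_integral[OF mpres_diff_right, of "\<lambda>x. \<bar>g x\<bar>" z] by simp
  show "(\<lambda>(z, x). f z * g (x - z)) \<in> borel_measurable (lborel \<Otimes>\<^sub>M lborel)" by simp
  show "integrable lborel (\<lambda>z. LINT x|lborel. norm (case (z, x) of (z, x) \<Rightarrow> f z * g (x - z)))"
    using f by (simp add: abs_mult ega)
  show "AE z in lborel. integrable lborel (\<lambda>x. case (z, x) of (z, x) \<Rightarrow> f z * g (x - z))"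
    using ig by simp
qed

lemma conv_fn_integrable:
  assumes f: "integrable lborel f" and g: "integrable lborel g"
  shows "integrable lborel (conv f g)" "(\<integral>x. conv f g x \<partial>lborel) = (\<integral>x. f x \<partial>lborel) * (\<integral>x. g x \<partial>lborel)"
proof -
  have m[measurable]: "f \<in> borel_measurable borel" "g \<in> borel_measurable borel"
    using assms by auto
  have eg: "(\<integral>x. g (x - z) \<partial>lborel) = (\<integral>x. g x \<partial>lborel)" for z using mpres_integral[OF mpres_diff_right, of g z] by simp
  note i = shifted_prod_integrable[OF f g]
  show "integrable lborel (conv f g)"
    using lborel_pair.integrable_snd[OF i] by (simp add: conv_def[abs_def])
  have "(\<integral>x. conv f g x \<partial>lborel) = (\<integral>x. (\<integral>z. f z * g (x - z) \<partial>lborel) \<partial>lborel)" by (simp add: conv_def)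
  also have "\<dots> = (\<integral>z. (\<integral>x. f z * g (x - z) \<partial>lborel) \<partial>lborel)" by (rule lborel_pair.Fubini_integral[OF i])
  also have "\<dots> = (\<integral>x. f x \<partial>lborel) * (\<integral>x. g x \<partial>lborel)" by (simp add: eg)
  finally show "(\<integral>x. conv f g x \<partial>lborel) = (\<integral>x. f x \<partial>lborel) * (\<integral>x. g x \<partial>lborel)" .
qed

lemma conv_assoc:
  assumes f: "integrable lborel f" and g: "integrable lborel g" and \<phi>: "bdm \<phi>"
  shows "conv (conv f g) \<phi> x = conv f (conv g \<phi>) x"
proof -
  have [measurable]: "f \<in> borel_measurable borel" "g \<in> borel_measurable borel" "\<phi> \<in> borel_measurable borel"
    using assms by (auto simp: bdm_def)
  obtain B where B0: "B \<ge> 0" and B: "\<And>x. \<bar>\<phi> x\<bar> \<le> B" using bdmE[OF \<phi>] by metis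
  have bb: "\<bar>a * \<phi> p\<bar> \<le> \<bar>B * a\<bar>" for a p
    using B0 mult_mono[OF B[of p] order_refl[of "\<bar>a\<bar>"]] by (simp add: abs_mult mult.commute)
  have i2: "integrable (lborel \<Otimes>\<^sub>M lborel) (\<lambda>(z, y). f z * g (y - z) * \<phi> (x - y))"
    by (rule Bochner_Integration.integrable_bound[OF integrable_mult_right[OF shifted_prod_integrable[OF f g], of B]])
       (use bb in \<open>auto intro!: AE_I2 split: prod.split\<close>)
  have "conv (conv f g) \<phi> x = (\<integral>y. (\<integral>z. f z * g (y - z) * \<phi> (x - y) \<partial>lborel) \<partial>lborel)"
    by (simp add: conv_def)
  also have "\<dots> = (\<integral>z. (\<integral>y. f z * g (y - z) * \<phi> (x - y) \<partial>lborel) \<partial>lborel)"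
    by (rule lborel_pair.Fubini_integral[OF i2])
  also have "\<dots> = (\<integral>z. f z * (\<integral>y. g (y - z) * \<phi> (x - z - (y - z)) \<partial>lborel) \<partial>lborel)"
    by (simp add: mult.assoc)
  also have "\<dots> = (\<integral>z. f z * (\<integral>y. g y * \<phi> (x - z - y) \<partial>lborel) \<partial>lborel)"
  proof (rule Bochner_Integration.integral_cong[OF refl], rule arg_cong2[where f="(*)", OF refl])
    fix z
    show "(\<integral>y. g (y - z) * \<phi> (x - z - (y - z)) \<partial>lborel) = (\<integral>y. g y * \<phi> (x - z - y) \<partial>lborel)"
      by (rule mpres_integral[OF mpres_diff_right, of "\<lambda>y. g y * \<phi> (x - z - y)"]) simp
  qed
  also have "\<dots> = conv f (conv g \<phi>) x" by (simp add: conv_def)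
  finally show ?thesis .
qed

text \<open>Young's inequality for an integrable and a square integrable function:
  \<open>\<bar>g z\<bar>\<close> is split into two square roots, one of which stays with
  \<open>\<phi>\<close> in the Cauchy-Schwarz inequality, and the resulting double integral is
  evaluated in the other order.\<close>

lemma young:
  assumes g: "integrable lborel g" and \<phi>: "nice \<phi>"
  shows "nice (conv g \<phi>)" "nrm (conv g \<phi>) \<le> (\<integral>z. \<bar>g z\<bar> \<partial>lborel) * nrm \<phi>"
proof -
  have [measurable]: "g \<in> borel_measurable borel" "\<phi> \<in> borel_measurable borel"
    using assms by (auto simp: bdm_def nice_def)
  note [measurable] = conv_measurable[of g \<phi>]
  let ?I = "\<integral>z. \<bar>g z\<bar> \<partial>lborel"
  have I: "(\<integral>\<^sup>+z. ennreal \<bar>g z\<bar> \<partial>lborel) = ennreal ?I"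
    using g by (intro nn_integral_eq_integral) auto
  have N: "(\<integral>\<^sup>+x. ennreal ((\<phi> x)\<^sup>2) \<partial>lborel) = ennreal (ip \<phi> \<phi>)"
    using nice_sq[OF \<phi>] by (subst nn_integral_eq_integral) (auto simp: ip_def power2_eq_square)
  have pt: "ennreal ((conv g \<phi> x)\<^sup>2) \<le> ennreal ?I * (\<integral>\<^sup>+z. ennreal (\<bar>g z\<bar> * (\<phi> (x - z))\<^sup>2) \<partial>lborel)" for x
  proof -
    have int: "integrable lborel (\<lambda>z. g z * \<phi> (x - z))" by (rule conv_integrable[OF g nice_bdm[OF \<phi>]])
    have "ennreal \<bar>conv g \<phi> x\<bar> \<le> (\<integral>\<^sup>+z. ennreal \<bar>g z * \<phi> (x - z)\<bar> \<partial>lborel)"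
      unfolding conv_def using integral_norm_bound_ennreal[OF int] by simp
    also have "\<dots> = (\<integral>\<^sup>+z. ennreal (sqrt \<bar>g z\<bar>) * ennreal (sqrt \<bar>g z\<bar> * \<bar>\<phi> (x - z)\<bar>) \<partial>lborel)"
      by (intro nn_integral_cong) (simp add: abs_mult flip: ennreal_mult mult.assoc)
    finally have "(ennreal \<bar>conv g \<phi> x\<bar>)\<^sup>2 \<le> \<dots>\<^sup>2" by (rule power_mono) simp
    also have "\<dots> \<le> (\<integral>\<^sup>+z. (ennreal (sqrt \<bar>g z\<bar>))\<^sup>2 \<partial>lborel) * (\<integral>\<^sup>+z. (ennreal (sqrt \<bar>g z\<bar> * \<bar>\<phi> (x - z)\<bar>))\<^sup>2 \<partial>lborel)"
      by (rule Cauchy_Schwarz_nn_integral) simp_all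
    also have "\<dots> = ennreal ?I * (\<integral>\<^sup>+z. ennreal (\<bar>g z\<bar> * (\<phi> (x - z))\<^sup>2) \<partial>lborel)"
      by (simp add: ennreal_power power_mult_distrib I)
    finally show ?thesis by (simp add: ennreal_power)
  qed
  have "(\<integral>\<^sup>+x. ennreal ((conv g \<phi> x)\<^sup>2) \<partial>lborel) \<le> (\<integral>\<^sup>+x. ennreal ?I * (\<integral>\<^sup>+z. ennreal (\<bar>g z\<bar> * (\<phi> (x - z))\<^sup>2) \<partial>lborel) \<partial>lborel)"
    by (intro nn_integral_mono pt)
  also have "\<dots> = ennreal ?I * (\<integral>\<^sup>+x. (\<integral>\<^sup>+z. ennreal (\<bar>g z\<bar> * (\<phi> (x - z))\<^sup>2) \<partial>lborel) \<partial>lborel)"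
    by (rule nn_integral_cmult) simp
  also have "(\<integral>\<^sup>+x. (\<integral>\<^sup>+z. ennreal (\<bar>g z\<bar> * (\<phi> (x - z))\<^sup>2) \<partial>lborel) \<partial>lborel) = (\<integral>\<^sup>+z. (\<integral>\<^sup>+x. ennreal (\<bar>g z\<bar> * (\<phi> (x - z))\<^sup>2) \<partial>lborel) \<partial>lborel)"
    by (rule lborel_pair.Fubini') simp
  also have "\<dots> = (\<integral>\<^sup>+z. ennreal \<bar>g z\<bar> * (\<integral>\<^sup>+x. ennreal ((\<phi> (x - z))\<^sup>2) \<partial>lborel) \<partial>lborel)"
    by (simp add: ennreal_mult nn_integral_cmult)
  also have "\<dots> = (\<integral>\<^sup>+z. ennreal \<bar>g z\<bar> * ennreal (ip \<phi> \<phi>) \<partial>lborel)"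
  proof (intro nn_integral_cong arg_cong2[where f="(*)"] refl)
    fix z
    show "(\<integral>\<^sup>+x. ennreal ((\<phi> (x - z))\<^sup>2) \<partial>lborel) = ennreal (ip \<phi> \<phi>)"
      unfolding N[symmetric] by (rule mpres_nn_integral[OF mpres_diff_right, of "\<lambda>x. ennreal ((\<phi> x)\<^sup>2)"]) simp
  qed
  also have "\<dots> = ennreal ?I * ennreal (ip \<phi> \<phi>)" by (simp add: nn_integral_multc I)
  finally have main: "(\<integral>\<^sup>+x. ennreal ((conv g \<phi> x)\<^sup>2) \<partial>lborel) \<le> ennreal (?I\<^sup>2 * ip \<phi> \<phi>)"
    by (simp add: ennreal_mult[symmetric] ip_nonneg power2_eq_square mult.assoc)
  then have "(\<integral>\<^sup>+x. ennreal ((conv g \<phi> x)\<^sup>2) \<partial>lborel) < \<infinity>"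
    by (rule le_less_trans) simp
  then have int: "integrable lborel (\<lambda>x. (conv g \<phi> x)\<^sup>2)"
    by (intro integrableI_bounded) auto
  then show n: "nice (conv g \<phi>)" using bdm_conv[OF g nice_bdm[OF \<phi>]] by (simp add: nice_def)
  have "ennreal (ip (conv g \<phi>) (conv g \<phi>)) \<le> ennreal (?I\<^sup>2 * ip \<phi> \<phi>)"
    using main int by (subst (asm) nn_integral_eq_integral) (auto simp: ip_def power2_eq_square)
  then have "ip (conv g \<phi>) (conv g \<phi>) \<le> ?I\<^sup>2 * ip \<phi> \<phi>"
    by (simp add: ip_nonneg)
  then have "sqrt (ip (conv g \<phi>) (conv g \<phi>)) \<le> sqrt (?I\<^sup>2 * ip \<phi> \<phi>)" by (rule real_sqrt_le_mono)
  then show "nrm (conv g \<phi>) \<le> ?I * nrm \<phi>" by (simp add: nrm_def real_sqrt_mult)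
qed

lemma ip_conv_integrable:
  assumes g: "integrable lborel g" and \<phi>: "nice \<phi>" and \<psi>: "nice \<psi>"
  shows "integrable (lborel \<Otimes>\<^sub>M lborel) (\<lambda>(x, y). \<phi> x * (g (x - y) * \<psi> y))"
proof (rule lborel_pair.Fubini_integrable)
  have [measurable]: "g \<in> borel_measurable borel" "\<phi> \<in> borel_measurable borel" "\<psi> \<in> borel_measurable borel"
    using assms by (auto simp: bdm_def nice_def)
  show "(\<lambda>(x, y). \<phi> x * (g (x - y) * \<psi> y)) \<in> borel_measurable (lborel \<Otimes>\<^sub>M lborel)" by simp
  have na: "nice (\<lambda>x. \<bar>\<phi> x\<bar>)" "nice (\<lambda>x. \<bar>\<psi> x\<bar>)" using nice_le[OF \<phi>] nice_le[OF \<psi>] by auto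
  have ga: "integrable lborel (\<lambda>z. \<bar>g z\<bar>)" using g by auto
  have "integrable lborel (\<lambda>x. \<bar>\<phi> x\<bar> * conv (\<lambda>z. \<bar>g z\<bar>) (\<lambda>x. \<bar>\<psi> x\<bar>) x)"
    by (rule nice_mult_integrable[OF na(1) young(1)[OF ga na(2)]])
  then show "integrable lborel (\<lambda>x. LINT y|lborel. norm (case (x, y) of (x, y) \<Rightarrow> \<phi> x * (g (x - y) * \<psi> y)))"
    by (simp add: abs_mult conv_alt)
  show "AE x in lborel. integrable lborel (\<lambda>y. case (x, y) of (x, y) \<Rightarrow> \<phi> x * (g (x - y) * \<psi> y))"
    using conv_alt_integrable[OF g nice_bdm[OF \<psi>]] by simp
qed

lemma ip_conv_sym:
  assumes g: "integrable lborel g" and \<phi>: "nice \<phi>" and \<psi>: "nice \<psi>" and even: "\<And>z. g (- z) = g z"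
  shows "ip \<phi> (conv g \<psi>) = ip (conv g \<phi>) \<psi>"
proof -
  have m: "g \<in> borel_measurable borel" "\<phi> \<in> borel_measurable borel" "\<psi> \<in> borel_measurable borel"
    using assms by (auto simp: bdm_def nice_def)
  have ev: "g (x - y) = g (y - x)" for x y using even[of "x - y"] by simp
  have "ip \<phi> (conv g \<psi>) = (\<integral>x. (\<integral>y. \<phi> x * (g (x - y) * \<psi> y) \<partial>lborel) \<partial>lborel)"
    using m by (simp add: ip_def conv_alt)
  also have "\<dots> = (\<integral>y. (\<integral>x. \<phi> x * (g (x - y) * \<psi> y) \<partial>lborel) \<partial>lborel)"
    by (rule lborel_pair.Fubini_integral[symmetric]) (rule ip_conv_integrable[OF g \<phi> \<psi>])
  also have "\<dots> = (\<integral>y. (\<integral>x. (g (y - x) * \<phi> x) * \<psi> y \<partial>lborel) \<partial>lborel)"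
  proof (intro Bochner_Integration.integral_cong refl)
    fix y x show "\<phi> x * (g (x - y) * \<psi> y) = (g (y - x) * \<phi> x) * \<psi> y"
      unfolding ev[of x y] by simp
  qed
  also have "\<dots> = ip (conv g \<phi>) \<psi>"
    using m by (simp add: ip_def conv_alt)
  finally show ?thesis .
qed

section \<open>Truncated resolvents\<close>

text \<open>For points of equal norm the condition applies in both directions, so radial symmetry
  and monotonicity are expressed together and no profile function has to be named.\<close>

definition RD :: "('a::euclidean_space \<Rightarrow> real) \<Rightarrow> bool" where
  "RD g \<longleftrightarrow> (\<forall>x y. norm x \<le> norm y \<longrightarrow> g y \<le> g x)"

lemma RD_D: "RD g \<Longrightarrow> norm x \<le> norm y \<Longrightarrow> g y \<le> g x" by (auto simp: RD_def)
lemma RD_eq: "RD g \<Longrightarrow> norm x = norm y \<Longrightarrow> g x = g y" by (auto simp: RD_def intro: antisym)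
lemma RD_even: "RD g \<Longrightarrow> g (- x) = g x" by (rule RD_eq) simp_all

text \<open>Along a ray the function is monotone, hence measurable, and everywhere else its value is
  determined by the norm.\<close>

lemma RD_measurable:
  fixes g :: "'a::euclidean_space \<Rightarrow> real"
  assumes "RD g" shows "g \<in> borel_measurable borel"
proof -
  obtain e :: 'a where e: "norm e = 1" using norm_Basis nonempty_Basis by blast
  define \<kappa> where "\<kappa> r = - g (max r 0 *\<^sub>R e)" for r :: real
  have "mono \<kappa>"
    by (intro monoI) (auto simp: \<kappa>_def e intro!: RD_D[OF assms])
  then have [measurable]: "\<kappa> \<in> borel_measurable borel" by (rule borel_measurable_mono)
  have "g = (\<lambda>x. - \<kappa> (norm x))"
    by (rule ext) (auto simp: \<kappa>_def e intro!: RD_eq[OF assms])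
  moreover have "(\<lambda>x::'a. - \<kappa> (norm x)) \<in> borel_measurable borel" by measurable
  ultimately show ?thesis by simp
qed

lemma conv_rfl:
  assumes e: "norm e = 1" and g: "RD g" and [measurable]: "\<phi> \<in> borel_measurable borel"
  shows "conv g (\<lambda>z. \<phi> (rfl e l z)) x = conv g \<phi> (rfl e l x)"
proof -
  note [measurable] = RD_measurable[OF g]
  have "conv g \<phi> (rfl e l x) = (\<integral>z. g (rfl e l x - z) * \<phi> z \<partial>lborel)" by (rule conv_alt) auto
  also have "\<dots> = (\<integral>z. g (rfl e l x - rfl e l z) * \<phi> (rfl e l z) \<partial>lborel)"
    by (rule mpres_integral[OF mpres_rfl[OF e], symmetric]) simp
  also have "\<dots> = (\<integral>z. g (x - z) * \<phi> (rfl e l z) \<partial>lborel)"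
    using RD_eq[OF g norm_rfl_diff[OF e]] by simp
  also have "\<dots> = conv g (\<lambda>z. \<phi> (rfl e l z)) x" by (rule conv_alt[symmetric]) auto
  finally show ?thesis by simp
qed

text \<open>The resolvents map this cone into itself, which is the comparison principle for reflected differences.\<close>
definition ascone :: "'a::euclidean_space \<Rightarrow> real \<Rightarrow> ('a \<Rightarrow> real) \<Rightarrow> bool" where
  "ascone e l \<phi> \<longleftrightarrow> bdm \<phi> \<and> (\<forall>x. \<phi> (rfl e l x) = - \<phi> x) \<and> (\<forall>x. x \<bullet> e \<le> l \<longrightarrow> 0 \<le> \<phi> x)"

lemma norm_rfl_le:
  assumes "norm e = 1" "(x \<bullet> e - l) * (z \<bullet> e - l) \<ge> 0"
  shows "norm (x - z) \<le> norm (x - rfl e l z)"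
proof (rule power2_le_imp_le)
  show "(norm (x - z))\<^sup>2 \<le> (norm (x - rfl e l z))\<^sup>2"
    unfolding norm_rfl_sq[OF assms(1), of x l z] mult.assoc using assms(2) by linarith
qed simp

lemma norm_rfl_ge:
  assumes "norm e = 1" "(x \<bullet> e - l) * (z \<bullet> e - l) \<le> 0"
  shows "norm (x - rfl e l z) \<le> norm (x - z)"
proof (rule power2_le_imp_le)
  show "(norm (x - rfl e l z))\<^sup>2 \<le> (norm (x - z))\<^sup>2"
    unfolding norm_rfl_sq[OF assms(1), of x l z] mult.assoc using assms(2) by linarith
qed simp

text \<open>Averaging the convolution integral with its reflected form replaces the kernel by the
  difference of its values at mirror points, which has a sign on each side of the plane.\<close>

lemma conv_cone_half:
  assumes e: "norm e = 1" and g: "RD g" "integrable lborel g" and \<phi>: "ascone e l \<phi>"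
  shows "integrable lborel (\<lambda>z. (g (x - z) - g (x - rfl e l z)) * \<phi> z)"
    and "conv g \<phi> x = (\<integral>z. (g (x - z) - g (x - rfl e l z)) * \<phi> z \<partial>lborel) / 2"
proof -
  note [measurable] = RD_measurable[OF g(1)]
  have b: "bdm \<phi>" and anti: "\<phi> (rfl e l z) = - \<phi> z" for z using \<phi> by (auto simp: ascone_def)
  note [measurable] = bdm_meas[OF b]
  have i1: "integrable lborel (\<lambda>z. g (x - z) * \<phi> z)" by (rule conv_alt_integrable[OF g(2) b])
  have "integrable lborel (\<lambda>z. g (x - rfl e l z) * \<phi> (rfl e l z))"
    using i1 by (subst mpres_integrable[OF mpres_rfl[OF e]]) auto
  then have i2: "integrable lborel (\<lambda>z. g (x - rfl e l z) * \<phi> z)" by (simp add: anti)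
  show "integrable lborel (\<lambda>z. (g (x - z) - g (x - rfl e l z)) * \<phi> z)"
    using i1 i2 by (simp add: left_diff_distrib)
  have c: "conv g \<phi> x = (\<integral>z. g (x - z) * \<phi> z \<partial>lborel)" by (rule conv_alt) auto
  also have "\<dots> = (\<integral>z. g (x - rfl e l z) * \<phi> (rfl e l z) \<partial>lborel)"
    by (rule mpres_integral[OF mpres_rfl[OF e], symmetric]) simp
  also have "\<dots> = - (\<integral>z. g (x - rfl e l z) * \<phi> z \<partial>lborel)" by (simp add: anti)
  finally show "conv g \<phi> x = (\<integral>z. (g (x - z) - g (x - rfl e l z)) * \<phi> z \<partial>lborel) / 2"
    using c i1 i2 by (simp add: left_diff_distrib)
qed

text \<open>Both factors change sign when \<open>z\<close> crosses the plane: the kernel is larger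
  at whichever of \<open>z\<close> and its mirror image lies on the side of
  \<open>x\<close>.\<close>

lemma cone_integrand_nonneg:
  assumes e: "norm e = 1" and g: "RD g" and \<phi>: "ascone e l \<phi>" and x: "x \<bullet> e \<le> l"
  shows "0 \<le> (g (x - z) - g (x - rfl e l z)) * \<phi> z"
proof (cases "z \<bullet> e \<le> l")
  case True
  then have "norm (x - z) \<le> norm (x - rfl e l z)" using x by (intro norm_rfl_le[OF e] mult_nonpos_nonpos) auto
  then have "g (x - rfl e l z) \<le> g (x - z)" by (rule RD_D[OF g])
  then show ?thesis using True \<phi> by (auto simp: ascone_def)
next
  case False
  then have "norm (x - rfl e l z) \<le> norm (x - z)" using x by (intro norm_rfl_ge[OF e] mult_nonpos_nonneg) auto
  then have 1: "g (x - z) \<le> g (x - rfl e l z)" by (rule RD_D[OF g])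
  have "rfl e l z \<bullet> e \<le> l" using False by (simp add: rfl_inner[OF e])
  then have "0 \<le> \<phi> (rfl e l z)" "\<phi> (rfl e l z) = - \<phi> z" using \<phi> by (auto simp: ascone_def)
  then show ?thesis using 1 by (intro mult_nonpos_nonpos) auto
qed

lemma cone_conv:
  assumes e: "norm e = 1" and g: "RD g" "integrable lborel g" and \<phi>: "ascone e l \<phi>"
  shows "ascone e l (conv g \<phi>)"
proof -
  have b: "bdm \<phi>" and anti: "\<phi> (rfl e l z) = - \<phi> z" for z using \<phi> by (auto simp: ascone_def)
  have "conv g \<phi> (rfl e l x) = - conv g \<phi> x" for x
    using conv_rfl[OF e g(1) bdm_meas[OF b], of l x] conv_cmult_right[of g "-1" \<phi> x] by (simp add: anti)
  moreover have "0 \<le> conv g \<phi> x" if "x \<bullet> e \<le> l" for x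
    unfolding conv_cone_half(2)[OF e g \<phi>] using cone_integrand_nonneg[OF e g(1) \<phi> that] by simp
  ultimately show ?thesis using bdm_conv[OF g(2) b] by (simp add: ascone_def)
qed

lemma cone_add: "ascone e l \<phi> \<Longrightarrow> ascone e l \<psi> \<Longrightarrow> ascone e l (\<lambda>x. \<phi> x + \<psi> x)"
  by (auto simp: ascone_def bdm_add)

lemma cone_cmult: "ascone e l \<phi> \<Longrightarrow> 0 \<le> c \<Longrightarrow> ascone e l (\<lambda>x. c * \<phi> x)"
  by (auto simp: ascone_def bdm_cmult)

lemma cone_antisym:
  assumes e: "norm e = 1" and b: "bdm g" and le: "\<And>z. z \<bullet> e \<le> l \<Longrightarrow> g (rfl e l z) \<le> g z"
  shows "ascone e l (\<lambda>z. g z - g (rfl e l z))"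
  using bdm_diff[OF b bdm_mpres[OF b mpres_rfl[OF e]]] le by (auto simp: ascone_def rfl_rfl[OF e])

text \<open>If \<open>x\<close> is no farther from 0 than \<open>y\<close>, the bisector of the two
  has 0 on the side of \<open>x\<close>. Hence \<open>g\<close> minus its reflection lies in the
  cone of that plane, convolution with \<open>K\<close> keeps it there, and its value at
  \<open>x\<close> is the difference to be estimated.\<close>

lemma RD_conv:
  assumes K: "RD K" "integrable lborel K" and g: "RD g" "bdm g"
  shows "RD (conv K g)"
  unfolding RD_def
proof (intro allI impI)
  fix x y :: 'a assume xy: "norm x \<le> norm y"
  show "conv K g y \<le> conv K g x"
  proof (cases "x = y")
    case False
    then obtain e l where e: "norm e = 1" and r: "rfl e l x = y"
      and side: "\<And>z. (z \<bullet> e \<le> l) \<longleftrightarrow> norm (z - x) \<le> norm (z - y)"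
      using exists_rfl_swap by blast
    have l0: "0 \<le> l" using side[of 0] xy by simp
    have xl: "x \<bullet> e \<le> l" using side[of x] by simp
    have le: "g (rfl e l z) \<le> g z" if "z \<bullet> e \<le> l" for z
    proof (rule RD_D[OF g(1)])
      have "norm (0 - z) \<le> norm (0 - rfl e l z)" using that l0
        by (intro norm_rfl_le[OF e] mult_nonpos_nonpos) auto
      then show "norm z \<le> norm (rfl e l z)" by simp
    qed
    have "ascone e l (conv K (\<lambda>z. g z - g (rfl e l z)))"
      by (intro cone_conv[OF e K] cone_antisym[OF e g(2)] le)
    then have "0 \<le> conv K (\<lambda>z. g z - g (rfl e l z)) x" using xl by (auto simp: ascone_def)
    also have "\<dots> = conv K g x - conv K g y"
      using conv_diff_right[OF K(2) g(2) bdm_mpres[OF g(2) mpres_rfl[OF e]]]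
        conv_rfl[OF e K(1) bdm_meas[OF g(2)]] r by simp
    finally show ?thesis by simp
  qed simp
qed

text \<open>
  The resolvent of the operator with an integrable kernel \<open>K\<close> is \<open>(\<Lambda> + 2 \<integral>K - 2 K *)\<^sup>-\<^sup>1 = ratom + g *\<close>. The factor 2
  arises because the double integral counts every pair of points twice.
\<close>
definition ratom :: "real \<Rightarrow> ('a::euclidean_space \<Rightarrow> real) \<Rightarrow> real" where
  "ratom \<Lambda> K = 1 / (\<Lambda> + 2 * (\<integral>x. K x \<partial>lborel))"

definition rkernel :: "('a::euclidean_space \<Rightarrow> real) \<Rightarrow> bool" where
  "rkernel K \<longleftrightarrow> RD K \<and> (\<forall>x. 0 \<le> K x) \<and> integrable lborel K \<and> bdm K"

text \<open>The last clause is what remains of the resolvent equation once the multiple of the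
  identity has been cancelled. The clause on the integral says that the resolvent multiplies
  constants by \<open>1 / \<Lambda>\<close>.\<close>

definition reskernel :: "real \<Rightarrow> ('a::euclidean_space \<Rightarrow> real) \<Rightarrow> ('a \<Rightarrow> real) \<Rightarrow> bool" where
  "reskernel \<Lambda> K g \<longleftrightarrow> rkernel g \<and> (\<integral>x. g x \<partial>lborel) = 1 / \<Lambda> - ratom \<Lambda> K \<and>
     (\<forall>x. g x = 2 * ratom \<Lambda> K * (conv K g x + ratom \<Lambda> K * K x))"

lemma kernelD: "rkernel K \<Longrightarrow> RD K" "rkernel K \<Longrightarrow> 0 \<le> K x" "rkernel K \<Longrightarrow> integrable lborel K" "rkernel K \<Longrightarrow> bdm K"
  by (auto simp: rkernel_def)

lemma kernel_int_nonneg: "rkernel K \<Longrightarrow> 0 \<le> (\<integral>x. K x \<partial>lborel)"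
  by (simp add: rkernel_def)

lemma kernel_int_abs: "rkernel K \<Longrightarrow> (\<integral>x. \<bar>K x\<bar> \<partial>lborel) = (\<integral>x. K x \<partial>lborel)"
  by (simp add: rkernel_def)

lemma ratom_pos: "rkernel K \<Longrightarrow> \<Lambda> > 0 \<Longrightarrow> 0 < ratom \<Lambda> K"
  using kernel_int_nonneg[of K] by (simp add: ratom_def)

lemma ratom_eq: "rkernel K \<Longrightarrow> \<Lambda> > 0 \<Longrightarrow> ratom \<Lambda> K * (\<Lambda> + 2 * (\<integral>x. K x \<partial>lborel)) = 1"
  using kernel_int_nonneg[of K] by (simp add: ratom_def)

text \<open>\<open>g\<close> is the sum of a Neumann series, obtained as the increasing limit of its
  partial sums \<open>F n\<close>. The ratio \<open>2 * a * ?M = 1 - a * \<Lambda>\<close> is less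
  than 1, and monotone limits keep sign, bounds and radial monotonicity.\<close>

lemma reskernel_exists:
  fixes K :: "'a::euclidean_space \<Rightarrow> real"
  assumes K: "rkernel K" and \<Lambda>: "\<Lambda> > 0"
  shows "\<exists>g. reskernel \<Lambda> K g"
proof -
  let ?M = "\<integral>x. K x \<partial>lborel"
  define a where "a = ratom \<Lambda> K"
  note K' = kernelD[OF K]
  note [measurable] = bdm_meas[OF K'(4)]
  have M0: "?M \<ge> 0" by (rule kernel_int_nonneg[OF K])
  have a0: "a > 0" unfolding a_def by (rule ratom_pos[OF K \<Lambda>])
  have aM: "a * \<Lambda> + 2 * a * ?M = 1" using ratom_eq[OF K \<Lambda>] by (simp add: a_def algebra_simps)
  obtain m where m0: "m \<ge> 0" and m: "\<And>x. \<bar>K x\<bar> \<le> m" using bdmE[OF K'(4)] by metis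
  \<comment> \<open>The fixed point of the recursion that the iteration induces on upper bounds, as
    \<open>bstep\<close> shows.\<close>
  define b where "b = 2 * a * m / \<Lambda>"
  have b0: "b \<ge> 0" using a0 m0 \<Lambda> by (simp add: b_def)
  have bstep: "2 * a * (?M * b + a * m) = b"
  proof -
    have "2 * a * ?M * b + 2 * a * a * m = (2 * a * ?M) * b + (a * \<Lambda>) * b"
      using \<Lambda> by (simp add: b_def)
    also have "\<dots> = (a * \<Lambda> + 2 * a * ?M) * b" by (simp add: algebra_simps)
    also have "\<dots> = b" by (simp add: aM)
    finally show ?thesis by (simp add: algebra_simps)
  qed
  define F where "F = rec_nat (\<lambda>_::'a. 0::real) (\<lambda>_ G x. 2 * a * (conv K G x + a * K x))"
  have F0: "F 0 = (\<lambda>_. 0)" and FS: "F (Suc n) = (\<lambda>x. 2 * a * (conv K (F n) x + a * K x))" for n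
    by (simp_all add: F_def)
  have inv: "RD (F n) \<and> bdm (F n) \<and> (\<forall>x. 0 \<le> F n x \<and> F n x \<le> b) \<and> integrable lborel (F n)" for n
  proof (induction n)
    case 0 then show ?case using b0 by (auto simp: F0 RD_def bdm_def)
  next
    case (Suc n)
    then have IH: "RD (F n)" "bdm (F n)" "\<And>x. 0 \<le> F n x" "\<And>x. F n x \<le> b" "integrable lborel (F n)" by auto
    have "RD (conv K (F n))" by (rule RD_conv[OF K'(1,3) IH(1,2)])
    then have "RD (F (Suc n))" using K'(1) a0 unfolding FS RD_def
      by (auto intro!: mult_left_mono add_mono)
    moreover have "bdm (F (Suc n))" unfolding FS
      by (intro bdm_cmult bdm_add bdm_conv K' IH)
    moreover have "0 \<le> F (Suc n) x" for x
      unfolding FS using a0 conv_nonneg[of K "F n" x] K'(2) IH(3) by simp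
    moreover have "F (Suc n) x \<le> b" for x
    proof -
      have "\<bar>conv K (F n) x\<bar> \<le> ?M * b"
        using conv_bound[OF K'(3) IH(2), of b x] IH(3,4) by (simp add: kernel_int_abs[OF K])
      moreover have "a * K x \<le> a * m" using m[of x] a0 by (intro mult_left_mono) auto
      ultimately have "2 * a * (conv K (F n) x + a * K x) \<le> 2 * a * (?M * b + a * m)"
        using a0 abs_le_D1 by (intro mult_left_mono add_mono) fastforce+
      then show ?thesis unfolding FS bstep .
    qed
    moreover have "integrable lborel (F (Suc n))"
      unfolding FS using conv_fn_integrable(1)[OF K'(3) IH(5)] K'(3) by auto
    ultimately show ?case by auto
  qed
  have Fm[measurable]: "F n \<in> borel_measurable borel" for n using inv bdm_meas by blast
  have Fi: "integrable lborel (F n)" for n using inv by blast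
  have inc: "F n x \<le> F (Suc n) x" for n x
  proof (induction n arbitrary: x)
    case 0 then show ?case using inv[of "Suc 0"] by (simp add: F0)
  next
    case (Suc n)
    have "conv K (F n) x \<le> conv K (F (Suc n)) x" 
      using inv Suc by (intro conv_mono[OF K'(3,2)]) auto
    then show ?case unfolding FS[of "Suc n"] unfolding FS[of n] using a0 
      by (intro mult_left_mono add_right_mono) (auto simp: FS)
  qed
  then have incs: "incseq (\<lambda>n. F n x)" for x by (simp add: incseq_Suc_iff)
  have bdd: "bdd_above (range (\<lambda>n. F n x))" for x using inv by (intro bdd_aboveI2[of _ _ b]) auto
  define g where "g x = (SUP n. F n x)" for x
  have lim: "(\<lambda>n. F n x) \<longlonglongrightarrow> g x" for x
    unfolding g_def by (rule LIMSEQ_incseq_SUP[OF bdd incs])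
  have g0: "0 \<le> g x" for x using inv by (intro LIMSEQ_le_const[OF lim]) auto
  have gb: "g x \<le> b" for x using inv by (intro LIMSEQ_le_const2[OF lim]) auto
  have gm[measurable]: "g \<in> borel_measurable borel"
    by (rule borel_measurable_LIMSEQ_real[OF lim]) simp
  have gRD: "RD g" unfolding RD_def using inv
    by (intro allI impI LIMSEQ_le[OF lim lim]) (auto simp: RD_def)
  have gbdm: "bdm g" by (rule bdmI[OF gm, of b]) (use g0 gb in auto)
  define J where "J n = (\<integral>x. F n x \<partial>lborel)" for n
  have JS: "J (Suc n) = 2 * a * (?M * J n + a * ?M)" for n
    unfolding J_def FS using conv_fn_integrable[OF K'(3) Fi] K'(3) by simp
  \<comment> \<open>In the same way the fixed point of the recursion \<open>JS\<close> for the
    integrals.\<close>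
  define I where "I = 2 * a * ?M / \<Lambda>"
  have Istep: "2 * a * (?M * I + a * ?M) = I"
  proof -
    have "2 * a * ?M * I + 2 * a * a * ?M = (2 * a * ?M) * I + (a * \<Lambda>) * I"
      using \<Lambda> by (simp add: I_def)
    also have "\<dots> = (a * \<Lambda> + 2 * a * ?M) * I" by (simp add: algebra_simps)
    also have "\<dots> = I" by (simp add: aM)
    finally show ?thesis by (simp add: algebra_simps)
  qed
  have I0: "I \<ge> 0" using a0 M0 \<Lambda> by (simp add: I_def)
  have JI: "J n \<le> I" for n
  proof (induction n)
    case 0 then show ?case using I0 by (simp add: J_def F0)
  next
    case (Suc n)
    have "2 * a * (?M * J n + a * ?M) \<le> 2 * a * (?M * I + a * ?M)"
      using a0 M0 Suc by (intro mult_left_mono add_right_mono) auto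
    then show ?case unfolding JS Istep .
  qed
  have Jinc: "incseq J" unfolding incseq_Suc_iff J_def by (intro allI integral_mono Fi inc)
  have "convergent J" using JI Jinc by (meson incseq_convergent convergentI)
  then obtain j where j: "J \<longlonglongrightarrow> j" by (auto simp: convergent_def)
  have "(\<lambda>n. J (Suc n)) \<longlonglongrightarrow> 2 * a * (?M * j + a * ?M)"
    unfolding JS by (intro tendsto_intros j)
  then have jeq: "j = 2 * a * (?M * j + a * ?M)"
    using LIMSEQ_unique LIMSEQ_Suc[OF j] by blast
  have "j * (a * \<Lambda>) = 2 * a * a * ?M"
  proof -
    have "j * (a * \<Lambda> + 2 * a * ?M) = 2 * a * (?M * j + a * ?M)" using jeq aM by simp
    then show ?thesis by (simp add: algebra_simps)
  qed
  then have jval: "j = 1 / \<Lambda> - a"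
  proof -
    have "j * \<Lambda> = 2 * a * ?M" using \<open>j * (a * \<Lambda>) = 2 * a * a * ?M\<close> a0 by simp
    then have "j * \<Lambda> = 1 - a * \<Lambda>" using aM by simp
    then show ?thesis using \<Lambda> by (simp add: field_simps)
  qed
  have gi: "integrable lborel g" and gint: "(\<integral>x. g x \<partial>lborel) = j"
    using integrable_monotone_convergence[of lborel F g j] integral_monotone_convergence[of lborel F g j]
      Fi incs lim j by (auto simp: J_def[abs_def] incseq_def)
  have convlim: "(\<lambda>n. conv K (F n) x) \<longlonglongrightarrow> conv K g x" for x
    unfolding conv_def
  proof (rule integral_dominated_convergence[where w="\<lambda>z. K z * b"])
    show "integrable lborel (\<lambda>z. K z * b)" using K'(3) by simp
    show "AE z in lborel. (\<lambda>n. K z * F n (x - z)) \<longlonglongrightarrow> K z * g (x - z)"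
      by (intro AE_I2 tendsto_intros lim)
    show "AE z in lborel. norm (K z * F n (x - z)) \<le> K z * b" for n
      using inv K'(2) by (intro AE_I2) (auto simp: abs_mult intro!: mult_left_mono)
  qed simp_all
  have geq: "g x = 2 * a * (conv K g x + a * K x)" for x
  proof (rule LIMSEQ_unique)
    show "(\<lambda>n. F (Suc n) x) \<longlonglongrightarrow> g x" by (rule LIMSEQ_Suc[OF lim])
    show "(\<lambda>n. F (Suc n) x) \<longlonglongrightarrow> 2 * a * (conv K g x + a * K x)"
      unfolding FS by (intro tendsto_intros convlim)
  qed
  have "reskernel \<Lambda> K g"
    unfolding reskernel_def rkernel_def a_def[symmetric]
    using gRD g0 gi gbdm gint[unfolded jval] geq by blast
  then show ?thesis by blast
qed

section \<open>The resolvent as an operator\<close>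

definition Gop :: "real \<Rightarrow> ('a::euclidean_space \<Rightarrow> real) \<Rightarrow> ('a \<Rightarrow> real) \<Rightarrow> 'a \<Rightarrow> real" where
  "Gop a g \<phi> x = a * \<phi> x + conv g \<phi> x"

context
  fixes K g :: "'a::euclidean_space \<Rightarrow> real" and \<Lambda> a :: real
  assumes K: "rkernel K" and \<Lambda>: "\<Lambda> > 0" and rk: "reskernel \<Lambda> K g" and a: "a = ratom \<Lambda> K"
begin

lemma rk_kernel: "rkernel g" using rk by (simp add: reskernel_def)
lemma rk_int: "(\<integral>x. g x \<partial>lborel) = 1 / \<Lambda> - a" using rk unfolding reskernel_def a by blast

lemma a_pos: "a > 0" using ratom_pos[OF K \<Lambda>] a by simp

lemma Gop_eq:
  assumes \<phi>: "bdm \<phi>"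
  shows "(\<Lambda> + 2 * (\<integral>x. K x \<partial>lborel)) * Gop a g \<phi> x = \<phi> x + 2 * conv K (Gop a g \<phi>) x"
proof -
  note K' = kernelD[OF K] and g' = kernelD[OF rk_kernel]
  have geq: "g = (\<lambda>x. 2 * a * (conv K g x + a * K x))" using rk unfolding reskernel_def a by blast
  have "conv g \<phi> x = conv (\<lambda>x. 2 * a * (conv K g x + a * K x)) \<phi> x" using geq by simp
  also have "\<dots> = 2 * a * (conv (conv K g) \<phi> x + a * conv K \<phi> x)"
    using conv_add_left[OF conv_fn_integrable(1)[OF K'(3) g'(3)] integrable_mult_right[OF K'(3), of a] \<phi>, of x]
    by (simp add: conv_cmult_left)
  also have "\<dots> = 2 * a * conv K (Gop a g \<phi>) x"
    unfolding Gop_def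
    using conv_add_right[OF K'(3) bdm_cmult[OF \<phi>, of a] bdm_conv[OF g'(3) \<phi>], of x]
      conv_assoc[OF K'(3) g'(3) \<phi>] by (simp add: conv_cmult_right)
  finally have "Gop a g \<phi> x = a * (\<phi> x + 2 * conv K (Gop a g \<phi>) x)"
    by (simp add: Gop_def algebra_simps)
  then show ?thesis using ratom_eq[OF K \<Lambda>] a by (simp add: mult.commute mult.left_commute flip: mult.assoc)
qed

lemma nice_Gop: "nice \<phi> \<Longrightarrow> nice (Gop a g \<phi>)"
  unfolding Gop_def using kernelD[OF rk_kernel] by (intro nice_add nice_cmult young) auto

lemma nrm_Gop: assumes "nice \<phi>" shows "nrm (Gop a g \<phi>) \<le> nrm \<phi> / \<Lambda>"
proof -
  note g' = kernelD[OF rk_kernel]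
  have "nrm (Gop a g \<phi>) \<le> nrm (\<lambda>x. a * \<phi> x) + nrm (conv g \<phi>)"
    unfolding Gop_def by (rule nrm_triangle[OF nice_cmult[OF assms] young(1)[OF g'(3) assms]])
  also have "\<dots> \<le> a * nrm \<phi> + (1 / \<Lambda> - a) * nrm \<phi>"
    using young(2)[OF g'(3) assms] a_pos by (simp add: nrm_cmult kernel_int_abs[OF rk_kernel] rk_int)
  finally show ?thesis by (simp add: algebra_simps)
qed

lemma cone_Gop: "norm e = 1 \<Longrightarrow> ascone e l \<phi> \<Longrightarrow> ascone e l (Gop a g \<phi>)"
  unfolding Gop_def using kernelD[OF rk_kernel] a_pos by (intro cone_add cone_cmult cone_conv) auto

lemma Gop_diff: "bdm \<phi> \<Longrightarrow> bdm \<psi> \<Longrightarrow> Gop a g (\<lambda>x. \<phi> x - \<psi> x) x = Gop a g \<phi> x - Gop a g \<psi> x"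
  using kernelD[OF rk_kernel] by (simp add: Gop_def conv_diff_right algebra_simps)

lemma Gop_add: "bdm \<phi> \<Longrightarrow> bdm \<psi> \<Longrightarrow> Gop a g (\<lambda>x. \<phi> x + \<psi> x) x = Gop a g \<phi> x + Gop a g \<psi> x"
  using kernelD[OF rk_kernel] by (simp add: Gop_def conv_add_right algebra_simps)

lemma Gop_rfl: "norm e = 1 \<Longrightarrow> bdm \<phi> \<Longrightarrow> Gop a g (\<lambda>x. \<phi> (rfl e l x)) x = Gop a g \<phi> (rfl e l x)"
  using kernelD[OF rk_kernel] by (simp add: Gop_def conv_rfl bdm_meas)

lemma ip_Gop_sym:
  assumes "nice \<phi>" "nice \<psi>" shows "ip \<phi> (Gop a g \<psi>) = ip (Gop a g \<phi>) \<psi>"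
proof -
  note g' = kernelD[OF rk_kernel]
  show ?thesis unfolding Gop_def
    using ip_add_right[OF nice_cmult[OF assms(2), of a] young(1)[OF g'(3) assms(2)] assms(1)]
      ip_add_left[OF nice_cmult[OF assms(1), of a] young(1)[OF g'(3) assms(1)] assms(2)]
      ip_conv_sym[OF g'(3) assms RD_even[OF g'(1)]]
    by (simp add: ip_cmult_left ip_cmult_right)
qed

lemma conv_Gop:
  assumes "integrable lborel f" "bdm \<phi>" shows "conv f (Gop a g \<phi>) x = Gop a g (conv f \<phi>) x"
proof -
  note g' = kernelD[OF rk_kernel]
  show ?thesis unfolding Gop_def
    using conv_add_right[OF assms(1) bdm_cmult[OF assms(2), of a] bdm_conv[OF g'(3) assms(2)]]
      conv_commute[OF assms(1) g'(3) assms(2)] by (simp add: conv_cmult_right)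
qed

text \<open>The equation for \<open>\<psi> = Gop a g \<phi>\<close> is paired with
  \<open>\<psi>\<close>, and \<open>K\<close> is split into \<open>\<rho>\<close> and a remainder.
  The remainder is estimated by its mass, which cancels against the same amount on the left and
  leaves the mass of \<open>\<rho>\<close> there. The term with \<open>\<rho>\<close> is harmless
  because convolution commutes with the resolvent and may be applied to \<open>\<phi>\<close> first.
  So the resolvent is small on functions that \<open>\<rho>\<close> almost averages out.\<close>

lemma nrm_Gop_smoothing:
  assumes \<rho>: "integrable lborel \<rho>" "\<And>x. 0 \<le> \<rho> x" "\<And>x. \<rho> x \<le> K x" and \<phi>: "nice \<phi>"
  shows "(\<Lambda> + 2 * (\<integral>x. \<rho> x \<partial>lborel)) * nrm (Gop a g \<phi>) \<le> nrm \<phi> + 2 / \<Lambda> * nrm (conv \<rho> \<phi>)"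
proof -
  let ?M = "\<integral>x. K x \<partial>lborel" and ?R = "\<integral>x. \<rho> x \<partial>lborel"
  note K' = kernelD[OF K]
  define \<psi> where "\<psi> = Gop a g \<phi>"
  have n\<psi>: "nice \<psi>" unfolding \<psi>_def by (rule nice_Gop[OF \<phi>])
  have nK: "nice (conv K \<psi>)" and n\<rho>: "nice (conv \<rho> \<psi>)" using young(1) K'(3) \<rho>(1) n\<psi> by auto
  have \<kappa>: "integrable lborel (\<lambda>x. K x - \<rho> x)" using K'(3) \<rho>(1) by simp
  have n\<kappa>: "nice (conv (\<lambda>x. K x - \<rho> x) \<psi>)" by (rule young(1)[OF \<kappa> n\<psi>])
  have \<kappa>a: "(\<integral>x. \<bar>K x - \<rho> x\<bar> \<partial>lborel) = ?M - ?R" using K'(3) \<rho> by simp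
  have "(\<Lambda> + 2 * ?M) * ip \<psi> \<psi> = ip \<psi> (\<lambda>x. (\<Lambda> + 2 * ?M) * \<psi> x)" by (simp add: ip_cmult_right)
  also have "\<dots> = ip \<psi> (\<lambda>x. \<phi> x + 2 * conv K \<psi> x)"
    unfolding \<psi>_def using Gop_eq[OF nice_bdm[OF \<phi>]] by simp
  also have "\<dots> = ip \<psi> \<phi> + 2 * ip \<psi> (conv K \<psi>)"
    using ip_add_right[OF \<phi> nice_cmult[OF nK, of 2] n\<psi>] by (simp add: ip_cmult_right)
  finally have 1: "(\<Lambda> + 2 * ?M) * ip \<psi> \<psi> = ip \<psi> \<phi> + 2 * ip \<psi> (conv K \<psi>)" .
  have "conv K \<psi> = (\<lambda>x. conv \<rho> \<psi> x + conv (\<lambda>x. K x - \<rho> x) \<psi> x)"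
    using conv_diff_left[OF K'(3) \<rho>(1) nice_bdm[OF n\<psi>]] by auto
  then have 2: "ip \<psi> (conv K \<psi>) = ip \<psi> (conv \<rho> \<psi>) + ip \<psi> (conv (\<lambda>x. K x - \<rho> x) \<psi>)"
    using ip_add_right[OF n\<rho> n\<kappa> n\<psi>] by simp
  have "ip \<psi> (conv (\<lambda>x. K x - \<rho> x) \<psi>) \<le> nrm \<psi> * nrm (conv (\<lambda>x. K x - \<rho> x) \<psi>)"
    using ip_CS[OF n\<psi> n\<kappa>] by linarith
  also have "\<dots> \<le> nrm \<psi> * ((?M - ?R) * nrm \<psi>)"
    using young(2)[OF \<kappa> n\<psi>] unfolding \<kappa>a by (intro mult_left_mono nrm_nonneg)
  also have "\<dots> = (?M - ?R) * ip \<psi> \<psi>" by (simp add: nrm_sq[symmetric] power2_eq_square)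
  finally have 3: "ip \<psi> (conv (\<lambda>x. K x - \<rho> x) \<psi>) \<le> (?M - ?R) * ip \<psi> \<psi>" .
  have "conv \<rho> \<psi> = Gop a g (conv \<rho> \<phi>)"
    unfolding \<psi>_def using conv_Gop[OF \<rho>(1) nice_bdm[OF \<phi>]] by auto
  then have 4: "nrm (conv \<rho> \<psi>) \<le> nrm (conv \<rho> \<phi>) / \<Lambda>" using nrm_Gop[OF young(1)[OF \<rho>(1) \<phi>]] by simp
  have 5: "ip \<psi> (conv \<rho> \<psi>) \<le> nrm \<psi> * (nrm (conv \<rho> \<phi>) / \<Lambda>)"
    using ip_CS[OF n\<psi> n\<rho>] mult_left_mono[OF 4 nrm_nonneg[of \<psi>]] by linarith
  have 6: "ip \<psi> \<phi> \<le> nrm \<psi> * nrm \<phi>" using ip_CS[OF n\<psi> \<phi>] by linarith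
  have "(\<Lambda> + 2 * ?R) * ip \<psi> \<psi> = (\<Lambda> + 2 * ?M) * ip \<psi> \<psi> - 2 * ((?M - ?R) * ip \<psi> \<psi>)" by (simp add: algebra_simps)
  also have "\<dots> \<le> nrm \<psi> * nrm \<phi> + 2 * (nrm \<psi> * (nrm (conv \<rho> \<phi>) / \<Lambda>))" using 1 2 3 5 6 by linarith
  finally have 7: "nrm \<psi> * ((\<Lambda> + 2 * ?R) * nrm \<psi>) \<le> nrm \<psi> * (nrm \<phi> + 2 / \<Lambda> * nrm (conv \<rho> \<phi>))"
    by (simp add: nrm_sq[symmetric] power2_eq_square algebra_simps)
  show ?thesis
  proof (cases "nrm \<psi> = 0")
    case True
    then show ?thesis using \<Lambda> nrm_nonneg[of \<phi>] nrm_nonneg[of "conv \<rho> \<phi>"] by (simp add: \<psi>_def)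
  next
    case False
    then have "nrm \<psi> > 0" using nrm_nonneg[of \<psi>] by simp
    then show ?thesis using 7 by (simp add: \<psi>_def)
  qed
qed

end

section \<open>Radial kernels of infinite mass\<close>

text \<open>\<open>Gop_eq\<close> makes the resolvent a right inverse; since convolutions commute it
  is a left inverse as well.\<close>

lemma Gop_inverse:
  assumes K: "rkernel K" and \<Lambda>: "\<Lambda> > 0" and rk: "reskernel \<Lambda> K g" and a: "a = ratom \<Lambda> K" and \<eta>: "bdm \<eta>"
  shows "Gop a g (\<lambda>x. (\<Lambda> + 2 * (\<integral>x. K x \<partial>lborel)) * \<eta> x - 2 * conv K \<eta> x) x = \<eta> x"
proof -
  note K' = kernelD[OF K]
  let ?M = "\<integral>x. K x \<partial>lborel"
  have g': "rkernel g" by (rule rk_kernel[OF K \<Lambda> rk a])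
  have b: "bdm (conv K \<eta>)" by (rule bdm_conv[OF K'(3) \<eta>])
  have "Gop a g (\<lambda>x. (\<Lambda> + 2 * ?M) * \<eta> x - 2 * conv K \<eta> x) x
      = Gop a g (\<lambda>x. (\<Lambda> + 2 * ?M) * \<eta> x) x - Gop a g (\<lambda>x. 2 * conv K \<eta> x) x"
    by (rule Gop_diff[OF K \<Lambda> rk a bdm_cmult[OF \<eta>] bdm_cmult[OF b]])
  also have "\<dots> = (\<Lambda> + 2 * ?M) * Gop a g \<eta> x - 2 * Gop a g (conv K \<eta>) x"
    unfolding Gop_def conv_cmult_right by (simp add: algebra_simps)
  also have "Gop a g (conv K \<eta>) x = conv K (Gop a g \<eta>) x"
    using conv_Gop[OF K \<Lambda> rk a K'(3) \<eta>] by simp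
  finally show ?thesis using Gop_eq[OF K \<Lambda> rk a \<eta>, of x] by simp
qed

text \<open>Only \<open>S\<close> is kept from an integral with nonnegative integrand. Its mirror
  image contributes the same amount and is dropped, which leaves the factor
  \<open>1 / 2\<close>.\<close>

lemma cone_lower_bound:
  assumes e: "norm e = 1" and g: "RD g" "integrable lborel g" and \<phi>: "ascone e l \<phi>" and x: "x \<bullet> e \<le> l"
    and S: "S \<in> sets borel" "\<And>z. z \<in> S \<Longrightarrow> z \<bullet> e \<le> l \<and> \<epsilon> \<le> \<phi> z" and \<epsilon>: "0 \<le> \<epsilon>"
  shows "\<epsilon> / 2 * ((\<integral>z. indicator S z * g (x - z) \<partial>lborel) - (\<integral>z. indicator S z * g (x - rfl e l z) \<partial>lborel)) \<le> conv g \<phi> x"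
proof -
  note [measurable] = RD_measurable[OF g(1)] S(1)
  have i1: "integrable lborel (\<lambda>z. g (x - z))"
    using g(2) mpres_integrable[OF mpres_diff_left[of x], of g] by auto
  then have i2: "integrable lborel (\<lambda>z. g (x - rfl e l z))"
    using mpres_integrable[OF mpres_rfl[OF e, of l], of "\<lambda>z. g (x - z)"] by auto
  have j1: "integrable lborel (\<lambda>z. indicator S z * g (x - z))"
    using integrable_mult_indicator[OF _ i1, of S] by simp
  have j2: "integrable lborel (\<lambda>z. indicator S z * g (x - rfl e l z))"
    using integrable_mult_indicator[OF _ i2, of S] by simp
  have "\<epsilon> * ((\<integral>z. indicator S z * g (x - z) \<partial>lborel) - (\<integral>z. indicator S z * g (x - rfl e l z) \<partial>lborel))
      = (\<integral>z. \<epsilon> * (indicator S z * g (x - z) - indicator S z * g (x - rfl e l z)) \<partial>lborel)"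
    using j1 j2 by simp
  also have "\<dots> \<le> (\<integral>z. (g (x - z) - g (x - rfl e l z)) * \<phi> z \<partial>lborel)"
  proof (rule integral_mono[OF _ conv_cone_half(1)[OF e g \<phi>]])
    show "integrable lborel (\<lambda>z. \<epsilon> * (indicator S z * g (x - z) - indicator S z * g (x - rfl e l z)))"
      using j1 j2 by simp
    show "\<epsilon> * (indicator S z * g (x - z) - indicator S z * g (x - rfl e l z)) \<le> (g (x - z) - g (x - rfl e l z)) * \<phi> z" for z
    proof (cases "z \<in> S")
      case True
      then have z: "z \<bullet> e \<le> l" "\<epsilon> \<le> \<phi> z" using S by auto
      have "norm (x - z) \<le> norm (x - rfl e l z)" using x z by (intro norm_rfl_le[OF e] mult_nonpos_nonpos) auto
      then have "g (x - rfl e l z) \<le> g (x - z)" by (rule RD_D[OF g(1)])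
      then have "(g (x - z) - g (x - rfl e l z)) * \<epsilon> \<le> (g (x - z) - g (x - rfl e l z)) * \<phi> z"
        using z by (intro mult_left_mono) auto
      then show ?thesis using True by (simp add: mult.commute)
    next
      case False
      then show ?thesis using cone_integrand_nonneg[OF e g(1) \<phi> x] by simp
    qed
  qed
  finally show ?thesis unfolding conv_cone_half(2)[OF e g \<phi>] by simp
qed

text \<open>\<open>K0\<close> is the kernel as a function on space. Monotonicity is required only
  away from the origin: near it a kernel of infinite mass is unbounded, and its value there is
  arbitrary.\<close>

locale radial =
  fixes K0 :: "'a::euclidean_space \<Rightarrow> real" and r0 :: real
  assumes K0_meas[measurable]: "K0 \<in> borel_measurable borel"
    and K0_nonneg: "0 \<le> K0 x"
    and K0_mono: "x \<noteq> 0 \<Longrightarrow> norm x \<le> norm y \<Longrightarrow> K0 y \<le> K0 x"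
    and K0_fin: "(\<integral>\<^sup>+x. ennreal (min 1 ((norm x)\<^sup>2) * K0 x) \<partial>lborel) < \<infinity>"
    and K0_inf: "(\<integral>\<^sup>+x. ennreal (K0 x) \<partial>lborel) = \<infinity>"
    and r0_pos: "0 < r0"
    and K0_strict: "0 < norm x \<Longrightarrow> norm x < norm y \<Longrightarrow> norm y < r0 \<Longrightarrow> K0 y < K0 x"
begin

text \<open>The value at the origin makes the truncation radially decreasing there too, whatever
  \<open>K0 0\<close> is.\<close>

definition km :: "real \<Rightarrow> 'a \<Rightarrow> real" where
  "km m x = (if x = 0 then m else min (K0 x) m)"

lemma km_le: "x \<noteq> 0 \<Longrightarrow> km m x \<le> K0 x" by (simp add: km_def)
lemma km_le_m: "km m x \<le> m" by (simp add: km_def)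
lemma km_nonneg: "0 \<le> m \<Longrightarrow> 0 \<le> km m x" using K0_nonneg by (simp add: km_def)
lemma km_meas[measurable]: "km m \<in> borel_measurable borel" unfolding km_def by measurable

lemma fin_integrable: "integrable lborel (\<lambda>x. min 1 ((norm x)\<^sup>2) * K0 x)"
  using K0_fin by (intro integrableI_nonneg) (auto simp: K0_nonneg)

lemma km_integrable: assumes "0 \<le> m" shows "integrable lborel (km m)"
proof (rule Bochner_Integration.integrable_bound)
  show "integrable lborel (\<lambda>x. m * indicator (ball 0 1) x + min 1 ((norm x)\<^sup>2) * K0 x)"
    by (intro Bochner_Integration.integrable_add integrable_mult_right integrable_real_indicator fin_integrable)
      (auto simp: emeasure_lborel_ball_finite[unfolded infinity_ennreal_def])
  have "km m x \<le> m * indicator (ball 0 1) x + min 1 ((norm x)\<^sup>2) * K0 x" for x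
  proof (cases "norm x < 1")
    case True then show ?thesis using km_le_m[of m x] K0_nonneg[of x] by (simp add: add_increasing2)
  next
    case False
    then have "1 \<le> (norm x)\<^sup>2" "x \<noteq> 0" by (auto simp: one_le_power)
    then show ?thesis using False km_le[of x m] by simp
  qed
  then show "AE x in lborel. norm (km m x) \<le> norm (m * indicator (ball 0 1) x + min 1 ((norm x)\<^sup>2) * K0 x)"
    using km_nonneg[OF assms] K0_nonneg assms by (intro AE_I2) (simp add: abs_of_nonneg)
qed simp

text \<open>The portion of a number between two fixed heights grows with the number. Hence every
  layer of the kernel is itself a radially decreasing kernel, and a fixed truncation can be split
  off from a varying one.\<close>

lemma km_diff_RD: assumes "0 \<le> m'" "m' \<le> m" shows "RD (\<lambda>x. km m x - km m' x)"
  unfolding RD_def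
proof (intro allI impI)
  fix x y :: 'a assume xy: "norm x \<le> norm y"
  show "km m y - km m' y \<le> km m x - km m' x"
  proof (cases "x = 0")
    case True then show ?thesis using assms by (auto simp: km_def min_def)
  next
    case False
    then have "y \<noteq> 0" "K0 y \<le> K0 x" using K0_mono[OF False xy] xy by auto
    then show ?thesis using False assms by (auto simp: km_def min_def)
  qed
qed

lemma km_zero: "0 \<le> m \<Longrightarrow> km 0 x = 0" using K0_nonneg[of x] by (simp add: km_def)

lemma rkernel_km: assumes "0 \<le> m" shows "rkernel (km m)"
proof -
  have "RD (km m)" using km_diff_RD[of 0 m] assms by (simp add: km_zero[OF assms])
  moreover have "bdm (km m)" using km_nonneg[OF assms] km_le_m by (intro bdmI[of _ m]) auto
  ultimately show ?thesis using km_integrable[OF assms] km_nonneg[OF assms] by (simp add: rkernel_def)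
qed

lemma km_mono: "m' \<le> m \<Longrightarrow> km m' x \<le> km m x" by (auto simp: km_def)

lemma rkernel_km_diff: assumes "0 \<le> m'" "m' \<le> m" shows "rkernel (\<lambda>x. km m x - km m' x)"
proof -
  have "bdm (\<lambda>x. km m x - km m' x)"
    by (intro bdm_diff kernelD(4)[OF rkernel_km]) (use assms in auto)
  then show ?thesis using km_diff_RD[OF assms] km_mono[OF assms(2)] km_integrable assms
    by (simp add: rkernel_def)
qed

text \<open>A barrier argument: the operator is applied to a function \<open>\<eta>\<close> that
  vanishes at 0 and is at least \<open>1 / 2\<close> outside the ball of radius
  \<open>\<delta>\<close>. Its second differences are controlled by
  \<open>min 1 ((norm z)\<^sup>2)\<close>, so the constant depends on \<open>K0\<close> and
  \<open>\<delta>\<close> only and not on the truncation.\<close>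

lemma tight:
  assumes \<delta>: "\<delta> > 0"
  shows "\<exists>C\<ge>0. \<forall>\<Lambda>>0. \<forall>K g. rkernel K \<longrightarrow> (\<forall>x. x \<noteq> 0 \<longrightarrow> K x \<le> K0 x) \<longrightarrow> reskernel \<Lambda> K g \<longrightarrow>
     (\<integral>x. indicator {x. \<delta> \<le> norm x} x * g x \<partial>lborel) \<le> C / \<Lambda>\<^sup>2"
proof -
  define C1 where "C1 = (\<integral>z. (max 1 (1 / \<delta>\<^sup>2)) * (min 1 ((norm z)\<^sup>2) * K0 z) \<partial>lborel)"
  have C1: "C1 \<ge> 0" unfolding C1_def using K0_nonneg by (intro integral_nonneg_AE) (auto simp: max_def)
  \<comment> \<open>A bounded concave function of the squared norm; concavity is what makes the
    bound on its second differences one-sided and simple.\<close>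
  define \<eta> :: "'a \<Rightarrow> real" where "\<eta> x = (norm x)\<^sup>2 / (\<delta>\<^sup>2 + (norm x)\<^sup>2)" for x
  have d2: "\<delta>\<^sup>2 > 0" using \<delta> by simp
  have den: "\<delta>\<^sup>2 + (norm (x::'a))\<^sup>2 > 0" for x using d2 by (simp add: add_pos_nonneg)
  have [measurable]: "\<eta> \<in> borel_measurable borel" unfolding \<eta>_def by measurable
  have \<eta>01: "0 \<le> \<eta> x" "\<eta> x \<le> 1" for x using d2 den[of x] by (auto simp: \<eta>_def divide_le_eq_1)
  have b\<eta>: "bdm \<eta>" using \<eta>01 by (intro bdmI[of _ 1]) auto
  have \<eta>0: "\<eta> 0 = 0" by (simp add: \<eta>_def)
  have \<eta>half: "1 / 2 \<le> \<eta> x" if "\<delta> \<le> norm x" for x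
  proof -
    have "\<delta>\<^sup>2 \<le> (norm x)\<^sup>2" using that \<delta> by (intro power_mono) auto
    then show ?thesis unfolding \<eta>_def using den[of x] by (simp add: field_simps)
  qed
  have sd: "\<eta> (x - z) + \<eta> (x + z) - 2 * \<eta> x \<le> 2 * (max 1 (1 / \<delta>\<^sup>2) * min 1 ((norm z)\<^sup>2))" for x z
  proof -
    \<comment> \<open>The squared norms of \<open>x - z\<close> and \<open>x + z\<close> have mean
      \<open>t\<close>, so the tangent of the concave function \<open>h\<close> at \<open>t\<close>
      bounds the sum of the two values by \<open>2 * h t\<close>.\<close>
    define h where "h s = s / (\<delta>\<^sup>2 + s)" for s :: real
    define p q where "p = (norm (x - z))\<^sup>2" and "q = (norm (x + z))\<^sup>2"
    define t where "t = (norm x)\<^sup>2 + (norm z)\<^sup>2"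
    have pq: "p + q = 2 * t" unfolding p_def q_def t_def power2_norm_eq_inner
      by (simp add: inner_diff_left inner_diff_right inner_add_left inner_add_right)
    have nn: "p \<ge> 0" "q \<ge> 0" "t \<ge> 0" by (auto simp: p_def q_def t_def)
    have tang: "h s \<le> h t + \<delta>\<^sup>2 / (\<delta>\<^sup>2 + t)\<^sup>2 * (s - t)" if "s \<ge> 0" for s
    proof -
      have "h t + \<delta>\<^sup>2 / (\<delta>\<^sup>2 + t)\<^sup>2 * (s - t) - h s = \<delta>\<^sup>2 * (s - t)\<^sup>2 / ((\<delta>\<^sup>2 + t)\<^sup>2 * (\<delta>\<^sup>2 + s))"
      proof -
        have p: "\<delta>\<^sup>2 + t > 0" "\<delta>\<^sup>2 + s > 0" using d2 nn that by (auto intro: add_pos_nonneg)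
        have "h t = t * (\<delta>\<^sup>2 + t) * (\<delta>\<^sup>2 + s) / ((\<delta>\<^sup>2 + t)\<^sup>2 * (\<delta>\<^sup>2 + s))"
          using p unfolding h_def by (simp add: power2_eq_square)
        moreover have "h s = s * (\<delta>\<^sup>2 + t)\<^sup>2 / ((\<delta>\<^sup>2 + t)\<^sup>2 * (\<delta>\<^sup>2 + s))"
          using p unfolding h_def by (simp add: power2_eq_square)
        moreover have "\<delta>\<^sup>2 / (\<delta>\<^sup>2 + t)\<^sup>2 * (s - t) = \<delta>\<^sup>2 * (s - t) * (\<delta>\<^sup>2 + s) / ((\<delta>\<^sup>2 + t)\<^sup>2 * (\<delta>\<^sup>2 + s))"
          unfolding mult_divide_mult_cancel_right[OF less_imp_neq[OF p(2), symmetric]] by (rule times_divide_eq_left)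
        moreover have "t * (\<delta>\<^sup>2 + t) * (\<delta>\<^sup>2 + s) + \<delta>\<^sup>2 * (s - t) * (\<delta>\<^sup>2 + s) - s * (\<delta>\<^sup>2 + t)\<^sup>2 = \<delta>\<^sup>2 * (s - t)\<^sup>2"
          by (simp add: power2_eq_square algebra_simps)
        ultimately show ?thesis by (metis add_divide_distrib diff_divide_distrib)
      qed
      also have "\<dots> \<ge> 0" using add_pos_nonneg[OF d2 nn(3)] add_pos_nonneg[OF d2 that]
        by (intro divide_nonneg_pos mult_pos_pos) auto
      finally show ?thesis by simp
    qed
    have "\<eta> (x - z) + \<eta> (x + z) = h p + h q" by (simp add: \<eta>_def h_def p_def q_def)
    also have "\<dots> \<le> 2 * h t + \<delta>\<^sup>2 / (\<delta>\<^sup>2 + t)\<^sup>2 * ((p + q) - 2 * t)"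
    proof -
      define A where "A = \<delta>\<^sup>2 / (\<delta>\<^sup>2 + t)\<^sup>2"
      have "A * (p - t) + A * (q - t) = A * ((p + q) - 2 * t)" by (simp add: algebra_simps)
      then show ?thesis using tang[OF nn(1)] tang[OF nn(2)] unfolding A_def[symmetric] by linarith
    qed
    also have "\<dots> = 2 * h t" using pq by simp
    finally have 1: "\<eta> (x - z) + \<eta> (x + z) \<le> 2 * h t" .
    have "h t \<le> 1" unfolding h_def using add_pos_nonneg[OF d2 nn(3)] by (simp add: divide_le_eq_1)
    then have 2: "h t - \<eta> x \<le> 1" using \<eta>01(1)[of x] by linarith
    have 3: "h t - \<eta> x \<le> (norm z)\<^sup>2 / \<delta>\<^sup>2"
    proof -
      have "(norm x)\<^sup>2 / (\<delta>\<^sup>2 + t) \<le> \<eta> x" unfolding \<eta>_def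
        using den[of x] add_pos_nonneg[OF d2 nn(3)] by (intro divide_left_mono mult_pos_pos) (auto simp: t_def)
      moreover have "(norm z)\<^sup>2 / (\<delta>\<^sup>2 + t) \<le> (norm z)\<^sup>2 / \<delta>\<^sup>2"
        using nn(3) add_pos_nonneg[OF d2 nn(3)] by (intro divide_left_mono mult_pos_pos d2) auto
      moreover have "h t = (norm x)\<^sup>2 / (\<delta>\<^sup>2 + t) + (norm z)\<^sup>2 / (\<delta>\<^sup>2 + t)"
        by (simp add: h_def t_def add_divide_distrib)
      ultimately show ?thesis by linarith
    qed
    have "h t - \<eta> x \<le> max 1 (1 / \<delta>\<^sup>2) * min 1 ((norm z)\<^sup>2)"
    proof (cases "(norm z)\<^sup>2 \<le> 1")
      case True
      have "(norm z)\<^sup>2 / \<delta>\<^sup>2 \<le> max 1 (1 / \<delta>\<^sup>2) * (norm z)\<^sup>2"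
        using mult_right_mono[of "1 / \<delta>\<^sup>2" "max 1 (1 / \<delta>\<^sup>2)" "(norm z)\<^sup>2"] by simp
      then show ?thesis using 3 True by (simp add: min_def)
    next
      case False
      then show ?thesis using 2 by simp
    qed
    then show ?thesis using 1 by linarith
  qed
  have "(\<integral>x. indicator {x. \<delta> \<le> norm x} x * g x \<partial>lborel) \<le> 4 * C1 / \<Lambda>\<^sup>2"
    if \<Lambda>: "\<Lambda> > 0" and K: "rkernel K" and KK: "\<And>x. x \<noteq> 0 \<Longrightarrow> K x \<le> K0 x" and rk: "reskernel \<Lambda> K g" for \<Lambda> K g
  proof -
    define a where "a = ratom \<Lambda> K"
    note K' = kernelD[OF K]
    note [measurable] = bdm_meas[OF K'(4)]
    have gk: "rkernel g" by (rule rk_kernel[OF K \<Lambda> rk a_def])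
    note g' = kernelD[OF gk]
    note [measurable] = bdm_meas[OF g'(4)]
    let ?M = "\<integral>x. K x \<partial>lborel"
    \<comment> \<open>Pairing \<open>z\<close> with \<open>- z\<close> produces the second
      difference of \<open>\<eta>\<close>, to which \<open>sd\<close> applies.\<close>
    have diff: "conv K \<eta> x - ?M * \<eta> x \<le> C1" for x
    proof -
      have i1: "integrable lborel (\<lambda>z. K z * \<eta> (x - z))" by (rule conv_integrable[OF K'(3) b\<eta>])
      have r: "(\<integral>z. K z * \<eta> (x - z) \<partial>lborel) = (\<integral>z. K z * \<eta> (x + z) \<partial>lborel)"
        using mpres_integral[OF mpres_uminus, of "\<lambda>z. K z * \<eta> (x - z)"] by (simp add: RD_even[OF K'(1)])
      have i2: "integrable lborel (\<lambda>z. K z * \<eta> (x + z))"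
        using mpres_integrable[OF mpres_uminus, of "\<lambda>z. K z * \<eta> (x - z)"] i1 by (simp add: RD_even[OF K'(1)])
      have "2 * (conv K \<eta> x - ?M * \<eta> x) = (\<integral>z. K z * \<eta> (x - z) \<partial>lborel) + (\<integral>z. K z * \<eta> (x + z) \<partial>lborel) - (\<integral>z. K z * (2 * \<eta> x) \<partial>lborel)"
        unfolding conv_def r by simp
      also have "\<dots> = (\<integral>z. K z * \<eta> (x - z) + K z * \<eta> (x + z) - K z * (2 * \<eta> x) \<partial>lborel)"
        using i1 i2 K'(3) by simp
      also have "\<dots> \<le> (\<integral>z. 2 * (max 1 (1 / \<delta>\<^sup>2) * (min 1 ((norm z)\<^sup>2) * K0 z)) \<partial>lborel)"
      proof (rule integral_mono_AE)
        show "integrable lborel (\<lambda>z. K z * \<eta> (x - z) + K z * \<eta> (x + z) - K z * (2 * \<eta> x))"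
          using i1 i2 K'(3) by simp
        show "integrable lborel (\<lambda>z. 2 * (max 1 (1 / \<delta>\<^sup>2) * (min 1 ((norm z)\<^sup>2) * K0 z)))"
          using fin_integrable by simp
        show "AE z in lborel. K z * \<eta> (x - z) + K z * \<eta> (x + z) - K z * (2 * \<eta> x) \<le> 2 * (max 1 (1 / \<delta>\<^sup>2) * (min 1 ((norm z)\<^sup>2) * K0 z))"
          using AE_lborel_singleton[of 0]
        proof eventually_elim
          case (elim z)
          have "K z * \<eta> (x - z) + K z * \<eta> (x + z) - K z * (2 * \<eta> x) = K z * (\<eta> (x - z) + \<eta> (x + z) - 2 * \<eta> x)"
            by (simp add: algebra_simps)
          also have "\<dots> \<le> K z * (2 * (max 1 (1 / \<delta>\<^sup>2) * min 1 ((norm z)\<^sup>2)))"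
            by (intro mult_left_mono sd K'(2))
          also have "\<dots> \<le> K0 z * (2 * (max 1 (1 / \<delta>\<^sup>2) * min 1 ((norm z)\<^sup>2)))"
            using KK[of z] elim by (intro mult_right_mono) (auto simp: max_def)
          finally show ?case by (simp add: mult_ac)
        qed
      qed
      also have "\<dots> = 2 * C1" unfolding C1_def by simp
      finally show ?thesis by simp
    qed
    define \<theta> where "\<theta> x = (\<Lambda> + 2 * ?M) * \<eta> x - 2 * conv K \<eta> x" for x
    have b\<theta>: "bdm \<theta>" unfolding \<theta>_def by (intro bdm_diff bdm_cmult b\<eta> bdm_conv K')
    have \<theta>: "\<Lambda> * \<eta> x - 2 * C1 \<le> \<theta> x" for x using diff[of x] by (simp add: \<theta>_def algebra_simps)
    have bd: "bdm (\<lambda>x. \<Lambda> * \<eta> x - 2 * C1)" by (intro bdm_diff bdm_cmult b\<eta>) (auto simp: bdm_def)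
    \<comment> \<open>At the origin \<open>\<eta>\<close> vanishes, so the resolvent applied to the
      lower bound of \<open>\<theta>\<close> is at most 0 there. This bounds the integral of
      \<open>\<eta>\<close> against \<open>g\<close>.\<close>
    have "0 = Gop a g \<theta> 0" unfolding \<theta>_def using Gop_inverse[OF K \<Lambda> rk a_def b\<eta>, of 0] \<eta>0 by simp
    also have "\<dots> \<ge> Gop a g (\<lambda>x. \<Lambda> * \<eta> x - 2 * C1) 0"
      unfolding Gop_def using \<theta> a_pos[OF K \<Lambda> rk a_def]
      by (intro add_mono mult_left_mono conv_mono[OF g'(3,2) bd b\<theta>]) auto
    finally have 1: "Gop a g (\<lambda>x. \<Lambda> * \<eta> x - 2 * C1) 0 \<le> 0" by simp
    have "conv g (\<lambda>x. \<Lambda> * \<eta> x - 2 * C1) 0 = \<Lambda> * conv g \<eta> 0 - 2 * C1 * (1 / \<Lambda> - a)"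
    proof -
      have "conv g (\<lambda>x. \<Lambda> * \<eta> x - 2 * C1) 0 = conv g (\<lambda>x. \<Lambda> * \<eta> x) 0 - conv g (\<lambda>x. 2 * C1) 0"
        by (rule conv_diff_right[OF g'(3) bdm_cmult[OF b\<eta>]]) (auto simp: bdm_def)
      moreover have "conv g (\<lambda>x. 2 * C1) 0 = 2 * C1 * (1 / \<Lambda> - a)"
        by (simp add: conv_def rk_int[OF K \<Lambda> rk a_def])
      ultimately show ?thesis by (simp add: conv_cmult_right)
    qed
    then have "\<Lambda> * conv g \<eta> 0 \<le> 2 * C1 / \<Lambda>" using 1 by (simp add: Gop_def \<eta>0 algebra_simps)
    then have 2: "conv g \<eta> 0 \<le> 2 * C1 / \<Lambda>\<^sup>2" using \<Lambda> by (simp add: power2_eq_square field_simps)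
    have "(\<integral>x. indicator {x. \<delta> \<le> norm x} x * g x \<partial>lborel) \<le> (\<integral>z. 2 * (g z * \<eta> (0 - z)) \<partial>lborel)"
    proof (rule integral_mono)
      show "integrable lborel (\<lambda>x. indicator {x. \<delta> \<le> norm x} x * g x)"
        using integrable_mult_indicator[OF _ g'(3), of "{x. \<delta> \<le> norm x}"] by simp
      show "integrable lborel (\<lambda>z. 2 * (g z * \<eta> (0 - z)))" using conv_integrable[OF g'(3) b\<eta>, of 0] by simp
      show "indicator {x. \<delta> \<le> norm x} z * g z \<le> 2 * (g z * \<eta> (0 - z))" for z
        using \<eta>half[of "-z"] g'(2)[of z] \<eta>01(1)[of "-z"] mult_left_mono[of "1/2" "\<eta> (-z)" "g z"]
        by (auto simp: indicator_def)
    qed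
    also have "\<dots> = 2 * conv g \<eta> 0" by (simp add: conv_def)
    also have "\<dots> \<le> 4 * C1 / \<Lambda>\<^sup>2" using 2 by simp
    finally show ?thesis .
  qed
  then show ?thesis using C1 by (intro exI[of _ "4 * C1"]) auto
qed

section \<open>Propagation of positivity from ball to ball\<close>

lemma ball_vol_pos: "0 < r \<Longrightarrow> 0 < measure lborel (ball (x::'a) r)"
  by (simp add: content_ball unit_ball_vol_pos)

text \<open>Almost all mass of the resolvent lies within distance \<open>\<rho> / 2\<close>, so a
  lower bound survives on a ball that is smaller by this margin. The mirror images of its points are
  at distance at least \<open>2 * \<rho>\<close> and meet only the small tail of
  \<open>g\<close>.\<close>

lemma Gop_ball_step:
  fixes g :: "'a \<Rightarrow> real"
  assumes K: "rkernel K" and \<Lambda>: "\<Lambda> > 0" and rk: "reskernel \<Lambda> K g" and a: "a = ratom \<Lambda> K"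
    and \<rho>: "0 < \<rho>" and I2: "(\<integral>x. indicator {x. \<rho> / 2 \<le> norm x} x * g x \<partial>lborel) \<le> 1 / (4 * \<Lambda>)"
    and e: "norm e = 1" and \<phi>: "ascone e l \<phi>" and y: "y \<bullet> e \<le> l - 4 * \<rho>" and \<sigma>: "\<sigma> + \<rho> / 2 \<le> 2 * \<rho>"
    and lb: "\<And>x. x \<in> ball y (\<sigma> + \<rho> / 2) \<Longrightarrow> \<epsilon> \<le> \<phi> x" and \<epsilon>: "0 \<le> \<epsilon>" and x: "x \<in> ball y \<sigma>"
  shows "\<epsilon> / (4 * \<Lambda>) \<le> Gop a g \<phi> x"
proof -
  have gk: "rkernel g" by (rule rk_kernel[OF K \<Lambda> rk a])
  note g' = kernelD[OF gk]
  note [measurable] = bdm_meas[OF g'(4)]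
  define S where "S = ball y (\<sigma> + \<rho> / 2)"
  have S[measurable]: "S \<in> sets borel" by (simp add: S_def)
  have le: "\<bar>z \<bullet> e - y \<bullet> e\<bar> \<le> norm (z - y)" for z
    using Cauchy_Schwarz_ineq2[of "z - y" e] e by (simp add: inner_diff_left)
  have Sl: "z \<bullet> e \<le> l - 2 * \<rho>" if "z \<in> S" for z
  proof -
    have "norm (z - y) < 2 * \<rho>" using that \<sigma> by (simp add: S_def dist_norm norm_minus_commute)
    then show ?thesis using le[of z] y by linarith
  qed
  have xS: "x \<in> S" using x \<rho> by (simp add: S_def)
  have xl: "x \<bullet> e \<le> l" using Sl[OF xS] \<rho> by simp
  let ?I2 = "\<integral>x. indicator {x. \<rho> / 2 \<le> norm x} x * g x \<partial>lborel"
  have Iint: "integrable lborel (\<lambda>x. indicator A x * g x)" if "A \<in> sets borel" for A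
    using integrable_mult_indicator[OF _ g'(3), of A] that by simp
  have gx: "integrable lborel (\<lambda>z. g (x - z))"
    using g'(3) mpres_integrable[OF mpres_diff_left[of x], of g] by auto
  have gx2: "integrable lborel (\<lambda>z. g (x - rfl e l z))"
    using mpres_integrable[OF mpres_rfl[OF e, of l], of "\<lambda>z. g (x - z)"] gx by auto
  have 1: "1 / \<Lambda> - a - ?I2 \<le> (\<integral>z. indicator S z * g (x - z) \<partial>lborel)"
  proof -
    have "1 / \<Lambda> - a - ?I2 = (\<integral>z. g z - indicator {x. \<rho> / 2 \<le> norm x} z * g z \<partial>lborel)"
      using Iint[of "{x. \<rho> / 2 \<le> norm x}"] g'(3) by (simp add: rk_int[OF K \<Lambda> rk a])
    also have "\<dots> = (\<integral>z. indicator {x. norm x < \<rho> / 2} z * g z \<partial>lborel)"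
      by (intro Bochner_Integration.integral_cong) (auto simp: indicator_def)
    also have "\<dots> = (\<integral>z. indicator {x. norm x < \<rho> / 2} (x - z) * g (x - z) \<partial>lborel)"
      by (rule mpres_integral[OF mpres_diff_left, symmetric]) simp
    also have "\<dots> \<le> (\<integral>z. indicator S z * g (x - z) \<partial>lborel)"
    proof (rule integral_mono)
      show "integrable lborel (\<lambda>z. indicator {x. norm x < \<rho> / 2} (x - z) * g (x - z))"
        using mpres_integrable[OF mpres_diff_left[of x], of "\<lambda>z. indicator {x. norm x < \<rho> / 2} z * g z"] Iint[of "{x. norm x < \<rho> / 2}"] by auto
      show "integrable lborel (\<lambda>z. indicator S z * g (x - z))"
        using integrable_mult_indicator[OF _ gx, of S] by simp
      show "indicator {x. norm x < \<rho> / 2} (x - z) * g (x - z) \<le> indicator S z * g (x - z)" for z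
      proof (cases "norm (x - z) < \<rho> / 2")
        case True
        then have "dist y z < \<sigma> + \<rho> / 2" using x dist_triangle[of y z x] by (simp add: dist_norm)
        then show ?thesis using g'(2)[of "x - z"] by (auto simp: S_def indicator_def)
      qed (simp add: g'(2))
    qed
    finally show ?thesis .
  qed
  have 2: "(\<integral>z. indicator S z * g (x - rfl e l z) \<partial>lborel) \<le> ?I2"
  proof -
    have "(\<integral>z. indicator S z * g (x - rfl e l z) \<partial>lborel) \<le> (\<integral>z. indicator {x. \<rho> / 2 \<le> norm x} (x - rfl e l z) * g (x - rfl e l z) \<partial>lborel)"
    proof (rule integral_mono)
      have "integrable lborel (\<lambda>z. indicator {x. \<rho> / 2 \<le> norm x} (x - z) * g (x - z))"
        using mpres_integrable[OF mpres_diff_left[of x], of "\<lambda>z. indicator {x. \<rho> / 2 \<le> norm x} z * g z"] Iint[of "{x. \<rho> / 2 \<le> norm x}"] by auto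
      then show "integrable lborel (\<lambda>z. indicator {x. \<rho> / 2 \<le> norm x} (x - rfl e l z) * g (x - rfl e l z))"
        using mpres_integrable[OF mpres_rfl[OF e, of l], of "\<lambda>z. indicator {x. \<rho> / 2 \<le> norm x} (x - z) * g (x - z)"] by auto
      show "integrable lborel (\<lambda>z. indicator S z * g (x - rfl e l z))"
        using integrable_mult_indicator[OF _ gx2, of S] by simp
      show "indicator S z * g (x - rfl e l z) \<le> indicator {x. \<rho> / 2 \<le> norm x} (x - rfl e l z) * g (x - rfl e l z)" for z
      proof (cases "z \<in> S")
        case True
        have "2 * \<rho> \<le> (rfl e l z - x) \<bullet> e" using Sl[OF True] Sl[OF xS] \<rho> by (simp add: inner_diff_left rfl_inner[OF e])
        also have "\<dots> \<le> norm (x - rfl e l z)"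
          using norm_cauchy_schwarz[of "rfl e l z - x" e] e by (simp add: norm_minus_commute)
        finally show ?thesis using \<rho> g'(2) by (simp add: indicator_def)
      qed (simp add: g'(2))
    qed
    also have "\<dots> = (\<integral>z. indicator {x. \<rho> / 2 \<le> norm x} (x - z) * g (x - z) \<partial>lborel)"
      by (rule mpres_integral[OF mpres_rfl[OF e], of "\<lambda>z. indicator {x. \<rho> / 2 \<le> norm x} (x - z) * g (x - z)"]) simp
    also have "\<dots> = ?I2"
      by (rule mpres_integral[OF mpres_diff_left, of "\<lambda>z. indicator {x. \<rho> / 2 \<le> norm x} z * g z"]) simp
    finally show ?thesis .
  qed
  have "\<epsilon> / 2 * (1 / \<Lambda> - a - ?I2 - ?I2) \<le> \<epsilon> / 2 * ((\<integral>z. indicator S z * g (x - z) \<partial>lborel) - (\<integral>z. indicator S z * g (x - rfl e l z) \<partial>lborel))"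
    using 1 2 \<epsilon> by (intro mult_left_mono) auto
  also have "\<dots> \<le> conv g \<phi> x"
  proof (rule cone_lower_bound[OF e g'(1,3) \<phi> xl S _ \<epsilon>])
    fix z assume "z \<in> S"
    then show "z \<bullet> e \<le> l \<and> \<epsilon> \<le> \<phi> z" using Sl[of z] lb[of z] \<rho> by (auto simp: S_def)
  qed
  finally have 3: "\<epsilon> / 2 * (1 / \<Lambda> - a - ?I2 - ?I2) \<le> conv g \<phi> x" .
  have 4: "a * \<epsilon> \<le> a * \<phi> x" using lb[of x] xS a_pos[OF K \<Lambda> rk a] by (intro mult_left_mono) (auto simp: S_def)
  \<comment> \<open>The estimate of the convolution loses half of the atom's share; the term
    \<open>a * \<phi> x\<close> returns more than that.\<close>
  have "\<epsilon> / (4 * \<Lambda>) = \<epsilon> / 2 * (1 / \<Lambda> - 2 * (1 / (4 * \<Lambda>)))" by (simp add: field_simps)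
  also have "\<dots> \<le> \<epsilon> / 2 * (1 / \<Lambda> - 2 * ?I2)" using I2 \<epsilon> by (intro mult_left_mono) auto
  also have "\<dots> = \<epsilon> / 2 * (1 / \<Lambda> - a - ?I2 - ?I2) + (a * \<epsilon>) / 2" by (simp add: algebra_simps)
  also have "\<dots> \<le> conv g \<phi> x + a * \<phi> x" using 3 4 \<epsilon> a_pos[OF K \<Lambda> rk a] mult_nonneg_nonneg[of a \<epsilon>] by linarith
  finally show ?thesis by (simp add: Gop_def)
qed

end

context radial
begin

text \<open>Points of the two balls are at most \<open>3 * \<rho>\<close> apart, while mirror images
  are at least \<open>5 * \<rho>\<close> away, and below \<open>r0\<close> the kernel is strictly
  larger at the smaller distance. Truncation at the height \<open>K0 z3\<close> leaves both values
  unchanged. Thus convolution enlarges the ball on which a lower bound is known.\<close>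

lemma km_ball_step:
  assumes \<rho>: "0 < \<rho>" "5 * \<rho> < r0" and z3: "norm z3 = 3 * \<rho>" and z5: "norm z5 = 5 * \<rho>"
    and e: "norm e = 1" and \<phi>: "ascone e l \<phi>" and y: "y \<bullet> e \<le> l - 4 * \<rho>"
    and lb: "\<And>x. x \<in> ball y \<rho> \<Longrightarrow> \<epsilon> \<le> \<phi> x" and \<epsilon>: "0 \<le> \<epsilon>" and x: "x \<in> ball y (2 * \<rho>)"
  shows "\<epsilon> / 2 * (measure lborel (ball (0::'a) \<rho>) * (K0 z3 - K0 z5)) \<le> conv (km (K0 z3)) \<phi> x"
proof -
  define \<kappa> where "\<kappa> = km (K0 z3)"
  have k: "rkernel \<kappa>" unfolding \<kappa>_def by (rule rkernel_km[OF K0_nonneg])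
  note k' = kernelD[OF k]
  note [measurable] = bdm_meas[OF k'(4)]
  have z: "z3 \<noteq> 0" "z5 \<noteq> 0" using z3 z5 \<rho> by auto
  have lt: "K0 z5 < K0 z3" using z3 z5 \<rho> by (intro K0_strict) auto
  have \<kappa>3: "\<kappa> z3 = K0 z3" and \<kappa>5: "\<kappa> z5 = K0 z5" using z lt by (auto simp: \<kappa>_def km_def)
  have le: "\<bar>z \<bullet> e - y \<bullet> e\<bar> \<le> norm (z - y)" for z
    using Cauchy_Schwarz_ineq2[of "z - y" e] e by (simp add: inner_diff_left)
  have xy: "norm (x - y) < 2 * \<rho>" using x by (simp add: dist_norm norm_minus_commute)
  have xl: "x \<bullet> e \<le> l - 2 * \<rho>" using le[of x] xy y by linarith
  let ?S = "ball y \<rho>"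
  have Sz: "z \<bullet> e \<le> l - 3 * \<rho> \<and> norm (x - z) \<le> norm z3 \<and> norm z5 \<le> norm (x - rfl e l z)" if "z \<in> ?S" for z
  proof -
    have zy: "norm (z - y) < \<rho>" using that by (simp add: dist_norm norm_minus_commute)
    have 1: "z \<bullet> e \<le> l - 3 * \<rho>" using le[of z] zy y by linarith
    have "norm (x - z) \<le> norm (x - y) + norm (z - y)" using norm_triangle_ineq4[of "x - y" "z - y"] by simp
    then have 2: "norm (x - z) \<le> norm z3" using xy zy z3 by simp
    have "5 * \<rho> \<le> (rfl e l z - x) \<bullet> e" using 1 xl by (simp add: inner_diff_left rfl_inner[OF e])
    also have "\<dots> \<le> norm (x - rfl e l z)"
      using norm_cauchy_schwarz[of "rfl e l z - x" e] e by (simp add: norm_minus_commute)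
    finally show ?thesis using 1 2 z5 by simp
  qed
  have gx: "integrable lborel (\<lambda>z. \<kappa> (x - z))"
    using k'(3) mpres_integrable[OF mpres_diff_left[of x], of \<kappa>] by auto
  have gx2: "integrable lborel (\<lambda>z. \<kappa> (x - rfl e l z))"
    using mpres_integrable[OF mpres_rfl[OF e, of l], of "\<lambda>z. \<kappa> (x - z)"] gx by auto
  have fin: "emeasure lborel ?S \<noteq> \<infinity>" using emeasure_lborel_ball_finite[of y \<rho>] by simp
  have iS: "integrable lborel (\<lambda>z. indicator ?S z * c)" for c :: real
    using fin by (intro integrable_mult_left integrable_real_indicator) (auto simp: less_top)
  have vol: "measure lborel ?S = measure lborel (ball (0::'a) \<rho>)"
    using \<rho> by (simp add: content_ball)
  have "measure lborel (ball (0::'a) \<rho>) * (K0 z3 - K0 z5) = (\<integral>z. indicator ?S z * K0 z3 \<partial>lborel) - (\<integral>z. indicator ?S z * K0 z5 \<partial>lborel)"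
    using fin by (simp add: vol algebra_simps)
  also have "\<dots> \<le> (\<integral>z. indicator ?S z * \<kappa> (x - z) \<partial>lborel) - (\<integral>z. indicator ?S z * \<kappa> (x - rfl e l z) \<partial>lborel)"
  proof (intro diff_mono integral_mono iS)
    show "integrable lborel (\<lambda>z. indicator ?S z * \<kappa> (x - z))" "integrable lborel (\<lambda>z. indicator ?S z * \<kappa> (x - rfl e l z))"
      using integrable_mult_indicator[OF _ gx, of ?S] integrable_mult_indicator[OF _ gx2, of ?S] by simp_all
    show "indicator ?S z * K0 z3 \<le> indicator ?S z * \<kappa> (x - z)" for z
      using RD_D[OF k'(1), of "x - z" z3] Sz[of z] \<kappa>3 by (auto simp: indicator_def)
    show "indicator ?S z * \<kappa> (x - rfl e l z) \<le> indicator ?S z * K0 z5" for z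
      using RD_D[OF k'(1), of z5 "x - rfl e l z"] Sz[of z] \<kappa>5 by (auto simp: indicator_def)
  qed
  finally have "\<epsilon> / 2 * (measure lborel (ball (0::'a) \<rho>) * (K0 z3 - K0 z5)) \<le>
     \<epsilon> / 2 * ((\<integral>z. indicator ?S z * \<kappa> (x - z) \<partial>lborel) - (\<integral>z. indicator ?S z * \<kappa> (x - rfl e l z) \<partial>lborel))"
    using \<epsilon> by (intro mult_left_mono) auto
  also have "\<dots> \<le> conv \<kappa> \<phi> x"
  proof (rule cone_lower_bound[OF e k'(1,3) \<phi> _ _ _ \<epsilon>])
    show "x \<bullet> e \<le> l" using xl \<rho> by simp
    show "z \<in> ?S \<Longrightarrow> z \<bullet> e \<le> l \<and> \<epsilon> \<le> \<phi> z" for z using Sz[of z] lb[of z] \<rho> by auto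
  qed simp
  finally show ?thesis by (simp add: \<kappa>_def)
qed

text \<open>The constant \<open>c\<close> has to serve all large \<open>m\<close>, so it must not
  feel the singularity of the kernel. A fixed truncation \<open>\<kappa>\<close> is split off;
  convolution with it enlarges balls, while the resolvent of the remaining kernel, controlled by
  tightness uniformly in \<open>m\<close>, costs a factor and a margin. A chain of overlapping balls
  then leads from \<open>y0\<close> to \<open>y1\<close>.\<close>

lemma propagation:
  assumes \<rho>: "0 < \<rho>" "5 * \<rho> < r0" and R: "0 \<le> R"
  shows "\<exists>\<Lambda>1>0. \<forall>\<Lambda>\<ge>\<Lambda>1. \<exists>c>0. \<exists>m0\<ge>0. \<forall>m\<ge>m0. \<forall>g. reskernel \<Lambda> (km m) g \<longrightarrow>
     (\<forall>e l \<phi> y0 y1 \<epsilon>. norm e = 1 \<longrightarrow> ascone e l \<phi> \<longrightarrow> y0 \<bullet> e \<le> l - 4 * \<rho> \<longrightarrow> y1 \<bullet> e \<le> l - 4 * \<rho> \<longrightarrow>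
        norm (y1 - y0) \<le> R \<longrightarrow> 0 \<le> \<epsilon> \<longrightarrow> (\<forall>x\<in>ball y0 (2 * \<rho>). \<epsilon> \<le> \<phi> x) \<longrightarrow>
        (\<forall>x\<in>ball y1 \<rho>. c * \<epsilon> \<le> Gop (ratom \<Lambda> (km m)) g \<phi> x))"
proof -
  obtain b :: 'a where b: "norm b = 1" using norm_Basis nonempty_Basis by blast
  define z3 z5 where "z3 = (3 * \<rho>) *\<^sub>R b" and "z5 = (5 * \<rho>) *\<^sub>R b"
  have z: "norm z3 = 3 * \<rho>" "norm z5 = 5 * \<rho>" using \<rho> b by (auto simp: z3_def z5_def)
  have lt: "K0 z5 < K0 z3" using z \<rho> by (intro K0_strict) auto
  obtain C where C: "C \<ge> 0" and tight: "\<And>\<Lambda> K g. \<Lambda> > 0 \<Longrightarrow> rkernel K \<Longrightarrow> (\<And>x. x \<noteq> 0 \<Longrightarrow> K x \<le> K0 x) \<Longrightarrow> reskernel \<Lambda> K g \<Longrightarrow>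
     (\<integral>x. indicator {x. \<rho> / 2 \<le> norm x} x * g x \<partial>lborel) \<le> C / \<Lambda>\<^sup>2"
    using tight[of "\<rho> / 2"] \<rho> by force
  define m0 where "m0 = K0 z3"
  define \<kappa> where "\<kappa> = km m0"
  have m0: "m0 \<ge> 0" by (simp add: m0_def K0_nonneg)
  have k: "rkernel \<kappa>" unfolding \<kappa>_def by (rule rkernel_km[OF m0])
  note k' = kernelD[OF k]
  define V where "V = measure lborel (ball (0::'a) \<rho>)"
  have V: "V > 0" unfolding V_def using ball_vol_pos \<rho> by blast
  define c2 where "c2 = V * (K0 z3 - K0 z5) / 2"
  have c2: "c2 > 0" using V lt by (simp add: c2_def)
  \<comment> \<open>Enough steps to keep consecutive centres at distance at most
    \<open>\<rho> / 2\<close>.\<close>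
  define n where "n = Suc (nat \<lceil>2 * R / \<rho>\<rceil>)"
  have n: "real n > 0" "R / real n \<le> \<rho> / 2"
  proof -
    show "real n > 0" by (simp add: n_def)
    have "2 * R / \<rho> \<le> real n" unfolding n_def by linarith
    then show "R / real n \<le> \<rho> / 2" using \<rho> \<open>real n > 0\<close> by (simp add: field_simps)
  qed
  show ?thesis
  \<comment> \<open>Above this threshold the tail bound \<open>C / \<Lambda>'\<^sup>2\<close> is at
    most \<open>1 / (4 * \<Lambda>')\<close>, as \<open>Gop_ball_step\<close> requires.\<close>
  proof (rule exI[of _ "4 * C + 1"], rule conjI, goal_cases)
    case 1
    show ?case using C by simp
  next
    case 2
    show ?case
    proof (intro allI impI)
    fix \<Lambda> :: real assume \<Lambda>1: "4 * C + 1 \<le> \<Lambda>"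
    then have \<Lambda>: "\<Lambda> > 0" using C by simp
    define \<Lambda>' where "\<Lambda>' = \<Lambda> + 2 * (\<integral>x. \<kappa> x \<partial>lborel)"
    have \<Lambda>': "\<Lambda>' \<ge> \<Lambda>" using kernel_int_nonneg[OF k] by (simp add: \<Lambda>'_def)
    then have \<Lambda>'0: "\<Lambda>' > 0" using \<Lambda> by simp
    define q where "q = c2 / (2 * \<Lambda>')"
    have q: "q > 0" using c2 \<Lambda>'0 by (simp add: q_def)
    define c where "c = q ^ n / (4 * \<Lambda>')"
    have c: "c > 0" using q \<Lambda>'0 by (simp add: c_def)
    show "\<exists>c>0. \<exists>m0\<ge>0. \<forall>m\<ge>m0. \<forall>g. reskernel \<Lambda> (km m) g \<longrightarrow>
     (\<forall>e l \<phi> y0 y1 \<epsilon>. norm e = 1 \<longrightarrow> ascone e l \<phi> \<longrightarrow> y0 \<bullet> e \<le> l - 4 * \<rho> \<longrightarrow> y1 \<bullet> e \<le> l - 4 * \<rho> \<longrightarrow>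
        norm (y1 - y0) \<le> R \<longrightarrow> 0 \<le> \<epsilon> \<longrightarrow> (\<forall>x\<in>ball y0 (2 * \<rho>). \<epsilon> \<le> \<phi> x) \<longrightarrow>
        (\<forall>x\<in>ball y1 \<rho>. c * \<epsilon> \<le> Gop (ratom \<Lambda> (km m)) g \<phi> x))"
    proof (rule exI[of _ c], rule conjI[OF c], rule exI[of _ m0], rule conjI[OF m0], intro allI impI ballI)
      fix m l \<epsilon> :: real and g \<phi> :: "'a \<Rightarrow> real" and e y0 y1 x :: 'a
      assume m: "m0 \<le> m" and rk: "reskernel \<Lambda> (km m) g" and e: "norm e = 1" and \<phi>: "ascone e l \<phi>"
        and y0: "y0 \<bullet> e \<le> l - 4 * \<rho>" and y1: "y1 \<bullet> e \<le> l - 4 * \<rho>" and d: "norm (y1 - y0) \<le> R"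
        and \<epsilon>: "0 \<le> \<epsilon>" and lb: "\<forall>x\<in>ball y0 (2 * \<rho>). \<epsilon> \<le> \<phi> x" and x: "x \<in> ball y1 \<rho>"
      have mn: "0 \<le> m" using m m0 by simp
      have Kk: "rkernel (km m)" by (rule rkernel_km[OF mn])
      note Kk' = kernelD[OF Kk]
      define K' where "K' = (\<lambda>x. km m x - \<kappa> x)"
      have K': "rkernel K'" unfolding K'_def \<kappa>_def by (rule rkernel_km_diff[OF m0 m])
      note K'' = kernelD[OF K']
      define a where "a = ratom \<Lambda> (km m)"
      have int': "(\<integral>x. K' x \<partial>lborel) = (\<integral>x. km m x \<partial>lborel) - (\<integral>x. \<kappa> x \<partial>lborel)"
        unfolding K'_def using Kk'(3) k'(3) by simp
      \<comment> \<open>The mass of \<open>\<kappa>\<close> is moved from the kernel into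
        \<open>\<Lambda>'\<close>, so the total and with it the atom stay the same.\<close>
      have a': "a = ratom \<Lambda>' K'" unfolding a_def ratom_def int' \<Lambda>'_def by (simp add: algebra_simps)
      obtain g' where g': "reskernel \<Lambda>' K' g'" using reskernel_exists[OF K' \<Lambda>'0] by blast
      have I2: "(\<integral>x. indicator {x. \<rho> / 2 \<le> norm x} x * g' x \<partial>lborel) \<le> 1 / (4 * \<Lambda>')"
      proof -
        have "K' x \<le> K0 x" if "x \<noteq> 0" for x using km_le[OF that, of m] k'(2)[of x] by (simp add: K'_def)
        then have "(\<integral>x. indicator {x. \<rho> / 2 \<le> norm x} x * g' x \<partial>lborel) \<le> C / \<Lambda>'\<^sup>2"
          by (intro tight[OF \<Lambda>'0 K' _ g'])
        also have "\<dots> \<le> 1 / (4 * \<Lambda>')" using \<Lambda>'0 \<Lambda>' \<Lambda>1 by (simp add: power2_eq_square field_simps)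
        finally show ?thesis .
      qed
      define \<psi> where "\<psi> = Gop a g \<phi>"
      have c\<psi>: "ascone e l \<psi>" unfolding \<psi>_def by (rule cone_Gop[OF Kk \<Lambda> rk a_def e \<phi>])
      have b\<phi>: "bdm \<phi>" and b\<psi>: "bdm \<psi>" using \<phi> c\<psi> by (auto simp: ascone_def)
      have c\<kappa>: "ascone e l (\<lambda>x. 2 * conv \<kappa> \<psi> x)" by (intro cone_cmult cone_conv[OF e k'(1,3) c\<psi>]) simp
      have b\<kappa>: "bdm (\<lambda>x. 2 * conv \<kappa> \<psi> x)" using c\<kappa> by (simp add: ascone_def)
      \<comment> \<open>The convolution with \<open>\<kappa>\<close> is treated as part of the right
        hand side and the equation is solved with the kernel \<open>K'\<close>. Both summands lie in
        the cone, so each of them is a lower bound for \<open>\<psi>\<close> on the half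
        space.\<close>
      have id: "\<psi> x = Gop a g' \<phi> x + Gop a g' (\<lambda>x. 2 * conv \<kappa> \<psi> x) x" for x
      proof -
        have "(\<Lambda>' + 2 * (\<integral>x. K' x \<partial>lborel)) * \<psi> x - 2 * conv K' \<psi> x = \<phi> x + 2 * conv \<kappa> \<psi> x" for x
        proof -
          have "(\<Lambda> + 2 * (\<integral>x. km m x \<partial>lborel)) * \<psi> x = \<phi> x + 2 * conv (km m) \<psi> x"
            unfolding \<psi>_def by (rule Gop_eq[OF Kk \<Lambda> rk a_def b\<phi>])
          moreover have "conv K' \<psi> x = conv (km m) \<psi> x - conv \<kappa> \<psi> x"
            unfolding K'_def by (rule conv_diff_left[OF Kk'(3) k'(3) b\<psi>])
          ultimately show ?thesis unfolding int' \<Lambda>'_def by (simp add: algebra_simps)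
        qed
        then have "\<psi> x = Gop a g' (\<lambda>x. \<phi> x + 2 * conv \<kappa> \<psi> x) x"
          using Gop_inverse[OF K' \<Lambda>'0 g' a' b\<psi>, of x] by simp
        also have "\<dots> = Gop a g' \<phi> x + Gop a g' (\<lambda>x. 2 * conv \<kappa> \<psi> x) x"
          by (rule Gop_add[OF K' \<Lambda>'0 g' a' b\<phi> b\<kappa>])
        finally show ?thesis .
      qed
      have ge1: "Gop a g' \<phi> x \<le> \<psi> x" and ge2: "Gop a g' (\<lambda>x. 2 * conv \<kappa> \<psi> x) x \<le> \<psi> x" if "x \<bullet> e \<le> l" for x
        using id[of x] cone_Gop[OF K' \<Lambda>'0 g' a' e \<phi>] cone_Gop[OF K' \<Lambda>'0 g' a' e c\<kappa>] that by (auto simp: ascone_def)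
      define y where "y i = y0 + (real i / real n) *\<^sub>R (y1 - y0)" for i :: nat
      have ye: "y i \<bullet> e \<le> l - 4 * \<rho>" if "i \<le> n" for i
      proof -
        define t where "t = real i / real n"
        have t: "0 \<le> t" "t \<le> 1" using that n by (auto simp: t_def)
        have "y i \<bullet> e = (1 - t) * (y0 \<bullet> e) + t * (y1 \<bullet> e)"
          by (simp add: y_def t_def inner_add_left inner_diff_left algebra_simps)
        also have "\<dots> \<le> (1 - t) * (l - 4 * \<rho>) + t * (l - 4 * \<rho>)"
          using t y0 y1 by (intro add_mono mult_left_mono) auto
        finally show ?thesis by (simp add: algebra_simps)
      qed
      have inH: "x \<bullet> e \<le> l" if "x \<in> ball w (2 * \<rho>)" "w \<bullet> e \<le> l - 4 * \<rho>" for x w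
      proof -
        have "\<bar>x \<bullet> e - w \<bullet> e\<bar> \<le> norm (x - w)"
          using Cauchy_Schwarz_ineq2[of "x - w" e] e by (simp add: inner_diff_left)
        moreover have "norm (x - w) < 2 * \<rho>" using that by (simp add: dist_norm norm_minus_commute)
        ultimately show ?thesis using that \<rho> by linarith
      qed
      \<comment> \<open>In each step \<open>\<kappa>\<close> enlarges the radius from
        \<open>\<rho>\<close> to \<open>2 * \<rho>\<close> and the resolvent of \<open>K'\<close>
        reduces it to \<open>3 * \<rho> / 2\<close>; this ball contains the next one of radius
        \<open>\<rho>\<close>. The price is the factor \<open>q\<close>.\<close>
      have step: "\<forall>x\<in>ball (y i) \<rho>. q ^ i / (4 * \<Lambda>') * \<epsilon> \<le> \<psi> x" if "i \<le> n" for i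
        using that
      proof (induction i)
        case 0
        show ?case
        proof
          fix x assume x: "x \<in> ball (y 0) \<rho>"
          then have x0: "x \<in> ball y0 \<rho>" by (simp add: y_def)
          have "\<epsilon> / (4 * \<Lambda>') \<le> Gop a g' \<phi> x"
            by (rule Gop_ball_step[OF K' \<Lambda>'0 g' a' \<rho>(1) I2 e \<phi> y0 _ _ \<epsilon> x0]) (use lb \<rho> in auto)
          also have "\<dots> \<le> \<psi> x" by (rule ge1[OF inH[OF _ y0]]) (use x0 \<rho> in auto)
          finally show "q ^ 0 / (4 * \<Lambda>') * \<epsilon> \<le> \<psi> x" by simp
        qed
      next
        case (Suc i)
        define \<epsilon>' where "\<epsilon>' = q ^ i / (4 * \<Lambda>') * \<epsilon>"
        have \<epsilon>': "0 \<le> \<epsilon>'" using q \<Lambda>'0 \<epsilon> by (simp add: \<epsilon>'_def)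
        have IH: "\<And>x. x \<in> ball (y i) \<rho> \<Longrightarrow> \<epsilon>' \<le> \<psi> x" using Suc by (auto simp: \<epsilon>'_def)
        have yi: "y i \<bullet> e \<le> l - 4 * \<rho>" using ye Suc by simp
        have lb2: "2 * (c2 * \<epsilon>') \<le> 2 * conv \<kappa> \<psi> x" if "x \<in> ball (y i) (3 * \<rho> / 2 + \<rho> / 2)" for x
        proof -
          have "\<epsilon>' / 2 * (V * (K0 z3 - K0 z5)) \<le> conv \<kappa> \<psi> x" unfolding V_def \<kappa>_def m0_def
            by (rule km_ball_step[OF \<rho> z e c\<psi> yi IH \<epsilon>']) (use that in auto)
          then show ?thesis by (simp add: c2_def algebra_simps)
        qed
        show ?case
        proof
          fix x assume x: "x \<in> ball (y (Suc i)) \<rho>"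
          have "dist (y i) (y (Suc i)) = norm ((1 / real n) *\<^sub>R (y1 - y0))"
            unfolding dist_norm y_def norm_minus_commute[of "y0 + (real i / real n) *\<^sub>R (y1 - y0)"]
            by (rule arg_cong[where f=norm]) (simp add: add_divide_distrib algebra_simps)
          also have "\<dots> = norm (y1 - y0) / n" using n by simp
          also have "\<dots> \<le> R / n" using d n by (intro divide_right_mono) auto
          also have "\<dots> \<le> \<rho> / 2" by (rule n)
          finally have x2: "x \<in> ball (y i) (3 * \<rho> / 2)"
            using x dist_triangle[of "y i" x "y (Suc i)"] by simp
          have "2 * (c2 * \<epsilon>') / (4 * \<Lambda>') \<le> Gop a g' (\<lambda>x. 2 * conv \<kappa> \<psi> x) x"
            by (rule Gop_ball_step[OF K' \<Lambda>'0 g' a' \<rho>(1) I2 e c\<kappa> yi _ lb2 _ x2]) (use c2 \<epsilon>' in auto)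
          also have "\<dots> \<le> \<psi> x" by (rule ge2[OF inH[OF _ yi]]) (use x2 \<rho> in auto)
          also have "2 * (c2 * \<epsilon>') / (4 * \<Lambda>') = q * \<epsilon>'" by (simp add: q_def)
          finally show "q ^ Suc i / (4 * \<Lambda>') * \<epsilon> \<le> \<psi> x" by (simp add: \<epsilon>'_def)
        qed
      qed
      have "y n = y1" using n by (simp add: y_def)
      then show "c * \<epsilon> \<le> Gop (ratom \<Lambda> (km m)) g \<phi> x"
        using step[of n] x by (auto simp: c_def \<psi>_def a_def)
    qed
    qed
  qed
qed

text \<open>The propagation estimate is applied to the indicator of a small ball at 0 minus its
  reflection. The resolvent of the indicator is, up to the volume, an average of \<open>g\<close>
  over a small ball, so the gap between mirror points becomes a gap between values of
  \<open>g\<close>.\<close>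

lemma strictness:
  assumes \<epsilon>0: "0 < \<epsilon>0" and Rb: "0 \<le> Rb"
  shows "\<exists>\<Lambda>1>0. \<forall>\<Lambda>\<ge>\<Lambda>1. \<exists>c>0. \<exists>m0\<ge>0. \<forall>m\<ge>m0. \<forall>g. reskernel \<Lambda> (km m) g \<longrightarrow>
     (\<forall>x y. norm y \<le> Rb \<longrightarrow> norm x + \<epsilon>0 \<le> norm y \<longrightarrow> g y + c \<le> g x)"
proof -
  define \<rho> where "\<rho> = min (\<epsilon>0 / 20) (r0 / 6)"
  have \<rho>: "0 < \<rho>" "5 * \<rho> < r0" "20 * \<rho> \<le> \<epsilon>0" using \<epsilon>0 r0_pos by (auto simp: \<rho>_def min_def)
  define V where "V = measure lborel (ball (0::'a) (2 * \<rho>))"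
  have V: "V > 0" unfolding V_def using ball_vol_pos \<rho> by simp
  have fin: "emeasure lborel (ball (0::'a) (2 * \<rho>)) \<noteq> \<infinity>" using emeasure_lborel_ball_finite[of "0::'a" "2 * \<rho>"] by simp
  obtain \<Lambda>1 where \<Lambda>1: "\<Lambda>1 > 0" and PR: "\<And>\<Lambda>. \<Lambda> \<ge> \<Lambda>1 \<Longrightarrow> \<exists>c>0. \<exists>m0\<ge>0. \<forall>m\<ge>m0. \<forall>g. reskernel \<Lambda> (km m) g \<longrightarrow>
     (\<forall>e l \<phi> y0 y1 \<epsilon>. norm e = 1 \<longrightarrow> ascone e l \<phi> \<longrightarrow> y0 \<bullet> e \<le> l - 4 * \<rho> \<longrightarrow> y1 \<bullet> e \<le> l - 4 * \<rho> \<longrightarrow>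
        norm (y1 - y0) \<le> Rb \<longrightarrow> 0 \<le> \<epsilon> \<longrightarrow> (\<forall>x\<in>ball y0 (2 * \<rho>). \<epsilon> \<le> \<phi> x) \<longrightarrow>
        (\<forall>x\<in>ball y1 \<rho>. c * \<epsilon> \<le> Gop (ratom \<Lambda> (km m)) g \<phi> x))"
    using propagation[OF \<rho>(1,2) Rb] by blast
  obtain e :: 'a where e: "norm e = 1" using norm_Basis nonempty_Basis by blast
  have ee: "e \<bullet> e = 1" using e by (simp add: dot_square_norm)
  show ?thesis
  proof (rule exI[of _ \<Lambda>1], rule conjI[OF \<Lambda>1], intro allI impI)
    fix \<Lambda> assume "\<Lambda>1 \<le> \<Lambda>"
    then have \<Lambda>: "\<Lambda> > 0" using \<Lambda>1 by simp
    obtain c m0 where c: "c > 0" and m0: "m0 \<ge> 0" and P0: "\<forall>m\<ge>m0. \<forall>g. reskernel \<Lambda> (km m) g \<longrightarrow>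
     (\<forall>e l \<phi> y0 y1 \<epsilon>. norm e = 1 \<longrightarrow> ascone e l \<phi> \<longrightarrow> y0 \<bullet> e \<le> l - 4 * \<rho> \<longrightarrow> y1 \<bullet> e \<le> l - 4 * \<rho> \<longrightarrow>
        norm (y1 - y0) \<le> Rb \<longrightarrow> 0 \<le> \<epsilon> \<longrightarrow> (\<forall>x\<in>ball y0 (2 * \<rho>). \<epsilon> \<le> \<phi> x) \<longrightarrow>
        (\<forall>x\<in>ball y1 \<rho>. c * \<epsilon> \<le> Gop (ratom \<Lambda> (km m)) g \<phi> x))"
      using PR[OF \<open>\<Lambda>1 \<le> \<Lambda>\<close>] by auto
    note P = P0[rule_format]
    have "g y + c / V \<le> g x" if m: "m \<ge> m0" and rk: "reskernel \<Lambda> (km m) g" and y: "norm y \<le> Rb"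
      and xy: "norm x + \<epsilon>0 \<le> norm y" for m g x y
    proof -
      define a where "a = ratom \<Lambda> (km m)"
      have Kk: "rkernel (km m)" by (rule rkernel_km) (use m m0 in auto)
      have gk: "rkernel g" by (rule rk_kernel[OF Kk \<Lambda> rk a_def])
      note g' = kernelD[OF gk]
      note [measurable] = bdm_meas[OF g'(4)]
      define \<alpha> \<beta> where "\<alpha> = norm x" and "\<beta> = norm y"
      define l where "l = (\<alpha> + \<beta>) / 2"
      \<comment> \<open>The shifts by \<open>2 * \<rho>\<close> let points within that distance of
        \<open>z1\<close> have norm at least that of \<open>x\<close>, and those near
        \<open>z2\<close> norm at most that of \<open>y\<close>; monotonicity of \<open>g\<close>
        then compares the averages with \<open>g x\<close> and \<open>g y\<close>. Moreover
        \<open>z1\<close> is outside the ball, so the atom does not enter the upper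
        estimate.\<close>
      define z1 z2 where "z1 = (\<alpha> + 2 * \<rho>) *\<^sub>R e" and "z2 = (\<beta> - 2 * \<rho>) *\<^sub>R e"
      have ab: "0 \<le> \<alpha>" "\<alpha> + 20 * \<rho> \<le> \<beta>" using xy \<rho> by (auto simp: \<alpha>_def \<beta>_def)
      have rz: "rfl e l z1 = z2"
        by (simp add: rfl_def z1_def z2_def ee l_def flip: scaleR_add_left) (simp add: algebra_simps)
      let ?B = "ball (0::'a) (2 * \<rho>)"
      define \<omega> :: "'a \<Rightarrow> real" where "\<omega> = indicator ?B"
      have b\<omega>: "bdm \<omega>" unfolding \<omega>_def
        by (intro bdmI[of _ 1] borel_measurable_indicator) (auto simp: indicator_def)
      define \<phi> where "\<phi> z = \<omega> z - \<omega> (rfl e l z)" for z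
      have c\<phi>: "ascone e l \<phi>" unfolding \<phi>_def
      proof (rule cone_antisym[OF e b\<omega>])
        fix z :: 'a assume z: "z \<bullet> e \<le> l"
        have "norm (0 - z) \<le> norm (0 - rfl e l z)" using z ab \<rho>
          by (intro norm_rfl_le[OF e] mult_nonpos_nonpos) (auto simp: l_def)
        then show "\<omega> (rfl e l z) \<le> \<omega> z" by (auto simp: \<omega>_def indicator_def)
      qed
      have one: "\<forall>z\<in>ball 0 (2 * \<rho>). 1 \<le> \<phi> z"
      proof
        fix z :: 'a assume z: "z \<in> ?B"
        have "z \<bullet> e \<le> norm z" using norm_cauchy_schwarz[of z e] e by simp
        moreover have "2 * l = \<alpha> + \<beta>" by (simp add: l_def)
        moreover have "norm z < 2 * \<rho>" using z by simp
        ultimately have "2 * \<rho> \<le> rfl e l z \<bullet> e" unfolding rfl_inner[OF e] using ab \<rho> by linarith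
        also have "\<dots> \<le> norm (rfl e l z)" using norm_cauchy_schwarz[of "rfl e l z" e] e by simp
        finally show "1 \<le> \<phi> z" using z by (simp add: \<phi>_def \<omega>_def indicator_def)
      qed
      have n1: "norm z1 = \<alpha> + 2 * \<rho>" and n2: "norm z2 = \<beta> - 2 * \<rho>" using ab \<rho> e by (auto simp: z1_def z2_def)
      have "c * 1 \<le> Gop a g \<phi> z1" unfolding a_def
      proof (rule P[OF m rk e c\<phi> _ _ _ _ one[rule_format]])
        show "0 \<bullet> e \<le> l - 4 * \<rho>" using ab \<rho> by (simp add: l_def)
        show "z1 \<bullet> e \<le> l - 4 * \<rho>" using ab \<rho> by (simp add: z1_def ee l_def)
        show "norm (z1 - 0) \<le> Rb" using n1 ab \<rho> y by (simp add: \<beta>_def)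
      qed (use \<rho> in auto)
      also have "\<dots> = Gop a g \<omega> z1 - Gop a g \<omega> z2"
        unfolding \<phi>_def using Gop_diff[OF Kk \<Lambda> rk a_def b\<omega> bdm_mpres[OF b\<omega> mpres_rfl[OF e]]]
          Gop_rfl[OF Kk \<Lambda> rk a_def e b\<omega>] rz by simp
      also have "Gop a g \<omega> z1 \<le> V * g x"
      proof -
        have "\<omega> z1 = 0" using n1 ab by (simp add: \<omega>_def indicator_def)
        then have "Gop a g \<omega> z1 = (\<integral>w. g (z1 - w) * \<omega> w \<partial>lborel)" by (simp add: Gop_def conv_alt bdm_meas b\<omega>)
        also have "\<dots> \<le> (\<integral>w. g x * \<omega> w \<partial>lborel)"
        proof (rule integral_mono[OF conv_alt_integrable[OF g'(3) b\<omega>]])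
          show "integrable lborel (\<lambda>w. g x * \<omega> w)" unfolding \<omega>_def using fin by (auto simp: less_top)
          fix w
          have "norm x \<le> norm (z1 - w)" if "w \<in> ?B"
            using that n1 norm_triangle_ineq2[of z1 w] by (simp add: \<alpha>_def)
          then show "g (z1 - w) * \<omega> w \<le> g x * \<omega> w"
            using RD_D[OF g'(1), of x "z1 - w"] by (auto simp: \<omega>_def indicator_def)
        qed
        also have "\<dots> = V * g x" unfolding \<omega>_def V_def by simp
        finally show ?thesis .
      qed
      finally have upper: "c \<le> V * g x - Gop a g \<omega> z2" by simp
      have "V * g y \<le> Gop a g \<omega> z2"
      proof -
        have "V * g y = (\<integral>w. g y * \<omega> w \<partial>lborel)" unfolding \<omega>_def V_def by simp
        also have "\<dots> \<le> (\<integral>w. g (z2 - w) * \<omega> w \<partial>lborel)"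
        proof (rule integral_mono[OF _ conv_alt_integrable[OF g'(3) b\<omega>]])
          show "integrable lborel (\<lambda>w. g y * \<omega> w)" unfolding \<omega>_def using fin by (auto simp: less_top)
          fix w
          have "norm (z2 - w) \<le> norm y" if "w \<in> ?B"
            using that n2 norm_triangle_ineq4[of z2 w] by (simp add: \<beta>_def)
          then show "g y * \<omega> w \<le> g (z2 - w) * \<omega> w"
            using RD_D[OF g'(1), of "z2 - w" y] by (auto simp: \<omega>_def indicator_def)
        qed
        also have "\<dots> \<le> Gop a g \<omega> z2" unfolding Gop_def using a_pos[OF Kk \<Lambda> rk a_def]
          by (simp add: conv_alt bdm_meas b\<omega>) (simp add: \<omega>_def)
        finally show ?thesis .
      qed
      with upper have "c \<le> V * g x - V * g y" by simp
      then show ?thesis using V by (simp add: field_simps)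
    qed
    then show "\<exists>c>0. \<exists>m0\<ge>0. \<forall>m\<ge>m0. \<forall>g. reskernel \<Lambda> (km m) g \<longrightarrow>
     (\<forall>x y. norm y \<le> Rb \<longrightarrow> norm x + \<epsilon>0 \<le> norm y \<longrightarrow> g y + c \<le> g x)"
      using c V m0 by (intro exI[of _ "c / V"] conjI exI[of _ m0]) auto
  qed
qed

section \<open>Lipschitz minorants of large mass\<close>

lemma K0_scaled_inf: "(\<integral>\<^sup>+x. ennreal (K0 (2 *\<^sub>R x)) \<partial>lborel) = \<infinity>"
proof (rule ccontr)
  assume fin: "(\<integral>\<^sup>+x. ennreal (K0 (2 *\<^sub>R x)) \<partial>lborel) \<noteq> \<infinity>"
  have "(\<integral>\<^sup>+x. ennreal (K0 x) \<partial>lborel) = (\<integral>\<^sup>+x. ennreal (2 ^ DIM('a)) * ennreal (K0 (2 *\<^sub>R x)) \<partial>lborel)"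
    by (subst lborel_affine[of 2 "0::'a"]) (simp_all add: nn_integral_density nn_integral_distr)
  also have "\<dots> = ennreal (2 ^ DIM('a)) * (\<integral>\<^sup>+x. ennreal (K0 (2 *\<^sub>R x)) \<partial>lborel)"
    by (rule nn_integral_cmult) simp
  also have "\<dots> < \<infinity>" using fin by (simp add: ennreal_mult_less_top less_top)
  finally show False using K0_inf by simp
qed

text \<open>The infimal convolution of a truncated, cut off kernel with a multiple of the norm is
  Lipschitz and lies below the kernel. Being supported in a ball, it changes in mean by at most a
  multiple of the displacement. Its mass is still large because away from 0 it dominates the kernel
  with doubled argument.\<close>

lemma lipschitz_minorant:
  "\<exists>m0\<ge>0. \<exists>\<rho>. (\<forall>x. 0 \<le> \<rho> x) \<and> (\<forall>m\<ge>m0. \<forall>x. \<rho> x \<le> km m x) \<and> integrable lborel \<rho> \<and> R \<le> (\<integral>x. \<rho> x \<partial>lborel) \<and>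
     (\<exists>C\<ge>0. \<forall>d. norm d \<le> 1 \<longrightarrow> (\<integral>x. \<bar>\<rho> (x + d) - \<rho> x\<bar> \<partial>lborel) \<le> C * norm d)"
proof -
  define Kc where "Kc n x = (if norm x \<le> real (Suc n) then km (Suc n) x else 0)" for n x
  have Kc0: "0 \<le> Kc n x" for n x by (simp add: Kc_def km_nonneg)
  have Kcn: "Kc n x \<le> Suc n" for n x using km_le_m[of "Suc n" x] by (simp add: Kc_def)
  have KcRD: "RD (Kc n)" for n
    using kernelD(1)[OF rkernel_km[of "Suc n"]] km_nonneg[of "Suc n"] unfolding RD_def Kc_def by auto
  have [measurable]: "Kc n \<in> borel_measurable borel" for n by (rule RD_measurable[OF KcRD])
  \<comment> \<open>This will be a lower bound for the minorant. Doubling the argument leaves room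
    for a displacement by up to \<open>norm x\<close>; a small ball at 0 is given up.\<close>
  define f where "f n x = indicator {x. 1 / real (Suc n) \<le> norm x} x * Kc n (2 *\<^sub>R x)" for n and x :: 'a
  have [measurable]: "f n \<in> borel_measurable borel" for n unfolding f_def by measurable
  have f0: "0 \<le> f n x" for n x by (simp add: f_def Kc0)
  have finc: "f n x \<le> f (Suc n) x" for n x
  proof -
    have "Kc n (2 *\<^sub>R x) \<le> Kc (Suc n) (2 *\<^sub>R x)"
      using km_mono[of "Suc n" "Suc (Suc n)"] km_nonneg[of "Suc (Suc n)"] by (auto simp: Kc_def)
    moreover have "1 / real (Suc (Suc n)) \<le> 1 / real (Suc n)" by (simp add: field_simps)
    ultimately show ?thesis using Kc0[of "Suc n" "2 *\<^sub>R x"] by (auto simp: f_def indicator_def)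
  qed
  have inc: "incseq (\<lambda>n x. ennreal (f n x))"
    by (auto simp: incseq_Suc_iff le_fun_def intro!: ennreal_leI finc)
  have ex: "\<exists>n. f n x = K0 (2 *\<^sub>R x)" if x: "x \<noteq> 0" for x
  proof -
    obtain n where n: "max (1 / norm x) (max (2 * norm x) (K0 (2 *\<^sub>R x))) \<le> real n"
      using real_arch_simple by blast
    then have "1 / norm x \<le> real (Suc n)" "norm (2 *\<^sub>R x) \<le> real (Suc n)" "K0 (2 *\<^sub>R x) \<le> real (Suc n)" by auto
    moreover from this(1) have "1 / real (Suc n) \<le> norm x" using x by (simp add: field_simps)
    ultimately show ?thesis using x by (intro exI[of _ n]) (simp add: f_def Kc_def km_def)
  qed
  have "\<infinity> = (\<integral>\<^sup>+x. ennreal (K0 (2 *\<^sub>R x)) \<partial>lborel)" by (simp add: K0_scaled_inf)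
  also have "\<dots> \<le> (\<integral>\<^sup>+x. (SUP n. ennreal (f n x)) \<partial>lborel)"
  proof (rule nn_integral_mono_AE)
    show "AE x in lborel. ennreal (K0 (2 *\<^sub>R x)) \<le> (SUP n. ennreal (f n x))"
      using AE_lborel_singleton[of 0]
    proof eventually_elim
      case (elim x)
      then obtain n where "f n x = K0 (2 *\<^sub>R x)" using ex by blast
      then show ?case by (metis SUP_upper UNIV_I)
    qed
  qed
  also have "\<dots> = (SUP n. (\<integral>\<^sup>+x. ennreal (f n x) \<partial>lborel))"
    by (rule nn_integral_monotone_convergence_SUP[OF inc]) simp
  finally have "ennreal R < (SUP n. (\<integral>\<^sup>+x. ennreal (f n x) \<partial>lborel))"
    by (metis ennreal_less_top infinity_ennreal_def less_le_trans)
  then obtain n where n: "ennreal R < (\<integral>\<^sup>+x. ennreal (f n x) \<partial>lborel)"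
    by (auto simp: less_SUP_iff)
  \<comment> \<open>With this slope a displacement by \<open>1 / real (Suc n)\<close> costs
    \<open>real (Suc n)\<close>, which is an upper bound of \<open>Kc n\<close>; only smaller
    displacements can matter in the infimum.\<close>
  define L where "L = (real (Suc n))\<^sup>2"
  have L: "L \<ge> 0" by (simp add: L_def)
  define \<rho> where "\<rho> x = (INF y. Kc n y + L * norm (x - y))" for x
  have bdd: "bdd_below (range (\<lambda>y. Kc n y + L * norm (x - y)))" for x
    using Kc0 L by (intro bdd_belowI2[of _ 0]) simp
  have low: "\<rho> x \<le> Kc n y + L * norm (x - y)" for x y
    unfolding \<rho>_def by (rule cINF_lower[OF bdd]) simp
  have great: "c \<le> \<rho> x" if "\<And>y. c \<le> Kc n y + L * norm (x - y)" for c x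
    unfolding \<rho>_def using that by (intro cINF_greatest) auto
  have \<rho>0: "0 \<le> \<rho> x" for x using Kc0 L by (intro great) simp
  have \<rho>K: "\<rho> x \<le> Kc n x" for x using low[of x x] by simp
  have lip1: "\<rho> x \<le> \<rho> x' + L * norm (x - x')" for x x'
  proof -
    have "\<rho> x - L * norm (x - x') \<le> \<rho> x'"
    proof (rule great)
      fix y
      have "norm (x - y) \<le> norm (x - x') + norm (x' - y)" using norm_triangle_ineq[of "x - x'" "x' - y"] by simp
      then have "L * norm (x - y) \<le> L * norm (x - x') + L * norm (x' - y)"
        using mult_left_mono[OF _ L] by (simp add: distrib_left[symmetric])
      then show "\<rho> x - L * norm (x - x') \<le> Kc n y + L * norm (x' - y)" using low[of x y] by linarith
    qed
    then show ?thesis by simp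
  qed
  have lip: "\<bar>\<rho> x - \<rho> x'\<bar> \<le> L * norm (x - x')" for x x'
    using lip1[of x x'] lip1[of x' x] by (auto simp: norm_minus_commute abs_le_iff)
  have "L-lipschitz_on UNIV \<rho>" using lip L by (intro lipschitz_onI) (auto simp: dist_norm)
  then have [measurable]: "\<rho> \<in> borel_measurable borel"
    by (intro borel_measurable_continuous_onI lipschitz_on_continuous_on)
  have fin: "emeasure lborel (cball (0::'a) r) < \<infinity>" for r by (rule emeasure_lborel_cball_finite)
  have icb: "integrable lborel (\<lambda>x. c * indicator (cball (0::'a) r) x)" for c r :: real
    using fin[of r] by (intro integrable_mult_right integrable_real_indicator) auto
  have \<rho>i: "integrable lborel \<rho>"
  proof (rule Bochner_Integration.integrable_bound[OF icb[of "Suc n" "Suc n"]])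
    have "\<rho> x \<le> real (Suc n) * indicator (cball 0 (real (Suc n))) x" for x
      using \<rho>K[of x] Kcn[of n x] by (auto simp: indicator_def Kc_def split: if_splits)
    then show "AE x in lborel. norm (\<rho> x) \<le> norm (real (Suc n) * indicator (cball 0 (real (Suc n))) x)"
      using \<rho>0 by (intro AE_I2) simp
  qed simp
  have f\<rho>: "f n x \<le> \<rho> x" for x
  proof (cases "1 / real (Suc n) \<le> norm x")
    case True
    have "Kc n (2 *\<^sub>R x) \<le> \<rho> x"
    proof (rule great)
      fix y
      show "Kc n (2 *\<^sub>R x) \<le> Kc n y + L * norm (x - y)"
      proof (cases "1 / real (Suc n) \<le> norm (x - y)")
        case True
        have "real (Suc n) = L * (1 / real (Suc n))" by (simp add: L_def power2_eq_square)
        also have "\<dots> \<le> L * norm (x - y)" using True L by (rule mult_left_mono)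
        finally show ?thesis using Kcn[of n "2 *\<^sub>R x"] Kc0[of n y] by linarith
      next
        case False
        have "norm y \<le> norm x + norm (x - y)" using norm_triangle_ineq2[of y x] by (simp add: norm_minus_commute)
        then have "norm y \<le> norm (2 *\<^sub>R x)" using False \<open>1 / real (Suc n) \<le> norm x\<close> by simp
        then have "Kc n (2 *\<^sub>R x) \<le> Kc n y" by (rule RD_D[OF KcRD])
        then show ?thesis using mult_nonneg_nonneg[OF L norm_ge_zero[of "x - y"]] by linarith
      qed
    qed
    then show ?thesis using True by (simp add: f_def)
  qed (simp add: f_def \<rho>0)
  have "ennreal R < (\<integral>\<^sup>+x. ennreal (\<rho> x) \<partial>lborel)"
    using n by (rule less_le_trans) (intro nn_integral_mono ennreal_leI f\<rho>)
  also have "\<dots> = ennreal (\<integral>x. \<rho> x \<partial>lborel)" by (rule nn_integral_eq_integral[OF \<rho>i]) (simp add: \<rho>0)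
  finally have R: "R \<le> (\<integral>x. \<rho> x \<partial>lborel)"
    by (metis ennreal_leI leD linorder_le_cases)
  have sh: "(\<integral>x. \<bar>\<rho> (x + d) - \<rho> x\<bar> \<partial>lborel) \<le> (L * measure lborel (cball (0::'a) (real (Suc n) + 1))) * norm d"
    if d: "norm d \<le> 1" for d
  proof -
    have "(\<integral>x. \<bar>\<rho> (x + d) - \<rho> x\<bar> \<partial>lborel) \<le> (\<integral>x. (L * norm d) * indicator (cball (0::'a) (real (Suc n) + 1)) x \<partial>lborel)"
    proof (rule integral_mono)
      show "integrable lborel (\<lambda>x. (L * norm d) * indicator (cball (0::'a) (real (Suc n) + 1)) x)" by (rule icb)
      show "integrable lborel (\<lambda>x. \<bar>\<rho> (x + d) - \<rho> x\<bar>)"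
        using \<rho>i mpres_integrable[OF mpres_add[of d], of \<rho>] by auto
      fix x
      show "\<bar>\<rho> (x + d) - \<rho> x\<bar> \<le> (L * norm d) * indicator (cball (0::'a) (real (Suc n) + 1)) x"
      proof (cases "norm x \<le> real (Suc n) + 1")
        case True then show ?thesis using lip[of "x + d" x] by simp
      next
        case False
        moreover have "norm x \<le> norm (x + d) + norm d" using norm_triangle_ineq4[of "x + d" d] by simp
        ultimately have "norm (x + d) > real (Suc n)" "norm x > real (Suc n)" using d by auto
        then have "\<rho> (x + d) = 0" "\<rho> x = 0" using \<rho>0 \<rho>K[of x] \<rho>K[of "x + d"] by (auto simp: Kc_def intro: antisym)
        then show ?thesis using L by simp
      qed
    qed
    also have "\<dots> = (L * measure lborel (cball (0::'a) (real (Suc n) + 1))) * norm d" using fin by simp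
    finally show ?thesis .
  qed
  have le: "\<rho> x \<le> km m x" if "real (Suc n) \<le> m" for m x
    using \<rho>K[of x] km_mono[OF that, of x] km_nonneg[of m x] that by (auto simp: Kc_def split: if_splits)
  show ?thesis
    using \<rho>0 \<rho>i R le sh L
    by (intro exI[of _ "real (Suc n)"] conjI exI[of _ \<rho>] exI[of _ "L * measure lborel (cball (0::'a) (real (Suc n) + 1))"]) auto
qed

end

section \<open>Shifting the runs of level sets along a lattice\<close>

text \<open>The last assumption makes every run finite.\<close>

locale fiber =
  fixes v :: "'a::euclidean_space \<Rightarrow> real" and e :: 'a and h :: real
  assumes e: "norm e = 1" and h: "0 < h" and nv: "nice v" and v0: "0 \<le> v x"
    and vb: "0 < s \<Longrightarrow> bounded {x. s < v x}"
begin

definition d :: 'a where "d = h *\<^sub>R e"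

text \<open>
  For \<open>0 < s < v x\<close>, \<open>up\<close> and \<open>dn\<close> count the steps from \<open>x\<close> to the two ends of its run in \<open>{v > s}\<close>, and \<open>cen\<close> is
  the height of the centre of this run; otherwise the values are meaningless, and \<open>P\<close> excludes them.
  The layer cake formula then makes \<open>part A\<close> the portion of \<open>v\<close> made up of the runs with centre in \<open>A\<close>.
\<close>
definition up :: "'a \<Rightarrow> real \<Rightarrow> nat" where "up x s = (LEAST k. v (x + real (Suc k) *\<^sub>R d) \<le> s)"
definition dn :: "'a \<Rightarrow> real \<Rightarrow> nat" where "dn x s = (LEAST k. v (x - real (Suc k) *\<^sub>R d) \<le> s)"
definition cen :: "'a \<Rightarrow> real \<Rightarrow> real" where "cen x s = x \<bullet> e + h * (real (up x s) - real (dn x s)) / 2"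
definition P :: "real set \<Rightarrow> ('a \<times> real) set" where "P A = {(x, s). 0 < s \<and> s < v x \<and> cen x s \<in> A}"
definition part :: "real set \<Rightarrow> 'a \<Rightarrow> real" where "part A x = (\<integral>s. indicator (P A) (x, s) \<partial>lborel)"

lemma vm[measurable]: "v \<in> borel_measurable borel" by (rule nice_meas[OF nv])

lemma de: "d \<bullet> e = h" using e by (simp add: d_def dot_square_norm)

lemma ex_far:
  assumes "0 < s" and "c \<noteq> 0" shows "\<exists>k. v (x + (c * real (Suc k)) *\<^sub>R d) \<le> s"
proof (rule ccontr)
  assume "\<not> ?thesis"
  then have *: "s < v (x + (c * real (Suc k)) *\<^sub>R d)" for k by (metis not_le)
  obtain B where B: "\<And>y. s < v y \<Longrightarrow> norm y \<le> B" using vb[OF assms(1)] by (auto simp: bounded_iff)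
  have 1: "\<bar>c\<bar> * h * real (Suc k) \<le> B + norm x" for k
  proof -
    have "norm ((c * real (Suc k)) *\<^sub>R d) \<le> norm (x + (c * real (Suc k)) *\<^sub>R d) + norm x"
      using norm_triangle_ineq4[of "x + (c * real (Suc k)) *\<^sub>R d" x] by simp
    also have "norm ((c * real (Suc k)) *\<^sub>R d) = \<bar>c\<bar> * h * real (Suc k)"
      using h e by (simp add: d_def abs_mult)
    finally show ?thesis using B[OF *[of k]] by linarith
  qed
  have p: "\<bar>c\<bar> * h > 0" using assms h by simp
  obtain k where "(B + norm x) / (\<bar>c\<bar> * h) < real k" using reals_Archimedean2 by blast
  then have "B + norm x < \<bar>c\<bar> * h * real k" using p by (simp add: field_simps)
  also have "\<dots> \<le> \<bar>c\<bar> * h * real (Suc k)" using p by (intro mult_left_mono) auto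
  finally show False using 1[of k] by simp
qed

lemma ex_up: "0 < s \<Longrightarrow> \<exists>k. v (x + real (Suc k) *\<^sub>R d) \<le> s"
  using ex_far[of s 1 x] by simp
lemma ex_dn: "0 < s \<Longrightarrow> \<exists>k. v (x - real (Suc k) *\<^sub>R d) \<le> s"
  using ex_far[of s "-1" x] by (simp del: of_nat_Suc)

text \<open>One step up inside a run shortens the way to its top and lengthens the way to its bottom
  by one, which balances the change of height.\<close>

lemma cen_shift:
  assumes s: "0 < s" and "s < v x" "s < v (x + d)" shows "cen (x + d) s = cen x s"
proof -
  have 1: "up x s = Suc (up (x + d) s)"
  proof -
    obtain k where k: "v (x + real (Suc k) *\<^sub>R d) \<le> s" using ex_up[OF s] by blast
    have "(LEAST k. v (x + real (Suc k) *\<^sub>R d) \<le> s) = Suc (LEAST k. v (x + real (Suc (Suc k)) *\<^sub>R d) \<le> s)"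
      by (rule Least_Suc[of _ k]) (use k assms in auto)
    moreover have "x + real (Suc (Suc k)) *\<^sub>R d = x + d + real (Suc k) *\<^sub>R d" for k
      by (simp add: scaleR_2 algebra_simps)
    ultimately show ?thesis by (simp only: up_def)
  qed
  have 2: "dn (x + d) s = Suc (dn x s)"
  proof -
    obtain k where k: "v (x + d - real (Suc k) *\<^sub>R d) \<le> s" using ex_dn[OF s] by blast
    have "(LEAST k. v (x + d - real (Suc k) *\<^sub>R d) \<le> s) = Suc (LEAST k. v (x + d - real (Suc (Suc k)) *\<^sub>R d) \<le> s)"
      by (rule Least_Suc[of _ k]) (use k assms in auto)
    moreover have "x + d - real (Suc 0) *\<^sub>R d = x" "x + d - real (Suc (Suc k)) *\<^sub>R d = x - real (Suc k) *\<^sub>R d" for k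
      by (simp_all add: scaleR_2 algebra_simps)
    ultimately show ?thesis by (simp only: dn_def)
  qed
  show ?thesis using 1 2 by (simp add: cen_def inner_add_left de field_simps)
qed

lemma P_shift: "0 < s \<Longrightarrow> s < v x \<Longrightarrow> s < v (x + d) \<Longrightarrow> (x + d, s) \<in> P A \<longleftrightarrow> (x, s) \<in> P A"
  using cen_shift[of s x] by (auto simp: P_def)

lemma up_measurable[measurable]: "(\<lambda>p. up (fst p) (snd p)) \<in> (borel \<Otimes>\<^sub>M borel) \<rightarrow>\<^sub>M count_space UNIV"
  unfolding up_def by measurable
lemma dn_measurable[measurable]: "(\<lambda>p. dn (fst p) (snd p)) \<in> (borel \<Otimes>\<^sub>M borel) \<rightarrow>\<^sub>M count_space UNIV"
  unfolding dn_def by measurable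

lemma cen_measurable[measurable]: "(\<lambda>p. cen (fst p) (snd p)) \<in> borel_measurable (borel \<Otimes>\<^sub>M borel)"
  unfolding cen_def by measurable

lemma P_measurable[measurable]: assumes [measurable]: "A \<in> sets borel" shows "P A \<in> sets (borel \<Otimes>\<^sub>M borel)"
proof -
  have "P A = {p \<in> space (borel \<Otimes>\<^sub>M borel). 0 < snd p \<and> snd p < v (fst p) \<and> cen (fst p) (snd p) \<in> A}"
    by (auto simp: P_def space_pair_measure)
  also have "\<dots> \<in> sets (borel \<Otimes>\<^sub>M borel)" by measurable
  finally show ?thesis .
qed

lemma slice_integrable: assumes [measurable]: "A \<in> sets borel"
  shows "integrable lborel (\<lambda>s. indicator (P A) (x, s) :: real)"
proof (rule Bochner_Integration.integrable_bound)
  show "integrable lborel (\<lambda>s. indicator {0..v x} s :: real)" by (rule integrable_real_indicator) (auto simp: v0)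
  show "AE s in lborel. norm (indicator (P A) (x, s) :: real) \<le> norm (indicator {0..v x} s :: real)"
    by (intro AE_I2) (auto simp: P_def indicator_def)
qed simp

lemma part_nonneg: "0 \<le> part A x" unfolding part_def by simp

lemma part_ennreal: assumes [measurable]: "A \<in> sets borel"
  shows "ennreal (part A x) = (\<integral>\<^sup>+s. indicator (P A) (x, s) \<partial>lborel)"
  unfolding part_def
  by (subst nn_integral_eq_integral[OF slice_integrable, symmetric]) (auto simp: ennreal_indicator)

lemma part_UNIV: "part UNIV x = v x"
proof -
  have "part UNIV x = (\<integral>s. indicator {0<..<v x} s \<partial>lborel)"
    unfolding part_def by (intro Bochner_Integration.integral_cong) (auto simp: P_def indicator_def)
  also have "\<dots> = v x" using v0[of x] by simp
  finally show ?thesis .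
qed

lemma part_Un:
  assumes "A \<in> sets borel" "B \<in> sets borel" "A \<inter> B = {}" shows "part (A \<union> B) x = part A x + part B x"
proof -
  have "part (A \<union> B) x = (\<integral>s. indicator (P A) (x, s) + indicator (P B) (x, s) \<partial>lborel)"
    unfolding part_def using assms(3) by (intro Bochner_Integration.integral_cong) (auto simp: P_def indicator_def)
  also have "\<dots> = part A x + part B x" using slice_integrable[OF assms(1)] slice_integrable[OF assms(2)] by (simp add: part_def)
  finally show ?thesis .
qed

lemma part_mono: assumes "A \<in> sets borel" "B \<in> sets borel" "A \<subseteq> B" shows "part A x \<le> part B x"
  using part_Un[of A "B - A" x] part_nonneg[of "B - A" x] assms by (auto simp: Un_absorb1)

lemma part_le: "A \<in> sets borel \<Longrightarrow> part A x \<le> v x"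
  using part_mono[of A UNIV x] by (simp add: part_UNIV)

lemma part_measurable: assumes [measurable]: "A \<in> sets borel" shows "part A \<in> borel_measurable borel"
  unfolding part_def by measurable

lemma nice_part: assumes "A \<in> sets borel" shows "nice (part A)"
  by (rule nice_le[OF nv part_measurable[OF assms]]) (use part_nonneg part_le[OF assms] v0 in auto)

lemma part_sum:
  assumes "finite I" "\<And>i. i \<in> I \<Longrightarrow> A i \<in> sets borel" "disjoint_family_on A I"
  shows "(\<Sum>i\<in>I. part (A i) x) \<le> v x"
proof -
  have "(\<Sum>i\<in>I. part (A i) x) = part (\<Union>i\<in>I. A i) x"
    using assms
  proof (induction I rule: finite_induct)
    case empty
    then show ?case by (simp add: part_def P_def)
  next
    case (insert i I)
    have "part (A i \<union> (\<Union>j\<in>I. A j)) x = part (A i) x + part (\<Union>j\<in>I. A j) x"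
      using insert by (intro part_Un sets.finite_UN) (auto simp: disjoint_family_on_def)
    moreover have "disjoint_family_on A I" using insert by (auto simp: disjoint_family_on_def)
    ultimately show ?case using insert by simp
  qed
  also have "\<dots> \<le> v x" using assms by (intro part_le sets.finite_UN) auto
  finally show ?thesis .
qed

section \<open>Rearrangement inequalities for moved runs\<close>

lemma nn_ip:
  assumes "nice \<phi>" "nice \<psi>" "\<And>x. 0 \<le> \<phi> x" "\<And>x. 0 \<le> \<psi> x"
  shows "ennreal (ip \<phi> \<psi>) = (\<integral>\<^sup>+x. ennreal (\<phi> x) * ennreal (\<psi> x) \<partial>lborel)"
  unfolding ip_def
  by (subst nn_integral_eq_integral[OF nice_mult_integrable[OF assms(1,2)], symmetric]) (auto simp: assms ennreal_mult)

lemma bounded_level_fin: assumes "0 < s" "A \<in> sets borel"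
  shows "emeasure lborel {x. (x, s) \<in> P A} < \<infinity>" "{x. (x, s) \<in> P A} \<in> sets borel"
proof -
  have "{x. (x, s) \<in> P A} = (\<lambda>x. (x, s)) -` P A \<inter> space borel" by auto
  also have "\<dots> \<in> sets borel" using P_measurable[OF assms(2)] by measurable
  finally show m: "{x. (x, s) \<in> P A} \<in> sets borel" .
  have "bounded {x. (x, s) \<in> P A}" by (rule bounded_subset[OF vb[OF assms(1)]]) (auto simp: P_def)
  then show "emeasure lborel {x. (x, s) \<in> P A} < \<infinity>" by (rule emeasure_bounded_finite)
qed

text \<open>\<open>part A (x + d)\<close> is the part moved one step against \<open>e\<close>. At
  level \<open>s\<close> the points gained by the move have \<open>v x \<le> s\<close>, the points
  lost have \<open>s < v x\<close>, and both sets have the same measure; a function that is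
  nondecreasing in \<open>v\<close> therefore loses on balance.\<close>

lemma ip_shift_monotone:
  assumes A[measurable]: "A \<in> sets borel" and F: "nice F" "\<And>x. 0 \<le> F x" "\<And>x y. v x \<le> v y \<Longrightarrow> F x \<le> F y"
  shows "ip (\<lambda>x. part A (x + d)) F \<le> ip (part A) F"
proof -
  have [measurable]: "F \<in> borel_measurable borel" by (rule nice_meas[OF F(1)])
  obtain b where b: "\<And>x. \<bar>F x\<bar> \<le> b" using bdmE[OF nice_bdm[OF F(1)]] by metis
  have npd: "nice (\<lambda>x. part A (x + d))" by (rule nice_mpres[OF nice_part[OF A] mpres_add])
  have rep: "ennreal (ip (\<lambda>x. part A (x + z)) F) = (\<integral>\<^sup>+s. (\<integral>\<^sup>+x. indicator (P A) (x + z, s) * ennreal (F x) \<partial>lborel) \<partial>lborel)" for z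
  proof -
    have "nice (\<lambda>x. part A (x + z))" by (rule nice_mpres[OF nice_part[OF A] mpres_add])
    then have "ennreal (ip (\<lambda>x. part A (x + z)) F) = (\<integral>\<^sup>+x. (\<integral>\<^sup>+s. indicator (P A) (x + z, s) * ennreal (F x) \<partial>lborel) \<partial>lborel)"
      using F part_nonneg by (simp add: nn_ip part_ennreal nn_integral_multc)
    also have "\<dots> = (\<integral>\<^sup>+s. (\<integral>\<^sup>+x. indicator (P A) (x + z, s) * ennreal (F x) \<partial>lborel) \<partial>lborel)"
      by (rule lborel_pair.Fubini') simp
    finally show ?thesis .
  qed
  have lev: "(\<integral>\<^sup>+x. indicator (P A) (x + d, s) * ennreal (F x) \<partial>lborel) \<le> (\<integral>\<^sup>+x. indicator (P A) (x + 0, s) * ennreal (F x) \<partial>lborel)" for s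
  proof (cases "0 < s")
    case False
    then show ?thesis by (simp add: P_def)
  next
    case s: True
    define S where "S = {x. (x, s) \<in> P A}"
    have S[measurable]: "S \<in> sets borel" and fin: "emeasure lborel S < \<infinity>"
      unfolding S_def using bounded_level_fin[OF s A] by auto
    have iS: "integrable lborel (indicator S :: 'a \<Rightarrow> real)" using fin by simp
    have iSd: "integrable lborel (\<lambda>x. indicator S (x + d) :: real)"
      using mpres_integrable[OF mpres_add[of d], of "indicator S :: 'a \<Rightarrow> real"] iS by simp
    have bF: "integrable lborel (\<lambda>x. f x * F x)" if "integrable lborel f" for f
    proof (rule Bochner_Integration.integrable_bound[OF integrable_mult_right[OF that, of b]])
      have [measurable]: "f \<in> borel_measurable borel" using that by auto
      show "(\<lambda>x. f x * F x) \<in> borel_measurable lborel" by simp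
      show "AE x in lborel. norm (f x * F x) \<le> norm (b * f x)"
        using b by (intro AE_I2) (auto simp: abs_mult mult.commute[of b] intro!: mult_left_mono order_trans[OF b] abs_ge_self)
    qed
    \<comment> \<open>This number separates the values of \<open>F\<close> on the two sides of the
      level, so \<open>F\<close> may be replaced by it in the difference.\<close>
    define c where "c = (SUP x\<in>{x. v x \<le> s}. F x)"
    obtain k where "v (0 + real (Suc k) *\<^sub>R d) \<le> s" using ex_up[OF s] by blast
    then have ne: "{x. v x \<le> s} \<noteq> {}" by blast
    have bdd: "bdd_above (F ` {x. v x \<le> s})" using b by (intro bdd_aboveI2[of _ _ b]) (auto intro: abs_le_D1)
    have c1: "F x \<le> c" if "v x \<le> s" for x unfolding c_def using that by (intro cSUP_upper bdd) auto
    have c2: "c \<le> F x" if "s < v x" for x unfolding c_def using that ne by (intro cSUP_least) (auto intro!: F(3))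
    have "(\<integral>x. (indicator S (x + d) - indicator S x) * F x \<partial>lborel) \<le> (\<integral>x. (indicator S (x + d) - indicator S x) * c \<partial>lborel)"
    proof (rule integral_mono)
      show "integrable lborel (\<lambda>x. (indicator S (x + d) - indicator S x) * F x)" using iS iSd by (intro bF) auto
      show "integrable lborel (\<lambda>x. (indicator S (x + d) - indicator S x) * c)" using iS iSd by auto
      fix x
      show "(indicator S (x + d) - indicator S x) * F x \<le> (indicator S (x + d) - indicator S x) * c"
      proof (cases "x + d \<in> S"; cases "x \<in> S")
        assume "x + d \<in> S" "x \<notin> S"
        then have "v x \<le> s" using P_shift[OF s, of x A] by (force simp: S_def P_def)
        then show ?thesis using \<open>x + d \<in> S\<close> \<open>x \<notin> S\<close> c1 by simp
      next
        assume "x + d \<notin> S" "x \<in> S"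
        then have "s < v x" by (auto simp: S_def P_def)
        then show ?thesis using \<open>x + d \<notin> S\<close> \<open>x \<in> S\<close> c2 by simp
      qed auto
    qed
    also have "\<dots> = 0"
    proof -
      have "(\<integral>x. indicator S (x + d) \<partial>lborel) = (\<integral>x. (indicator S x :: real) \<partial>lborel)"
        by (rule mpres_integral[OF mpres_add]) simp
      then show ?thesis using Bochner_Integration.integral_diff[OF iSd iS]
        by (simp only: integral_mult_left_zero diff_self mult_zero_left)
    qed
    finally have le: "(\<integral>x. indicator S (x + d) * F x \<partial>lborel) \<le> (\<integral>x. indicator S x * F x \<partial>lborel)"
      using bF[OF iS] bF[OF iSd] by (simp add: left_diff_distrib)
    have nn: "(\<integral>\<^sup>+x. indicator (P A) (x + z, s) * ennreal (F x) \<partial>lborel) = ennreal (\<integral>x. indicator S (x + z) * F x \<partial>lborel)"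
      if "integrable lborel (\<lambda>x. indicator S (x + z) :: real)" for z
      using F(2)
      by (subst nn_integral_eq_integral[OF bF[OF that], symmetric])
         (auto simp: S_def indicator_def intro!: nn_integral_cong)
    show ?thesis using nn[of d] nn[of 0] iSd iS le by (simp add: ennreal_leI)
  qed
  have "ennreal (ip (\<lambda>x. part A (x + d)) F) \<le> ennreal (ip (\<lambda>x. part A (x + 0)) F)"
    unfolding rep by (intro nn_integral_mono lev)
  moreover have "0 \<le> ip (part A) F" unfolding ip_def using F(2) part_nonneg by simp
  ultimately show ?thesis by simp
qed

text \<open>For levels \<open>s\<close> and \<open>t\<close> the superlevel sets are nested. If
  \<open>x + d\<close> belongs to one part and \<open>x\<close> to the other, both points lie in the
  same run for the lower of the two levels, so at this level the part contains both. Hence the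
  pairing counts such a pair also without the shift.\<close>

lemma ip_shift_parts:
  assumes A[measurable]: "A \<in> sets borel" and B[measurable]: "B \<in> sets borel"
  shows "ip (\<lambda>x. part A (x + d)) (part B) \<le> ip (part A) (part B)"
proof -
  have rep: "ennreal (ip (\<lambda>x. part A (x + z)) (part B)) =
      (\<integral>\<^sup>+s. (\<integral>\<^sup>+t. (\<integral>\<^sup>+x. indicator (P A) (x + z, s) * indicator (P B) (x, t) \<partial>lborel) \<partial>lborel) \<partial>lborel)" for z
  proof -
    have "nice (\<lambda>x. part A (x + z))" by (rule nice_mpres[OF nice_part[OF A] mpres_add])
    then have "ennreal (ip (\<lambda>x. part A (x + z)) (part B)) =
        (\<integral>\<^sup>+x. (\<integral>\<^sup>+s. indicator (P A) (x + z, s) * (\<integral>\<^sup>+t. indicator (P B) (x, t) \<partial>lborel) \<partial>lborel) \<partial>lborel)"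
      using nice_part[OF B] part_nonneg by (simp add: nn_ip part_ennreal nn_integral_multc)
    also have "\<dots> = (\<integral>\<^sup>+x. (\<integral>\<^sup>+s. (\<integral>\<^sup>+t. indicator (P A) (x + z, s) * indicator (P B) (x, t) \<partial>lborel) \<partial>lborel) \<partial>lborel)"
      by (simp add: nn_integral_cmult)
    also have "\<dots> = (\<integral>\<^sup>+s. (\<integral>\<^sup>+x. (\<integral>\<^sup>+t. indicator (P A) (x + z, s) * indicator (P B) (x, t) \<partial>lborel) \<partial>lborel) \<partial>lborel)"
      by (rule lborel_pair.Fubini') simp
    also have "\<dots> = (\<integral>\<^sup>+s. (\<integral>\<^sup>+t. (\<integral>\<^sup>+x. indicator (P A) (x + z, s) * indicator (P B) (x, t) \<partial>lborel) \<partial>lborel) \<partial>lborel)"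
      by (intro nn_integral_cong lborel_pair.Fubini') simp
    finally show ?thesis .
  qed
  have lev: "(\<integral>\<^sup>+x. indicator (P A) (x + d, s) * indicator (P B) (x, t) \<partial>lborel) \<le> (\<integral>\<^sup>+x. indicator (P A) (x + 0, s) * indicator (P B) (x, t) \<partial>lborel)" for s t
  proof (cases "s \<le> t")
    case True
    show ?thesis
    proof (intro nn_integral_mono)
      fix x
      have "(x, s) \<in> P A" if "(x + d, s) \<in> P A" "(x, t) \<in> P B"
        using P_shift[of s x A] that True by (auto simp: P_def)
      then show "indicator (P A) (x + d, s) * indicator (P B) (x, t) \<le> (indicator (P A) (x + 0, s) * indicator (P B) (x, t) :: ennreal)"
        by (auto simp: indicator_def)
    qed
  next
    case False
    have "(\<integral>\<^sup>+x. indicator (P A) (x + d, s) * indicator (P B) (x, t) \<partial>lborel) \<le> (\<integral>\<^sup>+x. indicator (P A) (x + d, s) * indicator (P B) (x + d, t) \<partial>lborel)"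
    proof (intro nn_integral_mono)
      fix x
      have "(x + d, t) \<in> P B" if "(x + d, s) \<in> P A" "(x, t) \<in> P B"
      proof -
        have "0 < t" "t < v x" "t < v (x + d)" using that False by (auto simp: P_def)
        then show ?thesis using P_shift[of t x B] that by blast
      qed
      then show "indicator (P A) (x + d, s) * indicator (P B) (x, t) \<le> (indicator (P A) (x + d, s) * indicator (P B) (x + d, t) :: ennreal)"
        by (auto simp: indicator_def)
    qed
    also have "\<dots> = (\<integral>\<^sup>+x. indicator (P A) (x, s) * indicator (P B) (x, t) \<partial>lborel)"
      by (rule mpres_nn_integral[OF mpres_add, of "\<lambda>x. indicator (P A) (x, s) * indicator (P B) (x, t)"]) simp
    finally show ?thesis by simp
  qed
  have "ennreal (ip (\<lambda>x. part A (x + d)) (part B)) \<le> ennreal (ip (\<lambda>x. part A (x + 0)) (part B))"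
    unfolding rep by (intro nn_integral_mono lev)
  moreover have "0 \<le> ip (part A) (part B)" unfolding ip_def using part_nonneg by simp
  ultimately show ?thesis by simp
qed

text \<open>A run of \<open>n + 1\<close> points is represented by its lowest one, so that integrals
  over level sets become integrals over representatives.\<close>

definition run :: "nat \<Rightarrow> real \<Rightarrow> real set \<Rightarrow> 'a set" where
  "run n s A = {x. v (x - d) \<le> s \<and> (\<forall>i\<le>n. s < v (x + real i *\<^sub>R d)) \<and> v (x + real (Suc n) *\<^sub>R d) \<le> s
     \<and> x \<bullet> e + real n * h / 2 \<in> A}"

lemma run_measurable[measurable]: assumes A: "A \<in> sets borel" shows "run n s A \<in> sets borel"
proof -
  have "run n s A = (\<lambda>x. v (x - d)) -` {..s} \<inter> (\<Inter>i\<in>{..n}. (\<lambda>x. v (x + real i *\<^sub>R d)) -` {s<..})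
      \<inter> (\<lambda>x. v (x + real (Suc n) *\<^sub>R d)) -` {..s} \<inter> (\<lambda>x. x \<bullet> e + real n * h / 2) -` A"
    by (auto simp: run_def)
  also have "\<dots> \<in> sets borel"
    by (intro sets.Int sets.finite_INT measurable_sets_borel[OF _ A]
        measurable_sets_borel[of _ borel "{..s}"] measurable_sets_borel[of _ borel "{s<..}"]) auto
  finally show ?thesis .
qed

lemma run_unique:
  assumes s: "0 < s" and r: "z - real i *\<^sub>R d \<in> run n s A" and i: "i \<le> n"
  shows "dn z s = i" "up z s = n - i" "s < v z" "cen z s \<in> A"
proof -
  let ?x = "z - real i *\<^sub>R d"
  have in1: "s < v (?x + real k *\<^sub>R d)" if "k \<le> n" for k using r that by (auto simp: run_def)
  show vz: "s < v z" using in1[OF i] by simp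
  show dn: "dn z s = i"
    unfolding dn_def
  proof (rule Least_equality)
    have "z - real (Suc i) *\<^sub>R d = ?x - d" by (simp add: algebra_simps)
    then show "v (z - real (Suc i) *\<^sub>R d) \<le> s" using r unfolding run_def by (simp only: mem_Collect_eq)
    fix k assume k: "v (z - real (Suc k) *\<^sub>R d) \<le> s"
    show "i \<le> k"
    proof (rule ccontr)
      assume "\<not> i \<le> k"
      then have "z - real (Suc k) *\<^sub>R d = ?x + real (i - Suc k) *\<^sub>R d"
        by (simp add: of_nat_diff algebra_simps)
      moreover have "s < v (?x + real (i - Suc k) *\<^sub>R d)" using i by (intro in1) simp
      ultimately show False using k by (metis not_le)
    qed
  qed
  show up: "up z s = n - i"
    unfolding up_def
  proof (rule Least_equality)
    have "z + real (Suc (n - i)) *\<^sub>R d = ?x + real (Suc n) *\<^sub>R d" using i by (simp add: of_nat_diff algebra_simps)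
    then show "v (z + real (Suc (n - i)) *\<^sub>R d) \<le> s" using r unfolding run_def by (simp only: mem_Collect_eq)
    fix k assume k: "v (z + real (Suc k) *\<^sub>R d) \<le> s"
    show "n - i \<le> k"
    proof (rule ccontr)
      assume "\<not> n - i \<le> k"
      moreover have "z + real (Suc k) *\<^sub>R d = ?x + real (i + Suc k) *\<^sub>R d"
        by (simp add: algebra_simps)
      moreover have "s < v (?x + real (i + Suc k) *\<^sub>R d)" using \<open>\<not> n - i \<le> k\<close> by (intro in1) simp
      ultimately show False using k by (metis not_le)
    qed
  qed
  have "cen z s = ?x \<bullet> e + real n * h / 2"
    using i by (simp add: cen_def dn up inner_diff_left de of_nat_diff field_simps)
  then show "cen z s \<in> A" using r by (simp add: run_def)
qed

lemma run_exists:
  assumes s: "0 < s" and z: "s < v z" and c: "cen z s \<in> A"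
  shows "z - real (dn z s) *\<^sub>R d \<in> run (dn z s + up z s) s A"
proof -
  let ?k = "dn z s" and ?l = "up z s"
  let ?x = "z - real ?k *\<^sub>R d"
  have 1: "v (z - real (Suc ?k) *\<^sub>R d) \<le> s" unfolding dn_def by (rule LeastI_ex[OF ex_dn[OF s]])
  have 2: "v (z + real (Suc ?l) *\<^sub>R d) \<le> s" unfolding up_def by (rule LeastI_ex[OF ex_up[OF s]])
  have 3: "s < v (z - real (Suc j) *\<^sub>R d)" if "j < ?k" for j
    using not_less_Least[of j] that unfolding dn_def by (metis not_le)
  have 4: "s < v (z + real (Suc j) *\<^sub>R d)" if "j < ?l" for j
    using not_less_Least[of j] that unfolding up_def by (metis not_le)
  have 5: "s < v (?x + real i *\<^sub>R d)" if "i \<le> ?k + ?l" for i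
  proof -
    consider "i < ?k" | "i = ?k" | "i > ?k" by linarith
    then show ?thesis
    proof cases
      case 1
      then have "?x + real i *\<^sub>R d = z - real (Suc (?k - i - 1)) *\<^sub>R d" by (simp add: of_nat_diff algebra_simps)
      show ?thesis unfolding \<open>?x + real i *\<^sub>R d = _\<close> by (rule 3) (use 1 in simp)
    next
      case 2 then show ?thesis using z by simp
    next
      case 3
      then have "?x + real i *\<^sub>R d = z + real (Suc (i - ?k - 1)) *\<^sub>R d" by (simp add: of_nat_diff algebra_simps)
      show ?thesis unfolding \<open>?x + real i *\<^sub>R d = _\<close> by (rule 4) (use 3 that in simp)
    qed
  qed
  have 6: "?x - d = z - real (Suc ?k) *\<^sub>R d" "?x + real (Suc (?k + ?l)) *\<^sub>R d = z + real (Suc ?l) *\<^sub>R d"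
    by (simp_all add: algebra_simps)
  have "?x \<bullet> e + real (?k + ?l) * h / 2 = cen z s" by (simp add: cen_def inner_diff_left de field_simps)
  then show ?thesis unfolding run_def mem_Collect_eq 6 using 1 2 5 c by simp
qed

lemma run_rep_point:
  assumes s: "0 < s"
  shows "(indicator (P A) (z, s) :: ennreal) = (\<Sum>n. \<Sum>i\<le>n. indicator (run n s A) (z - real i *\<^sub>R d))"
proof (cases "(z, s) \<in> P A")
  case True
  then have z: "s < v z" "cen z s \<in> A" by (auto simp: P_def)
  let ?k = "dn z s" and ?n = "dn z s + up z s"
  have r: "z - real i *\<^sub>R d \<in> run n s A \<longleftrightarrow> n = ?n \<and> i = ?k" if "i \<le> n" for n i
    using run_unique(1,2)[OF s _ that, of z A] run_exists[OF s z] that by auto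
  have "(\<Sum>i\<le>n. indicator (run n s A) (z - real i *\<^sub>R d)) = (if n = ?n then 1 else 0 :: ennreal)" for n
  proof (cases "n = ?n")
    case True
    have "(\<Sum>i\<le>n. indicator (run n s A) (z - real i *\<^sub>R d)) = (\<Sum>i\<le>n. if i = ?k then 1 else 0 :: ennreal)"
      by (intro sum.cong refl) (use r True in \<open>auto simp: indicator_def\<close>)
    also have "\<dots> = 1" using True by simp
    finally show ?thesis using True by simp
  next
    case False
    then show ?thesis using r by (auto simp: indicator_def intro!: sum.neutral)
  qed
  then have "(\<Sum>n. \<Sum>i\<le>n. indicator (run n s A) (z - real i *\<^sub>R d)) = (\<Sum>n. if n = ?n then 1 else 0 :: ennreal)" by simp
  also have "\<dots> = 1" by (subst suminf_finite[of "{?n}"]) auto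
  finally show ?thesis using True by simp
next
  case False
  have "z - real i *\<^sub>R d \<notin> run n s A" if "i \<le> n" for n i
    using run_unique(3,4)[OF s _ that, of z A] False s by (auto simp: P_def)
  then have "(\<Sum>i\<le>n. indicator (run n s A) (z - real i *\<^sub>R d)) = (0::ennreal)" for n
    by (intro sum.neutral) auto
  then show ?thesis using False by simp
qed

text \<open>Every point of the level set belongs to exactly one run and has exactly one position in
  it. Summation over run lengths and positions thus decomposes the integral.\<close>

lemma run_rep:
  assumes s: "0 < s" and A[measurable]: "A \<in> sets borel" and F[measurable]: "F \<in> borel_measurable borel"
  shows "(\<integral>\<^sup>+x. indicator (P A) (x, s) * F x \<partial>lborel) =
    (\<Sum>n. \<integral>\<^sup>+x. indicator (run n s A) x * (\<Sum>i\<le>n. F (x + real i *\<^sub>R d)) \<partial>lborel)"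
proof -
  let ?f = "\<lambda>n i x. indicator (run n s A) (x - real i *\<^sub>R d) * F x"
  have r: "run n s A \<in> sets borel" for n by (rule run_measurable[OF A])
  have m1: "(\<lambda>x. indicator (run n s A) x :: ennreal) \<in> borel_measurable borel" for n
    using r by (rule borel_measurable_indicator)
  have m2: "?f n i \<in> borel_measurable borel" for n i
    by (intro borel_measurable_times_ennreal F measurable_compose[OF _ m1]) simp
  have m3: "(\<lambda>x. \<Sum>i\<le>n. ?f n i x) \<in> borel_measurable borel" for n
    using m2 by (intro borel_measurable_sum)
  have m4: "(\<lambda>x. indicator (run n s A) x * F (x + real i *\<^sub>R d)) \<in> borel_measurable borel" for n i
    by (intro borel_measurable_times_ennreal m1 measurable_compose[OF _ F]) simp
  have "(\<integral>\<^sup>+x. indicator (P A) (x, s) * F x \<partial>lborel) = (\<integral>\<^sup>+x. (\<Sum>n. \<Sum>i\<le>n. ?f n i x) \<partial>lborel)"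
    unfolding run_rep_point[OF s] by (simp only: ennreal_suminf_multc sum_distrib_right[symmetric])
  also have "\<dots> = (\<Sum>n. \<integral>\<^sup>+x. (\<Sum>i\<le>n. ?f n i x) \<partial>lborel)"
    by (rule nn_integral_suminf) (simp only: measurable_lborel2 m3)
  also have "\<dots> = (\<Sum>n. \<Sum>i\<le>n. \<integral>\<^sup>+x. ?f n i x \<partial>lborel)"
    by (intro suminf_cong nn_integral_sum) (simp only: measurable_lborel2 m2)
  also have "\<dots> = (\<Sum>n. \<Sum>i\<le>n. \<integral>\<^sup>+x. indicator (run n s A) x * F (x + real i *\<^sub>R d) \<partial>lborel)"
  proof (intro suminf_cong sum.cong refl)
    fix n i
    show "(\<integral>\<^sup>+x. ?f n i x \<partial>lborel) = (\<integral>\<^sup>+x. indicator (run n s A) x * F (x + real i *\<^sub>R d) \<partial>lborel)"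
      using mpres_nn_integral[OF mpres_add[of "real i *\<^sub>R d"] m2[of n i]] by simp
  qed
  also have "\<dots> = (\<Sum>n. \<integral>\<^sup>+x. (\<Sum>i\<le>n. indicator (run n s A) x * F (x + real i *\<^sub>R d)) \<partial>lborel)"
    by (intro suminf_cong nn_integral_sum[symmetric]) (simp only: measurable_lborel2 m4)
  finally show ?thesis by (simp only: sum_distrib_left)
qed

end

section \<open>Double sums over pairs of runs\<close>

lemma double_sum_shift:
  fixes V :: "int \<Rightarrow> real"
  shows "(\<Sum>i\<le>n. \<Sum>j\<le>n'. V (int i - 1 - int j)) - (\<Sum>i\<le>n. \<Sum>j\<le>n'. V (int i - int j))
    = (\<Sum>j\<le>n'. V (- 1 - int j) - V (int n - int n' + int j))"
proof -
  have tel: "(\<Sum>i\<le>n. V (int i - 1 - int j) - V (int i - int j)) = V (- 1 - int j) - V (int n - int j)" for j n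
    by (induction n) (simp_all add: algebra_simps)
  have rev: "(\<Sum>j\<le>n'. V (int n - int j)) = (\<Sum>j\<le>n'. V (int n - int n' + int j))"
  proof -
    have "(\<Sum>j<Suc n'. V (int n - int j)) = (\<Sum>j<Suc n'. V (int n - int n' + int (Suc n' - Suc j)))"
      by (intro sum.cong refl arg_cong[where f=V]) auto
    also have "\<dots> = (\<Sum>j<Suc n'. V (int n - int n' + int j))"
      by (rule sum.nat_diff_reindex)
    finally show ?thesis by (simp only: lessThan_Suc_atMost)
  qed
  have "(\<Sum>i\<le>n. \<Sum>j\<le>n'. V (int i - 1 - int j)) - (\<Sum>i\<le>n. \<Sum>j\<le>n'. V (int i - int j))
      = (\<Sum>i\<le>n. \<Sum>j\<le>n'. V (int i - 1 - int j) - V (int i - int j))"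
    by (simp add: sum_subtractf)
  also have "\<dots> = (\<Sum>j\<le>n'. \<Sum>i\<le>n. V (int i - 1 - int j) - V (int i - int j))"
    by (rule sum.swap)
  also have "\<dots> = (\<Sum>j\<le>n'. V (- 1 - int j)) - (\<Sum>j\<le>n'. V (int n - int j))"
    unfolding tel by (rule sum_subtractf)
  finally show ?thesis by (simp add: rev sum_subtractf)
qed

text \<open>Telescoping leaves two extreme rows. If the second run is longer, their first
  \<open>n' - n\<close> entries are the same values in opposite order and cancel; otherwise the
  truncated difference is 0 and there are no such entries. The remaining ones are compared term by
  term.\<close>

lemma double_sum_shift_ge:
  fixes V :: "int \<Rightarrow> real"
  assumes nn: "\<And>j. n' - n \<le> j \<Longrightarrow> V (int n - int n' + int j) \<le> V (- 1 - int j)"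
    and J: "J \<subseteq> {n' - n..n'}" and c: "\<And>j. j \<in> J \<Longrightarrow> V (int n - int n' + int j) + c \<le> V (- 1 - int j)"
  shows "(\<Sum>i\<le>n. \<Sum>j\<le>n'. V (int i - int j)) + c * card J \<le> (\<Sum>i\<le>n. \<Sum>j\<le>n'. V (int i - 1 - int j))"
proof -
  let ?w = "\<lambda>j. V (- 1 - int j) - V (int n - int n' + int j)"
  let ?k = "n' - n"
  have z: "(\<Sum>j<?k. ?w j) = 0"
  proof (cases "n \<le> n'")
    case True
    have "(\<Sum>j<?k. V (- 1 - int j)) = (\<Sum>j<?k. V (int n - int n' + int (?k - Suc j)))"
      using True by (intro sum.cong refl arg_cong[where f=V]) (auto simp: of_nat_diff)
    also have "\<dots> = (\<Sum>j<?k. V (int n - int n' + int j))" by (rule sum.nat_diff_reindex)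
    finally show ?thesis by (simp add: sum_subtractf)
  qed simp
  have fJ: "finite J" using J finite_subset by blast
  have "c * card J = (\<Sum>j\<in>J. c)" by simp
  also have "\<dots> \<le> (\<Sum>j\<in>J. ?w j)" using c by (intro sum_mono) (simp add: le_diff_eq add.commute)
  also have "\<dots> \<le> (\<Sum>j\<in>{?k..n'}. ?w j)" using J nn by (intro sum_mono2) auto
  also have "\<dots> = (\<Sum>j<?k. ?w j) + (\<Sum>j\<in>{?k..n'}. ?w j)" by (simp add: z)
  also have "\<dots> = (\<Sum>j\<in>{..<?k} \<union> {?k..n'}. ?w j)" by (rule sum.union_disjoint[symmetric]) auto
  also have "{..<?k} \<union> {?k..n'} = {..n'}" by auto
  finally show ?thesis using double_sum_shift[of V n' n] by simp
qed

lemma norm_add_unit: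
  fixes e :: "'a::euclidean_space"
  assumes "norm e = 1"
  shows "(norm (z + c *\<^sub>R e))\<^sup>2 = (norm z)\<^sup>2 + 2 * c * (z \<bullet> e) + c\<^sup>2"
  using norm_sq_diff_unit[OF assms, of z "- c"] by simp

text \<open>Translation along \<open>e\<close> does not change the component orthogonal to
  \<open>e\<close>, which is less than \<open>\<delta>\<close>. With the bound on the other
  component Pythagoras gives \<open>sqrt 2 * \<delta>\<close>, rounded up here.\<close>

lemma near_translate:
  fixes e X Z p q :: "'a::euclidean_space"
  assumes e: "norm e = 1" and q: "q \<in> ball X \<delta>" and p: "p = q + a *\<^sub>R e" and Z: "Z = X + b *\<^sub>R e"
    and c: "\<bar>(p - Z) \<bullet> e\<bar> \<le> \<delta>"
  shows "p \<in> ball Z (2 * \<delta>)"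
proof -
  have ee: "e \<bullet> e = 1" using e by (simp add: dot_square_norm)
  define r where "r = q - X"
  have r: "norm r < \<delta>" using q by (simp add: r_def dist_norm norm_minus_commute)
  have pz: "p - Z = r + (a - b) *\<^sub>R e" by (simp add: p Z r_def algebra_simps)
  have A: "(p - Z) \<bullet> e = r \<bullet> e + (a - b)" by (simp add: pz inner_add_left ee)
  have B: "(norm (p - Z))\<^sup>2 = (norm r)\<^sup>2 + 2 * (a - b) * (r \<bullet> e) + (a - b)\<^sup>2"
    unfolding pz by (rule norm_add_unit[OF e])
  have "(norm (p - Z))\<^sup>2 = (norm r)\<^sup>2 - (r \<bullet> e)\<^sup>2 + ((p - Z) \<bullet> e)\<^sup>2"
    unfolding A B by (simp add: power2_eq_square algebra_simps)
  also have "\<dots> \<le> (norm r)\<^sup>2 + ((p - Z) \<bullet> e)\<^sup>2" by simp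
  also have "\<dots> < \<delta>\<^sup>2 + \<delta>\<^sup>2"
    using r c by (intro add_less_le_mono power_strict_mono) (auto simp: abs_le_square_iff[symmetric] intro: order_trans[OF _ abs_ge_self])
  also have "\<dots> \<le> (2 * \<delta>)\<^sup>2" by (simp add: power2_eq_square)
  finally have "norm (p - Z) < 2 * \<delta>"
    using le_less_trans[OF norm_ge_zero r] by (intro power2_less_imp_less[of _ "2 * \<delta>"]) simp_all
  then show ?thesis by (simp add: dist_norm norm_minus_commute)
qed

context fiber
begin

text \<open>In each remaining comparison the difference of squared norms is a nonnegative multiple
  of twice the distance of the centres minus \<open>h\<close>. So a step towards the other run does
  not overshoot as long as the centres are at least \<open>h / 2\<close> apart. Runs with centres
  within \<open>h / 2\<close> of a plane need separate treatment for this reason.\<close>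

lemma run_pair_sum:
  assumes g: "RD g" and D: "h / 2 \<le> (x \<bullet> e + real n * h / 2) - (y \<bullet> e + real n' * h / 2)"
    and J: "J \<subseteq> {n' - n..n'}"
    and c: "\<And>j. j \<in> J \<Longrightarrow> g ((x - y) + (real n - real n' + real j) *\<^sub>R d) + c \<le> g ((x - y) + (- 1 - real j) *\<^sub>R d)"
  shows "(\<Sum>i\<le>n. \<Sum>j\<le>n'. g ((x + real i *\<^sub>R d) - (y + real j *\<^sub>R d))) + c * card J
    \<le> (\<Sum>i\<le>n. \<Sum>j\<le>n'. g ((x + real i *\<^sub>R d - d) - (y + real j *\<^sub>R d)))"
proof -
  define V where "V a = g ((x - y) + of_int a *\<^sub>R d)" for a :: int
  have nn: "V (int n - int n' + int j) \<le> V (- 1 - int j)" if "n' - n \<le> j" for j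
  proof -
    define Z where "Z = (x - y) \<bullet> e"
    define a b where "a = (- 1 - real j) * h" and "b = (real n - real n' + real j) * h"
    have "b - a = (real n - real n' + 2 * real j + 1) * h" by (simp add: a_def b_def algebra_simps)
    moreover have "real n - real n' + 2 * real j + 1 \<ge> 0" using that by linarith
    ultimately have 1: "b - a \<ge> 0" using h by simp
    have 2: "2 * Z + (a + b) \<ge> 0" using D by (simp add: Z_def a_def b_def inner_diff_left algebra_simps)
    have "(norm ((x - y) + b *\<^sub>R e))\<^sup>2 - (norm ((x - y) + a *\<^sub>R e))\<^sup>2 = (b - a) * (2 * Z + (a + b))"
      unfolding norm_add_unit[OF e] Z_def by (simp add: power2_eq_square algebra_simps)
    also have "\<dots> \<ge> 0" using 1 2 by (rule mult_nonneg_nonneg)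
    finally have "(norm ((x - y) + a *\<^sub>R e))\<^sup>2 \<le> (norm ((x - y) + b *\<^sub>R e))\<^sup>2" by linarith
    then have "norm ((x - y) + a *\<^sub>R e) \<le> norm ((x - y) + b *\<^sub>R e)" by (rule power2_le_imp_le[OF _ norm_ge_zero])
    then show ?thesis unfolding V_def by (intro RD_D[OF g]) (simp add: a_def b_def d_def)
  qed
  have c': "V (int n - int n' + int j) + c \<le> V (- 1 - int j)" if "j \<in> J" for j
    using c[OF that] by (simp add: V_def)
  have eq1: "(x + real i *\<^sub>R d) - (y + real j *\<^sub>R d) = (x - y) + of_int (int i - int j) *\<^sub>R d" for i j
    by (simp add: algebra_simps)
  have eq2: "(x + real i *\<^sub>R d - d) - (y + real j *\<^sub>R d) = (x - y) + of_int (int i - 1 - int j) *\<^sub>R d" for i j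
    by (simp add: algebra_simps)
  show ?thesis using double_sum_shift_ge[OF nn J c'] unfolding eq1 eq2 V_def by simp
qed

section \<open>From pairs of runs to the quadratic form\<close>

lemma ip_conv_rep:
  assumes g: "rkernel g" and A[measurable]: "A \<in> sets borel" and B[measurable]: "B \<in> sets borel"
  shows "ennreal (ip (\<lambda>x. part A (x + z)) (conv g (part B))) =
    (\<integral>\<^sup>+s. \<integral>\<^sup>+t. \<integral>\<^sup>+x. indicator (P A) (x + z, s) * (\<integral>\<^sup>+y. indicator (P B) (y, t) * ennreal (g (x - y)) \<partial>lborel) \<partial>lborel \<partial>lborel \<partial>lborel)"
proof -
  note g' = kernelD[OF g]
  note [measurable] = bdm_meas[OF g'(4)]
  have nA: "nice (\<lambda>x. part A (x + z))" by (rule nice_mpres[OF nice_part[OF A] mpres_add])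
  have nB: "nice (part B)" by (rule nice_part[OF B])
  note [measurable] = nice_meas[OF nB]
  have cB: "nice (conv g (part B))" by (rule young(1)[OF g'(3) nB])
  have c0: "0 \<le> conv g (part B) x" for x by (rule conv_nonneg[OF g'(2) part_nonneg])
  let ?\<Phi> = "\<lambda>x t. (\<integral>\<^sup>+y. indicator (P B) (y, t) * ennreal (g (x - y)) \<partial>lborel)"
  have conv: "ennreal (conv g (part B) x) = (\<integral>\<^sup>+t. ?\<Phi> x t \<partial>lborel)" for x
  proof -
    have "ennreal (conv g (part B) x) = (\<integral>\<^sup>+y. ennreal (g (x - y) * part B y) \<partial>lborel)"
      unfolding conv_alt[OF bdm_meas[OF g'(4)] nice_meas[OF nB]]
      by (rule nn_integral_eq_integral[OF conv_alt_integrable[OF g'(3) nice_bdm[OF nB]], symmetric])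
         (simp add: g'(2) part_nonneg)
    also have "\<dots> = (\<integral>\<^sup>+y. (\<integral>\<^sup>+t. indicator (P B) (y, t) * ennreal (g (x - y)) \<partial>lborel) \<partial>lborel)"
      by (intro nn_integral_cong) (simp add: ennreal_mult g'(2) part_nonneg part_ennreal[OF B] nn_integral_cmult[symmetric] mult.commute)
    also have "\<dots> = (\<integral>\<^sup>+t. ?\<Phi> x t \<partial>lborel)"
      by (rule lborel_pair.Fubini') simp
    finally show ?thesis .
  qed
  have "ennreal (ip (\<lambda>x. part A (x + z)) (conv g (part B))) = (\<integral>\<^sup>+x. ennreal (part A (x + z)) * ennreal (conv g (part B) x) \<partial>lborel)"
    by (rule nn_ip[OF nA cB part_nonneg c0])
  also have "\<dots> = (\<integral>\<^sup>+x. (\<integral>\<^sup>+s. indicator (P A) (x + z, s) * (\<integral>\<^sup>+t. ?\<Phi> x t \<partial>lborel) \<partial>lborel) \<partial>lborel)"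
    by (intro nn_integral_cong) (simp add: conv part_ennreal[OF A] nn_integral_multc)
  also have "\<dots> = (\<integral>\<^sup>+x. (\<integral>\<^sup>+s. (\<integral>\<^sup>+t. indicator (P A) (x + z, s) * ?\<Phi> x t \<partial>lborel) \<partial>lborel) \<partial>lborel)"
    by (intro nn_integral_cong nn_integral_cmult[symmetric]) simp
  also have "\<dots> = (\<integral>\<^sup>+s. (\<integral>\<^sup>+x. (\<integral>\<^sup>+t. indicator (P A) (x + z, s) * ?\<Phi> x t \<partial>lborel) \<partial>lborel) \<partial>lborel)"
    by (rule lborel_pair.Fubini') simp
  also have "\<dots> = (\<integral>\<^sup>+s. (\<integral>\<^sup>+t. (\<integral>\<^sup>+x. indicator (P A) (x + z, s) * ?\<Phi> x t \<partial>lborel) \<partial>lborel) \<partial>lborel)"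
    by (intro nn_integral_cong lborel_pair.Fubini') simp
  finally show ?thesis .
qed

text \<open>Both level sets are decomposed into runs and the inequality is integrated over all
  pairs. The weights \<open>\<xi>\<close> and \<open>\<zeta>\<close> count chosen points of the
  runs, so that the extra gain factors into two integrals over the level sets.\<close>

lemma level_gain:
  assumes g: "rkernel g" and A[measurable]: "A \<in> sets borel" and B[measurable]: "B \<in> sets borel"
    and s: "0 < s" and t: "0 < t" and C: "0 \<le> C"
    and \<xi>[measurable]: "\<xi> \<in> borel_measurable borel" and \<xi>0: "\<And>x. 0 \<le> \<xi> x"
    and \<zeta>[measurable]: "\<zeta> \<in> borel_measurable borel" and \<zeta>0: "\<And>x. 0 \<le> \<zeta> x"
    and H: "\<And>n n' x y. x \<in> run n s A \<Longrightarrow> y \<in> run n' t B \<Longrightarrow>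
      (\<Sum>i\<le>n. \<Sum>j\<le>n'. g ((x + real i *\<^sub>R d) - (y + real j *\<^sub>R d)))
        + C * (\<Sum>i\<le>n. \<xi> (x + real i *\<^sub>R d)) * (\<Sum>j\<le>n'. \<zeta> (y + real j *\<^sub>R d))
      \<le> (\<Sum>i\<le>n. \<Sum>j\<le>n'. g ((x + real i *\<^sub>R d - d) - (y + real j *\<^sub>R d)))"
  shows "(\<integral>\<^sup>+x. indicator (P A) (x, s) * (\<integral>\<^sup>+y. indicator (P B) (y, t) * ennreal (g (x - y)) \<partial>lborel) \<partial>lborel)
      + ennreal C * (\<integral>\<^sup>+x. indicator (P A) (x, s) * ennreal (\<xi> x) \<partial>lborel) * (\<integral>\<^sup>+y. indicator (P B) (y, t) * ennreal (\<zeta> y) \<partial>lborel)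
    \<le> (\<integral>\<^sup>+x. indicator (P A) (x + d, s) * (\<integral>\<^sup>+y. indicator (P B) (y, t) * ennreal (g (x - y)) \<partial>lborel) \<partial>lborel)"
proof -
  note g' = kernelD[OF g]
  note [measurable] = bdm_meas[OF g'(4)]
  define \<Phi> where "\<Phi> x = (\<integral>\<^sup>+y. indicator (P B) (y, t) * ennreal (g (x - y)) \<partial>lborel)" for x
  define Z where "Z = (\<integral>\<^sup>+y. indicator (P B) (y, t) * ennreal (\<zeta> y) \<partial>lborel)"
  have [measurable]: "\<Phi> \<in> borel_measurable borel" unfolding \<Phi>_def by measurable
  have [measurable]: "(\<lambda>x. indicator (P A) (x, s) :: ennreal) \<in> borel_measurable borel"
    "(\<lambda>x. indicator (P B) (x, t) :: ennreal) \<in> borel_measurable borel" by measurable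
  have pt: "(\<Sum>i\<le>n. \<Phi> (x + real i *\<^sub>R d) + ennreal C * ennreal (\<xi> (x + real i *\<^sub>R d)) * Z) \<le> (\<Sum>i\<le>n. \<Phi> (x + real i *\<^sub>R d - d))"
    if x: "x \<in> run n s A" for n x
  proof -
    define F1 where "F1 y = (\<Sum>i\<le>n. g (x + real i *\<^sub>R d - y) + C * \<xi> (x + real i *\<^sub>R d) * \<zeta> y)" for y
    define F2 where "F2 y = (\<Sum>i\<le>n. g (x + real i *\<^sub>R d - d - y))" for y
    have [measurable]: "F1 \<in> borel_measurable borel" "F2 \<in> borel_measurable borel" unfolding F1_def F2_def by measurable
    have F0: "0 \<le> F1 y" "0 \<le> F2 y" for y unfolding F1_def F2_def using g'(2) C \<xi>0 \<zeta>0 by (auto intro!: sum_nonneg add_nonneg_nonneg mult_nonneg_nonneg)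
    have "(\<Sum>i\<le>n. \<Phi> (x + real i *\<^sub>R d) + ennreal C * ennreal (\<xi> (x + real i *\<^sub>R d)) * Z)
        = (\<Sum>i\<le>n. (\<integral>\<^sup>+y. indicator (P B) (y, t) * ennreal (g (x + real i *\<^sub>R d - y) + C * \<xi> (x + real i *\<^sub>R d) * \<zeta> y) \<partial>lborel))"
    proof (intro sum.cong refl)
      fix i
      have "\<Phi> (x + real i *\<^sub>R d) + ennreal C * ennreal (\<xi> (x + real i *\<^sub>R d)) * Z
        = (\<integral>\<^sup>+y. indicator (P B) (y, t) * ennreal (g (x + real i *\<^sub>R d - y)) \<partial>lborel)
          + (\<integral>\<^sup>+y. (ennreal C * ennreal (\<xi> (x + real i *\<^sub>R d))) * (indicator (P B) (y, t) * ennreal (\<zeta> y)) \<partial>lborel)"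
        unfolding \<Phi>_def Z_def by (subst nn_integral_cmult) simp_all
      also have "\<dots> = (\<integral>\<^sup>+y. indicator (P B) (y, t) * ennreal (g (x + real i *\<^sub>R d - y))
          + (ennreal C * ennreal (\<xi> (x + real i *\<^sub>R d))) * (indicator (P B) (y, t) * ennreal (\<zeta> y)) \<partial>lborel)"
        by (rule nn_integral_add[symmetric]) simp_all
      also have "\<dots> = (\<integral>\<^sup>+y. indicator (P B) (y, t) * ennreal (g (x + real i *\<^sub>R d - y) + C * \<xi> (x + real i *\<^sub>R d) * \<zeta> y) \<partial>lborel)"
        using g'(2) C \<xi>0 \<zeta>0 by (intro nn_integral_cong) (simp add: ennreal_mult indicator_def)
      finally show "\<Phi> (x + real i *\<^sub>R d) + ennreal C * ennreal (\<xi> (x + real i *\<^sub>R d)) * Z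
        = (\<integral>\<^sup>+y. indicator (P B) (y, t) * ennreal (g (x + real i *\<^sub>R d - y) + C * \<xi> (x + real i *\<^sub>R d) * \<zeta> y) \<partial>lborel)" .
    qed
    also have "\<dots> = (\<integral>\<^sup>+y. indicator (P B) (y, t) * ennreal (F1 y) \<partial>lborel)"
      unfolding F1_def using g'(2) C \<xi>0 \<zeta>0
      by (subst nn_integral_sum[symmetric]) (auto simp: sum_ennreal[symmetric] sum_distrib_left intro!: nn_integral_cong)
    also have "\<dots> = (\<Sum>n'. \<integral>\<^sup>+y. indicator (run n' t B) y * (\<Sum>j\<le>n'. ennreal (F1 (y + real j *\<^sub>R d))) \<partial>lborel)"
      by (rule run_rep[OF t B]) simp
    also have "\<dots> \<le> (\<Sum>n'. \<integral>\<^sup>+y. indicator (run n' t B) y * (\<Sum>j\<le>n'. ennreal (F2 (y + real j *\<^sub>R d))) \<partial>lborel)"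
    proof (intro suminf_le nn_integral_mono summableI)
      fix n' y
      show "indicator (run n' t B) y * (\<Sum>j\<le>n'. ennreal (F1 (y + real j *\<^sub>R d)))
          \<le> (indicator (run n' t B) y * (\<Sum>j\<le>n'. ennreal (F2 (y + real j *\<^sub>R d))) :: ennreal)"
      proof (cases "y \<in> run n' t B")
        case True
        have "(\<Sum>j\<le>n'. F1 (y + real j *\<^sub>R d)) = (\<Sum>i\<le>n. \<Sum>j\<le>n'. g ((x + real i *\<^sub>R d) - (y + real j *\<^sub>R d)))
            + C * (\<Sum>i\<le>n. \<xi> (x + real i *\<^sub>R d)) * (\<Sum>j\<le>n'. \<zeta> (y + real j *\<^sub>R d))"
        proof -
          have "(\<Sum>j\<le>n'. F1 (y + real j *\<^sub>R d)) = (\<Sum>j\<le>n'. \<Sum>i\<le>n. g ((x + real i *\<^sub>R d) - (y + real j *\<^sub>R d)))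
            + (\<Sum>j\<le>n'. C * (\<Sum>i\<le>n. \<xi> (x + real i *\<^sub>R d)) * \<zeta> (y + real j *\<^sub>R d))"
            unfolding F1_def by (simp only: sum.distrib sum_distrib_left sum_distrib_right)
          then show ?thesis by (simp only: sum.swap[of _ "{..n'}" "{..n}"] sum_distrib_left)
        qed
        also have "\<dots> \<le> (\<Sum>i\<le>n. \<Sum>j\<le>n'. g ((x + real i *\<^sub>R d - d) - (y + real j *\<^sub>R d)))" by (rule H[OF x True])
        also have "\<dots> = (\<Sum>j\<le>n'. F2 (y + real j *\<^sub>R d))" unfolding F2_def by (rule sum.swap)
        finally show ?thesis using F0 True by (simp add: sum_ennreal ennreal_leI)
      qed simp
    qed
    also have "\<dots> = (\<integral>\<^sup>+y. indicator (P B) (y, t) * ennreal (F2 y) \<partial>lborel)"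
      by (rule run_rep[OF t B, symmetric]) simp
    also have "\<dots> = (\<integral>\<^sup>+y. (\<Sum>i\<le>n. indicator (P B) (y, t) * ennreal (g (x + real i *\<^sub>R d - d - y))) \<partial>lborel)"
      by (intro nn_integral_cong) (simp add: F2_def sum_ennreal g'(2) flip: sum_distrib_left)
    also have "\<dots> = (\<Sum>i\<le>n. \<integral>\<^sup>+y. indicator (P B) (y, t) * ennreal (g (x + real i *\<^sub>R d - d - y)) \<partial>lborel)"
      by (rule nn_integral_sum) simp
    also have "\<dots> = (\<Sum>i\<le>n. \<Phi> (x + real i *\<^sub>R d - d))" by (simp only: \<Phi>_def)
    finally show ?thesis .
  qed
  have "(\<integral>\<^sup>+x. indicator (P A) (x, s) * \<Phi> x \<partial>lborel) + ennreal C * (\<integral>\<^sup>+x. indicator (P A) (x, s) * ennreal (\<xi> x) \<partial>lborel) * Z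
      = (\<integral>\<^sup>+x. indicator (P A) (x, s) * \<Phi> x \<partial>lborel) + (\<integral>\<^sup>+x. (ennreal C * Z) * (indicator (P A) (x, s) * ennreal (\<xi> x)) \<partial>lborel)"
    by (subst nn_integral_cmult) (simp_all add: mult_ac)
  also have "\<dots> = (\<integral>\<^sup>+x. indicator (P A) (x, s) * \<Phi> x + (ennreal C * Z) * (indicator (P A) (x, s) * ennreal (\<xi> x)) \<partial>lborel)"
    by (rule nn_integral_add[symmetric]) simp_all
  also have "\<dots> = (\<integral>\<^sup>+x. indicator (P A) (x, s) * (\<Phi> x + ennreal C * ennreal (\<xi> x) * Z) \<partial>lborel)"
    by (intro nn_integral_cong) (simp add: distrib_left mult_ac)
  also have "\<dots> = (\<Sum>n. \<integral>\<^sup>+x. indicator (run n s A) x * (\<Sum>i\<le>n. \<Phi> (x + real i *\<^sub>R d) + ennreal C * ennreal (\<xi> (x + real i *\<^sub>R d)) * Z) \<partial>lborel)"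
    by (rule run_rep[OF s A]) simp
  also have "\<dots> \<le> (\<Sum>n. \<integral>\<^sup>+x. indicator (run n s A) x * (\<Sum>i\<le>n. \<Phi> (x + real i *\<^sub>R d - d)) \<partial>lborel)"
    using pt by (intro suminf_le nn_integral_mono summableI) (auto simp: indicator_def)
  also have "\<dots> = (\<integral>\<^sup>+x. indicator (P A) (x, s) * \<Phi> (x - d) \<partial>lborel)"
    by (rule run_rep[OF s A, symmetric]) simp
  also have "\<dots> = (\<integral>\<^sup>+x. indicator (P A) (x + d, s) * \<Phi> x \<partial>lborel)"
    using mpres_nn_integral[OF mpres_add[of d], of "\<lambda>x. indicator (P A) (x, s) * \<Phi> (x - d)"] by simp
  finally show ?thesis unfolding \<Phi>_def Z_def .
qed

text \<open>With indicators of a ball and of an interval of levels as weights, integration over all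
  pairs of levels turns the extra gain into a product of two volumes. These lie inside the parts by
  the assumptions on the windows.\<close>

lemma gain:
  assumes g: "rkernel g" and A[measurable]: "A \<in> sets borel" and B[measurable]: "B \<in> sets borel" and C: "0 \<le> C"
    and W1: "\<And>s x. s \<in> {a1<..<b1} \<Longrightarrow> x \<in> ball X \<delta> \<Longrightarrow> (x, s) \<in> P A" "a1 \<le> b1"
    and W2: "\<And>s x. s \<in> {a2<..<b2} \<Longrightarrow> x \<in> ball Y \<delta> \<Longrightarrow> (x, s) \<in> P B" "a2 \<le> b2"
    and H: "\<And>s t n n' x y. 0 < s \<Longrightarrow> 0 < t \<Longrightarrow> x \<in> run n s A \<Longrightarrow> y \<in> run n' t B \<Longrightarrow>
      (\<Sum>i\<le>n. \<Sum>j\<le>n'. g ((x + real i *\<^sub>R d) - (y + real j *\<^sub>R d)))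
        + C * (\<Sum>i\<le>n. indicator {a1<..<b1} s * indicator (ball X \<delta>) (x + real i *\<^sub>R d))
            * (\<Sum>j\<le>n'. indicator {a2<..<b2} t * indicator (ball Y \<delta>) (y + real j *\<^sub>R d))
      \<le> (\<Sum>i\<le>n. \<Sum>j\<le>n'. g ((x + real i *\<^sub>R d - d) - (y + real j *\<^sub>R d)))"
  shows "ip (part A) (conv g (part B)) + C * ((b1 - a1) * measure lborel (ball X \<delta>)) * ((b2 - a2) * measure lborel (ball Y \<delta>))
     \<le> ip (\<lambda>x. part A (x + d)) (conv g (part B))"
proof -
  note g' = kernelD[OF g]
  note [measurable] = bdm_meas[OF g'(4)]
  let ?U = "\<lambda>z s t. (\<integral>\<^sup>+x. indicator (P A) (x + z, s) * (\<integral>\<^sup>+y. indicator (P B) (y, t) * ennreal (g (x - y)) \<partial>lborel) \<partial>lborel)"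
  let ?VX = "measure lborel (ball X \<delta>)" and ?VY = "measure lborel (ball Y \<delta>)"
  have emX: "emeasure lborel (ball X \<delta>) = ennreal ?VX" and emY: "emeasure lborel (ball Y \<delta>) = ennreal ?VY"
    using emeasure_lborel_ball_finite[of X \<delta>] emeasure_lborel_ball_finite[of Y \<delta>] by (simp_all add: emeasure_eq_ennreal_measure)
  have lev: "?U 0 s t + ennreal C * (indicator {a1<..<b1} s * ennreal ?VX) * (indicator {a2<..<b2} t * ennreal ?VY) \<le> ?U d s t" for s t
  proof (cases "0 < s \<and> 0 < t")
    case True
    have X: "(\<integral>\<^sup>+x. indicator (P A) (x, s) * ennreal (indicator {a1<..<b1} s * indicator (ball X \<delta>) x) \<partial>lborel) = indicator {a1<..<b1} s * ennreal ?VX"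
    proof (cases "s \<in> {a1<..<b1}")
      case True
      then have "(\<integral>\<^sup>+x. indicator (P A) (x, s) * ennreal (indicator {a1<..<b1} s * indicator (ball X \<delta>) x) \<partial>lborel) = (\<integral>\<^sup>+x. indicator (ball X \<delta>) x \<partial>lborel)"
        using W1(1)[OF True] by (intro nn_integral_cong) (auto simp: indicator_def)
      then show ?thesis using True by (simp add: emX)
    qed simp
    have Y: "(\<integral>\<^sup>+x. indicator (P B) (x, t) * ennreal (indicator {a2<..<b2} t * indicator (ball Y \<delta>) x) \<partial>lborel) = indicator {a2<..<b2} t * ennreal ?VY"
    proof (cases "t \<in> {a2<..<b2}")
      case True
      then have "(\<integral>\<^sup>+x. indicator (P B) (x, t) * ennreal (indicator {a2<..<b2} t * indicator (ball Y \<delta>) x) \<partial>lborel) = (\<integral>\<^sup>+x. indicator (ball Y \<delta>) x \<partial>lborel)"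
        using W2(1)[OF True] by (intro nn_integral_cong) (auto simp: indicator_def)
      then show ?thesis using True by (simp add: emY)
    qed simp
    have mb: "(\<lambda>x. c * indicator (ball z \<delta>) x :: real) \<in> borel_measurable borel" for c and z :: 'a
      by (intro borel_measurable_times borel_measurable_indicator) auto
    have "(\<integral>\<^sup>+x. indicator (P A) (x, s) * (\<integral>\<^sup>+y. indicator (P B) (y, t) * ennreal (g (x - y)) \<partial>lborel) \<partial>lborel)
      + ennreal C * (\<integral>\<^sup>+x. indicator (P A) (x, s) * ennreal (indicator {a1<..<b1} s * indicator (ball X \<delta>) x) \<partial>lborel)
        * (\<integral>\<^sup>+x. indicator (P B) (x, t) * ennreal (indicator {a2<..<b2} t * indicator (ball Y \<delta>) x) \<partial>lborel)
      \<le> ?U d s t"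
      by (rule level_gain[OF g A B _ _ C mb _ mb _ H]) (use True in auto)
    then show ?thesis unfolding X Y by simp
  next
    case False
    \<comment> \<open>A level in a window is positive, as the centre of a nonempty ball shows; if
      the ball is empty its measure is 0. In either case the extra term vanishes here.\<close>
    then have dj: "s \<notin> {a1<..<b1} \<or> t \<notin> {a2<..<b2} \<or> ?VX = 0 \<or> ?VY = 0"
    proof (cases "\<delta> > 0")
      case True
      have "s > 0" if "s \<in> {a1<..<b1}" using W1(1)[OF that, of X] True by (simp add: P_def)
      moreover have "t > 0" if "t \<in> {a2<..<b2}" using W2(1)[OF that, of Y] True by (simp add: P_def)
      ultimately show ?thesis using False by blast
    qed simp
    have z: "ennreal C * (indicator {a1<..<b1} s * ennreal ?VX) * (indicator {a2<..<b2} t * ennreal ?VY) = 0"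
      using dj by (elim disjE) simp_all
    have "?U 0 s t \<le> ?U d s t"
    proof -
      have "?U 0 s t = 0" using False by (auto simp: P_def indicator_def)
      then show ?thesis by simp
    qed
    then show ?thesis unfolding z by simp
  qed
  have cc: "(\<integral>\<^sup>+s. \<integral>\<^sup>+t. ennreal C * (indicator {a1<..<b1} s * ennreal ?VX) * (indicator {a2<..<b2} t * ennreal ?VY) \<partial>lborel \<partial>lborel)
     = ennreal (C * ((b1 - a1) * ?VX) * ((b2 - a2) * ?VY))"
  proof -
    have i: "(\<integral>\<^sup>+t. indicator {a<..<b} t * ennreal c \<partial>lborel) = ennreal ((b - a) * c)" if "a \<le> b" "0 \<le> c" for a b c :: real
      using that by (simp add: nn_integral_multc ennreal_mult)
    have "(\<integral>\<^sup>+s. \<integral>\<^sup>+t. ennreal C * (indicator {a1<..<b1} s * ennreal ?VX) * (indicator {a2<..<b2} t * ennreal ?VY) \<partial>lborel \<partial>lborel)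
      = (\<integral>\<^sup>+s. ennreal C * (indicator {a1<..<b1} s * ennreal ?VX) * ennreal ((b2 - a2) * ?VY) \<partial>lborel)"
      using W2(2) by (simp add: nn_integral_cmult i)
    also have "\<dots> = ennreal C * ennreal ((b1 - a1) * ?VX) * ennreal ((b2 - a2) * ?VY)"
      using W1(2) by (simp add: nn_integral_cmult nn_integral_multc ennreal_mult[symmetric])
    also have "\<dots> = ennreal (C * ((b1 - a1) * ?VX) * ((b2 - a2) * ?VY))"
      using C W1(2) W2(2) by (simp add: ennreal_mult)
    finally show ?thesis .
  qed
  have m[measurable]: "(\<lambda>(s, t). ?U z s t) \<in> borel_measurable (borel \<Otimes>\<^sub>M borel)" for z by measurable
  let ?W = "\<lambda>s t. ennreal C * (indicator {a1<..<b1} s * ennreal ?VX) * (indicator {a2<..<b2} t * ennreal ?VY)"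
  have c0: "0 \<le> conv g (part B) x" for x by (rule conv_nonneg[OF g'(2) part_nonneg])
  have nn0: "0 \<le> ip (part A) (conv g (part B))"
    unfolding ip_def using part_nonneg c0 by simp
  have k0: "0 \<le> C * ((b1 - a1) * ?VX) * ((b2 - a2) * ?VY)" using C W1(2) W2(2) by simp
  have "ennreal (ip (part A) (conv g (part B)) + C * ((b1 - a1) * ?VX) * ((b2 - a2) * ?VY))
     = (\<integral>\<^sup>+s. \<integral>\<^sup>+t. ?U 0 s t \<partial>lborel \<partial>lborel) + (\<integral>\<^sup>+s. \<integral>\<^sup>+t. ?W s t \<partial>lborel \<partial>lborel)"
    using ip_conv_rep[OF g A B, of 0] cc nn0 k0 by simp
  also have "\<dots> = (\<integral>\<^sup>+s. (\<integral>\<^sup>+t. ?U 0 s t \<partial>lborel) + (\<integral>\<^sup>+t. ?W s t \<partial>lborel) \<partial>lborel)"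
    by (rule nn_integral_add[symmetric]) measurable
  also have "\<dots> = (\<integral>\<^sup>+s. (\<integral>\<^sup>+t. ?U 0 s t + ?W s t \<partial>lborel) \<partial>lborel)"
    by (intro nn_integral_cong nn_integral_add[symmetric]) measurable
  also have "\<dots> \<le> (\<integral>\<^sup>+s. (\<integral>\<^sup>+t. ?U d s t \<partial>lborel) \<partial>lborel)"
    by (intro nn_integral_mono lev)
  also have "\<dots> = ennreal (ip (\<lambda>x. part A (x + d)) (conv g (part B)))"
    by (rule ip_conv_rep[OF g A B, symmetric])
  finally have le: "ennreal (ip (part A) (conv g (part B)) + C * ((b1 - a1) * ?VX) * ((b2 - a2) * ?VY)) \<le> ennreal (ip (\<lambda>x. part A (x + d)) (conv g (part B)))" .
  have "0 \<le> ip (\<lambda>x. part A (x + d)) (conv g (part B))"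
    unfolding ip_def using part_nonneg c0 by simp
  with le show ?thesis by simp
qed

end

section \<open>The first order estimate at one plane\<close>

text \<open>The shift is transferred from \<open>\<phi>\<close> to the kernel, whose increments are
  small in mean.\<close>

lemma nrm_conv_shift:
  assumes \<rho>: "integrable lborel \<rho>" and \<phi>: "nice \<phi>"
  shows "nrm (conv \<rho> (\<lambda>x. \<phi> (x + d) - \<phi> x)) \<le> (\<integral>x. \<bar>\<rho> (x + d) - \<rho> x\<bar> \<partial>lborel) * nrm \<phi>"
proof -
  have [measurable]: "\<rho> \<in> borel_measurable borel" "\<phi> \<in> borel_measurable borel" using \<rho> nice_meas[OF \<phi>] by auto
  have b: "bdm \<phi>" "bdm (\<lambda>x. \<phi> (x + d))" using nice_bdm[OF \<phi>] bdm_mpres[OF nice_bdm[OF \<phi>] mpres_add] by auto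
  have \<rho>d: "integrable lborel (\<lambda>x. \<rho> (x + d))" using \<rho> mpres_integrable[OF mpres_add, of \<rho> d] by auto
  have "conv \<rho> (\<lambda>x. \<phi> (x + d) - \<phi> x) x = conv (\<lambda>x. \<rho> (x + d) - \<rho> x) \<phi> x" for x
  proof -
    have "conv \<rho> (\<lambda>x. \<phi> (x + d)) x = conv (\<lambda>x. \<rho> (x + d)) \<phi> x"
      unfolding conv_def using mpres_integral[OF mpres_add, of "\<lambda>z. \<rho> z * \<phi> (x - z + d)" d] by (simp add: algebra_simps)
    then show ?thesis
      using conv_diff_right[OF \<rho> b(2,1)] conv_diff_left[OF \<rho>d \<rho> b(1)] by simp
  qed
  then have "conv \<rho> (\<lambda>x. \<phi> (x + d) - \<phi> x) = conv (\<lambda>x. \<rho> (x + d) - \<rho> x) \<phi>" by auto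
  then show ?thesis using young(2)[of "\<lambda>x. \<rho> (x + d) - \<rho> x", OF _ \<phi>] \<rho> \<rho>d by simp
qed

context fiber
begin

text \<open>
  Let \<open>w\<close> be the change of \<open>v\<close> when the runs centred above \<open>l\<close> move by one step. The gain is a lower bound for the change of the
  pairing between the two parts of \<open>v\<close>. For the upper bound this change is written as \<open>\<langle>w, G v\<rangle> + \<langle>w, G w\<rangle> / 2\<close> up to the atom:
  \<open>\<langle>w, u\<rangle> \<le> - \<mu> / 2 \<langle>w, w\<rangle>\<close> by rearrangement, and the smoothing of \<open>G\<close> absorbs the quadratic term.
\<close>
lemma single_plane_bound:
  assumes K: "rkernel K" and \<Lambda>: "\<Lambda> > 0" and rk: "reskernel \<Lambda> K g" and a: "a = ratom \<Lambda> K"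
    and \<rho>: "integrable lborel \<rho>" "\<And>x. 0 \<le> \<rho> x" "\<And>x. \<rho> x \<le> K x"
    and C\<rho>: "0 \<le> C" "(\<integral>x. \<bar>\<rho> (x + d) - \<rho> x\<bar> \<partial>lborel) \<le> C * h" "2 * C * h \<le> \<Lambda>"
    and q: "q = \<Lambda> + 2 * (\<integral>x. \<rho> x \<partial>lborel)" and \<mu>: "0 < \<mu>" "1 / q \<le> \<mu> / 2"
    and nu: "nice u" and u0: "\<And>x. \<mu> * v x \<le> u x" and um: "\<And>x y. v x \<le> v y \<Longrightarrow> u x - \<mu> * v x \<le> u y - \<mu> * v y"
    and gn: "ip (part {l + h / 2<..}) (conv g (part {..l})) + \<kappa> * h \<le> ip (\<lambda>x. part {l + h / 2<..} (x + d)) (conv g (part {..l}))"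
  shows "\<kappa> * h \<le> 3 / q * ip (part {l - h / 2<..l + h / 2}) (part {l - h / 2<..l + h / 2})
     + (C * nrm v / (\<Lambda> * q))\<^sup>2 / \<mu> * h\<^sup>2 + 4 * a * ip v v + 2 * nrm v * nrm (\<lambda>x. Gop a g v x - u x)"
proof -
  have gk: "rkernel g" by (rule rk_kernel[OF K \<Lambda> rk a])
  note g' = kernelD[OF gk]
  have a0: "a > 0" by (rule a_pos[OF K \<Lambda> rk a])
  have \<rho>int: "0 \<le> (\<integral>x. \<rho> x \<partial>lborel)" using \<rho>(2) by simp
  have q0: "q > 0" using \<Lambda> \<rho>int q by simp
  \<comment> \<open>The two sides of the plane are divided further: \<open>pW\<close> and
    \<open>pV\<close> are carried by runs centred within \<open>h / 2\<close> above and below it,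
    and \<open>r\<close> is the whole strip.\<close>
  define pA where "pA = part {l<..}"
  define pB where "pB = part {..l}"
  define pA1 where "pA1 = part {l + h / 2<..}"
  define pW where "pW = part {l<..l + h / 2}"
  define pB1 where "pB1 = part {..l - h / 2}"
  define pV where "pV = part {l - h / 2<..l}"
  define r where "r = part {l - h / 2<..l + h / 2}"
  have n: "nice pA" "nice pB" "nice pA1" "nice pW" "nice pB1" "nice pV" "nice r"
    unfolding pA_def pB_def pA1_def pW_def pB1_def pV_def r_def by (auto intro!: nice_part)
  have ns: "nice (\<lambda>x. f (x + d))" if "nice f" for f by (rule nice_mpres[OF that mpres_add])
  have nc: "nice (conv g f)" if "nice f" for f by (rule young(1)[OF g'(3) that])
  have nG: "nice (Gop a g f)" if "nice f" for f by (rule nice_Gop[OF K \<Lambda> rk a that])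
  have sA: "pA = (\<lambda>x. pA1 x + pW x)"
  proof
    fix x have s: "{l<..} = {l + h / 2<..} \<union> {l<..l + h / 2}" using h by auto
    show "pA x = pA1 x + pW x" unfolding pA_def pA1_def pW_def by (subst s, rule part_Un) auto
  qed
  have sB: "pB = (\<lambda>x. pB1 x + pV x)"
  proof
    fix x have s: "{..l} = {..l - h / 2} \<union> {l - h / 2<..l}" using h by auto
    show "pB x = pB1 x + pV x" unfolding pB_def pB1_def pV_def by (subst s, rule part_Un) auto
  qed
  have sv: "v = (\<lambda>x. pA x + pB x)"
  proof
    fix x have "{l<..} \<union> {..l} = UNIV" "{l<..} \<inter> {..l} = {}" by auto
    then show "v x = pA x + pB x" using part_Un[of "{l<..}" "{..l}" x] part_UNIV[of x] unfolding pA_def pB_def by auto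
  qed
  have le: "nrm f \<le> nrm f'" if "nice f" "nice f'" "\<And>x. 0 \<le> f x" "\<And>x. f x \<le> f' x" for f f' :: "'a \<Rightarrow> real"
    using nrm_mono[OF that(2,1)] that(3) order_trans[OF that(4) abs_ge_self] by simp
  have pv: "nrm pA \<le> nrm v" "nrm pB \<le> nrm v" "nrm pW \<le> nrm v" "nrm pV \<le> nrm v"
    unfolding pA_def pB_def pW_def pV_def by (rule le[OF nice_part nv part_nonneg part_le]; simp)+
  have sub: "{l<..l + h / 2} \<subseteq> {l - h / 2<..l + h / 2}" "{l - h / 2<..l} \<subseteq> {l - h / 2<..l + h / 2}" using h by auto
  have pr: "nrm pW \<le> nrm r" "nrm pV \<le> nrm r"
    using le[OF n(4,7)] le[OF n(6,7)] part_nonneg part_mono[OF _ _ sub(1)] part_mono[OF _ _ sub(2)]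
    by (simp_all add: pW_def pV_def r_def)
  define w where "w = (\<lambda>x. pA (x + d) - pA x)"
  define \<omega> where "\<omega> = (\<lambda>x. pW (x + d) - pW x)"
  have nw: "nice w" "nice \<omega>" unfolding w_def \<omega>_def by (intro nice_diff ns n)+
  have sh: "nrm (\<lambda>x. f (x + d) - f x) \<le> 2 * nrm f" if "nice f" for f
    using nrm_triangle_diff[OF ns[OF that] that] nrm_mpres[OF that mpres_add, of d] by simp
  have nw2: "nrm w \<le> 2 * nrm v" "nrm \<omega> \<le> 2 * nrm pW"
    using sh[OF n(1)] sh[OF n(4)] pv(1) unfolding w_def \<omega>_def by auto
  \<comment> \<open>The pairing uses the kernel without its atom. The passage to the full resolvent
    costs a multiple of \<open>a\<close> each time.\<close>
  define D where "D f f' = ip (\<lambda>x. f (x + d)) (conv g f') - ip f (conv g f')" for f f'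
  have Ddiff: "D f f' = ip (\<lambda>x. f (x + d) - f x) (conv g f')" if "nice f" "nice f'" for f f'
    unfolding D_def using ip_diff_left[OF ns[OF that(1)] that(1) nc[OF that(2)]] by simp
  have Dl: "D (\<lambda>x. f x + f2 x) f' = D f f' + D f2 f'" if "nice f" "nice f2" "nice f'" for f f2 f'
    unfolding D_def using that ns nc by (simp add: ip_add_left)
  have Dr: "D f (\<lambda>x. f' x + f2 x) = D f f' + D f f2" if "nice f" "nice f2" "nice f'" for f f2 f'
  proof -
    have "conv g (\<lambda>x. f' x + f2 x) = (\<lambda>x. conv g f' x + conv g f2 x)"
      using conv_add_right[OF g'(3) nice_bdm[OF that(3)] nice_bdm[OF that(2)]] by auto
    then show ?thesis unfolding D_def using that ns nc by (simp add: ip_add_right)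
  qed
  have DAB: "D pA pB = D pA1 pB + D pW pB1 + D pW pV"
    unfolding sA Dl[OF n(3,4,2)] by (subst (2) sB) (simp add: Dr[OF n(4) n(6) n(5)])
  have D1: "\<kappa> * h \<le> D pA1 pB" using gn by (simp add: D_def pA1_def pB_def)
  \<comment> \<open>The centres of these two parts are more than \<open>h / 2\<close> apart. Empty
    windows reduce \<open>gain\<close> to plain monotonicity.\<close>
  have D2: "0 \<le> D pW pB1"
  proof -
    have "ip pW (conv g pB1) + 0 * ((0 - 0) * measure lborel (ball (0::'a) 0)) * ((0 - 0) * measure lborel (ball (0::'a) 0)) \<le> ip (\<lambda>x. pW (x + d)) (conv g pB1)"
      unfolding pW_def pB1_def
    proof (rule gain[OF gk])
      fix s t n n' x y
      assume "0 < s" "0 < t" and x: "x \<in> run n s {l<..l + h / 2}" and y: "y \<in> run n' t {..l - h / 2}"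
      have "(\<Sum>i\<le>n. \<Sum>j\<le>n'. g ((x + real i *\<^sub>R d) - (y + real j *\<^sub>R d))) + (0::real) * card ({}::nat set)
        \<le> (\<Sum>i\<le>n. \<Sum>j\<le>n'. g ((x + real i *\<^sub>R d - d) - (y + real j *\<^sub>R d)))"
        by (rule run_pair_sum[OF g'(1)]) (use x y in \<open>auto simp: run_def\<close>)
      then show "(\<Sum>i\<le>n. \<Sum>j\<le>n'. g ((x + real i *\<^sub>R d) - (y + real j *\<^sub>R d)))
        + 0 * (\<Sum>i\<le>n. indicator {0<..<0} s * indicator (ball 0 0) (x + real i *\<^sub>R d))
            * (\<Sum>j\<le>n'. indicator {0<..<0} t * indicator (ball 0 0) (y + real j *\<^sub>R d))
        \<le> (\<Sum>i\<le>n. \<Sum>j\<le>n'. g ((x + real i *\<^sub>R d - d) - (y + real j *\<^sub>R d)))" by simp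
    qed auto
    then show ?thesis by (simp add: D_def)
  qed
  have conv_eq: "ip f (conv g f') = ip f (Gop a g f') - a * ip f f'" if "nice f" "nice f'" for f f'
    unfolding Gop_def using ip_add_right[OF nice_cmult[OF that(2)] nc[OF that(2)] that(1), of a] by (simp add: ip_cmult_right)
  have rw: "nrm (conv \<rho> w) \<le> C * h * nrm v"
  proof -
    have "nrm (conv \<rho> w) \<le> (\<integral>x. \<bar>\<rho> (x + d) - \<rho> x\<bar> \<partial>lborel) * nrm pA"
      unfolding w_def by (rule nrm_conv_shift[OF \<rho>(1) n(1)])
    also have "\<dots> \<le> (C * h) * nrm v" using C\<rho> h pv(1) nrm_nonneg by (intro mult_mono) auto
    finally show ?thesis .
  qed
  have r\<omega>: "nrm (conv \<rho> \<omega>) \<le> C * h * nrm pW"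
  proof -
    have "nrm (conv \<rho> \<omega>) \<le> (\<integral>x. \<bar>\<rho> (x + d) - \<rho> x\<bar> \<partial>lborel) * nrm pW"
      unfolding \<omega>_def by (rule nrm_conv_shift[OF \<rho>(1) n(4)])
    also have "\<dots> \<le> (C * h) * nrm pW" using C\<rho> nrm_nonneg by (intro mult_right_mono) auto
    finally show ?thesis .
  qed
  have Gb: "nrm (Gop a g f) \<le> (nrm f + 2 / \<Lambda> * nrm (conv \<rho> f)) / q" if "nice f" for f
    using nrm_Gop_smoothing[OF K \<Lambda> rk a \<rho> that] q q0 by (simp add: pos_le_divide_eq mult.commute)
  \<comment> \<open>Both parts lie in the strip, where no monotonicity is available. The increment
    of \<open>pW\<close> is almost averaged out by \<open>\<rho>\<close>, so the resolvent makes it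
    small by the factor \<open>3 / q\<close>.\<close>
  have D3: "- (3 / q * ip r r) - 2 * a * ip v v \<le> D pW pV"
  proof -
    have "nrm (Gop a g \<omega>) \<le> (nrm \<omega> + 2 / \<Lambda> * nrm (conv \<rho> \<omega>)) / q" by (rule Gb[OF nw(2)])
    also have "\<dots> \<le> (2 * nrm pW + 2 / \<Lambda> * (C * h * nrm pW)) / q"
      using nw2(2) r\<omega> \<Lambda> q0 by (intro divide_right_mono add_mono mult_left_mono) auto
    also have "2 / \<Lambda> * (C * h * nrm pW) = (2 * C * h / \<Lambda>) * nrm pW" by simp
    also have "(2 * nrm pW + (2 * C * h / \<Lambda>) * nrm pW) / q \<le> (2 * nrm pW + 1 * nrm pW) / q"
      using C\<rho>(3) \<Lambda> q0 nrm_nonneg[of pW] by (intro divide_right_mono add_mono mult_right_mono) auto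
    finally have G\<omega>: "nrm (Gop a g \<omega>) \<le> 3 / q * nrm pW" by simp
    have "D pW pV = ip \<omega> (conv g pV)" unfolding \<omega>_def by (rule Ddiff[OF n(4,6)])
    also have "\<dots> = ip (Gop a g \<omega>) pV - a * ip \<omega> pV"
      unfolding conv_eq[OF nw(2) n(6)] ip_Gop_sym[OF K \<Lambda> rk a nw(2) n(6)] by simp
    finally have 1: "D pW pV = ip (Gop a g \<omega>) pV - a * ip \<omega> pV" .
    have "\<bar>ip (Gop a g \<omega>) pV\<bar> \<le> nrm (Gop a g \<omega>) * nrm pV" by (rule ip_CS[OF nG[OF nw(2)] n(6)])
    also have "\<dots> \<le> (3 / q * nrm pW) * nrm pV" using G\<omega> nrm_nonneg by (intro mult_right_mono) auto
    also have "\<dots> = 3 / q * (nrm pW * nrm pV)" by simp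
    also have "\<dots> \<le> 3 / q * (nrm r * nrm r)" using pr nrm_nonneg q0 by (intro mult_left_mono mult_mono) auto
    also have "nrm r * nrm r = ip r r" by (simp add: nrm_sq[symmetric] power2_eq_square)
    finally have 2: "\<bar>ip (Gop a g \<omega>) pV\<bar> \<le> 3 / q * ip r r" .
    have "\<bar>ip \<omega> pV\<bar> \<le> nrm \<omega> * nrm pV" by (rule ip_CS[OF nw(2) n(6)])
    also have "\<dots> \<le> (2 * nrm v) * nrm v" using nw2(2) pv nrm_nonneg by (intro mult_mono) (auto intro: order_trans)
    also have "\<dots> = 2 * ip v v" by (simp add: nrm_sq[symmetric] power2_eq_square)
    finally have "a * \<bar>ip \<omega> pV\<bar> \<le> a * (2 * ip v v)" using a0 by (intro mult_left_mono) auto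
    then have 3: "a * ip \<omega> pV \<le> 2 * a * ip v v" using a0 mult_left_mono[OF abs_ge_self[of "ip \<omega> pV"], of a] by linarith
    show ?thesis using 1 2 3 by linarith
  qed
  have lower: "\<kappa> * h - 3 / q * ip r r - 2 * a * ip v v \<le> D pA pB" using DAB D1 D2 D3 by linarith
  \<comment> \<open>The move preserves the norm of \<open>pA\<close>, which expresses
    \<open>ip w pA\<close> by \<open>ip w w\<close>, and it does not increase the pairing with
    \<open>pB\<close>.\<close>
  have w2: "2 * ip w v + ip w w \<le> 0"
  proof -
    have "ip (\<lambda>x. pA (x + d)) pB \<le> ip pA pB" unfolding pA_def pB_def by (rule ip_shift_parts) auto
    then have wq: "ip w pB \<le> 0" unfolding w_def using ip_diff_left[OF ns[OF n(1)] n(1) n(2)] by simp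
    have "ip (\<lambda>x. pA (x + d)) (\<lambda>x. pA (x + d)) = ip pA pA" by (rule ip_mpres[OF n(1) n(1) mpres_add])
    moreover have "(\<lambda>x. pA (x + d)) = (\<lambda>x. w x + pA x)" by (auto simp: w_def)
    ultimately have "ip (\<lambda>x. w x + pA x) (\<lambda>x. w x + pA x) = ip pA pA" by simp
    then have "ip w w + 2 * ip w pA = 0"
      using nice_add[OF nw(1) n(1)] nw(1) n(1) by (simp add: ip_add_left ip_add_right ip_commute[of pA w])
    moreover have "ip w v = ip w pA + ip w pB" unfolding sv by (rule ip_add_right[OF n(1,2) nw(1)])
    ultimately show ?thesis using wq by linarith
  qed
  \<comment> \<open>By assumption \<open>u x - \<mu> * v x\<close> is nonnegative and nondecreasing
    in \<open>v x\<close>, so the rearrangement inequality applies to it.\<close>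
  have wu: "ip w u \<le> \<mu> * ip w v"
  proof -
    have nF: "nice (\<lambda>x. u x - \<mu> * v x)" by (intro nice_diff nu nice_cmult nv)
    have "ip (\<lambda>x. pA (x + d)) (\<lambda>x. u x - \<mu> * v x) \<le> ip pA (\<lambda>x. u x - \<mu> * v x)"
      unfolding pA_def by (rule ip_shift_monotone[OF _ nF]) (auto simp: u0 um)
    then have "ip w (\<lambda>x. u x - \<mu> * v x) \<le> 0" unfolding w_def using ip_diff_left[OF ns[OF n(1)] n(1) nF] by simp
    then show ?thesis using ip_diff_right[OF nu nice_cmult[OF nv, of \<mu>] nw(1)] by (simp add: ip_cmult_right)
  qed
  have nE: "nice (\<lambda>x. Gop a g v x - u x)" by (rule nice_diff[OF nG[OF nv] nu])
  have wGv: "ip w (Gop a g v) \<le> - (\<mu> / 2) * ip w w + 2 * nrm v * nrm (\<lambda>x. Gop a g v x - u x)"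
  proof -
    have "ip w (Gop a g v) = ip w u + ip w (\<lambda>x. Gop a g v x - u x)"
      using ip_add_right[OF nu nE nw(1)] by simp
    moreover have "ip w (\<lambda>x. Gop a g v x - u x) \<le> nrm w * nrm (\<lambda>x. Gop a g v x - u x)" using ip_CS[OF nw(1) nE] by linarith
    moreover have "\<dots> \<le> (2 * nrm v) * nrm (\<lambda>x. Gop a g v x - u x)" using nw2(1) nrm_nonneg by (intro mult_right_mono) auto
    moreover have "\<mu> * (2 * ip w v) \<le> \<mu> * (- ip w w)" using w2 \<mu> by (intro mult_left_mono) auto
    ultimately show ?thesis using wu by simp
  qed
  have wGw: "ip w (Gop a g w) / 2 \<le> \<mu> / 4 * ip w w + nrm w * (C * nrm v / (\<Lambda> * q) * h)"
  proof -
    have "ip w (Gop a g w) \<le> nrm w * nrm (Gop a g w)" using ip_CS[OF nw(1) nG[OF nw(1)]] by linarith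
    also have "\<dots> \<le> nrm w * ((nrm w + 2 / \<Lambda> * (C * h * nrm v)) / q)"
      using order_trans[OF Gb[OF nw(1)] divide_right_mono[OF add_left_mono[OF mult_left_mono[OF rw]]]] \<Lambda> q0 nrm_nonneg
      by (intro mult_left_mono) auto
    also have "\<dots> = (1 / q) * (nrm w)\<^sup>2 + 2 * (nrm w * (C * nrm v / (\<Lambda> * q) * h))"
      using \<Lambda> q0 by (simp add: power2_eq_square field_simps)
    also have "\<dots> \<le> \<mu> / 2 * (nrm w)\<^sup>2 + 2 * (nrm w * (C * nrm v / (\<Lambda> * q) * h))"
      using \<mu> by (intro add_right_mono mult_right_mono) auto
    finally show ?thesis by (simp add: nrm_sq)
  qed
  \<comment> \<open>The resolvent commutes with the shift, so the quadratic form of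
    \<open>pA\<close> does not change; this yields
    \<open>ip w (Gop a g pA) = - ip w (Gop a g w) / 2\<close>.\<close>
  have wGp: "ip w (Gop a g pB) = ip w (Gop a g v) + ip w (Gop a g w) / 2"
  proof -
    have "Gop a g v = (\<lambda>x. Gop a g pA x + Gop a g pB x)"
      using Gop_add[OF K \<Lambda> rk a nice_bdm[OF n(1)] nice_bdm[OF n(2)]] sv by metis
    then have 1: "ip w (Gop a g v) = ip w (Gop a g pA) + ip w (Gop a g pB)"
      using ip_add_right[OF nG[OF n(1)] nG[OF n(2)] nw(1)] by simp
    have "Gop a g (\<lambda>x. pA (x + d)) = (\<lambda>x. Gop a g pA (x + d))"
      by (auto simp: Gop_def conv_def algebra_simps)
    then have "ip (\<lambda>x. pA (x + d)) (Gop a g (\<lambda>x. pA (x + d))) = ip pA (Gop a g pA)"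
      using ip_mpres[OF n(1) nG[OF n(1)] mpres_add] by simp
    moreover have "(\<lambda>x. pA (x + d)) = (\<lambda>x. w x + pA x)" by (auto simp: w_def)
    ultimately have "ip (\<lambda>x. w x + pA x) (Gop a g (\<lambda>x. w x + pA x)) = ip pA (Gop a g pA)" by simp
    moreover have "Gop a g (\<lambda>x. w x + pA x) = (\<lambda>x. Gop a g w x + Gop a g pA x)"
      using Gop_add[OF K \<Lambda> rk a nice_bdm[OF nw(1)] nice_bdm[OF n(1)]] by auto
    ultimately have "ip (\<lambda>x. w x + pA x) (\<lambda>x. Gop a g w x + Gop a g pA x) = ip pA (Gop a g pA)" by simp
    then have "ip w (Gop a g w) + ip w (Gop a g pA) + ip pA (Gop a g w) = 0"
      using nw(1) n(1) nG[OF nw(1)] nG[OF n(1)] nice_add[OF nG[OF nw(1)] nG[OF n(1)]]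
      by (simp add: ip_add_left ip_add_right)
    moreover have "ip pA (Gop a g w) = ip w (Gop a g pA)"
      using ip_Gop_sym[OF K \<Lambda> rk a n(1) nw(1)] by (simp add: ip_commute)
    ultimately show ?thesis using 1 by simp
  qed
  \<comment> \<open>Here the atom is added to the pairing, which costs the second error term in
    \<open>a\<close>.\<close>
  have upper: "D pA pB \<le> ip w (Gop a g v) + ip w (Gop a g w) / 2 + 2 * a * ip v v"
  proof -
    have "D pA pB = ip w (Gop a g pB) - a * ip w pB"
      unfolding Ddiff[OF n(1,2)] w_def[symmetric] by (rule conv_eq[OF nw(1) n(2)])
    moreover have "\<bar>ip w pB\<bar> \<le> 2 * ip v v"
    proof -
      have "\<bar>ip w pB\<bar> \<le> nrm w * nrm pB" by (rule ip_CS[OF nw(1) n(2)])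
      also have "\<dots> \<le> (2 * nrm v) * nrm v" using nw2(1) pv nrm_nonneg by (intro mult_mono) auto
      also have "\<dots> = 2 * ip v v" by (simp add: nrm_sq[symmetric] power2_eq_square)
      finally show ?thesis .
    qed
    then have "a * (- ip w pB) \<le> a * (2 * ip v v)" using a0 by (intro mult_left_mono) auto
    ultimately show ?thesis unfolding wGp by simp
  qed
  \<comment> \<open>A quarter of \<open>\<mu>\<close> times \<open>ip w w\<close> remains with a
    negative sign after the quadratic term is absorbed; completing the square leaves an error of
    order \<open>h\<^sup>2\<close>.\<close>
  define \<beta> where "\<beta> = C * nrm v / (\<Lambda> * q) * h"
  have sq: "- (\<mu> / 4) * (nrm w)\<^sup>2 + nrm w * \<beta> \<le> \<beta>\<^sup>2 / \<mu>"
  proof -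
    have "0 \<le> (\<mu> / 2 * nrm w - \<beta>)\<^sup>2 / \<mu>" using \<mu> by simp
    also have "\<dots> = \<mu> / 4 * (nrm w)\<^sup>2 - nrm w * \<beta> + \<beta>\<^sup>2 / \<mu>" using \<mu> by (simp add: power2_eq_square field_simps)
    finally show ?thesis by simp
  qed
  have "\<beta>\<^sup>2 / \<mu> = (C * nrm v / (\<Lambda> * q))\<^sup>2 / \<mu> * h\<^sup>2" by (simp add: \<beta>_def power_mult_distrib power_divide)
  then show ?thesis using lower upper wGv wGw sq unfolding nrm_sq \<beta>_def[symmetric] r_def[symmetric] by linarith
qed

end

section \<open>Strict gain from two opposite reflections\<close>

lemma ball_inner_less:
  fixes X p e :: "'a::real_inner"
  assumes "norm e = 1" "p \<in> ball X \<delta>" shows "X \<bullet> e - \<delta> < p \<bullet> e" "p \<bullet> e < X \<bullet> e + \<delta>"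
proof -
  have "\<bar>(p - X) \<bullet> e\<bar> \<le> norm (p - X) * norm e" by (rule Cauchy_Schwarz_ineq2)
  also have "\<dots> < \<delta>" using assms by (simp add: dist_norm norm_minus_commute)
  finally show "X \<bullet> e - \<delta> < p \<bullet> e" "p \<bullet> e < X \<bullet> e + \<delta>" by (auto simp: inner_diff_left abs_less_iff)
qed

context fiber
begin

section \<open>Runs near a ball and near its mirror image\<close>

lemma inner_shift: "(x + r *\<^sub>R d) \<bullet> e = x \<bullet> e + r * h"
  by (simp add: inner_add_left de)

text \<open>The point one step beyond an end of the run has level at most \<open>s\<close>, so it
  lies outside the ball of radius \<open>2 * \<delta>\<close>; by \<open>near_translate\<close> its
  height is then off by more than \<open>\<delta>\<close>. The end itself is one step nearer, whence
  \<open>h\<close> in the bounds.\<close>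

lemma run_ends:
  assumes x: "x \<in> run n s A" and i: "i \<le> n" and p: "x + real i *\<^sub>R d \<in> ball X \<delta>"
    and hi: "\<And>z. z \<in> ball X (2 * \<delta>) \<Longrightarrow> s < v z"
  shows "X \<bullet> e + \<delta> - h \<le> x \<bullet> e + real n * h" "x \<bullet> e \<le> X \<bullet> e - \<delta> + h"
proof -
  note b = ball_inner_less[OF e p, unfolded inner_shift]
  have ih: "0 \<le> real i * h" "real i * h \<le> real n * h" using i h by auto
  show "X \<bullet> e + \<delta> - h \<le> x \<bullet> e + real n * h"
  proof (rule ccontr)
    assume c: "\<not> ?thesis"
    have "x + real (Suc n) *\<^sub>R d \<in> ball X (2 * \<delta>)"
    proof (rule near_translate[OF e p, where b = 0])
      show "x + real (Suc n) *\<^sub>R d = x + real i *\<^sub>R d + ((real (Suc n) - real i) * h) *\<^sub>R e"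
        by (simp add: d_def algebra_simps)
      have "real (Suc n) * h = real n * h + h" by (simp add: algebra_simps)
      then show "\<bar>(x + real (Suc n) *\<^sub>R d - X) \<bullet> e\<bar> \<le> \<delta>"
        unfolding inner_diff_left inner_shift using b ih c h by linarith
    qed simp
    then show False using hi x unfolding run_def by fastforce
  qed
  show "x \<bullet> e \<le> X \<bullet> e - \<delta> + h"
  proof (rule ccontr)
    assume c: "\<not> ?thesis"
    have "x - d \<in> ball X (2 * \<delta>)"
    proof (rule near_translate[OF e p, where b = 0])
      show "x - d = x + real i *\<^sub>R d + (- (real i + 1) * h) *\<^sub>R e" by (simp add: d_def algebra_simps)
      show "\<bar>(x - d - X) \<bullet> e\<bar> \<le> \<delta>" unfolding inner_diff_left de using b ih c h by linarith
    qed simp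
    then show False using hi x unfolding run_def by fastforce
  qed
qed

text \<open>Steps of length at most \<open>\<delta>\<close> cannot jump over a slab of height
  \<open>2 * \<delta>\<close>, and a point of the run in the slab would lie in the ball around
  \<open>Z\<close>, where \<open>v\<close> is too small.\<close>

lemma run_avoid:
  assumes x: "x \<in> run n s A" and i: "i \<le> n" and p: "x + real i *\<^sub>R d \<in> ball X \<delta>" and hd: "h \<le> \<delta>"
    and Z: "Z = X + b *\<^sub>R e" and lo: "\<And>z. z \<in> ball Z (2 * \<delta>) \<Longrightarrow> v z \<le> s"
  shows "b \<le> - 4 * \<delta> \<Longrightarrow> Z \<bullet> e + \<delta> < x \<bullet> e" "4 * \<delta> \<le> b \<Longrightarrow> x \<bullet> e + real n * h < Z \<bullet> e - \<delta>"
proof -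
  note bi = ball_inner_less[OF e p, unfolded inner_shift]
  have Ze: "Z \<bullet> e = X \<bullet> e + b" using e by (simp add: Z inner_add_left dot_square_norm)
  have no: False if k: "k \<le> n" "\<bar>x \<bullet> e + real k * h - Z \<bullet> e\<bar> \<le> \<delta>" for k
  proof -
    have "x + real k *\<^sub>R d \<in> ball Z (2 * \<delta>)"
    proof (rule near_translate[OF e p _ Z])
      show "x + real k *\<^sub>R d = x + real i *\<^sub>R d + ((real k - real i) * h) *\<^sub>R e" by (simp add: d_def algebra_simps)
      show "\<bar>(x + real k *\<^sub>R d - Z) \<bullet> e\<bar> \<le> \<delta>" unfolding inner_diff_left inner_shift by (rule k(2))
    qed
    then show False using lo x k(1) unfolding run_def by fastforce
  qed
  have le_iff: "k \<le> k'" if "real k * h \<le> real k' * h" for k k' using that h by simp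
  show "Z \<bullet> e + \<delta> < x \<bullet> e" if b: "b \<le> - 4 * \<delta>"
  proof (rule ccontr)
    assume c: "\<not> ?thesis"
    \<comment> \<open>The highest step not above \<open>Z \<bullet> e + \<delta>\<close>; it is less
      than \<open>h\<close> below this height.\<close>
    define k where "k = nat \<lfloor>(Z \<bullet> e + \<delta> - x \<bullet> e) / h\<rfloor>"
    have "0 \<le> (Z \<bullet> e + \<delta> - x \<bullet> e) / h" using c h by simp
    then have "real k \<le> (Z \<bullet> e + \<delta> - x \<bullet> e) / h" "(Z \<bullet> e + \<delta> - x \<bullet> e) / h < real k + 1"
      unfolding k_def by linarith+
    then have kk: "real k * h \<le> Z \<bullet> e + \<delta> - x \<bullet> e" "Z \<bullet> e + \<delta> - x \<bullet> e < real k * h + h"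
      using h by (simp_all add: pos_le_divide_eq pos_divide_less_eq distrib_right)
    have "k \<le> i" by (rule le_iff) (use kk bi Ze b hd h in linarith)
    then show False by (intro no[of k]) (use i kk hd h in \<open>auto simp: abs_le_iff\<close>)
  qed
  show "x \<bullet> e + real n * h < Z \<bullet> e - \<delta>" if b: "4 * \<delta> \<le> b"
  proof (rule ccontr)
    assume c: "\<not> ?thesis"
    \<comment> \<open>The lowest step not below \<open>Z \<bullet> e - \<delta>\<close>; it is less
      than \<open>h\<close> above this height.\<close>
    define k where "k = nat \<lceil>(Z \<bullet> e - \<delta> - x \<bullet> e) / h\<rceil>"
    have i0: "0 \<le> real i * h" using h by simp
    have "0 \<le> Z \<bullet> e - \<delta> - x \<bullet> e" using bi Ze b hd h i0 by linarith
    then have "0 \<le> (Z \<bullet> e - \<delta> - x \<bullet> e) / h" using h by simp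
    then have "(Z \<bullet> e - \<delta> - x \<bullet> e) / h \<le> real k" "real k < (Z \<bullet> e - \<delta> - x \<bullet> e) / h + 1"
      unfolding k_def by linarith+
    then have "Z \<bullet> e - \<delta> - x \<bullet> e \<le> real k * h" "(real k - 1) * h < Z \<bullet> e - \<delta> - x \<bullet> e"
      using h by (simp_all add: pos_divide_le_eq pos_less_divide_eq[symmetric])
    then have kk: "Z \<bullet> e - \<delta> - x \<bullet> e \<le> real k * h" "real k * h < Z \<bullet> e - \<delta> - x \<bullet> e + h"
      by (auto simp: left_diff_distrib)
    have "k \<le> n"
    proof (rule ccontr)
      assume "\<not> k \<le> n"
      then have "real n * h + h \<le> real k * h" using mult_right_mono[of "real n + 1" "real k" h] h by (simp add: distrib_right)
      then show False using kk c by linarith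
    qed
    then show False by (intro no[of k]) (use kk hd h in \<open>auto simp: abs_le_iff\<close>)
  qed
qed

lemma run_count:
  assumes hd: "h \<le> \<delta>"
  shows "(\<Sum>i\<le>n. indicator (ball X \<delta>) (x + real i *\<^sub>R d)) \<le> 3 * \<delta> / h"
proof -
  define S where "S = {i. i \<le> n \<and> x + real i *\<^sub>R d \<in> ball X \<delta>}"
  have fin: "finite S" unfolding S_def by simp
  have "(\<Sum>i\<le>n. indicator (ball X \<delta>) (x + real i *\<^sub>R d) :: real) = (\<Sum>i\<in>S. 1)"
    unfolding S_def by (rule sum.mono_neutral_cong_right) (auto simp: indicator_def)
  then have eq: "(\<Sum>i\<le>n. indicator (ball X \<delta>) (x + real i *\<^sub>R d) :: real) = card S" by simp
  have "real (card S) \<le> 2 * \<delta> / h + 1"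
  proof (cases "S = {}")
    case False
    define m where "m = Min S"
    have m: "m \<in> S" "\<And>i. i \<in> S \<Longrightarrow> m \<le> i" using fin False by (auto simp: m_def)
    have "S \<subseteq> {m..m + nat \<lfloor>2 * \<delta> / h\<rfloor>}"
    proof
      fix i assume i: "i \<in> S"
      have "x \<bullet> e + real i * h < X \<bullet> e + \<delta>" "X \<bullet> e - \<delta> < x \<bullet> e + real m * h"
        using ball_inner_less[OF e, of "x + real i *\<^sub>R d" X \<delta>] ball_inner_less[OF e, of "x + real m *\<^sub>R d" X \<delta>] i m(1)
        by (auto simp: S_def inner_shift)
      then have "(real i - real m) * h \<le> 2 * \<delta>" by (simp add: left_diff_distrib)
      then have "real i - real m \<le> 2 * \<delta> / h" using h by (simp add: pos_le_divide_eq)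
      then have "i - m \<le> nat \<lfloor>2 * \<delta> / h\<rfloor>" using m(2)[OF i] by (simp add: le_nat_floor of_nat_diff)
      then show "i \<in> {m..m + nat \<lfloor>2 * \<delta> / h\<rfloor>}" using m(2)[OF i] by auto
    qed
    then have "card S \<le> card {m..m + nat \<lfloor>2 * \<delta> / h\<rfloor>}" by (intro card_mono) auto
    then have "real (card S) \<le> real (nat \<lfloor>2 * \<delta> / h\<rfloor>) + 1" by simp
    also have "real (nat \<lfloor>2 * \<delta> / h\<rfloor>) \<le> 2 * \<delta> / h" using h hd by (intro of_nat_floor) simp
    finally show ?thesis by simp
  qed (use h hd in simp)
  also have "\<dots> \<le> 3 * \<delta> / h" using h hd by (simp add: field_simps)
  finally show ?thesis using eq by simp
qed

text \<open>The upper end is beyond \<open>X \<bullet> e + \<delta>\<close> up to one step, the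
  lower end stays more than \<open>\<delta>\<close> above the height of the mirror image of
  \<open>X\<close>, and the average of the two bounds is \<open>l + \<delta> - h / 2\<close>. The
  length bound comes from the two ends near \<open>X\<close>.\<close>

lemma run_right_bounds:
  assumes x: "x \<in> run n s A" and i: "i \<le> n" and p: "x + real i *\<^sub>R d \<in> ball X \<delta>" and hd: "h \<le> \<delta>"
    and X: "l + 2 * \<delta> \<le> X \<bullet> e" and hi: "\<And>z. z \<in> ball X (2 * \<delta>) \<Longrightarrow> s < v z"
    and lo: "\<And>z. z \<in> ball (rfl e l X) (2 * \<delta>) \<Longrightarrow> v z \<le> s"
  shows "l + \<delta> - h / 2 \<le> x \<bullet> e + real n * h / 2" "2 * \<delta> - 2 * h \<le> real n * h"
proof -
  note E = run_ends[OF x i p hi]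
  have "rfl e l X \<bullet> e + \<delta> < x \<bullet> e" by (rule run_avoid(1)[OF x i p hd rfl_def lo]) (use X in auto)
  then have "2 * l - X \<bullet> e + \<delta> < x \<bullet> e" by (simp add: rfl_inner[OF e])
  then show "l + \<delta> - h / 2 \<le> x \<bullet> e + real n * h / 2" "2 * \<delta> - 2 * h \<le> real n * h" using E by linarith+
qed

lemma run_left_bounds:
  assumes x: "x \<in> run n s A" and i: "i \<le> n" and p: "x + real i *\<^sub>R d \<in> ball X \<delta>" and hd: "h \<le> \<delta>"
    and X: "X \<bullet> e \<le> l - 2 * \<delta>" and hi: "\<And>z. z \<in> ball X (2 * \<delta>) \<Longrightarrow> s < v z"
    and lo: "\<And>z. z \<in> ball (rfl e l X) (2 * \<delta>) \<Longrightarrow> v z \<le> s"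
  shows "x \<bullet> e + real n * h / 2 \<le> l - \<delta> + h / 2" "2 * \<delta> - 2 * h \<le> real n * h"
proof -
  note E = run_ends[OF x i p hi]
  have "x \<bullet> e + real n * h < rfl e l X \<bullet> e - \<delta>" by (rule run_avoid(2)[OF x i p hd rfl_def lo]) (use X in auto)
  then have "x \<bullet> e + real n * h < 2 * l - X \<bullet> e - \<delta>" by (simp add: rfl_inner[OF e])
  then show "x \<bullet> e + real n * h / 2 \<le> l - \<delta> + h / 2" "2 * \<delta> - 2 * h \<le> real n * h" using E by linarith+
qed

lemma run_through:
  assumes s: "0 < s" "s < v z"
  shows "\<exists>x n i. x \<in> run n s UNIV \<and> i \<le> n \<and> z = x + real i *\<^sub>R d \<and> cen z s = x \<bullet> e + real n * h / 2"
  using run_exists[OF s UNIV_I]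
  by (intro exI[of _ "z - real (dn z s) *\<^sub>R d"] exI[of _ "dn z s + up z s"] exI[of _ "dn z s"])
    (simp add: cen_def inner_diff_left de field_simps)

text \<open>The squares of the norms differ by at least \<open>4 * \<delta>\<^sup>2\<close>, and the
  sum of the norms is at most \<open>4 * R0\<close>.\<close>

lemma end_distance_gap:
  assumes b: "2 * \<delta> \<le> b - a" and m: "2 * \<delta> \<le> 2 * (z \<bullet> e) + (a + b)" and \<delta>: "0 < \<delta>"
    and R: "norm (z + b *\<^sub>R e) \<le> 2 * R0" and R0: "0 < R0"
  shows "norm (z + a *\<^sub>R e) + \<delta>\<^sup>2 / R0 \<le> norm (z + b *\<^sub>R e)"
proof -
  let ?p = "norm (z + a *\<^sub>R e)" and ?q = "norm (z + b *\<^sub>R e)"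
  have "?q\<^sup>2 - ?p\<^sup>2 = (b - a) * (2 * (z \<bullet> e) + (a + b))"
    unfolding norm_add_unit[OF e] by (simp add: power2_eq_square algebra_simps)
  also have "\<dots> \<ge> (2 * \<delta>) * (2 * \<delta>)" using b m \<delta> by (intro mult_mono) auto
  finally have g: "4 * \<delta>\<^sup>2 \<le> ?q\<^sup>2 - ?p\<^sup>2" by (simp add: power2_eq_square)
  then have "?p\<^sup>2 \<le> ?q\<^sup>2" using zero_le_power2[of \<delta>] by linarith
  then have pq: "?p \<le> ?q" by (rule power2_le_imp_le) simp
  have "4 * \<delta>\<^sup>2 \<le> (?q - ?p) * (?q + ?p)" using g by (simp add: power2_eq_square algebra_simps)
  also have "\<dots> \<le> (?q - ?p) * (4 * R0)" using pq R by (intro mult_left_mono) auto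
  finally have "\<delta>\<^sup>2 \<le> (?q - ?p) * R0" by simp
  then show ?thesis using R0 by (simp add: pos_divide_le_eq[symmetric])
qed

text \<open>At levels in the two windows a run through the ball around \<open>X\<close> stops before
  the mirror ball and is centred well above \<open>l\<close>; a run through the ball around
  \<open>Y\<close> is centred well below. For such a pair about \<open>\<delta> / (4 * h)\<close>
  terms of the telescoped double sum involve distances that differ by a definite amount, and each of
  them gains \<open>c\<close>.\<close>

lemma strict_gain:
  assumes g: "rkernel g" and A[measurable]: "A \<in> sets borel" and B[measurable]: "B \<in> sets borel" and c: "0 < c"
    and \<delta>: "0 < \<delta>" "8 * h \<le> \<delta>"
    and sep: "\<And>a b. a \<in> A \<Longrightarrow> b \<in> B \<Longrightarrow> h / 2 \<le> a - b"
    and A': "{l + \<delta> - h / 2..} \<subseteq> A" and B': "{..l - \<delta> + h / 2} \<subseteq> B"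
    and X: "l + 2 * \<delta> \<le> X \<bullet> e" and Xhi: "\<And>z. z \<in> ball X (2 * \<delta>) \<Longrightarrow> b1 \<le> v z"
    and Xlo: "\<And>z. z \<in> ball (rfl e l X) (2 * \<delta>) \<Longrightarrow> v z \<le> a1" and ab1: "0 < a1" "a1 \<le> b1"
    and Y: "Y \<bullet> e \<le> l - 2 * \<delta>" and Yhi: "\<And>z. z \<in> ball Y (2 * \<delta>) \<Longrightarrow> b2 \<le> v z"
    and Ylo: "\<And>z. z \<in> ball (rfl e l Y) (2 * \<delta>) \<Longrightarrow> v z \<le> a2" and ab2: "0 < a2" "a2 \<le> b2"
    and R0: "0 < R0" "\<And>z. min a1 a2 < v z \<Longrightarrow> norm z \<le> R0"
    and st: "\<And>x y. norm y \<le> 2 * R0 \<Longrightarrow> norm x + \<delta>\<^sup>2 / R0 \<le> norm y \<Longrightarrow> g y + c \<le> g x"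
  shows "ip (part A) (conv g (part B))
      + c * h / (36 * \<delta>) * ((b1 - a1) * measure lborel (ball X \<delta>)) * ((b2 - a2) * measure lborel (ball Y \<delta>))
     \<le> ip (\<lambda>x. part A (x + d)) (conv g (part B))"
proof (rule gain[OF g A B])
  have hd: "h \<le> \<delta>" using h \<delta> by linarith
  show "0 \<le> c * h / (36 * \<delta>)" using c h \<delta> by simp
  show "a1 \<le> b1" "a2 \<le> b2" by fact+
  have hX: "s < v z" if "s \<in> {a1<..<b1}" "z \<in> ball X (2 * \<delta>)" for s z using Xhi[OF that(2)] that(1) by auto
  have lX: "v z \<le> s" if "s \<in> {a1<..<b1}" "z \<in> ball (rfl e l X) (2 * \<delta>)" for s z using Xlo[OF that(2)] that(1) by auto
  have hY: "s < v z" if "s \<in> {a2<..<b2}" "z \<in> ball Y (2 * \<delta>)" for s z using Yhi[OF that(2)] that(1) by auto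
  have lY: "v z \<le> s" if "s \<in> {a2<..<b2}" "z \<in> ball (rfl e l Y) (2 * \<delta>)" for s z using Ylo[OF that(2)] that(1) by auto
  note Xb = run_right_bounds[OF _ _ _ hd X] and Yb = run_left_bounds[OF _ _ _ hd Y]
  show "(z, s) \<in> P A" if s: "s \<in> {a1<..<b1}" and z: "z \<in> ball X \<delta>" for s z
  proof -
    have sz: "0 < s" "s < v z" using s z ab1 Xhi[of z] \<delta> by auto
    obtain x n i where x: "x \<in> run n s UNIV" "i \<le> n" "z = x + real i *\<^sub>R d" "cen z s = x \<bullet> e + real n * h / 2"
      using run_through[OF sz] by auto
    have "l + \<delta> - h / 2 \<le> cen z s" unfolding x(4)
      by (rule Xb(1)[OF x(1,2)]) (use x(3) z hX[OF s] lX[OF s] in \<open>simp_all del: mem_ball\<close>)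
    then show ?thesis using A' sz unfolding P_def by auto
  qed
  show "(z, s) \<in> P B" if s: "s \<in> {a2<..<b2}" and z: "z \<in> ball Y \<delta>" for s z
  proof -
    have sz: "0 < s" "s < v z" using s z ab2 Yhi[of z] \<delta> by auto
    obtain x n i where x: "x \<in> run n s UNIV" "i \<le> n" "z = x + real i *\<^sub>R d" "cen z s = x \<bullet> e + real n * h / 2"
      using run_through[OF sz] by auto
    have "cen z s \<le> l - \<delta> + h / 2" unfolding x(4)
      by (rule Yb(1)[OF x(1,2)]) (use x(3) z hY[OF s] lY[OF s] in \<open>simp_all del: mem_ball\<close>)
    then show ?thesis using B' sz unfolding P_def by auto
  qed
  fix s t n n' x y
  assume st0: "0 < s" "0 < t" and x: "x \<in> run n s A" and y: "y \<in> run n' t B"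
  have D: "h / 2 \<le> (x \<bullet> e + real n * h / 2) - (y \<bullet> e + real n' * h / 2)"
    by (rule sep) (use x y in \<open>simp_all add: run_def\<close>)
  let ?Sx = "\<Sum>i\<le>n. indicator {a1<..<b1} s * indicator (ball X \<delta>) (x + real i *\<^sub>R d) :: real"
  let ?Sy = "\<Sum>j\<le>n'. indicator {a2<..<b2} t * indicator (ball Y \<delta>) (y + real j *\<^sub>R d) :: real"
  let ?L = "\<Sum>i\<le>n. \<Sum>j\<le>n'. g ((x + real i *\<^sub>R d) - (y + real j *\<^sub>R d))"
  let ?U = "\<Sum>i\<le>n. \<Sum>j\<le>n'. g ((x + real i *\<^sub>R d - d) - (y + real j *\<^sub>R d))"
  show "?L + c * h / (36 * \<delta>) * ?Sx * ?Sy \<le> ?U"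
  proof (cases "?Sx = 0 \<or> ?Sy = 0")
    case True
    have drop: "a + C * x * y \<le> b" if "a + 0 * m \<le> b" "x = 0 \<or> y = 0" for a b C m x y :: real
      using that by auto
    have "?L + (0::real) * card ({} :: nat set) \<le> ?U" by (rule run_pair_sum[OF kernelD(1)[OF g] D]) auto
    then show ?thesis by (rule drop[OF _ True])
  next
    case False
    obtain i where i: "i \<le> n" "s \<in> {a1<..<b1}" "x + real i *\<^sub>R d \<in> ball X \<delta>"
      using False by (metis (no_types, lifting) atMost_iff indicator_simps(2) mult_not_zero sum.neutral)
    obtain j where j: "j \<le> n'" "t \<in> {a2<..<b2}" "y + real j *\<^sub>R d \<in> ball Y \<delta>"
      using False by (metis (no_types, lifting) atMost_iff indicator_simps(2) mult_not_zero sum.neutral)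
    have bx: "l + \<delta> - h / 2 \<le> x \<bullet> e + real n * h / 2" "2 * \<delta> - 2 * h \<le> real n * h"
      by (rule Xb[OF x i(1,3) hX[OF i(2)] lX[OF i(2)]]; assumption)+
    have bY: "y \<bullet> e + real n' * h / 2 \<le> l - \<delta> + h / 2" "2 * \<delta> - 2 * h \<le> real n' * h"
      by (rule Yb[OF y j(1,3) hY[OF j(2)] lY[OF j(2)]]; assumption)+
    \<comment> \<open>Positions within \<open>\<delta> / 4\<close> of the end of the index range
      still satisfy the distance estimate, and both runs are long enough to contain them.\<close>
    define q where "q = nat \<lfloor>\<delta> / (4 * h)\<rfloor>"
    have "real q \<le> \<delta> / (4 * h)" unfolding q_def using h \<delta> by (intro of_nat_floor) simp
    then have qh: "real q * h \<le> \<delta> / 4" using h by (simp add: field_simps)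
    have q1: "\<delta> / (4 * h) \<le> real q + 1" unfolding q_def by linarith
    have "real q * h \<le> real n * h" "real q * h \<le> real n' * h" using qh bx bY \<delta> by linarith+
    then have qn: "q \<le> n" "q \<le> n'" using h by auto
    \<comment> \<open>For \<open>k\<close> close to \<open>n'\<close> the longer vector joins the
      top of the upper run to a point near the bottom of the lower run. Both points lie in
      superlevel sets and hence in the ball of radius \<open>R0\<close>.\<close>
    have "?L + c * card {n' - q..n'} \<le> ?U"
    proof (rule run_pair_sum[OF kernelD(1)[OF g] D])
      show "{n' - q..n'} \<subseteq> {n' - n..n'}" using qn by auto
      fix k assume k: "k \<in> {n' - q..n'}"
      have kq: "real n' * h - real q * h \<le> real k * h"
      proof -
        have "real n' - real q \<le> real k" using k by auto
        then have "(real n' - real q) * h \<le> real k * h" using h by (intro mult_right_mono) auto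
        then show ?thesis by (simp add: left_diff_distrib)
      qed
      have xe: "s < v (x + real n *\<^sub>R d)" and ye: "t < v (y + real (n' - k) *\<^sub>R d)"
        using x y unfolding run_def by auto
      have nn: "norm (x + real n *\<^sub>R d) \<le> R0" "norm (y + real (n' - k) *\<^sub>R d) \<le> R0"
        using R0(2)[of "x + real n *\<^sub>R d"] R0(2)[of "y + real (n' - k) *\<^sub>R d"] xe ye i(2) j(2) by auto
      define aa bb where "aa = (- 1 - real k) * h" and "bb = (real n - real n' + real k) * h"
      have eqb: "(x - y) + bb *\<^sub>R e = (x + real n *\<^sub>R d) - (y + real (n' - k) *\<^sub>R d)"
        using k by (simp add: bb_def d_def of_nat_diff algebra_simps)
      have "norm ((x - y) + aa *\<^sub>R e) + \<delta>\<^sup>2 / R0 \<le> norm ((x - y) + bb *\<^sub>R e)"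
      proof (rule end_distance_gap[OF _ _ \<delta>(1) _ R0(1)])
        have "bb - aa = real n * h - real n' * h + 2 * (real k * h) + h" by (simp add: aa_def bb_def algebra_simps)
        then show "2 * \<delta> \<le> bb - aa" using kq qh bx bY \<delta> h by linarith
        have "2 * ((x - y) \<bullet> e) + (aa + bb) = 2 * (x \<bullet> e) - 2 * (y \<bullet> e) + real n * h - real n' * h - h"
          by (simp add: aa_def bb_def inner_diff_left algebra_simps)
        then show "2 * \<delta> \<le> 2 * ((x - y) \<bullet> e) + (aa + bb)" using bx bY \<delta> h by linarith
        show "norm ((x - y) + bb *\<^sub>R e) \<le> 2 * R0" unfolding eqb
          using norm_triangle_ineq4[of "x + real n *\<^sub>R d" "y + real (n' - k) *\<^sub>R d"] nn by linarith
      qed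
      moreover have "norm ((x - y) + bb *\<^sub>R e) \<le> 2 * R0" unfolding eqb
        using norm_triangle_ineq4[of "x + real n *\<^sub>R d" "y + real (n' - k) *\<^sub>R d"] nn by linarith
      ultimately have "g ((x - y) + bb *\<^sub>R e) + c \<le> g ((x - y) + aa *\<^sub>R e)" by (intro st)
      then show "g ((x - y) + (real n - real n' + real k) *\<^sub>R d) + c \<le> g ((x - y) + (- 1 - real k) *\<^sub>R d)"
        by (simp add: aa_def bb_def d_def)
    qed
    \<comment> \<open>Each ball contains at most \<open>3 * \<delta> / h\<close> points of a run, so
      \<open>?Sx * ?Sy\<close> is at most \<open>9 * \<delta>\<^sup>2 / h\<^sup>2\<close>;
      distributing the gain \<open>c * \<delta> / (4 * h)\<close> over these pairs gives the factor
      \<open>36\<close>.\<close>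
    moreover have "c * h / (36 * \<delta>) * ?Sx * ?Sy \<le> c * card {n' - q..n'}"
    proof -
      have S: "?Sx \<le> 3 * \<delta> / h" "?Sy \<le> 3 * \<delta> / h" using run_count[OF hd] i(2) j(2) by simp_all
      have S0: "0 \<le> ?Sx" "0 \<le> ?Sy" by (intro sum_nonneg; simp)+
      have "?Sx * ?Sy \<le> (3 * \<delta> / h) * (3 * \<delta> / h)" by (rule mult_mono) (use S S0 h \<delta> in auto)
      then have "c * h / (36 * \<delta>) * (?Sx * ?Sy) \<le> c * h / (36 * \<delta>) * ((3 * \<delta> / h) * (3 * \<delta> / h))"
        using c h \<delta> by (intro mult_left_mono) auto
      also have "\<dots> = c * (\<delta> / (4 * h))" using h \<delta> by (simp add: field_simps)
      also have "\<dots> \<le> c * card {n' - q..n'}" using q1 c qn by (intro mult_left_mono) auto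
      finally show ?thesis by (simp add: mult.assoc)
    qed
    ultimately show ?thesis by linarith
  qed
qed

end

section \<open>Constant sign of reflected differences\<close>

text \<open>The parts are nonnegative and add up to at most \<open>v\<close>, so the sum of their
  squares is at most \<open>v\<close> times their sum.\<close>

lemma (in fiber) sum_ip_part_le:
  assumes I: "finite I" and A: "\<And>i. i \<in> I \<Longrightarrow> A i \<in> sets borel" and dis: "disjoint_family_on A I"
  shows "(\<Sum>i\<in>I. ip (part (A i)) (part (A i))) \<le> ip v v"
proof -
  have int: "integrable lborel (\<lambda>x. part (A i) x * part (A i) x)" if "i \<in> I" for i
    using nice_mult_integrable[OF nice_part nice_part] A[OF that] by blast
  have "(\<Sum>i\<in>I. ip (part (A i)) (part (A i))) = (\<integral>x. (\<Sum>i\<in>I. part (A i) x * part (A i) x) \<partial>lborel)"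
    unfolding ip_def using int by (simp add: Bochner_Integration.integral_sum)
  also have "\<dots> \<le> (\<integral>x. v x * v x \<partial>lborel)"
  proof (rule integral_mono)
    show "integrable lborel (\<lambda>x. \<Sum>i\<in>I. part (A i) x * part (A i) x)" using int by (rule Bochner_Integration.integrable_sum)
    show "integrable lborel (\<lambda>x. v x * v x)" by (rule nice_mult_integrable[OF nv nv])
    fix x
    have "(\<Sum>i\<in>I. part (A i) x * part (A i) x) \<le> (\<Sum>i\<in>I. part (A i) x * v x)"
      using A by (intro sum_mono mult_left_mono part_le part_nonneg) auto
    also have "\<dots> = (\<Sum>i\<in>I. part (A i) x) * v x" by (simp add: sum_distrib_right)
    also have "\<dots> \<le> v x * v x" by (intro mult_right_mono part_sum[OF I A dis] v0)
    finally show "(\<Sum>i\<in>I. part (A i) x * part (A i) x) \<le> v x * v x" .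
  qed
  finally show ?thesis unfolding ip_def .
qed

lemma level_gap:
  fixes u :: "'a::euclidean_space \<Rightarrow> real"
  assumes u0: "\<And>x. 0 \<le> u x" and uc: "continuous_on UNIV u" and X: "u X' < u X"
  shows "\<exists>\<delta>>0. \<exists>\<alpha>>0. \<exists>\<beta>>\<alpha>. (\<forall>z\<in>ball X \<delta>. \<beta> \<le> u z) \<and> (\<forall>z\<in>ball X' \<delta>. u z \<le> \<alpha>)"
proof -
  define \<alpha> \<beta> where "\<alpha> = (2 * u X' + u X) / 3" and "\<beta> = (u X' + 2 * u X) / 3"
  have ab: "0 < \<alpha>" "\<alpha> < \<beta>" "\<beta> < u X" "u X' < \<alpha>" using X u0[of X'] by (auto simp: \<alpha>_def \<beta>_def)
  have "open {z. \<beta> < u z}" "open {z. u z < \<alpha>}"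
    using uc by (auto intro: open_Collect_less)
  moreover have "X \<in> {z. \<beta> < u z}" "X' \<in> {z. u z < \<alpha>}" using ab by auto
  ultimately obtain d1 d2 where "d1 > 0" "ball X d1 \<subseteq> {z. \<beta> < u z}" "d2 > 0" "ball X' d2 \<subseteq> {z. u z < \<alpha>}"
    by (meson openE)
  then show ?thesis using ab
    by (intro exI[of _ "min d1 d2"] conjI exI[of _ \<alpha>] exI[of _ \<beta>]) (auto simp: subset_iff intro: less_imp_le)
qed

context radial
begin

lemma ratom_small: assumes "0 < \<eta>" "0 < \<Lambda>" shows "\<exists>m1\<ge>0. \<forall>m\<ge>m1. ratom \<Lambda> (km m) \<le> \<eta>"
proof -
  obtain m0 \<rho> where \<rho>: "0 \<le> m0" "\<And>m x. m \<ge> m0 \<Longrightarrow> \<rho> x \<le> km m x" "integrable lborel \<rho>" "1 / \<eta> \<le> (\<integral>x. \<rho> x \<partial>lborel)"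
    using lipschitz_minorant[of "1 / \<eta>"] by blast
  have "ratom \<Lambda> (km m) \<le> \<eta>" if m: "m \<ge> m0" for m
  proof -
    have "(\<integral>x. \<rho> x \<partial>lborel) \<le> (\<integral>x. km m x \<partial>lborel)"
      by (rule integral_mono[OF \<rho>(3) km_integrable]) (use m \<rho> in auto)
    then have i: "1 / \<eta> \<le> \<Lambda> + 2 * (\<integral>x. km m x \<partial>lborel)" using \<rho>(4) assms by (smt (verit) divide_pos_pos)
    moreover have "0 < 1 / \<eta>" using assms by simp
    ultimately have "1 / (\<Lambda> + 2 * (\<integral>x. km m x \<partial>lborel)) \<le> 1 / (1 / \<eta>)" by (intro divide_left_mono mult_pos_pos) linarith+
    then show ?thesis by (simp add: ratom_def)
  qed
  then show ?thesis using \<rho>(1) by blast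
qed

text \<open>Here \<open>F s = f s + \<Lambda> s\<close> and \<open>1 / \<mu>\<close> is a Lipschitz constant of \<open>F\<close>; the last clause is the equation.\<close>
definition resolved :: "real \<Rightarrow> (real \<Rightarrow> real) \<Rightarrow> real \<Rightarrow> (real \<Rightarrow> 'a \<Rightarrow> real) \<Rightarrow> ('a \<Rightarrow> real) \<Rightarrow> bool" where
  "resolved \<Lambda> F \<mu> g u \<longleftrightarrow> 0 < \<mu> \<and> nice u \<and> nice (\<lambda>x. F (u x)) \<and> (\<forall>s\<ge>0. 0 \<le> F s) \<and> (\<forall>s t. 0 \<le> s \<longrightarrow> s < t \<longrightarrow> F s < F t)
     \<and> (\<forall>s>0. bounded {x. s < F (u x)}) \<and> (\<forall>s\<ge>0. \<mu> * F s \<le> s)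
     \<and> (\<forall>s t. 0 \<le> s \<longrightarrow> s \<le> t \<longrightarrow> s - \<mu> * F s \<le> t - \<mu> * F t)
     \<and> (\<forall>m\<ge>0. reskernel \<Lambda> (km m) (g m))
     \<and> (\<forall>\<eta>>0. \<exists>m1\<ge>0. \<forall>m\<ge>m1. nrm (\<lambda>x. Gop (ratom \<Lambda> (km m)) (g m) (\<lambda>x. F (u x)) x - u x) \<le> \<eta>)"

text \<open>The threshold \<open>\<Lambda>1\<close> depends on \<open>u\<close> and the two points
  alone, so that \<open>F\<close>, \<open>\<mu>\<close> and \<open>g\<close> can be constructed
  afterwards for a suitable \<open>\<Lambda>\<close>. The contradiction comes from summing the bound
  of \<open>single_plane_bound\<close> over the planes: the gain per plane is proportional to
  \<open>h\<close>, the number of planes to \<open>1 / h\<close>, and the total of the strip terms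
  is at most \<open>3 / q * ip v v\<close>.\<close>

lemma no_opposite_signs:
  assumes e: "norm e = 1" and u0: "\<And>x. 0 \<le> u x" and uc: "continuous_on UNIV u" and ub: "\<And>s. 0 < s \<Longrightarrow> bounded {x. s < u x}"
    and X: "l < X \<bullet> e" "u (rfl e l X) < u X" and Y: "Y \<bullet> e < l" "u (rfl e l Y) < u Y"
  shows "\<exists>\<Lambda>1>0. \<forall>\<Lambda>\<ge>\<Lambda>1. \<forall>F \<mu> g. \<not> resolved \<Lambda> F \<mu> g u"
proof -
  obtain d1 \<alpha>1 \<beta>1 where 1: "d1 > 0" "\<alpha>1 > 0" "\<beta>1 > \<alpha>1" "\<And>z. z \<in> ball X d1 \<Longrightarrow> \<beta>1 \<le> u z" "\<And>z. z \<in> ball (rfl e l X) d1 \<Longrightarrow> u z \<le> \<alpha>1"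
    using level_gap[OF u0 uc X(2)] by blast
  obtain d2 \<alpha>2 \<beta>2 where 2: "d2 > 0" "\<alpha>2 > 0" "\<beta>2 > \<alpha>2" "\<And>z. z \<in> ball Y d2 \<Longrightarrow> \<beta>2 \<le> u z" "\<And>z. z \<in> ball (rfl e l Y) d2 \<Longrightarrow> u z \<le> \<alpha>2"
    using level_gap[OF u0 uc Y(2)] by blast
  \<comment> \<open>The balls of radius \<open>2 * \<delta>\<close> fit into those given by the
    level gaps, and both points keep the distance \<open>2 * \<delta>\<close> from the
    plane.\<close>
  define \<delta> where "\<delta> = min (min d1 d2) (min (X \<bullet> e - l) (l - Y \<bullet> e)) / 2"
  have \<delta>: "0 < \<delta>" "2 * \<delta> \<le> d1" "2 * \<delta> \<le> d2" "l + 2 * \<delta> \<le> X \<bullet> e" "Y \<bullet> e \<le> l - 2 * \<delta>"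
    using 1(1) 2(1) X(1) Y(1) by (auto simp: \<delta>_def min_def)
  have "bounded {x. min \<alpha>1 \<alpha>2 < u x}" using 1(2) 2(2) by (intro ub) simp
  then obtain R0 where R0: "0 < R0" "\<And>z. min \<alpha>1 \<alpha>2 < u z \<Longrightarrow> norm z \<le> R0" unfolding bounded_pos by blast
  have p: "0 < \<delta>\<^sup>2 / R0" "0 \<le> 2 * R0" using \<delta>(1) R0(1) by auto
  obtain \<Lambda>1 where \<Lambda>1: "\<Lambda>1 > 0" and ST: "\<And>\<Lambda>. \<Lambda> \<ge> \<Lambda>1 \<Longrightarrow> \<exists>c>0. \<exists>m0\<ge>0. \<forall>m\<ge>m0. \<forall>g. reskernel \<Lambda> (km m) g \<longrightarrow>
     (\<forall>x y. norm y \<le> 2 * R0 \<longrightarrow> norm x + \<delta>\<^sup>2 / R0 \<le> norm y \<longrightarrow> g y + c \<le> g x)"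
    using strictness[OF p] by blast
  have False if L: "\<Lambda> \<ge> \<Lambda>1" and r: "resolved \<Lambda> F \<mu> g u" for \<Lambda> F \<mu> g
  proof -
    define v where "v = (\<lambda>x. F (u x))"
    have \<Lambda>: "\<Lambda> > 0" using L \<Lambda>1 by simp
    note r' = r[unfolded resolved_def, folded v_def]
    have \<mu>: "0 < \<mu>" and nu: "nice u" and nv: "nice v" and F0: "\<And>s. 0 \<le> s \<Longrightarrow> 0 \<le> F s"
      and Fs: "\<And>s t. 0 \<le> s \<Longrightarrow> s < t \<Longrightarrow> F s < F t" and vb: "\<And>s. 0 < s \<Longrightarrow> bounded {x. s < v x}"
      and F\<mu>: "\<And>s. 0 \<le> s \<Longrightarrow> \<mu> * F s \<le> s" "\<And>s t. 0 \<le> s \<Longrightarrow> s \<le> t \<Longrightarrow> s - \<mu> * F s \<le> t - \<mu> * F t"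
      and rk: "\<And>m. 0 \<le> m \<Longrightarrow> reskernel \<Lambda> (km m) (g m)"
      and lim: "\<And>\<eta>. 0 < \<eta> \<Longrightarrow> \<exists>m1\<ge>0. \<forall>m\<ge>m1. nrm (\<lambda>x. Gop (ratom \<Lambda> (km m)) (g m) v x - u x) \<le> \<eta>"
      using r' by (auto simp: v_def)
    have v0: "0 \<le> v x" for x unfolding v_def by (rule F0[OF u0])
    have Fm: "F s \<le> F t" if "0 \<le> s" "s \<le> t" for s t using Fs[OF that(1), of t] that(2) by (cases "s = t") (simp_all add: less_imp_le)
    have Fi: "s \<le> t" if "0 \<le> t" "F s \<le> F t" for s t using Fs[OF that(1), of s] that(2) by (meson not_le)
    obtain c m0 where c: "0 < c" "0 \<le> m0" "\<And>m g x y. m \<ge> m0 \<Longrightarrow> reskernel \<Lambda> (km m) g \<Longrightarrow> norm y \<le> 2 * R0 \<Longrightarrow> norm x + \<delta>\<^sup>2 / R0 \<le> norm y \<Longrightarrow> g y + c \<le> g x"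
      using ST[OF L] by blast
    \<comment> \<open>The gain per unit of \<open>h\<close>. It involves neither \<open>h\<close>
      nor \<open>m\<close>, because \<open>c\<close> serves all \<open>m\<close> from
      \<open>m0\<close> on.\<close>
    define \<kappa> where "\<kappa> = c / (36 * \<delta>) * ((F \<beta>1 - F \<alpha>1) * measure lborel (ball X \<delta>)) * ((F \<beta>2 - F \<alpha>2) * measure lborel (ball Y \<delta>))"
    have \<kappa>: "\<kappa> > 0"
      unfolding \<kappa>_def using c(1) \<delta>(1) 1 2 Fs ball_vol_pos[OF \<delta>(1)] by (intro mult_pos_pos) auto
    define V where "V = ip v v"
    have V: "0 \<le> V" unfolding V_def by (rule ip_nonneg)
    \<comment> \<open>The first entry makes the strip terms at most
      \<open>\<delta> * \<kappa> / 32\<close> in total, the second gives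
      \<open>1 / q \<le> \<mu> / 2\<close>.\<close>
    define R where "R = max (96 * V / (\<delta> * \<kappa>)) (2 / \<mu>)"
    obtain m2 \<rho> C where \<rho>: "0 \<le> m2" "\<And>x. 0 \<le> \<rho> x" "\<And>m x. m \<ge> m2 \<Longrightarrow> \<rho> x \<le> km m x" "integrable lborel \<rho>" "R \<le> (\<integral>x. \<rho> x \<partial>lborel)"
      and C: "0 \<le> C" "\<And>d. norm d \<le> 1 \<Longrightarrow> (\<integral>x. \<bar>\<rho> (x + d) - \<rho> x\<bar> \<partial>lborel) \<le> C * norm d"
      using lipschitz_minorant[of R] by blast
    define q where "q = \<Lambda> + 2 * (\<integral>x. \<rho> x \<partial>lborel)"
    have R: "2 / \<mu> \<le> R" "96 * V / (\<delta> * \<kappa>) \<le> R" by (auto simp: R_def)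
    have R0': "0 < R" using \<mu> R(1) by (intro less_le_trans[OF _ R(1)]) simp
    have qR: "R \<le> q" using \<rho>(5) R0' \<Lambda> by (simp add: q_def)
    have q0: "0 < q" using qR R0' by simp
    have q\<mu>: "1 / q \<le> \<mu> / 2"
    proof -
      have "1 / q \<le> 1 / (2 / \<mu>)" using R(1) qR \<mu> q0 by (intro divide_left_mono) auto
      then show ?thesis by simp
    qed
    have "96 * V / (\<delta> * \<kappa>) \<le> q" using R qR by simp
    then have "96 * V \<le> q * (\<delta> * \<kappa>)" using \<delta>(1) \<kappa> by (simp add: pos_divide_le_eq)
    then have qV: "3 / q * V \<le> \<delta> * \<kappa> / 32" using q0 by (simp add: pos_divide_le_eq mult.commute)
    define \<beta> where "\<beta> = (C * nrm v / (\<Lambda> * q))\<^sup>2 / \<mu>"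
    have \<beta>: "0 \<le> \<beta>" unfolding \<beta>_def using \<mu> by simp
    \<comment> \<open>In this order: the modulus of \<open>\<rho>\<close> is known for displacements
      up to 1; the geometry of the runs needs \<open>8 * h \<le> \<delta>\<close>; the strip
      estimate needs \<open>2 * C * h \<le> \<Lambda>\<close>; and the quadratic error becomes at
      most \<open>\<kappa> * h / 8\<close>.\<close>
    define h where "h = min (min 1 (\<delta> / 8)) (min (\<Lambda> / (2 * C + 1)) (\<kappa> / (8 * \<beta> + 1)))"
    have "0 < h" using \<delta>(1) \<Lambda> C(1) \<kappa> \<beta> by (simp add: h_def)
    then have hh: "0 < h" "h \<le> 1" "h \<le> \<delta> / 8" "h \<le> \<Lambda> / (2 * C + 1)" "h \<le> \<kappa> / (8 * \<beta> + 1)"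
      unfolding h_def by linarith+
    have hC: "2 * C * h \<le> \<Lambda>" using hh(1,4) C(1) by (simp add: pos_le_divide_eq algebra_simps)
    have h\<beta>: "\<beta> * h \<le> \<kappa> / 8" using hh(1,5) \<beta> by (simp add: pos_le_divide_eq algebra_simps)
    \<comment> \<open>Tolerances for the atom and for the resolvent error, so that each costs at
      most one sixteenth of \<open>\<kappa> * h\<close> at a plane. They may depend on
      \<open>h\<close> because \<open>m\<close> is chosen last.\<close>
    define \<eta>1 \<eta>2 where "\<eta>1 = h * \<kappa> / (64 * (V + 1))" and "\<eta>2 = h * \<kappa> / (32 * (nrm v + 1))"
    have \<eta>: "\<eta>1 > 0" "\<eta>2 > 0" using hh(1) \<kappa> V nrm_nonneg[of v] by (auto simp: \<eta>1_def \<eta>2_def intro!: divide_pos_pos add_nonneg_pos)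
    obtain m3 where m3: "0 \<le> m3" "\<And>m. m \<ge> m3 \<Longrightarrow> ratom \<Lambda> (km m) \<le> \<eta>1" using ratom_small[OF \<eta>(1) \<Lambda>] by blast
    obtain m4 where m4: "0 \<le> m4" "\<And>m. m \<ge> m4 \<Longrightarrow> nrm (\<lambda>x. Gop (ratom \<Lambda> (km m)) (g m) v x - u x) \<le> \<eta>2" using lim[OF \<eta>(2)] by blast
    define m where "m = max (max m0 m2) (max m3 m4)"
    have m: "m \<ge> m0" "m \<ge> m2" "m \<ge> m3" "m \<ge> m4" "m \<ge> 0" using c(2) by (auto simp: m_def)
    define a where "a = ratom \<Lambda> (km m)"
    have err1: "4 * a * V \<le> h * \<kappa> / 16"
    proof -
      have "4 * a * V \<le> 4 * \<eta>1 * (V + 1)" using m3(2)[OF m(3)] V \<eta> mult_mono[of "4 * a" "4 * \<eta>1" V "V + 1"] by (simp add: a_def)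
      also have "\<dots> = h * \<kappa> / 16" using V by (simp add: \<eta>1_def field_simps)
      finally show ?thesis .
    qed
    have err2: "2 * nrm v * nrm (\<lambda>x. Gop a (g m) v x - u x) \<le> h * \<kappa> / 16"
    proof -
      have "2 * nrm v * nrm (\<lambda>x. Gop a (g m) v x - u x) \<le> 2 * (nrm v + 1) * \<eta>2"
      proof (rule mult_mono)
        show "2 * nrm v \<le> 2 * (nrm v + 1)" "0 \<le> 2 * (nrm v + 1)" using nrm_nonneg[of v] by simp_all
      qed (use m4(2)[OF m(4)] nrm_nonneg in \<open>simp_all add: a_def\<close>)
      also have "\<dots> = h * \<kappa> / 16" using nrm_nonneg[of v] by (simp add: \<eta>2_def field_simps)
      finally show ?thesis .
    qed
    interpret fiber v e h by unfold_locales (use e hh(1) nv v0 vb in auto)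
    have nd: "norm d = h" using e hh(1) by (simp add: d_def)
    \<comment> \<open>All planes stay within \<open>\<delta> / 4\<close> of the first one, so the
      same two balls serve every plane.\<close>
    define J where "J = nat \<lfloor>\<delta> / (4 * h)\<rfloor>"
    have "real J \<le> \<delta> / (4 * h)" unfolding J_def using hh \<delta> by (intro of_nat_floor) simp
    then have Jh: "real J * h \<le> \<delta> / 4" using hh(1) by (simp add: field_simps)
    have "\<delta> / (4 * h) \<le> real J + 1" unfolding J_def by linarith
    then have "\<delta> / 4 \<le> (real J + 1) * h" using hh(1) by (simp add: field_simps)
    then have Jh2: "\<delta> / 8 \<le> real J * h" using hh(3) by (simp add: distrib_right)
    \<comment> \<open>The three errors take one eighth and twice one sixteenth of
      \<open>\<kappa> * h\<close>; three quarters remain.\<close>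
    have plane: "3 / 4 * \<kappa> * h \<le> 3 / q * ip (part {l + real j * h - h / 2<..l + real j * h + h / 2}) (part {l + real j * h - h / 2<..l + real j * h + h / 2})"
      if j: "j < J" for j
    proof -
      let ?l = "l + real j * h"
      have jh: "0 \<le> real j * h" "real j * h + h \<le> \<delta> / 4"
        using mult_right_mono[of "real j + 1" "real J" h] j hh(1) Jh by (auto simp: distrib_right)
      have "real j * h + h < \<delta>" "h / 2 - \<delta> \<le> real j * h" using jh \<delta>(1) hh(1,3) by linarith+
      have gain: "ip (part {?l + h / 2<..}) (conv (g m) (part {..?l})) + \<kappa> * h \<le> ip (\<lambda>x. part {?l + h / 2<..} (x + d)) (conv (g m) (part {..?l}))"
      proof -
        have "ip (part {?l + h / 2<..}) (conv (g m) (part {..?l}))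
          + c * h / (36 * \<delta>) * ((F \<beta>1 - F \<alpha>1) * measure lborel (ball X \<delta>)) * ((F \<beta>2 - F \<alpha>2) * measure lborel (ball Y \<delta>))
          \<le> ip (\<lambda>x. part {?l + h / 2<..} (x + d)) (conv (g m) (part {..?l}))"
        proof (rule strict_gain[OF rk_kernel[OF rkernel_km[OF m(5)] \<Lambda> rk[OF m(5)] HOL.refl], where l = l and \<delta> = \<delta> and ?a1.0 = "F \<alpha>1" and ?b1.0 = "F \<beta>1" and ?a2.0 = "F \<alpha>2" and ?b2.0 = "F \<beta>2" and ?R0.0 = R0 and X = X and Y = Y and c = c])
          show "{l + \<delta> - h / 2..} \<subseteq> {?l + h / 2<..}" "{..l - \<delta> + h / 2} \<subseteq> {..?l}"
            using \<open>real j * h + h < \<delta>\<close> \<open>h / 2 - \<delta> \<le> real j * h\<close> by auto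
          show "F \<beta>1 \<le> v z" if "z \<in> ball X (2 * \<delta>)" for z
            unfolding v_def using 1(2,3) 1(4)[of z] that \<delta>(2) by (intro Fm) auto
          show "v z \<le> F \<alpha>1" if "z \<in> ball (rfl e l X) (2 * \<delta>)" for z
            unfolding v_def using 1(5)[of z] that \<delta>(2) by (intro Fm u0) auto
          show "F \<beta>2 \<le> v z" if "z \<in> ball Y (2 * \<delta>)" for z
            unfolding v_def using 2(2,3) 2(4)[of z] that \<delta>(3) by (intro Fm) auto
          show "v z \<le> F \<alpha>2" if "z \<in> ball (rfl e l Y) (2 * \<delta>)" for z
            unfolding v_def using 2(5)[of z] that \<delta>(3) by (intro Fm u0) auto
          show "0 < F \<alpha>1" "0 < F \<alpha>2" using Fs[of 0 \<alpha>1] Fs[of 0 \<alpha>2] F0[of 0] 1(2) 2(2) by auto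
          show "F \<alpha>1 \<le> F \<beta>1" "F \<alpha>2 \<le> F \<beta>2" using Fm 1(2,3) 2(2,3) by auto
          show "norm z \<le> R0" if z: "min (F \<alpha>1) (F \<alpha>2) < v z" for z
          proof (rule R0(2), rule ccontr)
            assume "\<not> min \<alpha>1 \<alpha>2 < u z"
            then have "u z \<le> \<alpha>1" "u z \<le> \<alpha>2" by auto
            then have "v z \<le> F \<alpha>1" "v z \<le> F \<alpha>2" unfolding v_def by (auto intro: Fm u0)
            then show False using z by simp
          qed
          show "g m y + c \<le> g m x" if "norm y \<le> 2 * R0" "norm x + \<delta>\<^sup>2 / R0 \<le> norm y" for x y
            by (rule c(3)[OF m(1) rk[OF m(5)] that])
        qed (use hh \<delta> R0(1) c(1) in auto)
        then show ?thesis by (simp add: \<kappa>_def mult_ac)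
      qed
      have "\<kappa> * h \<le> 3 / q * ip (part {?l - h / 2<..?l + h / 2}) (part {?l - h / 2<..?l + h / 2})
         + (C * nrm v / (\<Lambda> * q))\<^sup>2 / \<mu> * h\<^sup>2 + 4 * a * ip v v + 2 * nrm v * nrm (\<lambda>x. Gop a (g m) v x - u x)"
      proof (rule single_plane_bound[OF rkernel_km[OF m(5)] \<Lambda> rk[OF m(5)] a_def \<rho>(4,2) \<rho>(3)[OF m(2)] C(1) _ hC q_def \<mu> q\<mu> nu _ _ gain])
        show "(\<integral>x. \<bar>\<rho> (x + d) - \<rho> x\<bar> \<partial>lborel) \<le> C * h" using C(2)[of d] nd hh(2) by simp
        show "\<mu> * v x \<le> u x" for x unfolding v_def by (rule F\<mu>(1)[OF u0])
        show "u x - \<mu> * v x \<le> u y - \<mu> * v y" if "v x \<le> v y" for x y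
          unfolding v_def by (rule F\<mu>(2)[OF u0 Fi[OF u0]]) (use that in \<open>simp add: v_def\<close>)
      qed
      moreover have "(C * nrm v / (\<Lambda> * q))\<^sup>2 / \<mu> * h\<^sup>2 \<le> \<kappa> / 8 * h"
        using mult_right_mono[OF h\<beta>, of h] hh(1) unfolding \<beta>_def[symmetric] by (simp add: power2_eq_square mult.assoc)
      ultimately show ?thesis using err1 err2 unfolding V_def by (simp add: mult_ac)
    qed
    \<comment> \<open>As \<open>real J * h\<close> is at least \<open>\<delta> / 8\<close>, the left
      side is at least \<open>3 * \<delta> * \<kappa> / 32\<close>, while the strips, being
      disjoint, contribute at most \<open>\<delta> * \<kappa> / 32\<close>.\<close>
    have "real J * (3 / 4 * \<kappa> * h) \<le> (\<Sum>j<J. 3 / q * ip (part {l + real j * h - h / 2<..l + real j * h + h / 2}) (part {l + real j * h - h / 2<..l + real j * h + h / 2}))"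
      using sum_mono[of "{..<J}" "\<lambda>j. 3 / 4 * \<kappa> * h"] plane by simp
    also have "\<dots> = 3 / q * (\<Sum>j<J. ip (part {l + real j * h - h / 2<..l + real j * h + h / 2}) (part {l + real j * h - h / 2<..l + real j * h + h / 2}))"
      by (simp only: sum_distrib_left)
    also have "\<dots> \<le> 3 / q * V" unfolding V_def
    proof (intro mult_left_mono sum_ip_part_le)
      show "disjoint_family_on (\<lambda>j. {l + real j * h - h / 2<..l + real j * h + h / 2}) {..<J}"
        unfolding disjoint_family_on_def
      proof (intro ballI impI)
        fix i j :: nat assume "i \<noteq> j"
        then have "real i + 1 \<le> real j \<or> real j + 1 \<le> real i" by linarith
        then have "real i * h + h \<le> real j * h \<or> real j * h + h \<le> real i * h"
          using mult_right_mono[of "real i + 1" "real j" h] mult_right_mono[of "real j + 1" "real i" h] hh(1) by (auto simp: distrib_right)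
        then show "{l + real i * h - h / 2<..l + real i * h + h / 2} \<inter> {l + real j * h - h / 2<..l + real j * h + h / 2} = {}"
          by auto
      qed
    qed (use q0 in auto)
    also note qV
    finally have "(real J * h) * (3 / 4 * \<kappa>) \<le> \<delta> * \<kappa> / 32" by (simp add: mult_ac)
    moreover have "\<delta> / 8 * (3 / 4 * \<kappa>) \<le> (real J * h) * (3 / 4 * \<kappa>)" using Jh2 \<kappa> by (intro mult_right_mono) auto
    moreover have "0 < \<delta> * \<kappa>" using \<delta>(1) \<kappa> by simp
    ultimately show False by simp
  qed
  then show ?thesis using \<Lambda>1 by blast
qed

end

lemma nrm_ball_lower:
  assumes \<phi>: "nice \<phi>" and t: "0 \<le> t" "\<And>x. x \<in> ball y \<rho> \<Longrightarrow> t \<le> \<bar>\<phi> x\<bar>"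
  shows "t\<^sup>2 * measure lborel (ball y \<rho>) \<le> (nrm \<phi>)\<^sup>2"
proof -
  have fin: "emeasure lborel (ball y \<rho>) < \<infinity>" using emeasure_lborel_ball_finite[of y \<rho>] by simp
  have "t\<^sup>2 * measure lborel (ball y \<rho>) = (\<integral>x. t\<^sup>2 * indicator (ball y \<rho>) x \<partial>lborel)" by simp
  also have "\<dots> \<le> (\<integral>x. \<phi> x * \<phi> x \<partial>lborel)"
  proof (rule integral_mono)
    show "integrable lborel (\<lambda>x. t\<^sup>2 * indicator (ball y \<rho>) x)" using fin by (intro integrable_mult_right integrable_real_indicator) auto
    show "integrable lborel (\<lambda>x. \<phi> x * \<phi> x)" by (rule nice_mult_integrable[OF \<phi> \<phi>])
    fix x show "t\<^sup>2 * indicator (ball y \<rho>) x \<le> \<phi> x * \<phi> x"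
    proof (cases "x \<in> ball y \<rho>")
      case True
      have "t\<^sup>2 \<le> \<bar>\<phi> x\<bar>\<^sup>2" by (rule power_mono[OF t(2)[OF True] t(1)])
      then show ?thesis using True by (simp add: power2_eq_square)
    qed simp
  qed
  also have "\<dots> = (nrm \<phi>)\<^sup>2" by (simp add: nrm_sq ip_def)
  finally show ?thesis .
qed

context radial
begin

text \<open>The reflected difference of \<open>v\<close> lies in the cone and is bounded below near
  \<open>y0\<close>, so by propagation its image under the resolvent is bounded below near
  \<open>y1\<close>, uniformly in \<open>m\<close>. These images converge in mean square to the
  reflected difference of \<open>u\<close>, which by continuity would be smaller near
  \<open>y1\<close> if the claim failed.\<close>

lemma one_sided_strict:
  assumes e: "norm e = 1" and u0: "\<And>x. 0 \<le> u x" and uc: "continuous_on UNIV u"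
    and half: "\<And>x. x \<bullet> e \<le> l \<Longrightarrow> u (rfl e l x) \<le> u x"
    and y0: "y0 \<bullet> e < l" "u (rfl e l y0) < u y0" and y1: "y1 \<bullet> e < l"
  shows "\<exists>\<Lambda>1>0. \<forall>\<Lambda>\<ge>\<Lambda>1. \<forall>F \<mu> g. resolved \<Lambda> F \<mu> g u \<longrightarrow> u (rfl e l y1) < u y1"
proof -
  obtain d1 \<alpha> \<beta> where 1: "d1 > 0" "\<alpha> > 0" "\<beta> > \<alpha>" "\<And>z. z \<in> ball y0 d1 \<Longrightarrow> \<beta> \<le> u z" "\<And>z. z \<in> ball (rfl e l y0) d1 \<Longrightarrow> u z \<le> \<alpha>"
    using level_gap[OF u0 uc y0(2)] by blast
  define \<rho> where "\<rho> = min (min (d1 / 2) (r0 / 6)) (min ((l - y0 \<bullet> e) / 4) ((l - y1 \<bullet> e) / 4))"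
  have \<rho>: "0 < \<rho>" unfolding \<rho>_def using 1(1) r0_pos y0(1) y1 by simp
  have \<rho>': "2 * \<rho> \<le> d1" "5 * \<rho> < r0" "y0 \<bullet> e \<le> l - 4 * \<rho>" "y1 \<bullet> e \<le> l - 4 * \<rho>"
  proof -
    have "\<rho> \<le> d1 / 2" "\<rho> \<le> r0 / 6" "\<rho> \<le> (l - y0 \<bullet> e) / 4" "\<rho> \<le> (l - y1 \<bullet> e) / 4" by (auto simp only: \<rho>_def min.coboundedI1 min.coboundedI2 order_refl)
    then show "2 * \<rho> \<le> d1" "5 * \<rho> < r0" "y0 \<bullet> e \<le> l - 4 * \<rho>" "y1 \<bullet> e \<le> l - 4 * \<rho>" using r0_pos
      by (simp_all add: pos_le_divide_eq algebra_simps)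
  qed
  obtain \<Lambda>1 where \<Lambda>1: "\<Lambda>1 > 0" and PR: "\<forall>\<Lambda>\<ge>\<Lambda>1. \<exists>c>0. \<exists>m0\<ge>0. \<forall>m\<ge>m0. \<forall>g. reskernel \<Lambda> (km m) g \<longrightarrow>
     (\<forall>e l \<phi> y0' y1' \<epsilon>. norm e = 1 \<longrightarrow> ascone e l \<phi> \<longrightarrow> y0' \<bullet> e \<le> l - 4 * \<rho> \<longrightarrow> y1' \<bullet> e \<le> l - 4 * \<rho> \<longrightarrow>
        norm (y1' - y0') \<le> norm (y1 - y0) \<longrightarrow> 0 \<le> \<epsilon> \<longrightarrow> (\<forall>x\<in>ball y0' (2 * \<rho>). \<epsilon> \<le> \<phi> x) \<longrightarrow>
        (\<forall>x\<in>ball y1' \<rho>. c * \<epsilon> \<le> Gop (ratom \<Lambda> (km m)) g \<phi> x))"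
    using propagation[OF \<rho> \<rho>'(2) norm_ge_zero[of "y1 - y0"]] by (elim exE conjE) (rule that)
  have "u (rfl e l y1) < u y1" if L: "\<Lambda> \<ge> \<Lambda>1" and r: "resolved \<Lambda> F \<mu> g u" for \<Lambda> F \<mu> g
  proof (rule ccontr)
    assume neg: "\<not> ?thesis"
    define v where "v = (\<lambda>x. F (u x))"
    have \<Lambda>: "\<Lambda> > 0" using L \<Lambda>1 by simp
    have nu: "nice u" and nv: "nice v" and Fs: "\<And>s t. 0 \<le> s \<Longrightarrow> s < t \<Longrightarrow> F s < F t"
      and rk: "\<And>m. 0 \<le> m \<Longrightarrow> reskernel \<Lambda> (km m) (g m)"
      and lim: "\<And>\<eta>. 0 < \<eta> \<Longrightarrow> \<exists>m1\<ge>0. \<forall>m\<ge>m1. nrm (\<lambda>x. Gop (ratom \<Lambda> (km m)) (g m) v x - u x) \<le> \<eta>"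
      using r by (auto simp: v_def resolved_def)
    have Fm: "F s \<le> F t" if "0 \<le> s" "s \<le> t" for s t using Fs[OF that(1), of t] that(2) by (cases "s = t") (simp_all add: less_imp_le)
    obtain c m0 where c: "0 < c" "0 \<le> m0" and PR': "\<forall>m\<ge>m0. \<forall>g. reskernel \<Lambda> (km m) g \<longrightarrow>
     (\<forall>e l \<phi> y0' y1' \<epsilon>. norm e = 1 \<longrightarrow> ascone e l \<phi> \<longrightarrow> y0' \<bullet> e \<le> l - 4 * \<rho> \<longrightarrow> y1' \<bullet> e \<le> l - 4 * \<rho> \<longrightarrow>
        norm (y1' - y0') \<le> norm (y1 - y0) \<longrightarrow> 0 \<le> \<epsilon> \<longrightarrow> (\<forall>x\<in>ball y0' (2 * \<rho>). \<epsilon> \<le> \<phi> x) \<longrightarrow>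
        (\<forall>x\<in>ball y1' \<rho>. c * \<epsilon> \<le> Gop (ratom \<Lambda> (km m)) g \<phi> x))"
      using PR[THEN spec, THEN mp, OF L] by (elim exE conjE) (rule that)
    define \<phi> where "\<phi> = (\<lambda>x. v x - v (rfl e l x))"
    have mr: "mpres (rfl e l)" by (rule mpres_rfl[OF e])
    have nvr: "nice (\<lambda>x. v (rfl e l x))" by (rule nice_mpres[OF nv mr])
    have cone: "ascone e l \<phi>"
      unfolding ascone_def \<phi>_def
    proof (intro conjI allI impI)
      show "bdm (\<lambda>x. v x - v (rfl e l x))" by (intro nice_bdm nice_diff nv nvr)
      show "0 \<le> v x - v (rfl e l x)" if "x \<bullet> e \<le> l" for x
        unfolding v_def using Fm[OF u0 half[OF that]] by simp
    qed (simp add: rfl_rfl[OF e])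
    define \<epsilon> where "\<epsilon> = F \<beta> - F \<alpha>"
    have \<epsilon>: "0 < \<epsilon>" unfolding \<epsilon>_def using Fs[of \<alpha> \<beta>] 1 by simp
    have lowb: "\<forall>x\<in>ball y0 (2 * \<rho>). \<epsilon> \<le> \<phi> x"
    proof
      fix x assume x: "x \<in> ball y0 (2 * \<rho>)"
      have "rfl e l x \<in> ball (rfl e l y0) d1" using x \<rho>'(1) by (simp add: dist_norm norm_rfl_diff[OF e])
      moreover have "x \<in> ball y0 d1" using x \<rho>'(1) by simp
      ultimately show "\<epsilon> \<le> \<phi> x"
        unfolding \<epsilon>_def \<phi>_def v_def using 1 by (intro diff_mono Fm u0) auto
    qed
    \<comment> \<open>Half of the uniform lower bound; the other half separates the image from
      \<open>w\<close> near \<open>y1\<close>.\<close>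
    define t where "t = c * \<epsilon> / 2"
    have t: "t > 0" using c \<epsilon> by (simp add: t_def)
    define w where "w = (\<lambda>x. u x - u (rfl e l x))"
    have nw: "nice w" unfolding w_def by (intro nice_diff nu nice_mpres mr)
    have "continuous_on UNIV w" unfolding w_def rfl_def
      by (intro continuous_intros continuous_on_compose2[OF uc]) auto
    then have "open {x. w x < t}" by (auto intro: open_Collect_less)
    moreover have "y1 \<in> {x. w x < t}" using neg t by (simp add: w_def)
    ultimately obtain d2 where d2: "d2 > 0" "ball y1 d2 \<subseteq> {x. w x < t}" by (meson openE)
    define \<rho>2 where "\<rho>2 = min \<rho> d2"
    have \<rho>2: "0 < \<rho>2" "ball y1 \<rho>2 \<subseteq> ball y1 \<rho>" "ball y1 \<rho>2 \<subseteq> ball y1 d2" using \<rho> d2 by (auto simp: \<rho>2_def)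
    \<comment> \<open>A third of the mean square distance forced by the gap \<open>t\<close>; the
      error enters once directly and once reflected, so twice \<open>\<eta>\<close> must not reach
      it.\<close>
    define \<eta> where "\<eta> = sqrt (t\<^sup>2 * measure lborel (ball y1 \<rho>2)) / 3"
    have \<eta>: "\<eta> > 0" unfolding \<eta>_def using t ball_vol_pos[OF \<rho>2(1)] by simp
    obtain m1 where m1: "0 \<le> m1" "\<And>m. m \<ge> m1 \<Longrightarrow> nrm (\<lambda>x. Gop (ratom \<Lambda> (km m)) (g m) v x - u x) \<le> \<eta>" using lim[OF \<eta>] by blast
    define m where "m = max m0 m1"
    have m: "m \<ge> m0" "m \<ge> m1" "0 \<le> m" using c(2) by (auto simp: m_def)
    note K = rkernel_km[OF m(3)] and rkm = rk[OF m(3)]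
    define G where "G = Gop (ratom \<Lambda> (km m)) (g m)"
    have big: "c * \<epsilon> \<le> G \<phi> x" if "x \<in> ball y1 \<rho>" for x unfolding G_def
      by (rule PR'[THEN spec, THEN mp, OF m(1), THEN spec, THEN mp, OF rkm, rule_format, OF e cone \<rho>'(3,4) order_refl less_imp_le[OF \<epsilon>] _ that])
        (use lowb in auto)
    define E where "E = (\<lambda>x. G v x - u x)"
    have nG: "nice (G f)" if "nice f" for f unfolding G_def by (rule nice_Gop[OF K \<Lambda> rkm HOL.refl that])
    have nE: "nice E" unfolding E_def by (intro nice_diff nG nv nu)
    have eq: "G \<phi> x - w x = E x - E (rfl e l x)" for x
      using Gop_diff[OF K \<Lambda> rkm HOL.refl nice_bdm[OF nv] nice_bdm[OF nvr]] Gop_rfl[OF K \<Lambda> rkm HOL.refl e nice_bdm[OF nv]]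
      by (simp add: \<phi>_def w_def E_def G_def)
    have "t\<^sup>2 * measure lborel (ball y1 \<rho>2) \<le> (nrm (\<lambda>x. G \<phi> x - w x))\<^sup>2"
    proof (rule nrm_ball_lower)
      show "nice (\<lambda>x. G \<phi> x - w x)" unfolding \<phi>_def by (intro nice_diff nG nv nvr nw)
      fix x assume "x \<in> ball y1 \<rho>2"
      then have "c * \<epsilon> \<le> G \<phi> x" "w x < t" using big \<rho>2 d2 by auto
      then show "t \<le> \<bar>G \<phi> x - w x\<bar>" using t by (simp add: t_def)
    qed (use t in simp)
    then have "sqrt (t\<^sup>2 * measure lborel (ball y1 \<rho>2)) \<le> nrm (\<lambda>x. G \<phi> x - w x)"
      by (rule real_le_lsqrt[OF nrm_nonneg])
    also have "\<dots> \<le> nrm E + nrm (\<lambda>x. E (rfl e l x))" unfolding eq by (rule nrm_triangle_diff[OF nE nice_mpres[OF nE mr]])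
    also have "\<dots> = 2 * nrm E" by (simp add: nrm_mpres[OF nE mr])
    also have "\<dots> \<le> 2 * \<eta>" using m1(2)[OF m(2)] by (simp add: E_def G_def)
    finally have "3 * \<eta> \<le> 2 * \<eta>" by (simp add: \<eta>_def)
    then show False using \<eta> by simp
  qed
  then show ?thesis using \<Lambda>1 by blast
qed

end

section \<open>The energy form and convergence of the resolvents\<close>

text \<open>After the substitution \<open>z = x - y\<close> the energy form is the integral of the
  kernel at \<open>z\<close> times \<open>ip (df z v) (df z w)\<close>, so all energy estimates
  reduce to mean square norms of differences.\<close>

definition df :: "'a::euclidean_space \<Rightarrow> ('a \<Rightarrow> real) \<Rightarrow> 'a \<Rightarrow> real" where
  "df z \<phi> = (\<lambda>x. \<phi> x - \<phi> (x - z))"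

lemma nice_df: "nice \<phi> \<Longrightarrow> nice (df z \<phi>)"
  unfolding df_def by (rule nice_diff[OF _ nice_mpres[OF _ mpres_diff_right]])

lemma df_zero: "df 0 \<phi> = (\<lambda>x. 0)" by (auto simp: df_def)

lemma ip_df_measurable:
  assumes [measurable]: "\<phi> \<in> borel_measurable borel" "\<psi> \<in> borel_measurable borel"
  shows "(\<lambda>z. ip (df z \<phi>) (df z \<psi>)) \<in> borel_measurable borel"
  unfolding ip_def df_def by measurable

lemma nrm_df_measurable: "\<phi> \<in> borel_measurable borel \<Longrightarrow> (\<lambda>z. nrm (df z \<phi>)) \<in> borel_measurable borel"
  unfolding nrm_def using ip_df_measurable by measurable

lemma ip_df:
  assumes \<phi>: "nice \<phi>" and \<psi>: "nice \<psi>"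
  shows "ip (df z \<phi>) (df z \<psi>) = 2 * ip \<phi> \<psi> - ip (\<lambda>x. \<phi> (x - z)) \<psi> - ip (\<lambda>x. \<psi> (x - z)) \<phi>"
proof -
  note s = nice_mpres[OF \<phi> mpres_diff_right[of z]] nice_mpres[OF \<psi> mpres_diff_right[of z]]
  show ?thesis
    unfolding df_def ip_diff_left[OF \<phi> s(1) nice_diff[OF \<psi> s(2)]] ip_diff_right[OF \<psi> s(2) \<phi>] ip_diff_right[OF \<psi> s(2) s(1)]
      ip_mpres[OF \<phi> \<psi> mpres_diff_right] ip_commute[of \<phi> "\<lambda>x. \<psi> (x - z)"] by simp
qed

lemma ip_translate_kernel:
  assumes K: "integrable lborel K" and \<phi>: "nice \<phi>" and \<psi>: "nice \<psi>"
  shows "integrable lborel (\<lambda>z. K z * ip (\<lambda>x. \<phi> (x - z)) \<psi>)"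
    and "(\<integral>z. K z * ip (\<lambda>x. \<phi> (x - z)) \<psi> \<partial>lborel) = ip (conv K \<phi>) \<psi>"
proof -
  have [measurable]: "K \<in> borel_measurable borel" "\<phi> \<in> borel_measurable borel" "\<psi> \<in> borel_measurable borel"
    using K nice_meas[OF \<phi>] nice_meas[OF \<psi>] by auto
  have i: "integrable (lborel \<Otimes>\<^sub>M lborel) (\<lambda>(x, z). K z * \<phi> (x - z) * \<psi> x)"
  proof (rule lborel_pair.Fubini_integrable)
    have na: "nice (\<lambda>x. \<bar>\<phi> x\<bar>)" "nice (\<lambda>x. \<bar>\<psi> x\<bar>)" using nice_le[OF \<phi>] nice_le[OF \<psi>] by auto
    have "integrable lborel (\<lambda>x. conv (\<lambda>z. \<bar>K z\<bar>) (\<lambda>x. \<bar>\<phi> x\<bar>) x * \<bar>\<psi> x\<bar>)"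
      by (rule nice_mult_integrable[OF young(1) na(2)]) (use K na in auto)
    then show "integrable lborel (\<lambda>x. LINT z|lborel. norm (case (x, z) of (x, z) \<Rightarrow> K z * \<phi> (x - z) * \<psi> x))"
      by (simp add: abs_mult conv_def)
    show "AE x in lborel. integrable lborel (\<lambda>z. case (x, z) of (x, z) \<Rightarrow> K z * \<phi> (x - z) * \<psi> x)"
      using conv_integrable[OF K nice_bdm[OF \<phi>]] by simp
  qed measurable
  have eq: "(\<integral>x. K z * \<phi> (x - z) * \<psi> x \<partial>lborel) = K z * ip (\<lambda>x. \<phi> (x - z)) \<psi>" for z
    by (simp add: ip_def mult.assoc)
  show "integrable lborel (\<lambda>z. K z * ip (\<lambda>x. \<phi> (x - z)) \<psi>)"
    using lborel_pair.integrable_snd[OF i] by (simp add: eq)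
  have "(\<integral>z. (\<integral>x. K z * \<phi> (x - z) * \<psi> x \<partial>lborel) \<partial>lborel) = (\<integral>x. (\<integral>z. K z * \<phi> (x - z) * \<psi> x \<partial>lborel) \<partial>lborel)"
    using lborel_pair.Fubini_integral[OF i] by simp
  then show "(\<integral>z. K z * ip (\<lambda>x. \<phi> (x - z)) \<psi> \<partial>lborel) = ip (conv K \<phi>) \<psi>"
    by (simp add: eq ip_def conv_def)
qed

text \<open>This identifies the form of an integrable kernel with the operator that
  \<open>Gop\<close> inverts after \<open>\<Lambda>\<close> has been added.\<close>

lemma form_bounded_kernel:
  assumes K: "rkernel K" and \<phi>: "nice \<phi>" and \<psi>: "nice \<psi>"
  shows "integrable lborel (\<lambda>z. K z * ip (df z \<phi>) (df z \<psi>))"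
    and "(\<integral>z. K z * ip (df z \<phi>) (df z \<psi>) \<partial>lborel) = 2 * (\<integral>z. K z \<partial>lborel) * ip \<phi> \<psi> - 2 * ip (conv K \<phi>) \<psi>"
proof -
  note K' = kernelD[OF K]
  note t1 = ip_translate_kernel[OF K'(3) \<phi> \<psi>] and t2 = ip_translate_kernel[OF K'(3) \<psi> \<phi>]
  have eq: "K z * ip (df z \<phi>) (df z \<psi>) = K z * (2 * ip \<phi> \<psi>) - K z * ip (\<lambda>x. \<phi> (x - z)) \<psi> - K z * ip (\<lambda>x. \<psi> (x - z)) \<phi>" for z
    by (simp add: ip_df[OF \<phi> \<psi>] right_diff_distrib)
  have i0: "integrable lborel (\<lambda>z. K z * (2 * ip \<phi> \<psi>))" using K'(3) by simp
  show "integrable lborel (\<lambda>z. K z * ip (df z \<phi>) (df z \<psi>))"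
    unfolding eq by (intro Bochner_Integration.integrable_diff i0 t1 t2)
  have "(\<integral>z. K z * ip (df z \<phi>) (df z \<psi>) \<partial>lborel) = (\<integral>z. K z * (2 * ip \<phi> \<psi>) \<partial>lborel) - ip (conv K \<phi>) \<psi> - ip (conv K \<psi>) \<phi>"
    unfolding eq using i0 t1 t2 by simp
  also have "ip (conv K \<psi>) \<phi> = ip (conv K \<phi>) \<psi>"
    using ip_conv_sym[OF K'(3) \<phi> \<psi> RD_even[OF K'(1)]] by (simp add: ip_commute)
  finally show "(\<integral>z. K z * ip (df z \<phi>) (df z \<psi>) \<partial>lborel) = 2 * (\<integral>z. K z \<partial>lborel) * ip \<phi> \<psi> - 2 * ip (conv K \<phi>) \<psi>"
    by (simp add: mult_ac)
qed

lemma nrm_df_lipschitz: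
  assumes \<phi>: "nice \<phi>" and T: "nice (\<lambda>x. T (\<phi> x))" and C: "0 \<le> C" "\<And>x y. \<bar>T (\<phi> x) - T (\<phi> y)\<bar> \<le> C * \<bar>\<phi> x - \<phi> y\<bar>"
  shows "nrm (df z (\<lambda>x. T (\<phi> x))) \<le> C * nrm (df z \<phi>)"
proof -
  have "nrm (df z (\<lambda>x. T (\<phi> x))) \<le> nrm (\<lambda>x. C * df z \<phi> x)"
    by (rule nrm_mono[OF nice_cmult[OF nice_df[OF \<phi>]] nice_df[OF T]]) (use C in \<open>simp add: df_def abs_mult\<close>)
  then show ?thesis using C(1) by (simp add: nrm_cmult)
qed

text \<open>The resolvent commutes with translations, so its norm bound passes to differences and to
  the energy.\<close>

lemma nrm_df_Gop:
  assumes K: "rkernel K" and \<Lambda>: "\<Lambda> > 0" and rk: "reskernel \<Lambda> K g" and a: "a = ratom \<Lambda> K" and \<phi>: "nice \<phi>"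
  shows "nrm (df z (Gop a g \<phi>)) \<le> nrm (df z \<phi>) / \<Lambda>"
proof -
  note s = nice_mpres[OF \<phi> mpres_diff_right[of z]]
  have "Gop a g (\<lambda>x. \<phi> (x - z)) x = Gop a g \<phi> (x - z)" for x
    by (simp add: Gop_def conv_def algebra_simps)
  then have "df z (Gop a g \<phi>) = Gop a g (df z \<phi>)"
    unfolding df_def using Gop_diff[OF K \<Lambda> rk a nice_bdm[OF \<phi>] nice_bdm[OF s]] by auto
  then show ?thesis using nrm_Gop[OF K \<Lambda> rk a nice_df[OF \<phi>]] by simp
qed

section \<open>Decay at infinity and truncated test functions\<close>

lemma integral_tail_tendsto_0:
  fixes g :: "'a::euclidean_space \<Rightarrow> real"
  assumes g: "integrable lborel g"
  shows "(\<lambda>n. \<integral>z. g z * indicator {z. real n \<le> norm z} z \<partial>lborel) \<longlonglongrightarrow> 0"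
proof -
  have [measurable]: "g \<in> borel_measurable borel" using g by auto
  have "(\<lambda>n. \<integral>z. g z * indicator {z. real n \<le> norm z} z \<partial>lborel) \<longlonglongrightarrow> integral\<^sup>L (lborel :: 'a measure) (\<lambda>z. 0 :: real)"
  proof (rule integral_dominated_convergence[where w = "\<lambda>z. \<bar>g z\<bar>"])
    show "AE z in lborel. (\<lambda>n. g z * indicator {z. real n \<le> norm z} z) \<longlonglongrightarrow> 0"
    proof (rule AE_I2)
      fix z :: 'a
      obtain N where N: "norm z < real N" using reals_Archimedean2 by blast
      have "\<forall>\<^sub>F n in sequentially. g z * indicator {z. real n \<le> norm z} z = 0"
        using eventually_ge_at_top[of N] by eventually_elim (use N in \<open>auto simp: indicator_def\<close>)
      then show "(\<lambda>n. g z * indicator {z. real n \<le> norm z} z) \<longlonglongrightarrow> 0" by (rule tendsto_eventually)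
    qed
  qed (use g in \<open>auto simp: indicator_def\<close>)
  then show ?thesis by simp
qed

text \<open>Far out, a displacement below \<open>n\<close> meets only small values of
  \<open>v\<close>, and the larger displacements carry little mass of \<open>g\<close>. The purpose
  is that the error of the approximate solution decays, so that its truncations have bounded support
  and are admissible in the weak equation.\<close>

lemma conv_bounded_levels:
  fixes g v :: "'a::euclidean_space \<Rightarrow> real"
  assumes g: "integrable lborel g" "\<And>z. 0 \<le> g z" and v: "bdm v" and vb: "\<And>s. 0 < s \<Longrightarrow> bounded {x. s < v x}" and s: "0 < s"
  shows "bounded {x. s < conv g v x}"
proof -
  have [measurable]: "g \<in> borel_measurable borel" using g by auto
  obtain B where B: "B \<ge> 0" "\<And>x. \<bar>v x\<bar> \<le> B" using bdmE[OF v] by blast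
  define I where "I = (\<integral>z. g z \<partial>lborel)"
  have I: "0 \<le> I" unfolding I_def using g(2) by simp
  define \<eta> where "\<eta> = s / (2 * (I + 1))"
  have \<eta>: "0 < \<eta>" "\<eta> * I \<le> s / 2" using I s by (auto simp: \<eta>_def field_simps)
  obtain R where R: "\<And>x. \<eta> < v x \<Longrightarrow> norm x \<le> R" using vb[OF \<eta>(1)] unfolding bounded_pos by blast
  have "\<forall>\<^sub>F n in sequentially. (\<integral>z. g z * indicator {z. real n \<le> norm z} z \<partial>lborel) < s / (2 * (B + 1))"
    using integral_tail_tendsto_0[OF g(1)] by (rule order_tendstoD) (use s B in simp)
  then obtain n where n: "(\<integral>z. g z * indicator {z. real n \<le> norm z} z \<partial>lborel) < s / (2 * (B + 1))"
    using eventually_happens'[OF sequentially_bot] by blast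
  have "norm x \<le> R + real n" if x: "s < conv g v x" for x
  proof (rule ccontr)
    assume far: "\<not> ?thesis"
    have it: "integrable lborel (\<lambda>z. g z * indicator {z. real n \<le> norm z} z)"
      by (rule Bochner_Integration.integrable_bound[OF g(1)]) (auto simp: indicator_def)
    have "conv g v x \<le> (\<integral>z. g z * \<eta> + B * (g z * indicator {z. real n \<le> norm z} z) \<partial>lborel)"
      unfolding conv_def
    proof (rule integral_mono[OF conv_integrable[OF g(1) v]])
      show "integrable lborel (\<lambda>z. g z * \<eta> + B * (g z * indicator {z. real n \<le> norm z} z))"
        using g(1) it by (intro Bochner_Integration.integrable_add integrable_mult_right integrable_mult_left)
      fix z
      show "g z * v (x - z) \<le> g z * \<eta> + B * (g z * indicator {z. real n \<le> norm z} z)"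
      proof (cases "real n \<le> norm z")
        case True
        have "g z * v (x - z) \<le> g z * (\<eta> + B)"
          using B(2)[of "x - z"] \<eta>(1) g(2) by (intro mult_left_mono) auto
        then show ?thesis using True by (simp add: algebra_simps)
      next
        case False
        then have "R < norm (x - z)" using far norm_triangle_sub[of x z] by linarith
        then have "v (x - z) \<le> \<eta>" using R[of "x - z"] by linarith
        then have "g z * v (x - z) \<le> g z * \<eta>" by (intro mult_left_mono g(2))
        then show ?thesis using False by simp
      qed
    qed
    also have "\<dots> = \<eta> * I + B * (\<integral>z. g z * indicator {z. real n \<le> norm z} z \<partial>lborel)"
      using g(1) it by (simp add: I_def mult.commute)
    also have "\<dots> \<le> s / 2 + B * (s / (2 * (B + 1)))"
      using \<eta>(2) n B(1) by (intro add_mono mult_left_mono) auto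
    also have "\<dots> \<le> s" using B(1) s by (simp add: field_simps)
    finally show False using x by simp
  qed
  then show ?thesis unfolding bounded_iff by blast
qed

text \<open>Soft thresholding. Being monotone and a contraction, it keeps the energy finite and
  pairs nonnegatively with its argument in the form.\<close>

definition trunc :: "real \<Rightarrow> real \<Rightarrow> real" where "trunc \<epsilon> s = s - max (- \<epsilon>) (min \<epsilon> s)"

lemma trunc:
  assumes "0 < \<epsilon>"
  shows "\<bar>trunc \<epsilon> s - trunc \<epsilon> t\<bar> \<le> \<bar>s - t\<bar>" "0 \<le> (s - t) * (trunc \<epsilon> s - trunc \<epsilon> t)"
    "\<bar>trunc \<epsilon> s\<bar> \<le> \<bar>s\<bar>" "trunc \<epsilon> s \<noteq> 0 \<Longrightarrow> \<epsilon> < \<bar>s\<bar>" "\<bar>s - trunc \<epsilon> s\<bar> \<le> \<epsilon>"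
proof -
  show "\<bar>trunc \<epsilon> s - trunc \<epsilon> t\<bar> \<le> \<bar>s - t\<bar>" "\<bar>trunc \<epsilon> s\<bar> \<le> \<bar>s\<bar>" "trunc \<epsilon> s \<noteq> 0 \<Longrightarrow> \<epsilon> < \<bar>s\<bar>" "\<bar>s - trunc \<epsilon> s\<bar> \<le> \<epsilon>"
    using assms unfolding trunc_def by linarith+
  have "trunc \<epsilon> t \<le> trunc \<epsilon> s" if "t \<le> s" for s t using that assms unfolding trunc_def by linarith
  then have "t \<le> s \<and> trunc \<epsilon> t \<le> trunc \<epsilon> s \<or> s \<le> t \<and> trunc \<epsilon> s \<le> trunc \<epsilon> t" using linear by blast
  then show "0 \<le> (s - t) * (trunc \<epsilon> s - trunc \<epsilon> t)" by (simp add: zero_le_mult_iff)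
qed

lemma ip_trunc_tendsto:
  assumes e: "nice e"
  shows "(\<lambda>n. ip e (\<lambda>x. trunc (1 / real (Suc n)) (e x))) \<longlonglongrightarrow> ip e e"
proof -
  have [measurable]: "e \<in> borel_measurable borel" by (rule nice_meas[OF e])
  have [measurable]: "(\<lambda>x. trunc \<epsilon> (e x)) \<in> borel_measurable borel" for \<epsilon> unfolding trunc_def by measurable
  show ?thesis unfolding ip_def
  proof (rule integral_dominated_convergence[where w = "\<lambda>x. e x * e x"])
    show "integrable lborel (\<lambda>x. e x * e x)" by (rule nice_mult_integrable[OF e e])
    show "AE x in lborel. (\<lambda>n. e x * trunc (1 / real (Suc n)) (e x)) \<longlonglongrightarrow> e x * e x"
    proof (intro AE_I2 tendsto_intros)
      fix x
      have "(\<lambda>n. e x - trunc (1 / real (Suc n)) (e x)) \<longlonglongrightarrow> 0"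
        by (rule Lim_null_comparison[OF always_eventually lim_inverse_n'[THEN LIMSEQ_Suc]])
          (use trunc(5) in \<open>simp\<close>)
      then have "(\<lambda>n. e x - (e x - trunc (1 / real (Suc n)) (e x))) \<longlonglongrightarrow> e x - 0" by (intro tendsto_intros)
      then show "(\<lambda>n. trunc (1 / real (Suc n)) (e x)) \<longlonglongrightarrow> e x" by simp
    qed
    show "AE x in lborel. norm (e x * trunc (1 / real (Suc n)) (e x)) \<le> e x * e x" for n
    proof (rule AE_I2)
      fix x
      have "\<bar>e x\<bar> * \<bar>trunc (1 / real (Suc n)) (e x)\<bar> \<le> \<bar>e x\<bar> * \<bar>e x\<bar>" by (intro mult_left_mono trunc(3)) auto
      then show "norm (e x * trunc (1 / real (Suc n)) (e x)) \<le> e x * e x" by (simp add: abs_mult)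
    qed
  qed measurable
qed

context radial
begin

text \<open>The value at the origin is irrelevant to the form, and \<open>km m\<close> has the value \<open>m\<close> there.\<close>
definition excess :: "real \<Rightarrow> 'a \<Rightarrow> real" where
  "excess m z = (if z = 0 then 0 else K0 z - km m z)"

lemma excess_measurable[measurable]: "excess m \<in> borel_measurable borel"
  unfolding excess_def by measurable

lemma excess_bounds: assumes "0 \<le> m" shows "0 \<le> excess m z" "excess m z \<le> K0 z" "m \<le> m' \<Longrightarrow> excess m' z \<le> excess m z"
  using K0_nonneg[of z] assms by (auto simp: excess_def km_def)

lemma excess_eventually_0: "\<forall>\<^sub>F n in sequentially. excess (real n) z = 0"
proof -
  obtain N where N: "K0 z \<le> real N" using real_arch_simple by blast
  show ?thesis using eventually_ge_at_top[of N]
    by eventually_elim (use N in \<open>auto simp: excess_def km_def\<close>)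
qed

lemma energy_integrable:
  assumes u: "nice u" and fin: "(\<integral>\<^sup>+z. ennreal (K0 z * (nrm (df z u))\<^sup>2) \<partial>lborel) < \<infinity>"
  shows "integrable lborel (\<lambda>z. K0 z * (nrm (df z u))\<^sup>2)"
proof -
  note [measurable] = nrm_df_measurable[OF nice_meas[OF u]]
  show ?thesis using fin by (intro integrableI_nonneg) (auto simp: K0_nonneg)
qed

lemma excess_energy_tendsto_0:
  assumes u: "nice u" and i: "integrable lborel (\<lambda>z. K0 z * (nrm (df z u))\<^sup>2)"
  shows "(\<lambda>n. \<integral>z. excess (real n) z * (nrm (df z u))\<^sup>2 \<partial>lborel) \<longlonglongrightarrow> 0"
proof -
  note [measurable] = nrm_df_measurable[OF nice_meas[OF u]]
  have "(\<lambda>n. \<integral>z. excess (real n) z * (nrm (df z u))\<^sup>2 \<partial>lborel) \<longlonglongrightarrow> integral\<^sup>L (lborel :: 'a measure) (\<lambda>z. 0 :: real)"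
  proof (rule integral_dominated_convergence[OF _ _ i])
    show "AE z in lborel. (\<lambda>n. excess (real n) z * (nrm (df z u))\<^sup>2) \<longlonglongrightarrow> 0"
    proof (intro AE_I2 tendsto_eventually)
      fix z show "\<forall>\<^sub>F n in sequentially. excess (real n) z * (nrm (df z u))\<^sup>2 = 0"
        by (rule eventually_mono[OF excess_eventually_0[of z]]) simp
    qed
    show "AE z in lborel. norm (excess (real n) z * (nrm (df z u))\<^sup>2) \<le> K0 z * (nrm (df z u))\<^sup>2" for n
    proof (rule AE_I2)
      fix z
      have "excess (real n) z * (nrm (df z u))\<^sup>2 \<le> K0 z * (nrm (df z u))\<^sup>2"
        by (intro mult_right_mono excess_bounds(2)) auto
      then show "norm (excess (real n) z * (nrm (df z u))\<^sup>2) \<le> K0 z * (nrm (df z u))\<^sup>2"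
        using excess_bounds(1)[of "real n" z] by simp
    qed
  qed measurable
  then show ?thesis by simp
qed

text \<open>The error \<open>e = u - w\<close> between the solution and the truncated resolvent
  satisfies the difference of their equations, whose right hand side is the form of the cut off part
  of the kernel. Testing with \<open>e\<close> itself would give the claim; since test functions
  need bounded support, soft truncations of \<open>e\<close> are used and the threshold tends to 0
  afterwards.\<close>

lemma resolved_exists:
  assumes nu: "nice u" and u0: "\<And>x. 0 \<le> u x" and ub: "\<And>s. 0 < s \<Longrightarrow> bounded {x. s < u x}"
    and L: "0 \<le> L" "\<And>s t. \<bar>f s - f t\<bar> \<le> L * \<bar>s - t\<bar>" and f0: "f 0 = 0"
    and fin: "(\<integral>\<^sup>+z. ennreal (K0 z * (nrm (df z u))\<^sup>2) \<partial>lborel) < \<infinity>"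
    and weak: "\<And>\<phi>. nice \<phi> \<Longrightarrow> bounded {x. \<phi> x \<noteq> 0} \<Longrightarrow> (\<integral>\<^sup>+z. ennreal (K0 z * (nrm (df z \<phi>))\<^sup>2) \<partial>lborel) < \<infinity> \<Longrightarrow>
      (\<integral>z. K0 z * ip (df z u) (df z \<phi>) \<partial>lborel) = ip (\<lambda>x. f (u x)) \<phi>"
    and \<Lambda>: "L < \<Lambda>"
  shows "\<exists>F \<mu> g. resolved \<Lambda> F \<mu> g u"
proof -
  \<comment> \<open>A multiple of \<open>s\<close> above the Lipschitz constant makes the right hand
    side strictly increasing.\<close>
  define F where "F s = f s + \<Lambda> * s" for s
  have \<Lambda>0: "0 < \<Lambda>" using L(1) \<Lambda> by simp
  have Flip: "\<bar>F s - F t\<bar> \<le> (L + \<Lambda>) * \<bar>s - t\<bar>" for s t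
  proof -
    have "F s - F t = (f s - f t) + \<Lambda> * (s - t)" by (simp add: F_def algebra_simps)
    then have "\<bar>F s - F t\<bar> \<le> \<bar>f s - f t\<bar> + \<bar>\<Lambda> * (s - t)\<bar>" by (simp only: abs_triangle_ineq)
    also have "\<dots> \<le> L * \<bar>s - t\<bar> + \<Lambda> * \<bar>s - t\<bar>" using L(2)[of s t] \<Lambda>0 by (simp add: abs_mult)
    finally show ?thesis by (simp add: distrib_right)
  qed
  have F0: "F 0 = 0" by (simp add: F_def f0)
  have Fs: "F s < F t" if "s < t" for s t
  proof -
    have "f s - f t \<le> L * (t - s)" using L(2)[of s t] that by simp
    also have "\<dots> < \<Lambda> * (t - s)" using \<Lambda> that by simp
    finally show ?thesis by (simp add: F_def right_diff_distrib)
  qed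
  have cf: "continuous_on UNIV f"
  proof (rule lipschitz_on_continuous_on)
    show "L-lipschitz_on UNIV f" by (rule lipschitz_onI) (use L in \<open>auto simp: dist_real_def\<close>)
  qed
  have [measurable]: "f \<in> borel_measurable borel" by (rule borel_measurable_continuous_onI[OF cf])
  have [measurable]: "u \<in> borel_measurable borel" by (rule nice_meas[OF nu])
  have nfu: "nice (\<lambda>x. f (u x))"
    by (rule nice_le[OF nice_cmult[OF nu, of L]]) (use L(1) L(2)[of _ 0] f0 in \<open>auto simp: abs_mult\<close>)
  define v where "v = (\<lambda>x. F (u x))"
  have nv: "nice v" unfolding v_def F_def by (intro nice_add nfu nice_cmult nu)
  have v0: "0 \<le> v x" for x using Fs[of 0 "u x"] u0[of x] F0 by (cases "u x = 0") (auto simp: v_def)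
  have vu: "v x \<le> (L + \<Lambda>) * u x" for x using Flip[of "u x" 0] F0 u0[of x] by (simp add: v_def)
  have LL: "0 < L + \<Lambda>" using L \<Lambda>0 by simp
  have vb: "bounded {x. s < v x}" if "0 < s" for s
  proof (rule bounded_subset[OF ub])
    show "0 < s / (L + \<Lambda>)" using that LL by simp
    show "{x. s < v x} \<subseteq> {x. s / (L + \<Lambda>) < u x}"
      using vu LL by (auto simp: pos_divide_less_eq mult.commute intro: less_le_trans)
  qed
  define g where "g m = (SOME g. reskernel \<Lambda> (km m) g)" for m
  have rk: "reskernel \<Lambda> (km m) (g m)" if "0 \<le> m" for m
    unfolding g_def by (rule someI_ex[OF reskernel_exists[OF rkernel_km[OF that] \<Lambda>0]])
  define N where "N z = nrm (df z u)" for z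
  have [measurable]: "N \<in> borel_measurable borel" unfolding N_def by (rule nrm_df_measurable) measurable
  have N0: "0 \<le> N z" for z by (simp add: N_def nrm_nonneg)
  have Ni: "integrable lborel (\<lambda>z. K0 z * (N z)\<^sup>2)" unfolding N_def by (rule energy_integrable[OF nu fin])
  define \<delta> where "\<delta> m = (\<integral>z. excess m z * (N z)\<^sup>2 \<partial>lborel)" for m
  \<comment> \<open>One unit for \<open>u\<close> and \<open>(L + \<Lambda>) / \<Lambda>\<close> for
    \<open>w\<close>: \<open>F\<close> multiplies differences by at most
    \<open>L + \<Lambda>\<close>, the resolvent by \<open>1 / \<Lambda>\<close>.\<close>
  define C where "C = 1 + (L + \<Lambda>) / \<Lambda>"
  have C: "1 \<le> C" unfolding C_def using LL \<Lambda>0 by simp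
  have main: "\<Lambda> * (nrm (\<lambda>x. Gop (ratom \<Lambda> (km m)) (g m) v x - u x))\<^sup>2 \<le> C * \<delta> m" if m: "0 \<le> m" for m
  proof -
    note K = rkernel_km[OF m] and rkm = rk[OF m]
    note gk = kernelD[OF rk_kernel[OF K \<Lambda>0 rkm HOL.refl]]
    define a where "a = ratom \<Lambda> (km m)"
    define w where "w = Gop a (g m) v"
    have nw: "nice w" unfolding w_def a_def by (rule nice_Gop[OF K \<Lambda>0 rkm HOL.refl nv])
    have a0: "a > 0" unfolding a_def by (rule a_pos[OF K \<Lambda>0 rkm HOL.refl])
    define e where "e = (\<lambda>x. u x - w x)"
    have ne: "nice e" unfolding e_def by (rule nice_diff[OF nu nw])
    have [measurable]: "e \<in> borel_measurable borel" by (rule nice_meas[OF ne])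
    have cv0: "0 \<le> conv (g m) v x" for x by (rule conv_nonneg[OF gk(2) v0])
    \<comment> \<open>Where \<open>e\<close> exceeds \<open>\<epsilon>\<close>, one of the three
      nonnegative terms \<open>u x\<close>, \<open>a * v x\<close> and \<open>conv (g m) v x\<close>
      exceeds a third of it.\<close>
    have eb: "bounded {x. \<epsilon> < \<bar>e x\<bar>}" if \<epsilon>: "0 < \<epsilon>" for \<epsilon>
    proof (rule bounded_subset)
      have p: "0 < \<epsilon> / 3" "0 < \<epsilon> / 3 / a" using \<epsilon> a0 by auto
      show "bounded ({x. \<epsilon> / 3 < u x} \<union> {x. \<epsilon> / 3 / a < v x} \<union> {x. \<epsilon> / 3 < conv (g m) v x})"
        unfolding bounded_Un using ub[OF p(1)] vb[OF p(2)] conv_bounded_levels[OF gk(3,2) nice_bdm[OF nv] vb p(1)] by blast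
      show "{x. \<epsilon> < \<bar>e x\<bar>} \<subseteq> {x. \<epsilon> / 3 < u x} \<union> {x. \<epsilon> / 3 / a < v x} \<union> {x. \<epsilon> / 3 < conv (g m) v x}"
      proof
        fix x assume "x \<in> {x. \<epsilon> < \<bar>e x\<bar>}"
        then have "\<epsilon> < \<bar>u x - (a * v x + conv (g m) v x)\<bar>" by (simp add: e_def w_def Gop_def)
        moreover have "0 \<le> a * v x" using a0 v0[of x] by simp
        ultimately have "\<epsilon> / 3 < u x \<or> \<epsilon> / 3 < a * v x \<or> \<epsilon> / 3 < conv (g m) v x"
          using u0[of x] cv0[of x] \<epsilon> by linarith
        then show "x \<in> {x. \<epsilon> / 3 < u x} \<union> {x. \<epsilon> / 3 / a < v x} \<union> {x. \<epsilon> / 3 < conv (g m) v x}"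
          using a0 by (auto simp: pos_divide_less_eq mult_ac)
      qed
    qed
    have eN: "nrm (df z e) \<le> C * N z" for z
    proof -
      have "df z e = (\<lambda>x. df z u x - df z w x)" by (auto simp: df_def e_def)
      then have "nrm (df z e) \<le> N z + nrm (df z w)"
        using nrm_triangle_diff[OF nice_df[OF nu] nice_df[OF nw]] by (simp add: N_def)
      also have "nrm (df z w) \<le> nrm (df z v) / \<Lambda>" unfolding w_def a_def by (rule nrm_df_Gop[OF K \<Lambda>0 rkm HOL.refl nv])
      also have "nrm (df z v) / \<Lambda> \<le> (L + \<Lambda>) * N z / \<Lambda>" unfolding v_def N_def
        by (intro divide_right_mono nrm_df_lipschitz nu) (use nv LL \<Lambda>0 Flip in \<open>auto simp: v_def\<close>)
      finally show ?thesis by (simp add: C_def distrib_right)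
    qed
    \<comment> \<open>The bound does not depend on \<open>\<epsilon>\<close>, because truncation
      does not increase differences.\<close>
    have test: "\<Lambda> * ip e (\<lambda>x. trunc \<epsilon> (e x)) \<le> C * \<delta> m" if \<epsilon>: "0 < \<epsilon>" for \<epsilon>
    proof -
      define \<phi> where "\<phi> = (\<lambda>x. trunc \<epsilon> (e x))"
      have n\<phi>: "nice \<phi>" unfolding \<phi>_def
        by (rule nice_le[OF ne]) (use trunc(3)[OF \<epsilon>] in \<open>auto simp: trunc_def\<close>)
      have \<phi>N: "nrm (df z \<phi>) \<le> C * N z" for z
      proof -
        have "nrm (df z \<phi>) \<le> 1 * nrm (df z e)" unfolding \<phi>_def
          by (rule nrm_df_lipschitz[OF ne]) (use n\<phi> trunc(1)[OF \<epsilon>] in \<open>auto simp: \<phi>_def\<close>)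
        then show ?thesis using eN[of z] by simp
      qed
      have sup: "bounded {x. \<phi> x \<noteq> 0}"
        by (rule bounded_subset[OF eb[OF \<epsilon>]]) (use trunc(4)[OF \<epsilon>] in \<open>auto simp: \<phi>_def\<close>)
      have fin\<phi>: "(\<integral>\<^sup>+z. ennreal (K0 z * (nrm (df z \<phi>))\<^sup>2) \<partial>lborel) < \<infinity>"
      proof -
        have "(\<integral>\<^sup>+z. ennreal (K0 z * (nrm (df z \<phi>))\<^sup>2) \<partial>lborel) \<le> (\<integral>\<^sup>+z. ennreal (C\<^sup>2 * (K0 z * (N z)\<^sup>2)) \<partial>lborel)"
        proof (intro nn_integral_mono ennreal_leI)
          fix z
          have "(nrm (df z \<phi>))\<^sup>2 \<le> (C * N z)\<^sup>2" by (rule power_mono[OF \<phi>N nrm_nonneg])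
          then have "K0 z * (nrm (df z \<phi>))\<^sup>2 \<le> K0 z * (C * N z)\<^sup>2" by (rule mult_left_mono[OF _ K0_nonneg])
          then show "K0 z * (nrm (df z \<phi>))\<^sup>2 \<le> C\<^sup>2 * (K0 z * (N z)\<^sup>2)" by (simp add: power_mult_distrib mult_ac)
        qed
        also have "\<dots> = ennreal (\<integral>z. C\<^sup>2 * (K0 z * (N z)\<^sup>2) \<partial>lborel)"
          by (rule nn_integral_eq_integral) (use Ni K0_nonneg in auto)
        finally show ?thesis by (simp add: le_less_trans)
      qed
      define b where "b z = ip (df z u) (df z \<phi>)" for z
      have bm[measurable]: "b \<in> borel_measurable borel" unfolding b_def
        by (rule ip_df_measurable[OF nice_meas[OF nu] nice_meas[OF n\<phi>]])
      have bb: "\<bar>b z\<bar> \<le> C * (N z)\<^sup>2" for z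
      proof -
        have "\<bar>b z\<bar> \<le> N z * nrm (df z \<phi>)" unfolding b_def N_def by (rule ip_CS[OF nice_df[OF nu] nice_df[OF n\<phi>]])
        also have "\<dots> \<le> N z * (C * N z)" by (rule mult_left_mono[OF \<phi>N N0])
        finally show ?thesis by (simp add: power2_eq_square mult_ac)
      qed
      have ei: "integrable lborel (\<lambda>z. excess m z * (N z)\<^sup>2)"
        by (rule Bochner_Integration.integrable_bound[OF Ni])
          (use excess_bounds[OF m] K0_nonneg in \<open>auto intro!: mult_right_mono\<close>)
      have bd: "\<bar>excess m z * b z\<bar> \<le> C * (excess m z * (N z)\<^sup>2)" for z
        using mult_left_mono[OF bb[of z] excess_bounds(1)[OF m, of z]] excess_bounds(1)[OF m, of z] by (simp add: abs_mult mult_ac)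
      have ebi: "integrable lborel (\<lambda>z. excess m z * b z)"
        by (rule Bochner_Integration.integrable_bound[OF integrable_mult_right[OF ei, of C]])
          (use bd C in \<open>auto intro: order_trans[OF _ abs_ge_self]\<close>)
      define Br where "Br = (\<integral>z. excess m z * b z \<partial>lborel)"
      have "(\<integral>z. - (C * (excess m z * (N z)\<^sup>2)) \<partial>lborel) \<le> Br" unfolding Br_def
        by (rule integral_mono) (use ei ebi bd in \<open>auto simp: abs_le_iff minus_le_iff\<close>)
      then have Br: "- (C * \<delta> m) \<le> Br" by (simp add: \<delta>_def)
      define Bm where "Bm \<psi> = 2 * (\<integral>z. km m z \<partial>lborel) * ip \<psi> \<phi> - 2 * ip (conv (km m) \<psi>) \<phi>" for \<psi>
      note fb = form_bounded_kernel[OF K _ n\<phi>]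
      note K' = kernelD[OF K]
      \<comment> \<open>At the origin, where \<open>km m\<close> and \<open>K0\<close> need not be
        comparable, both sides vanish since \<open>df 0\<close> is zero.\<close>
      have split: "K0 z * b z = km m z * b z + excess m z * b z" for z
        by (cases "z = 0") (auto simp: excess_def b_def df_zero ip_def algebra_simps)
      have "(\<integral>z. K0 z * b z \<partial>lborel) = Bm u + Br"
        unfolding split Br_def Bm_def using fb[OF nu] ebi by (simp add: b_def)
      moreover have "(\<integral>z. K0 z * b z \<partial>lborel) = ip (\<lambda>x. f (u x)) \<phi>" unfolding b_def by (rule weak[OF n\<phi> sup fin\<phi>])
      moreover have "ip v \<phi> = ip (\<lambda>x. f (u x)) \<phi> + \<Lambda> * ip u \<phi>"
        unfolding v_def F_def ip_add_left[OF nfu nice_cmult[OF nu] n\<phi>] ip_cmult_left ..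
      moreover have "\<Lambda> * ip w \<phi> + Bm w = ip v \<phi>"
      proof -
        have "(\<lambda>x. (\<Lambda> + 2 * (\<integral>z. km m z \<partial>lborel)) * w x) = (\<lambda>x. v x + 2 * conv (km m) w x)"
          unfolding w_def a_def using Gop_eq[OF K \<Lambda>0 rkm HOL.refl nice_bdm[OF nv]] by auto
        then have "(\<Lambda> + 2 * (\<integral>z. km m z \<partial>lborel)) * ip w \<phi> = ip (\<lambda>x. v x + 2 * conv (km m) w x) \<phi>"
          by (simp flip: ip_cmult_left)
        also have "\<dots> = ip v \<phi> + 2 * ip (conv (km m) w) \<phi>"
          unfolding ip_add_left[OF nv nice_cmult[OF young(1)[OF K'(3) nw]] n\<phi>] ip_cmult_left ..
        finally show ?thesis by (simp add: Bm_def algebra_simps)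
      qed
      moreover have "Bm u - Bm w = Bm e"
      proof -
        have "conv (km m) e = (\<lambda>x. conv (km m) u x - conv (km m) w x)"
          unfolding e_def using conv_diff_right[OF K'(3) nice_bdm[OF nu] nice_bdm[OF nw]] by auto
        then have "ip (conv (km m) e) \<phi> = ip (conv (km m) u) \<phi> - ip (conv (km m) w) \<phi>"
          using ip_diff_left[OF young(1)[OF K'(3) nu] young(1)[OF K'(3) nw] n\<phi>] by simp
        moreover have "ip e \<phi> = ip u \<phi> - ip w \<phi>" unfolding e_def by (rule ip_diff_left[OF nu nw n\<phi>])
        ultimately show ?thesis unfolding Bm_def by (simp add: right_diff_distrib)
      qed
      moreover have "ip e \<phi> = ip u \<phi> - ip w \<phi>" unfolding e_def by (rule ip_diff_left[OF nu nw n\<phi>])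
      ultimately have id: "\<Lambda> * ip e \<phi> = - Bm e - Br" by (simp add: right_diff_distrib)
      \<comment> \<open>Truncation is monotone, so the increments of \<open>e\<close> and of
        \<open>\<phi>\<close> never have opposite signs.\<close>
      have "0 \<le> Bm e"
      proof -
        have "0 \<le> (\<integral>z. km m z * ip (df z e) (df z \<phi>) \<partial>lborel)"
        proof (intro integral_nonneg_AE AE_I2 mult_nonneg_nonneg km_nonneg[OF m])
          fix z show "0 \<le> ip (df z e) (df z \<phi>)"
            unfolding ip_def df_def \<phi>_def by (intro integral_nonneg_AE AE_I2 trunc(2)[OF \<epsilon>])
        qed
        then show ?thesis using fb(2)[OF ne] by (simp add: Bm_def)
      qed
      then show ?thesis using id Br by (simp add: \<phi>_def)
    qed
    \<comment> \<open>The threshold tends to 0, which replaces the truncated test function by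
      \<open>e\<close>.\<close>
    have "(\<lambda>n. \<Lambda> * ip e (\<lambda>x. trunc (1 / real (Suc n)) (e x))) \<longlonglongrightarrow> \<Lambda> * ip e e"
      by (intro tendsto_mult tendsto_const ip_trunc_tendsto[OF ne])
    then have "\<Lambda> * ip e e \<le> C * \<delta> m" by (rule LIMSEQ_le_const2) (intro exI[of _ 0] allI impI test, simp)
    moreover have "nrm (\<lambda>x. w x - u x) = nrm e"
      using nrm_cmult[of "-1" e] by (simp add: e_def)
    ultimately show ?thesis by (simp add: w_def a_def nrm_sq[symmetric])
  qed
  have lim: "\<exists>m1\<ge>0. \<forall>m\<ge>m1. nrm (\<lambda>x. Gop (ratom \<Lambda> (km m)) (g m) v x - u x) \<le> \<eta>" if \<eta>: "0 < \<eta>" for \<eta>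
  proof -
    have "(\<lambda>n. \<delta> (real n)) \<longlonglongrightarrow> 0" unfolding \<delta>_def N_def
      by (rule excess_energy_tendsto_0[OF nu]) (use Ni in \<open>simp add: N_def\<close>)
    then have "\<forall>\<^sub>F n in sequentially. \<delta> (real n) < \<Lambda> * \<eta>\<^sup>2 / C"
      by (rule order_tendstoD) (use \<Lambda>0 \<eta> C in simp)
    then obtain n where n: "\<delta> (real n) < \<Lambda> * \<eta>\<^sup>2 / C" using eventually_happens'[OF sequentially_bot] by blast
    have "nrm (\<lambda>x. Gop (ratom \<Lambda> (km m)) (g m) v x - u x) \<le> \<eta>" if m: "m \<ge> real n" for m
    proof -
      have m0: "0 \<le> m" using m by linarith
      have i: "integrable lborel (\<lambda>z. excess m z * (N z)\<^sup>2)" if "0 \<le> m" for m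
        by (rule Bochner_Integration.integrable_bound[OF Ni])
          (use excess_bounds[OF that] K0_nonneg in \<open>auto intro!: mult_right_mono\<close>)
      have "\<delta> m \<le> \<delta> (real n)" unfolding \<delta>_def
        by (rule integral_mono[OF i[OF m0] i]) (use m excess_bounds(3) in \<open>auto intro!: mult_right_mono\<close>)
      then have "C * \<delta> m \<le> C * \<delta> (real n)" using C by (intro mult_left_mono) auto
      also have "\<dots> \<le> \<Lambda> * \<eta>\<^sup>2" using n C by (simp add: pos_less_divide_eq mult.commute)
      finally have "C * \<delta> m \<le> \<Lambda> * \<eta>\<^sup>2" .
      then have "\<Lambda> * (nrm (\<lambda>x. Gop (ratom \<Lambda> (km m)) (g m) v x - u x))\<^sup>2 \<le> \<Lambda> * \<eta>\<^sup>2" using main[OF m0] by linarith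
      then have "(nrm (\<lambda>x. Gop (ratom \<Lambda> (km m)) (g m) v x - u x))\<^sup>2 \<le> \<eta>\<^sup>2" using \<Lambda>0 by simp
      then show ?thesis by (rule power2_le_imp_le) (use \<eta> in simp)
    qed
    then show ?thesis by (intro exI[of _ "real n"]) simp
  qed
  \<comment> \<open>The inverse Lipschitz constant of \<open>F\<close> makes
    \<open>s - \<mu> * F s\<close> nondecreasing, and nonnegative for nonnegative
    \<open>s\<close>.\<close>
  define \<mu> where "\<mu> = 1 / (L + \<Lambda>)"
  have \<mu>: "0 < \<mu>" using LL by (simp add: \<mu>_def)
  have mono: "\<mu> * (F t - F s) \<le> t - s" if "s \<le> t" for s t
    using Flip[of t s] that LL by (simp add: \<mu>_def pos_divide_le_eq mult.commute)
  have "resolved \<Lambda> F \<mu> g u"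
    unfolding resolved_def
  proof (intro conjI allI impI)
    fix s t :: real assume st: "0 \<le> s"
    show "0 \<le> F s" using Fs[of 0 s] F0 st by (cases "s = 0") auto
    show "\<mu> * F s \<le> s" using mono[OF st] F0 by simp
    show "F s < F t" if "s < t" by (rule Fs[OF that])
    show "s - \<mu> * F s \<le> t - \<mu> * F t" if "s \<le> t" using mono[OF that] by (simp add: right_diff_distrib)
  next
    fix \<eta> :: real assume "0 < \<eta>"
    then show "\<exists>m1\<ge>0. \<forall>m\<ge>m1. nrm (\<lambda>x. Gop (ratom \<Lambda> (km m)) (g m) (\<lambda>x. F (u x)) x - u x) \<le> \<eta>"
      using lim by (simp add: v_def)
  qed (use \<mu> nu nv vb rk in \<open>auto simp: v_def\<close>)
  then show ?thesis by blast
qed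

end

section \<open>Polar coordinates and the double integral form\<close>

text \<open>Measurability of the profile is a consequence of monotonicity: on the half line its
  superlevel sets are intervals. On the rest the profile is replaced by 0, since nothing is known
  about it there.\<close>

lemma borel_measurable_antimono_pos:
  fixes k :: "real \<Rightarrow> real"
  assumes k: "antimono_on {0<..} k"
  shows "(\<lambda>r. if r \<le> 0 then 0 else k r) \<in> borel_measurable borel"
proof -
  have "{r. a < (if r \<le> 0 then 0 else k r)} \<in> sets borel" for a
  proof -
    have "is_interval ({0<..} \<inter> {r. a < k r})"
      unfolding is_interval_1
    proof (intro ballI allI impI)
      fix r s x assume r: "r \<in> {0<..} \<inter> {r. a < k r}" "s \<in> {0<..} \<inter> {r. a < k r}" and x: "r \<le> x \<and> x \<le> s"
      have "k s \<le> k x" by (rule monotone_onD[OF k]) (use r x in auto)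
      then show "x \<in> {0<..} \<inter> {r. a < k r}" using r x by auto
    qed
    then have 1: "{0<..} \<inter> {r. a < k r} \<in> sets borel" by (rule real_interval_borel_measurable)
    have "{r. a < (if r \<le> 0 then 0 else k r)} = ({0<..} \<inter> {r. a < k r}) \<union> (if a < 0 then {..0} else {})" by auto
    then show ?thesis using 1 by auto
  qed
  then show ?thesis by (simp add: borel_measurable_iff_greater)
qed

text \<open>Polar coordinates for radial integrands. Two measures on the line are compared on the
  half lines \<open>{..a}\<close>, where the left side is the volume of a ball and the right side an
  elementary integral.\<close>

lemma distr_norm:
  defines "N \<equiv> DIM('a::euclidean_space)"
  shows "distr lborel borel (norm :: 'a \<Rightarrow> real)
    = density lborel (\<lambda>r. ennreal (real N * unit_ball_vol N) * (indicator {0<..} r * ennreal (r ^ (N - 1))))" (is "?\<nu> = ?\<mu>")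
proof (rule measure_eqI_generator_eq)
  let ?E = "range (\<lambda>a::real. {..a})"
  have N: "N > 0" by (simp add: N_def)
  show "Int_stable ?E" by (auto simp: Int_stable_def)
  show "?E \<subseteq> Pow UNIV" by simp
  show "sets ?\<nu> = sigma_sets UNIV ?E" "sets ?\<mu> = sigma_sets UNIV ?E" by (simp_all add: borel_eq_atMost)
  have \<nu>: "emeasure ?\<nu> {..a} = (if a < 0 then 0 else ennreal (unit_ball_vol N * a ^ N))" for a
  proof -
    have "emeasure ?\<nu> {..a} = emeasure lborel (cball (0::'a) a)"
      by (subst emeasure_distr) (auto intro!: arg_cong[where f = "emeasure lborel"])
    then show ?thesis by (auto simp: N_def emeasure_cball)
  qed
  show "range (\<lambda>n::nat. {..real n}) \<subseteq> ?E" by auto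
  show "(\<Union>n::nat. {..real n}) = UNIV" using real_arch_simple by auto
  show "emeasure ?\<nu> {..real n} \<noteq> \<infinity>" for n unfolding \<nu> by auto
  fix X assume "X \<in> ?E"
  then obtain a where X: "X = {..a}" by auto
  have "emeasure ?\<mu> {..a} = ennreal (real N * unit_ball_vol N) * (\<integral>\<^sup>+r. ennreal (r ^ (N - 1)) * indicator {0..a} r \<partial>lborel)"
  proof -
    have "emeasure ?\<mu> {..a} = (\<integral>\<^sup>+r. ennreal (real N * unit_ball_vol N) * (indicator {0<..} r * ennreal (r ^ (N - 1)) * indicator {..a} r) \<partial>lborel)"
      by (subst emeasure_density) (auto simp: mult.assoc)
    also have "\<dots> = ennreal (real N * unit_ball_vol N) * (\<integral>\<^sup>+r. indicator {0<..} r * ennreal (r ^ (N - 1)) * indicator {..a} r \<partial>lborel)"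
      by (rule nn_integral_cmult) auto
    also have "(\<integral>\<^sup>+r. indicator {0<..} r * ennreal (r ^ (N - 1)) * indicator {..a} r \<partial>lborel)
      = (\<integral>\<^sup>+r. ennreal (r ^ (N - 1)) * indicator {0..a} r \<partial>lborel)"
    proof (rule nn_integral_cong_AE)
      have "AE r in lborel. r \<noteq> (0::real)" by (rule AE_lborel_singleton)
      then show "AE r in lborel. indicator {0<..} r * ennreal (r ^ (N - 1)) * indicator {..a} r = ennreal (r ^ (N - 1)) * indicator {0..a} r"
        by eventually_elim (auto simp: indicator_def)
    qed
    finally show ?thesis .
  qed
  also have "\<dots> = (if a < 0 then 0 else ennreal (unit_ball_vol N * a ^ N))"
  proof (cases "a < 0")
    case False
    have "(\<integral>\<^sup>+r. ennreal (r ^ (N - 1)) * indicator {0..a} r \<partial>lborel) = ennreal (a ^ N / N - 0 ^ N / N)"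
    proof (rule nn_integral_FTC_Icc[where F = "\<lambda>r. r ^ N / N"])
      fix x :: real
      show "DERIV (\<lambda>r. r ^ N / N) x :> x ^ (N - 1)"
        using N by (auto intro!: derivative_eq_intros)
    qed (use False in auto)
    then have "ennreal (real N * unit_ball_vol N) * (\<integral>\<^sup>+r. ennreal (r ^ (N - 1)) * indicator {0..a} r \<partial>lborel)
      = ennreal (real N * unit_ball_vol N) * ennreal (a ^ N / N)" using N by (simp add: power_0_left)
    also have "\<dots> = ennreal (real N * unit_ball_vol N * (a ^ N / N))"
      by (rule ennreal_mult[symmetric]) (use False in simp_all)
    also have "real N * unit_ball_vol N * (a ^ N / N) = unit_ball_vol N * a ^ N" using N by simp
    finally show ?thesis using False by simp
  qed (auto simp: indicator_def)
  finally show "emeasure ?\<nu> X = emeasure ?\<mu> X" unfolding X \<nu> by simp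
qed

lemma nn_integral_norm:
  fixes F :: "real \<Rightarrow> real"
  assumes [measurable]: "F \<in> borel_measurable borel" and F: "\<And>r. 0 < r \<Longrightarrow> 0 \<le> F r"
  defines "N \<equiv> DIM('a::euclidean_space)"
  shows "(\<integral>\<^sup>+x. ennreal (F (norm x)) \<partial>(lborel :: 'a measure))
    = ennreal (real N * unit_ball_vol N) * (\<integral>\<^sup>+r\<in>{0<..}. ennreal (F r * r ^ (N - 1)) \<partial>lborel)"
proof -
  have "(\<integral>\<^sup>+x. ennreal (F (norm x)) \<partial>(lborel :: 'a measure)) = (\<integral>\<^sup>+r. ennreal (F r) \<partial>distr lborel borel (norm :: 'a \<Rightarrow> real))"
    by (rule nn_integral_distr[symmetric]) auto
  also have "\<dots> = (\<integral>\<^sup>+r. ennreal (real N * unit_ball_vol N) * (indicator {0<..} r * ennreal (r ^ (N - 1))) * ennreal (F r) \<partial>lborel)"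
    unfolding distr_norm N_def[symmetric] by (rule nn_integral_density) auto
  also have "\<dots> = (\<integral>\<^sup>+r. ennreal (real N * unit_ball_vol N) * (ennreal (F r * r ^ (N - 1)) * indicator {0<..} r) \<partial>lborel)"
    by (rule nn_integral_cong) (auto simp: indicator_def ennreal_mult[OF F] mult_ac)
  also have "\<dots> = ennreal (real N * unit_ball_vol N) * (\<integral>\<^sup>+r\<in>{0<..}. ennreal (F r * r ^ (N - 1)) \<partial>lborel)"
    by (rule nn_integral_cmult) auto
  finally show ?thesis .
qed

section \<open>The change of variables from two points to a point and a difference\<close>

lemma nn_shear:
  fixes H :: "'a::euclidean_space \<times> 'a \<Rightarrow> ennreal"
  assumes H[measurable]: "H \<in> borel_measurable (borel \<Otimes>\<^sub>M borel)"
  shows "(\<integral>\<^sup>+p. H p \<partial>(lborel \<Otimes>\<^sub>M lborel)) = (\<integral>\<^sup>+z. \<integral>\<^sup>+x. H (x, x - z) \<partial>lborel \<partial>lborel)"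
proof -
  have "(\<integral>\<^sup>+p. H p \<partial>(lborel \<Otimes>\<^sub>M lborel)) = (\<integral>\<^sup>+x. \<integral>\<^sup>+y. H (x, y) \<partial>lborel \<partial>lborel)"
    by (rule lborel.nn_integral_fst[symmetric]) measurable
  also have "\<dots> = (\<integral>\<^sup>+x. \<integral>\<^sup>+z. H (x, x - z) \<partial>lborel \<partial>lborel)"
    by (intro nn_integral_cong mpres_nn_integral[OF mpres_diff_left, symmetric]) measurable
  also have "\<dots> = (\<integral>\<^sup>+z. \<integral>\<^sup>+x. H (x, x - z) \<partial>lborel \<partial>lborel)"
    by (rule lborel_pair.Fubini'[symmetric]) measurable
  finally show ?thesis .
qed

text \<open>Stated as preservation of measure so that signed integrands can be transformed as
  well.\<close>

lemma mpres_shear: "mpres (\<lambda>p :: 'a::euclidean_space \<times> 'a. (fst p, fst p - snd p))"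
  unfolding mpres_def
proof
  let ?T = "\<lambda>p :: 'a \<times> 'a. (fst p, fst p - snd p)"
  show T[measurable]: "?T \<in> borel_measurable borel"
    by (intro borel_measurable_continuous_onI continuous_intros)
  show "distr lborel borel ?T = lborel"
  proof (rule measure_eqI)
    fix A assume "A \<in> sets (distr lborel borel ?T)"
    then have A[measurable]: "A \<in> sets borel" by simp
    then have A'[measurable]: "A \<in> sets (borel \<Otimes>\<^sub>M borel)" by (subst borel_prod) (rule A)
    have T'[measurable]: "?T \<in> (borel \<Otimes>\<^sub>M borel) \<rightarrow>\<^sub>M (borel \<Otimes>\<^sub>M borel)" by measurable
    have "emeasure lborel A = (\<integral>\<^sup>+p. indicator A p \<partial>(lborel \<Otimes>\<^sub>M lborel))" by (simp add: lborel_prod)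
    also have "\<dots> = (\<integral>\<^sup>+z. \<integral>\<^sup>+x. indicator A (x, x - z) \<partial>lborel \<partial>lborel)" by (rule nn_shear) measurable
    also have "\<dots> = (\<integral>\<^sup>+x. \<integral>\<^sup>+z. indicator A (x, x - z) \<partial>lborel \<partial>lborel)" by (rule lborel_pair.Fubini') measurable
    also have "\<dots> = (\<integral>\<^sup>+p. indicator A (?T p) \<partial>(lborel \<Otimes>\<^sub>M lborel))"
      using lborel.nn_integral_fst[of "\<lambda>p. indicator A (?T p)" lborel] by simp
    also have "\<dots> = (\<integral>\<^sup>+p. indicator (?T -` A) p \<partial>lborel)" by (simp add: lborel_prod indicator_def)
    also have "\<dots> = emeasure (distr lborel borel ?T) A"
      by (subst emeasure_distr) (use measurable_sets_borel[OF T A] in auto)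
    finally show "emeasure (distr lborel borel ?T) A = emeasure lborel A" ..
  qed simp
qed

lemma energy_shear:
  fixes K u :: "'a::euclidean_space \<Rightarrow> real"
  assumes [measurable]: "K \<in> borel_measurable borel" and K: "\<And>z. 0 \<le> K z" and u: "nice u"
  shows "(\<integral>\<^sup>+p. ennreal ((u (fst p) - u (snd p))\<^sup>2 * K (fst p - snd p)) \<partial>(lborel \<Otimes>\<^sub>M lborel))
    = (\<integral>\<^sup>+z. ennreal (K z * (nrm (df z u))\<^sup>2) \<partial>lborel)"
proof -
  have [measurable]: "u \<in> borel_measurable borel" by (rule nice_meas[OF u])
  have "(\<integral>\<^sup>+p. ennreal ((u (fst p) - u (snd p))\<^sup>2 * K (fst p - snd p)) \<partial>(lborel \<Otimes>\<^sub>M lborel))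
     = (\<integral>\<^sup>+z. \<integral>\<^sup>+x. ennreal ((u x - u (x - z))\<^sup>2 * K z) \<partial>lborel \<partial>lborel)"
    by (subst nn_shear) simp_all
  also have "\<dots> = (\<integral>\<^sup>+z. ennreal (K z * (nrm (df z u))\<^sup>2) \<partial>lborel)"
  proof (rule nn_integral_cong)
    fix z
    have "(\<integral>\<^sup>+x. ennreal ((u x - u (x - z))\<^sup>2 * K z) \<partial>lborel) = (\<integral>\<^sup>+x. ennreal (K z * (df z u x * df z u x)) \<partial>lborel)"
      by (simp add: df_def power2_eq_square mult_ac)
    also have "\<dots> = ennreal (\<integral>x. K z * (df z u x * df z u x) \<partial>lborel)"
      by (rule nn_integral_eq_integral) (use K nice_mult_integrable[OF nice_df[OF u] nice_df[OF u], of z z] in auto)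
    also have "(\<integral>x. K z * (df z u x * df z u x) \<partial>lborel) = K z * (nrm (df z u))\<^sup>2" by (simp add: nrm_sq ip_def)
    finally show "(\<integral>\<^sup>+x. ennreal ((u x - u (x - z))\<^sup>2 * K z) \<partial>lborel) = ennreal (K z * (nrm (df z u))\<^sup>2)" .
  qed
  finally show ?thesis .
qed

text \<open>Finiteness of both energies bounds the mixed integrand by the sum of the two quadratic
  ones; this integrability allows Fubini for the signed form.\<close>

lemma form_shear:
  fixes K u \<phi> :: "'a::euclidean_space \<Rightarrow> real"
  assumes [measurable]: "K \<in> borel_measurable borel" and K: "\<And>z. 0 \<le> K z" and u: "nice u" and \<phi>: "nice \<phi>"
    and fu: "(\<integral>\<^sup>+z. ennreal (K z * (nrm (df z u))\<^sup>2) \<partial>lborel) < \<infinity>" and f\<phi>: "(\<integral>\<^sup>+z. ennreal (K z * (nrm (df z \<phi>))\<^sup>2) \<partial>lborel) < \<infinity>"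
  shows "(\<integral>p. (u (fst p) - u (snd p)) * (\<phi> (fst p) - \<phi> (snd p)) * K (fst p - snd p) \<partial>(lborel \<Otimes>\<^sub>M lborel))
    = (\<integral>z. K z * ip (df z u) (df z \<phi>) \<partial>lborel)"
proof -
  have [measurable]: "u \<in> borel_measurable borel" "\<phi> \<in> borel_measurable borel" using nice_meas u \<phi> by auto
  define Q where "Q p = (u (fst p) - u (snd p)) * (\<phi> (fst p) - \<phi> (snd p)) * K (fst p - snd p)" for p :: "'a \<times> 'a"
  have Qm[measurable]: "Q \<in> borel_measurable (borel \<Otimes>\<^sub>M borel)" unfolding Q_def by measurable
  have sq: "integrable (lborel \<Otimes>\<^sub>M lborel) (\<lambda>p. (v (fst p) - v (snd p))\<^sup>2 * K (fst p - snd p))"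
    if v: "nice v" and fv: "(\<integral>\<^sup>+z. ennreal (K z * (nrm (df z v))\<^sup>2) \<partial>lborel) < \<infinity>" for v :: "'a \<Rightarrow> real"
  proof (rule integrableI_nonneg)
    have [measurable]: "v \<in> borel_measurable borel" by (rule nice_meas[OF v])
    show "(\<lambda>p. (v (fst p) - v (snd p))\<^sup>2 * K (fst p - snd p)) \<in> borel_measurable (lborel \<Otimes>\<^sub>M lborel)" by measurable
  qed (use energy_shear[OF assms(1) K v] fv K in auto)
  have Qi: "integrable (lborel \<Otimes>\<^sub>M lborel) Q"
  proof (rule Bochner_Integration.integrable_bound[OF Bochner_Integration.integrable_add[OF sq[OF u fu] sq[OF \<phi> f\<phi>]]])
    show "AE p in lborel \<Otimes>\<^sub>M lborel. norm (Q p) \<le> norm ((u (fst p) - u (snd p))\<^sup>2 * K (fst p - snd p) + (\<phi> (fst p) - \<phi> (snd p))\<^sup>2 * K (fst p - snd p))"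
    proof (rule AE_I2)
      fix p :: "'a \<times> 'a"
      have "\<bar>s * t\<bar> \<le> s\<^sup>2 + t\<^sup>2" for s t :: real
      proof -
        have "2 * (\<bar>s\<bar> * \<bar>t\<bar>) \<le> s\<^sup>2 + t\<^sup>2" using zero_le_power2[of "\<bar>s\<bar> - \<bar>t\<bar>"] by (simp add: power2_diff)
        moreover have "0 \<le> \<bar>s\<bar> * \<bar>t\<bar>" by simp
        ultimately show ?thesis unfolding abs_mult by linarith
      qed
      from mult_right_mono[OF this K[of "fst p - snd p"]]
      have "\<bar>(u (fst p) - u (snd p)) * (\<phi> (fst p) - \<phi> (snd p))\<bar> * K (fst p - snd p)
         \<le> (u (fst p) - u (snd p))\<^sup>2 * K (fst p - snd p) + (\<phi> (fst p) - \<phi> (snd p))\<^sup>2 * K (fst p - snd p)"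
        by (simp add: distrib_right)
      then show "norm (Q p) \<le> norm ((u (fst p) - u (snd p))\<^sup>2 * K (fst p - snd p) + (\<phi> (fst p) - \<phi> (snd p))\<^sup>2 * K (fst p - snd p))"
        using K[of "fst p - snd p"] by (simp add: Q_def abs_mult)
    qed
  qed measurable
  have Qb: "Q \<in> borel_measurable borel" using Qm by (simp add: borel_prod)
  have "integrable lborel Q" using Qi by (simp add: lborel_prod)
  then have i: "integrable (lborel \<Otimes>\<^sub>M lborel) (\<lambda>(x, z). Q (x, x - z))"
    using mpres_integrable[OF mpres_shear Qb] by (simp add: lborel_prod case_prod_unfold)
  have "(\<integral>p. Q p \<partial>(lborel \<Otimes>\<^sub>M lborel)) = (\<integral>(x, z). Q (x, x - z) \<partial>(lborel \<Otimes>\<^sub>M lborel))"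
    using mpres_integral[OF mpres_shear Qb] by (simp add: lborel_prod case_prod_unfold)
  also have "\<dots> = (\<integral>z. (\<integral>x. Q (x, x - z) \<partial>lborel) \<partial>lborel)" by (rule lborel_pair.integral_snd[OF i, symmetric])
  also have "\<dots> = (\<integral>z. K z * ip (df z u) (df z \<phi>) \<partial>lborel)"
    by (rule Bochner_Integration.integral_cong) (simp_all add: Q_def ip_def df_def mult.commute)
  finally show ?thesis unfolding Q_def .
qed

section \<open>From reflections to radial symmetry\<close>

lemma rfl_rfl_parallel: "norm e = 1 \<Longrightarrow> rfl e l (rfl e l' x) = x + (2 * (l - l')) *\<^sub>R e"
  by (simp add: rfl_def inner_add_left dot_square_norm algebra_simps flip: scaleR_add_left)

section \<open>Decay along orbits of translations\<close>

locale decaying =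
  fixes u :: "'a::euclidean_space \<Rightarrow> real"
  assumes u_nonneg: "0 \<le> u x" and u_cont: "continuous_on UNIV u" and levels: "0 < s \<Longrightarrow> bounded {x. s < u x}"
begin

lemma small_along_ray:
  assumes e: "norm e = 1" and s: "0 < s"
  shows "\<exists>T. \<forall>t. T \<le> \<bar>t\<bar> \<longrightarrow> u (x + t *\<^sub>R e) \<le> s"
proof -
  obtain R where R: "\<And>y. s < u y \<Longrightarrow> norm y \<le> R" using levels[OF s] unfolding bounded_iff by blast
  have "u (x + t *\<^sub>R e) \<le> s" if t: "R + norm x + 1 \<le> \<bar>t\<bar>" for t
  proof (rule ccontr)
    assume "\<not> ?thesis"
    then have "norm (x + t *\<^sub>R e) \<le> R" by (intro R) simp
    moreover have "\<bar>t\<bar> = norm ((x + t *\<^sub>R e) - x)" using e by simp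
    moreover have "norm ((x + t *\<^sub>R e) - x) \<le> norm (x + t *\<^sub>R e) + norm x" by (rule norm_triangle_ineq4)
    ultimately show False using t by linarith
  qed
  then show ?thesis by blast
qed

text \<open>The orbit runs to infinity, where \<open>u\<close> becomes smaller than half of any
  positive value.\<close>

lemma zero_of_dominated_orbit:
  assumes e: "norm e = 1" and t: "t \<noteq> 0" and step: "\<And>n. u x \<le> u (x + (real n * t) *\<^sub>R e)"
  shows "u x = 0"
proof (rule ccontr)
  assume "u x \<noteq> 0"
  then have s: "0 < u x / 2" using u_nonneg[of x] by simp
  obtain T where T: "\<And>r. T \<le> \<bar>r\<bar> \<Longrightarrow> u (x + r *\<^sub>R e) \<le> u x / 2" using small_along_ray[OF e s] by blast
  obtain n where "T / \<bar>t\<bar> \<le> real n" using real_arch_simple by blast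
  then have "T \<le> \<bar>real n * t\<bar>" using t by (simp add: pos_divide_le_eq abs_mult)
  then show False using T[of "real n * t"] step[of n] s by simp
qed

lemma periodic_zero:
  assumes e: "norm e = 1" and t: "t \<noteq> 0" and per: "\<And>x. u (x + t *\<^sub>R e) = u x"
  shows "u x = 0"
proof (rule zero_of_dominated_orbit[OF e t])
  fix n show "u x \<le> u (x + (real n * t) *\<^sub>R e)"
  proof (induction n)
    case (Suc n)
    have "x + (real (Suc n) * t) *\<^sub>R e = (x + (real n * t) *\<^sub>R e) + t *\<^sub>R e" by (simp add: algebra_simps)
    then have "u (x + (real (Suc n) * t) *\<^sub>R e) = u (x + (real n * t) *\<^sub>R e)" by (simp only: per)
    then show ?case using Suc by simp
  qed simp
qed

end

text \<open>\<open>sided\<close> and \<open>strict\<close> are the conclusions of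
  \<open>no_opposite_signs\<close> and \<open>one_sided_strict\<close>. From here on the argument is
  the geometry of reflections combined with decay.\<close>

locale polarized = decaying +
  assumes sided: "norm e = 1 \<Longrightarrow> (\<forall>x. l < x \<bullet> e \<longrightarrow> u x \<le> u (rfl e l x)) \<or> (\<forall>x. x \<bullet> e < l \<longrightarrow> u x \<le> u (rfl e l x))"
    and strict: "norm e = 1 \<Longrightarrow> (\<And>x. x \<bullet> e \<le> l \<Longrightarrow> u (rfl e l x) \<le> u x) \<Longrightarrow> y0 \<bullet> e < l \<Longrightarrow> u (rfl e l y0) < u y0 \<Longrightarrow>
      y1 \<bullet> e < l \<Longrightarrow> u (rfl e l y1) < u y1"
    and nontrivial: "\<exists>x. u x \<noteq> 0"
begin

lemma symmetry_plane: assumes e: "norm e = 1" shows "\<exists>l. \<forall>x. u (rfl e l x) = u x"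
proof -
  define A where "A = {l. \<forall>x. l < x \<bullet> e \<longrightarrow> u x \<le> u (rfl e l x)}"
  define B where "B = {l. \<forall>x. x \<bullet> e < l \<longrightarrow> u x \<le> u (rfl e l x)}"
  have cont: "continuous_on UNIV (\<lambda>l. u (rfl e l x))" for x
    unfolding rfl_def by (intro continuous_on_compose2[OF u_cont] continuous_intros) auto
  \<comment> \<open>For fixed \<open>x\<close> the condition on \<open>l\<close> is closed, since
    \<open>u (rfl e l x)\<close> depends continuously on \<open>l\<close>; the set is the
    intersection over all \<open>x\<close>.\<close>
  have "closed ({x \<bullet> e..} \<union> {l. u x \<le> u (rfl e l x)})" for x
    using cont by (intro closed_Un closed_atLeast closed_Collect_le continuous_on_const)
  then have "closed (\<Inter>x. {x \<bullet> e..} \<union> {l. u x \<le> u (rfl e l x)})" by (intro closed_INT) simp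
  moreover have "(\<Inter>x. {x \<bullet> e..} \<union> {l. u x \<le> u (rfl e l x)}) = A" by (force simp: A_def)
  ultimately have cA: "closed A" by simp
  have "closed ({..x \<bullet> e} \<union> {l. u x \<le> u (rfl e l x)})" for x
    using cont by (intro closed_Un closed_atMost closed_Collect_le continuous_on_const)
  then have "closed (\<Inter>x. {..x \<bullet> e} \<union> {l. u x \<le> u (rfl e l x)})" by (intro closed_INT) simp
  moreover have "(\<Inter>x. {..x \<bullet> e} \<union> {l. u x \<le> u (rfl e l x)}) = B" by (force simp: B_def)
  ultimately have cB: "closed B" by simp
  have AB: "UNIV \<subseteq> A \<union> B" using sided[OF e] by (auto simp: A_def B_def)
  obtain x0 where "u x0 \<noteq> 0" using nontrivial by blast
  then have s: "0 < u x0 / 2" using u_nonneg[of x0] by simp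
  obtain T where T: "\<And>t. T \<le> \<bar>t\<bar> \<Longrightarrow> u (x0 + t *\<^sub>R e) \<le> u x0 / 2" using small_along_ray[OF e s] by blast
  \<comment> \<open>A plane far from \<open>x0\<close> sends this point to where \<open>u\<close> is
    at most half of \<open>u x0\<close>. Far below the point this excludes the first alternative and
    far above it the second, so both sets are nonempty.\<close>
  have far: "u (rfl e l x0) < u x0" if "T \<le> \<bar>2 * (l - x0 \<bullet> e)\<bar>" for l
    using T[OF that] s by (simp add: rfl_def)
  have "x0 \<bullet> e - \<bar>T\<bar> - 1 \<notin> A" "x0 \<bullet> e + \<bar>T\<bar> + 1 \<notin> B"
    using far[of "x0 \<bullet> e - \<bar>T\<bar> - 1"] far[of "x0 \<bullet> e + \<bar>T\<bar> + 1"] unfolding A_def B_def by (auto simp: not_le intro!: exI[of _ x0])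
  then have ne: "A \<noteq> {}" "B \<noteq> {}" using AB by auto
  have "A \<inter> B \<noteq> {}"
  proof
    assume "A \<inter> B = {}"
    then show False using connected_UNIV[where 'a = real] cA cB AB ne unfolding connected_closed by auto
  qed
  then obtain l where l: "l \<in> A" "l \<in> B" by auto
  have "u (rfl e l x) = u x" for x
  proof (cases "x \<bullet> e" l rule: linorder_cases)
    case less
    then have "l < rfl e l x \<bullet> e" by (simp add: rfl_inner[OF e])
    then have "u (rfl e l x) \<le> u x" using l(1) rfl_rfl[OF e, of l x] unfolding A_def by fastforce
    moreover have "u x \<le> u (rfl e l x)" using l(2) less unfolding B_def by blast
    ultimately show ?thesis by simp
  next
    case equal then show ?thesis by (simp add: rfl_def)
  next
    case greater
    then have "rfl e l x \<bullet> e < l" by (simp add: rfl_inner[OF e])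
    then have "u (rfl e l x) \<le> u x" using l(2) rfl_rfl[OF e, of l x] unfolding B_def by fastforce
    moreover have "u x \<le> u (rfl e l x)" using l(1) greater unfolding A_def by blast
    ultimately show ?thesis by simp
  qed
  then show ?thesis by blast
qed

text \<open>The reflections in one symmetry plane for each basis direction compose to a point
  reflection. Its centre is the point through which all other symmetry planes will have to
  pass.\<close>

lemma symmetry_center: "\<exists>z. \<forall>x. u (2 *\<^sub>R z - x) = u x"
proof -
  have "\<forall>b\<in>Basis. \<exists>l. \<forall>x. u (rfl b l x) = u x" using symmetry_plane norm_Basis by blast
  then obtain l where l: "\<And>b x. b \<in> Basis \<Longrightarrow> u (rfl b (l b) x) = u x" by metis
  define S where "S F x = x + (\<Sum>b\<in>F. (2 * (l b - x \<bullet> b)) *\<^sub>R b)" for F x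
  have "F \<subseteq> Basis \<Longrightarrow> u (S F x) = u x" if "finite F" for F x
    using that
  proof (induction F rule: finite_induct)
    case (insert b F)
    have "(\<Sum>c\<in>F. (2 * (l c - x \<bullet> c)) *\<^sub>R c) \<bullet> b = 0"
      unfolding inner_sum_left
    proof (intro sum.neutral ballI)
      fix c assume "c \<in> F"
      then have "c \<in> Basis" "b \<in> Basis" "c \<noteq> b" using insert by auto
      then show "((2 * (l c - x \<bullet> c)) *\<^sub>R c) \<bullet> b = 0" by (simp add: inner_Basis)
    qed
    then have "S (insert b F) x = rfl b (l b) (S F x)"
      using insert.hyps by (simp add: S_def rfl_def inner_add_left algebra_simps)
    then show ?case using insert l by simp
  qed (simp add: S_def)
  then have S: "u (S Basis x) = u x" for x by simp
  define z where "z = (\<Sum>b\<in>Basis. l b *\<^sub>R b)"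
  have "S Basis x = 2 *\<^sub>R z - x" for x
  proof -
    have "(\<Sum>b\<in>Basis. (2 * (l b - x \<bullet> b)) *\<^sub>R b) = 2 *\<^sub>R z - 2 *\<^sub>R (\<Sum>b\<in>Basis. (x \<bullet> b) *\<^sub>R b)"
      by (simp add: z_def scaleR_sum_right sum_subtractf[symmetric] algebra_simps)
    then show ?thesis by (simp add: S_def euclidean_representation scaleR_2)
  qed
  then show ?thesis using S by metis
qed

lemma radially_decreasing:
  "\<exists>z. (\<forall>x y. norm (x - z) = norm (y - z) \<longrightarrow> u x = u y) \<and> (\<forall>x y. norm (x - z) < norm (y - z) \<longrightarrow> u y < u x)"
proof -
  obtain z where z: "\<And>x. u (2 *\<^sub>R z - x) = u x" using symmetry_center by blast
  have plane: "u (rfl e (z \<bullet> e) x) = u x" if e: "norm e = 1" for e x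
  proof -
    obtain l where l: "\<And>x. u (rfl e l x) = u x" using symmetry_plane[OF e] by blast
    have "l = z \<bullet> e"
    proof (rule ccontr)
      assume "l \<noteq> z \<bullet> e"
      then have t: "4 * (l - z \<bullet> e) \<noteq> 0" by simp
      \<comment> \<open>Conjugation by the point reflection moves a symmetry plane to the opposite
        side of \<open>z\<close>, and two parallel reflections compose to a translation.\<close>
      have per: "u (x + (4 * (l - z \<bullet> e)) *\<^sub>R e) = u x" for x
      proof -
        have "rfl e l (2 *\<^sub>R z - rfl e l (2 *\<^sub>R z - x)) = x + (4 * (l - z \<bullet> e)) *\<^sub>R e"
          using e by (simp add: rfl_def inner_add_left inner_diff_left dot_square_norm algebra_simps flip: scaleR_add_left)
        then show ?thesis using l z by metis
      qed
      show False using periodic_zero[OF e t per] nontrivial by blast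
    qed
    then show ?thesis using l by simp
  qed
  have rad: "u x = u y" if xy: "norm (x - z) = norm (y - z)" for x y
  proof (cases "x = y")
    case False
    \<comment> \<open>The plane through \<open>z\<close> orthogonal to \<open>x - y\<close>
      interchanges the two points because they are equally far from \<open>z\<close>.\<close>
    define e where "e = (x - y) /\<^sub>R norm (x - y)"
    have e: "norm e = 1" using False by (simp add: e_def)
    have "(x - z) \<bullet> (x - z) = (y - z) \<bullet> (y - z)" using xy by (simp add: dot_square_norm)
    then have "2 * (z \<bullet> (x - y)) - 2 * (x \<bullet> (x - y)) = - ((x - y) \<bullet> (x - y))"
      by (simp add: inner_diff_left inner_diff_right inner_commute)
    then have d: "2 * (z \<bullet> (x - y) - x \<bullet> (x - y)) = - (norm (x - y))\<^sup>2" by (simp add: dot_square_norm)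
    have "z \<bullet> e - x \<bullet> e = (z \<bullet> (x - y) - x \<bullet> (x - y)) / norm (x - y)"
      by (simp add: e_def divide_inverse_commute right_diff_distrib)
    then have "2 * (z \<bullet> e - x \<bullet> e) = 2 * (z \<bullet> (x - y) - x \<bullet> (x - y)) / norm (x - y)" by (simp only: times_divide_eq_right)
    also have "\<dots> = - (norm (x - y))\<^sup>2 / norm (x - y)" by (simp only: d)
    also have "\<dots> = - norm (x - y)" using False by (simp add: power2_eq_square)
    finally have "rfl e (z \<bullet> e) x = x - norm (x - y) *\<^sub>R e" by (simp add: rfl_def)
    also have "\<dots> = y" using False by (simp add: e_def)
    finally show ?thesis using plane[OF e, of x] by simp
  qed simp
  have dec: "u y < u x" if xy: "norm (x - z) < norm (y - z)" for x y
  proof -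
    define p q where "p = norm (x - z)" and "q = norm (y - z)"
    have pq: "0 \<le> p" "p < q" using xy by (auto simp: p_def q_def)
    define e where "e = (y - z) /\<^sub>R q"
    have e: "norm e = 1" using pq by (simp add: e_def q_def[symmetric])
    \<comment> \<open>By radial symmetry \<open>x\<close> may be moved onto the ray from
      \<open>z\<close> through \<open>y\<close>; the plane halfway between then maps it to
      \<open>y\<close>.\<close>
    define x' where "x' = z + p *\<^sub>R e"
    have ux: "u x' = u x" by (rule rad) (use e pq in \<open>simp add: x'_def p_def\<close>)
    have y: "y = z + q *\<^sub>R e" using pq by (simp add: e_def)
    define t where "t = (p + q) / 2"
    define l where "l = z \<bullet> e + t"
    have t: "t > 0" using pq by (simp add: t_def)
    have ee: "e \<bullet> e = 1" using e by (simp add: dot_square_norm)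
    have x'e: "x' \<bullet> e = z \<bullet> e + p" by (simp add: x'_def inner_add_left ee)
    then have x'l: "x' \<bullet> e < l" using pq by (simp add: l_def t_def)
    have "2 * (l - x' \<bullet> e) = q - p" by (simp add: l_def t_def x'e field_simps)
    then have "rfl e l x' = x' + (q - p) *\<^sub>R e" unfolding rfl_def by (simp only:)
    then have rx: "rfl e l x' = y" by (simp add: x'_def y scaleR_diff_left)
    \<comment> \<open>The plane through \<open>z\<close> is a plane of symmetry, so the reflection
      at \<open>l\<close> acts on \<open>u\<close> like a translation by \<open>- 2 * t\<close>
      along \<open>e\<close>.\<close>
    have shift: "u (rfl e l w) = u (w + (- 2 * t) *\<^sub>R e)" for w
    proof -
      have "u (rfl e l w) = u (rfl e (z \<bullet> e) (rfl e l w))" by (simp add: plane[OF e])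
      also have "rfl e (z \<bullet> e) (rfl e l w) = w + (- 2 * t) *\<^sub>R e" unfolding rfl_rfl_parallel[OF e] by (simp add: l_def)
      finally show ?thesis .
    qed
    \<comment> \<open>In this alternative every value below the plane would be dominated along an
      orbit running away from the plane. So \<open>u\<close> would vanish there, and by symmetry
      everywhere.\<close>
    have "\<not> (\<forall>w. w \<bullet> e < l \<longrightarrow> u w \<le> u (rfl e l w))"
    proof
      assume B: "\<forall>w. w \<bullet> e < l \<longrightarrow> u w \<le> u (rfl e l w)"
      have low: "u w = 0" if w: "w \<bullet> e < l" for w
      proof (rule zero_of_dominated_orbit[OF e])
        show "- 2 * t \<noteq> 0" using t by simp
        fix n show "u w \<le> u (w + (real n * (- 2 * t)) *\<^sub>R e)"
        proof (induction n)
          case (Suc n)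
          let ?w = "w + (real n * (- 2 * t)) *\<^sub>R e"
          have "0 \<le> real n * t" using t by simp
          then have "?w \<bullet> e < l" using w by (simp add: inner_diff_left ee)
          then have "u ?w \<le> u (?w + (- 2 * t) *\<^sub>R e)" using B shift by metis
          also have "?w + (- 2 * t) *\<^sub>R e = w + (real (Suc n) * (- 2 * t)) *\<^sub>R e" by (simp add: algebra_simps)
          finally show ?case using Suc by simp
        qed simp
      qed
      have "u w = 0" for w
      proof (cases "w \<bullet> e < l")
        case False
        then have "rfl e (z \<bullet> e) w \<bullet> e < l" using t by (simp add: rfl_inner[OF e] l_def)
        then show ?thesis using low plane[OF e, of w] by metis
      qed (rule low)
      then show False using nontrivial by blast
    qed
    then have A: "\<forall>w. l < w \<bullet> e \<longrightarrow> u w \<le> u (rfl e l w)" using sided[OF e, of l] by blast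
    have half: "u (rfl e l w) \<le> u w" if "w \<bullet> e \<le> l" for w
    proof (cases "w \<bullet> e = l")
      case False
      then have "l < rfl e l w \<bullet> e" using that by (simp add: rfl_inner[OF e])
      then show ?thesis using A rfl_rfl[OF e, of l w] by metis
    qed (simp add: rfl_def)
    \<comment> \<open>Equality at all points would turn the reflection at \<open>l\<close> and the
      symmetry about \<open>z\<close> into a period of \<open>u\<close>.\<close>
    have "\<exists>y0. y0 \<bullet> e < l \<and> u (rfl e l y0) < u y0"
    proof (rule ccontr)
      assume no: "\<not> ?thesis"
      have eq1: "u (rfl e l w) = u w" if "w \<bullet> e \<le> l" for w
      proof (cases "w \<bullet> e = l")
        case False
        then have "\<not> u (rfl e l w) < u w" using no that by auto
        then show ?thesis using half[OF that] by simp
      qed (simp add: rfl_def)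
      have eq: "u (rfl e l w) = u w" for w
      proof (cases "w \<bullet> e \<le> l")
        case False
        then have "rfl e l w \<bullet> e \<le> l" by (simp add: rfl_inner[OF e])
        then show ?thesis using eq1[of "rfl e l w"] rfl_rfl[OF e, of l w] by simp
      qed (rule eq1)
      have "- 2 * t \<noteq> 0" using t by simp
      from periodic_zero[OF e this] show False using shift eq nontrivial by metis
    qed
    then obtain y0 where y0: "y0 \<bullet> e < l" "u (rfl e l y0) < u y0" by blast
    show ?thesis using strict[OF e half y0 x'l] rx ux by simp
  qed
  show ?thesis using rad dec by blast
qed

end

text \<open>Polar coordinates turn the conditions on the profile into conditions on a function on
  space. The profile is set to 0 off the positive half line, where the assumptions say nothing about
  it.\<close>

lemma radial_of_kernel_cond:
  fixes k :: "real \<Rightarrow> real"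
  assumes k0: "\<forall>r>0. k r \<ge> 0" and km: "antimono_on {0<..} k" and kc: "kernel_cond CARD('n) k"
  shows "\<exists>r0. radial (\<lambda>x :: real^'n. if norm x \<le> 0 then 0 else k (norm x)) r0"
proof -
  define k' where "k' = (\<lambda>r. if r \<le> 0 then 0 else k r)"
  have [measurable]: "k' \<in> borel_measurable borel" unfolding k'_def by (rule borel_measurable_antimono_pos[OF km])
  have k'0: "0 \<le> k' r" for r using k0 by (simp add: k'_def)
  define c where "c = ennreal (real CARD('n) * unit_ball_vol (real CARD('n)))"
  have c: "c \<noteq> 0" "c \<noteq> \<infinity>" by (auto simp: c_def ennreal_eq_0_iff not_le)
  have pc: "(\<integral>\<^sup>+x. ennreal (w (norm x) * k' (norm x)) \<partial>(lborel :: (real^'n) measure))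
     = c * (\<integral>\<^sup>+r\<in>{0<..}. ennreal (w r * k r * r ^ (CARD('n) - 1)) \<partial>lborel)"
    if [measurable]: "w \<in> borel_measurable borel" and w: "\<And>r. 0 \<le> w r" for w :: "real \<Rightarrow> real"
  proof -
    have "(\<integral>\<^sup>+x. ennreal (w (norm x) * k' (norm x)) \<partial>(lborel :: (real^'n) measure))
      = c * (\<integral>\<^sup>+r\<in>{0<..}. ennreal (w r * k' r * r ^ (CARD('n) - 1)) \<partial>lborel)"
      using nn_integral_norm[of "\<lambda>r. w r * k' r", where 'a = "real^'n"] w k'0 by (simp add: c_def)
    also have "(\<integral>\<^sup>+r\<in>{0<..}. ennreal (w r * k' r * r ^ (CARD('n) - 1)) \<partial>lborel)
      = (\<integral>\<^sup>+r\<in>{0<..}. ennreal (w r * k r * r ^ (CARD('n) - 1)) \<partial>lborel)"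
      by (rule nn_integral_cong) (auto simp: indicator_def k'_def)
    finally show ?thesis .
  qed
  obtain r0 where r0: "0 < r0" "strict_antimono_on {0<..<r0} k" using kc by (auto simp: kernel_cond_def)
  have "radial (\<lambda>x :: real^'n. k' (norm x)) r0"
  proof
    show "(\<lambda>x :: real^'n. k' (norm x)) \<in> borel_measurable borel" by measurable
    show "0 \<le> k' (norm x)" for x :: "real^'n" by (rule k'0)
    show "k' (norm y) \<le> k' (norm x)" if "x \<noteq> 0" "norm x \<le> norm y" for x y :: "real^'n"
    proof -
      have "0 < norm x" "0 < norm y" using that by auto
      then show ?thesis using monotone_onD[OF km, of "norm x" "norm y"] that by (simp add: k'_def)
    qed
    show "(\<integral>\<^sup>+x. ennreal (min 1 ((norm x)\<^sup>2) * k' (norm x)) \<partial>(lborel :: (real^'n) measure)) < \<infinity>"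
      using pc[of "\<lambda>r. min 1 (r\<^sup>2)"] kc c(2) by (simp add: kernel_cond_def ennreal_mult_less_top less_top)
    show "(\<integral>\<^sup>+x. ennreal (k' (norm x)) \<partial>(lborel :: (real^'n) measure)) = \<infinity>"
      using pc[of "\<lambda>r. 1"] kc c(1) by (simp add: kernel_cond_def ennreal_mult_top)
    show "0 < r0" by (rule r0)
    show "k' (norm y) < k' (norm x)" if "0 < norm x" "norm x < norm y" "norm y < r0" for x y :: "real^'n"
    proof -
      have "0 < norm y" using that by linarith
      then show ?thesis using monotone_onD[OF r0(2), of "norm x" "norm y"] that by (simp add: k'_def)
    qed
  qed
  then show ?thesis unfolding k'_def by blast
qed

lemma bounded_superlevel:
  fixes u :: "'a::euclidean_space \<Rightarrow> real"
  assumes "(u \<longlongrightarrow> 0) at_infinity" "0 < s" shows "bounded {x. s < u x}"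
proof -
  have "\<forall>\<^sub>F x in at_infinity. u x < s" by (rule order_tendstoD(2)[OF assms])
  then obtain b where b: "\<And>x. b \<le> norm x \<Longrightarrow> u x < s" by (auto simp: eventually_at_infinity)
  have "norm x \<le> b" if "s < u x" for x using b[of x] that by (cases "b \<le> norm x") auto
  then show ?thesis unfolding bounded_iff by blast
qed

theorem theorem1p10:
  fixes k :: "real \<Rightarrow> real" and f :: "real \<Rightarrow> real" and u :: "real^'n \<Rightarrow> real"
  assumes k_nonneg: "\<forall>r>0. k r \<ge> 0"
    and k_noninc: "antimono_on {0<..} k"
    and k_cond: "kernel_cond CARD('n) k"
    and F1: "F1 f" and F2: "F2 f"
    and u_nonneg: "\<forall>x. u x \<ge> 0"
    and u_bounded: "bounded (range u)"
    and u_cont: "continuous_on UNIV u"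
    and u_sol: "is_solution k f u"
    and u_decay: "(u \<longlongrightarrow> 0) at_infinity"
  shows "\<exists>z0::real^'n.
           (\<forall>x y. norm x = norm y \<longrightarrow> u (x - z0) = u (y - z0)) \<and>
           ((\<forall>x. u x = 0) \<or>
            ((\<forall>x y. norm x < norm y \<longrightarrow> u (y - z0) < u (x - z0)) \<and> (\<forall>x. u x > 0)))"
proof (cases "\<forall>x. u x = 0")
  case False
  \<comment> \<open>The nontrivial case: the kernel as a function on space, with the value 0 at the
    origin.\<close>
  define K where "K = (\<lambda>x :: real^'n. if norm x \<le> 0 then 0 else k (norm x))"
  obtain r0 where "radial K r0" using radial_of_kernel_cond[OF k_nonneg k_noninc k_cond] unfolding K_def by blast
  then interpret radial K r0 .
  obtain b where b: "0 < b" "\<And>x. \<bar>u x\<bar> \<le> b" using u_bounded unfolding bounded_pos by auto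
  have [measurable]: "u \<in> borel_measurable borel" by (rule borel_measurable_continuous_onI[OF u_cont])
  have uDJ: "u \<in> DJ k" using u_sol by (simp add: is_solution_def)
  have "bdm u" by (rule bdmI[of _ b]) (use b(2) in auto)
  then have nu: "nice u" using uDJ by (simp add: nice_def DJ_def)
  \<comment> \<open>On the diagonal \<open>k 0\<close> may differ from \<open>K 0\<close>, but there
    the increments in front of the kernel vanish.\<close>
  have K_eq: "c * k (dist x y) = c * K (x - y)" if "x = y \<Longrightarrow> c = 0" for c and x y :: "real^'n"
    using that by (cases "x = y") (auto simp: K_def dist_norm)
  have energy: "(\<integral>\<^sup>+p. ennreal ((\<phi> (fst p) - \<phi> (snd p))\<^sup>2 * k (dist (fst p) (snd p))) \<partial>(lborel \<Otimes>\<^sub>M lborel))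
    = (\<integral>\<^sup>+z. ennreal (K z * (nrm (df z \<phi>))\<^sup>2) \<partial>lborel)" if "nice \<phi>" for \<phi> :: "real^'n \<Rightarrow> real"
    unfolding energy_shear[OF K0_meas K0_nonneg that, symmetric] by (rule nn_integral_cong) (subst K_eq, auto)
  have fin: "(\<integral>\<^sup>+z. ennreal (K z * (nrm (df z u))\<^sup>2) \<partial>lborel) < \<infinity>" using uDJ energy[OF nu] by (simp add: DJ_def)
  obtain L where L: "0 < L" "\<And>s t. \<bar>s\<bar> \<le> b \<Longrightarrow> \<bar>t\<bar> \<le> b \<Longrightarrow> \<bar>f s - f t\<bar> \<le> L * \<bar>s - t\<bar>"
    using F1 b(1) unfolding F1_def by blast
  \<comment> \<open>The nonlinearity is frozen outside the range of \<open>u\<close>, which makes it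
    globally Lipschitz without changing the equation.\<close>
  define h where "h s = f (max (- b) (min b s))" for s
  have h_lip: "\<bar>h s - h t\<bar> \<le> L * \<bar>s - t\<bar>" for s t
  proof -
    have "\<bar>h s - h t\<bar> \<le> L * \<bar>max (- b) (min b s) - max (- b) (min b t)\<bar>"
      unfolding h_def using b(1) by (intro L(2)) (auto simp: abs_le_iff)
    also have "\<dots> \<le> L * \<bar>s - t\<bar>" using L(1) by (intro mult_left_mono) (auto simp: max_def min_def)
    finally show ?thesis .
  qed
  have hu: "h (u x) = f (u x)" for x using b(2)[of x] by (simp add: h_def abs_le_iff)
  have h0: "h 0 = 0" using F2 b(1) by (simp add: h_def F2_def)
  have weak: "(\<integral>z. K z * ip (df z u) (df z \<phi>) \<partial>lborel) = ip (\<lambda>x. h (u x)) \<phi>"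
    if \<phi>: "nice \<phi>" "bounded {x. \<phi> x \<noteq> 0}" "(\<integral>\<^sup>+z. ennreal (K z * (nrm (df z \<phi>))\<^sup>2) \<partial>lborel) < \<infinity>" for \<phi> :: "real^'n \<Rightarrow> real"
  proof -
    have "\<phi> \<in> DJ k" using nice_meas[OF \<phi>(1)] nice_sq[OF \<phi>(1)] \<phi>(3) energy[OF \<phi>(1)] by (simp add: DJ_def)
    moreover have "compact (closure {x. \<phi> x \<noteq> 0})" using \<phi>(2) by simp
    ultimately have "formJ k u \<phi> = ip (\<lambda>x. h (u x)) \<phi>" using u_sol by (simp add: is_solution_def ip_def hu)
    moreover have "formJ k u \<phi> = (\<integral>z. K z * ip (df z u) (df z \<phi>) \<partial>lborel)"
      unfolding form_shear[OF K0_meas K0_nonneg nu \<phi>(1) fin \<phi>(3), symmetric] formJ_def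
      by (rule Bochner_Integration.integral_cong[OF HOL.refl]) (subst K_eq, auto)
    ultimately show ?thesis by simp
  qed
  have u0: "0 \<le> u x" for x using u_nonneg by simp
  note lev = bounded_superlevel[OF u_decay]
  have ex: "\<exists>F \<mu> g. resolved \<Lambda> F \<mu> g u" if "L < \<Lambda>" for \<Lambda>
    by (rule resolved_exists[OF nu u0 lev _ h_lip h0 fin weak that]) (use L(1) in auto)
  interpret polarized u
  proof
    show "(\<forall>x. l < x \<bullet> e \<longrightarrow> u x \<le> u (rfl e l x)) \<or> (\<forall>x. x \<bullet> e < l \<longrightarrow> u x \<le> u (rfl e l x))"
      if e: "norm e = 1" for e l
    proof (rule ccontr)
      assume "\<not> ?thesis"
      then obtain X Y where XY: "l < X \<bullet> e" "u (rfl e l X) < u X" "Y \<bullet> e < l" "u (rfl e l Y) < u Y" by (auto simp: not_le)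
      obtain \<Lambda>1 where \<Lambda>1: "\<And>\<Lambda> F \<mu> g. \<Lambda> \<ge> \<Lambda>1 \<Longrightarrow> \<not> resolved \<Lambda> F \<mu> g u"
        using no_opposite_signs[OF e u0 u_cont lev XY] by blast
      \<comment> \<open>Large enough for the threshold just obtained and for the construction of the
        resolved form.\<close>
      have "L < max \<Lambda>1 (L + 1)" by linarith
      from ex[OF this] \<Lambda>1[of "max \<Lambda>1 (L + 1)"] show False by auto
    qed
    show "u (rfl e l y1) < u y1"
      if st: "norm e = 1" "\<And>x. x \<bullet> e \<le> l \<Longrightarrow> u (rfl e l x) \<le> u x" "y0 \<bullet> e < l" "u (rfl e l y0) < u y0" "y1 \<bullet> e < l" for e l y0 y1
    proof -
      obtain \<Lambda>1 where \<Lambda>1: "\<And>\<Lambda> F \<mu> g. \<Lambda> \<ge> \<Lambda>1 \<Longrightarrow> resolved \<Lambda> F \<mu> g u \<Longrightarrow> u (rfl e l y1) < u y1"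
        using one_sided_strict[OF st(1) u0 u_cont st(2-5)] by blast
      have "L < max \<Lambda>1 (L + 1)" by linarith
      from ex[OF this] obtain F \<mu> g where "resolved (max \<Lambda>1 (L + 1)) F \<mu> g u" by blast
      then show ?thesis by (rule \<Lambda>1[rotated]) simp
    qed
  qed (use u0 u_cont lev False in auto)
  obtain z where z: "\<And>x y. norm (x - z) = norm (y - z) \<Longrightarrow> u x = u y" "\<And>x y. norm (x - z) < norm (y - z) \<Longrightarrow> u y < u x"
    using radially_decreasing by blast
  \<comment> \<open>A point farther from the centre has a strictly smaller value, and that value is
    nonnegative.\<close>
  have pos: "u x > 0" for x
  proof -
    obtain a :: "real^'n" where "norm a = norm (x - z) + 1"
      using vector_choose_size[of "norm (x - z) + 1"] by auto
    then have "u (z + a) < u x" by (intro z(2)) simp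
    then show ?thesis using u0[of "z + a"] by simp
  qed
  \<comment> \<open>The translation in the statement subtracts \<open>z0\<close>, so
    \<open>z0 = - z\<close> for the centre \<open>z\<close>.\<close>
  have "u (x - - z) = u (y - - z)" if "norm x = norm y" for x y
    by (rule z(1)) (use that in simp)
  moreover have "u (y - - z) < u (x - - z)" if "norm x < norm y" for x y
    by (rule z(2)) (use that in simp)
  ultimately show ?thesis using pos by blast
qed simp

end
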